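(* For each $d\ge 1$ let $\{A_{d,i}\}_{i\in I}$ and $\{B_{d,j}\}_{j\in J}$ be two families of $d\times d$ random matrices such that the entries of the first family are independent from those of the second. Suppose that each of the two ensembles $\{A_{d,i}\}_{i\in I}$ and $\{B_{d,j}\}_{j\in J}$ has a real second order limit distribution as $d\to\infty$, and that for each $d$ the family $\{A_{d,i}\}_{i\in I}$ is invariant under conjugation by an orthogonal matrix. Then the ensembles $\{A_{d,i}\}_{i\in I}$ and $\{B_{d,j}\}_{j\in J}$ are asymptotically real free of second order.
   Context: Conventions. All random matrices have entries with moments of all orders. $\mathrm{Tr}$ is the un-normalized trace, $\mathrm{tr}=d^{-1}\mathrm{Tr}$ on $d\times d$ matrices, $A^t$ is the transpose. $k_r$ denotes the $r$-th classical (multilinear) joint cumulant of random variables; $\mathrm{cov}(X,Y)=k_2(X,Y)=\mathrm{E}(XY)-\mathrm{E}(X)\mathrm{E}(Y)$. Orthogonal invariance. A family $\{A_i\}_i$ of $d\times d$ random matrices is invariant under conjugation by an orthogonal matrix if for every (non-random) $d\times d$ orthogonal matrix $O$ all joint moments of the entries of the matrices $\{OA_iO^{-1}\}_i$ coincide with the corresponding joint moments of the entries of $\{A_i\}_i$. Real second order non-commutative probability space. This is a tuple $(\mathcal A,\varphi,\varphi_2,t)$ where $\mathcal A$ is a unital algebra over $\mathbb C$ with an anti-automorphism $a\mapsto a^t$ of order 2, $\varphi:\mathcal A\to\mathbb C$ is a tracial state (linear, $\varphi(1)=1$, $\varphi(ab)=\varphi(ba)$), and $\varphi_2:\mathcal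 A\times\mathcal A\to\mathbb C$ is bilinear and tracial in each entry, with $\varphi_2(1,a)=\varphi_2(a,1)=0$, $\varphi(a^t)=\varphi(a)$, $\varphi_2(a^t,b)=\varphi_2(a,b^t)=\varphi_2(a,b)$ for all $a,b$. Real freeness of second order. Let $\mathcal A_1,\dots,\mathcal A_r\subset\mathcal A$ be unital subalgebras invariant under $t$. A tuple $(a_1,\dots,a_n)$ is cyclically alternating if there are indices $j_i$ with $a_i\in\mathcal A_{j_i}$ and, if $n\ge2$, $j_k\ne j_{k+1}$ for all $k=1,\dots,n$ (indices modulo $n$). It is centred if $\varphi(a_i)=0$ for all $i$. The subalgebras are real free of second order if (i) they are free with respect to $\varphi$ (i.e. $\varphi(a_1\cdots a_n)=0$ whenever $a_i\in\mathcal A_{j_i}$, $\varphi(a_i)=0$, and $j_1\neq j_2\neq\cdots\neq j_n$), and (ii) whenever $(a_1,\dots,a_m)$ and $(b_1,\dots,b_n)$ are both centred and cyclically alternating: (a) $\varphi_2(a_1\cdots a_m,b_1\cdots b_n)=0$ if $m\ne n$, or if $m=n=1$ and $a_1,b_1$ are from different subalgebras; (b) if $m=n>1$, with indices modulo $n$, $$\varphi_2(a_1\cdots a_n,b_1\cdots b_n)=\sum_{k=1}^n\Big(\prod_{i=1}^n\varphi(a_ib_{k-i})+\prod_{i=1}^n\varphi(a_ib_{i-k}^t)\Big).$$ Real second order limit distribution. An ensemble $\{A_{d,i}\}_{i\in I}$ of $d\times d$ random matrices ($d\ge1$) has a real second order limit distribution, given by $\{a_i\}_{i\in I}$ in a real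 second order non-commutative probability space $(\mathcal A,\varphi,\varphi_2,t)$, if for all polynomials $p_1,p_2,\dots$ in the non-commuting variables $\{x_i,x_i^t\}_{i\in I}$ (evaluated by $x_i\mapsto A_{d,i}$, $x_i^t\mapsto A_{d,i}^t$, respectively $x_i\mapsto a_i$, $x_i^t\mapsto a_i^t$): $\lim_d \mathrm{E}(\mathrm{tr}(p_1(A_d)))=\varphi(p_1(a))$; $\lim_d\mathrm{cov}(\mathrm{Tr}(p_1(A_d)),\mathrm{Tr}(p_2(A_d)))=\varphi_2(p_1(a),p_2(a))$; and $\lim_d k_r(\mathrm{Tr}(p_1(A_d)),\dots,\mathrm{Tr}(p_r(A_d)))=0$ for all $r\ge3$. Asymptotic real second order freeness. Ensembles $\{A_{d,i}\}_{i\in I}$ and $\{B_{d,j}\}_{j\in J}$ are asymptotically real free of second order if the joint ensemble $\{A_{d,i}\}_i\cup\{B_{d,j}\}_j$ has a real second order limit distribution, given by $\{a_i\}_i\cup\{b_j\}_j$ in some $(\mathcal A,\varphi,\varphi_2,t)$, and the unital subalgebras generated by $\{a_i,a_i^t\}_i$ and by $\{b_j,b_j^t\}_j$ are real free of second order. *)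

theory Defs
  imports
    "HOL-Probability.Probability"
    "HOL-Library.Poly_Mapping"
    "Jordan_Normal_Form.Matrix"
begin

section \<open>Non-commutative polynomials in variables and their transposes\<close>

text \<open>
  The library has no free algebra. We use the monoid algebra of the free monoid: words form an
  additive monoid under concatenation, so that the convolution product of \<^theory>\<open>HOL-Library.Poly_Mapping\<close>
  is the product of non-commutative polynomials.
\<close>

datatype 'v free_monoid = Word (letters: "'v list")

instantiation free_monoid :: (type) monoid_add
begin

definition zero_free_monoid :: "'a free_monoid" where
  "0 = Word []"

definition plus_free_monoid :: "'a free_monoid \<Rightarrow> 'a free_monoid \<Rightarrow> 'a free_monoid" where
  "u + v = Word (letters u @ letters v)"

instance
  by standard (auto simp: zero_free_monoid_def plus_free_monoid_def)

end

datatype 'i letter = Var 'i | VarT 'i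

type_synonym 'i ncpoly = "'i letter free_monoid \<Rightarrow>\<^sub>0 complex"

primrec letter_val :: "('a \<Rightarrow> 'a) \<Rightarrow> ('i \<Rightarrow> 'a) \<Rightarrow> 'i letter \<Rightarrow> 'a" where
  "letter_val t a (Var i) = a i"
| "letter_val t a (VarT i) = t (a i)"

definition word_eval :: "('a::monoid_mult \<Rightarrow> 'a) \<Rightarrow> ('i \<Rightarrow> 'a) \<Rightarrow> 'i letter free_monoid \<Rightarrow> 'a" where
  "word_eval t a w = prod_list (map (letter_val t a) (letters w))"

definition ncpoly_eval ::
  "(complex \<Rightarrow> 'a \<Rightarrow> 'a) \<Rightarrow> ('a \<Rightarrow> 'a) \<Rightarrow> ('i \<Rightarrow> 'a) \<Rightarrow> 'i ncpoly \<Rightarrow> 'a::ring_1" where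
  "ncpoly_eval sc t a p =
     (\<Sum>w\<in>Poly_Mapping.keys p. sc (Poly_Mapping.lookup p w) (word_eval t a w))"

definition word_mat :: "nat \<Rightarrow> ('i \<Rightarrow> complex mat) \<Rightarrow> 'i letter free_monoid \<Rightarrow> complex mat" where
  "word_mat d X w = foldr (\<lambda>l B. letter_val transpose_mat X l * B) (letters w) (1\<^sub>m d)"

definition ncpoly_mat :: "nat \<Rightarrow> ('i \<Rightarrow> complex mat) \<Rightarrow> 'i ncpoly \<Rightarrow> complex mat" where
  "ncpoly_mat d X p =
     mat d d (\<lambda>(r, s). \<Sum>w\<in>Poly_Mapping.keys p. Poly_Mapping.lookup p w * word_mat d X w $$ (r, s))"


section \<open>Real second order non-commutative probability spaces\<close>

text \<open>
  The algebra is a type of class \<^class>\<open>ring_1\<close> with an explicit complex scalar multiplication.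
  The anti-automorphism is required to satisfy \<open>t (t x) = x\<close>; \<open>t = id\<close> is not excluded
  when the algebra is commutative.
\<close>

locale real_second_order_space = vector_space sc
  for sc :: "complex \<Rightarrow> 'a::ring_1 \<Rightarrow> 'a" +
  fixes \<phi> :: "'a \<Rightarrow> complex"
    and \<phi>2 :: "'a \<Rightarrow> 'a \<Rightarrow> complex"
    and t :: "'a \<Rightarrow> 'a"
  assumes scale_mult_left: "sc c x * y = sc c (x * y)"
    and scale_mult_right: "x * sc c y = sc c (x * y)"
    and t_linear: "Vector_Spaces.linear sc sc t"
    and t_mult: "t (x * y) = t y * t x"
    and t_t: "t (t x) = x"
    and phi_linear: "Vector_Spaces.linear sc (*) \<phi>"
    and phi_one: "\<phi> 1 = 1"
    and phi_tracial: "\<phi> (x * y) = \<phi> (y * x)"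
    and phi_t: "\<phi> (t x) = \<phi> x"
    and phi2_linear_left: "Vector_Spaces.linear sc (*) (\<lambda>x. \<phi>2 x y)"
    and phi2_linear_right: "Vector_Spaces.linear sc (*) (\<phi>2 x)"
    and phi2_tracial_left: "\<phi>2 (x * y) z = \<phi>2 (y * x) z"
    and phi2_tracial_right: "\<phi>2 z (x * y) = \<phi>2 z (y * x)"
    and phi2_one_left: "\<phi>2 1 x = 0"
    and phi2_one_right: "\<phi>2 x 1 = 0"
    and phi2_t_left: "\<phi>2 (t x) y = \<phi>2 x y"
    and phi2_t_right: "\<phi>2 x (t y) = \<phi>2 x y"

definition unital_subalgebra :: "(complex \<Rightarrow> 'a::ring_1 \<Rightarrow> 'a) \<Rightarrow> 'a set \<Rightarrow> bool" where
  "unital_subalgebra sc S \<longleftrightarrow>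
     module.subspace sc S \<and> 1 \<in> S \<and> (\<forall>x\<in>S. \<forall>y\<in>S. x * y \<in> S)"

definition generated_subalgebra ::
  "(complex \<Rightarrow> 'a::ring_1 \<Rightarrow> 'a) \<Rightarrow> ('a \<Rightarrow> 'a) \<Rightarrow> ('i \<Rightarrow> 'a) \<Rightarrow> 'a set" where
  "generated_subalgebra sc t a = unital_subalgebra sc hull (range a \<union> range (\<lambda>i. t (a i)))"


section \<open>Real freeness of second order\<close>

text \<open>
  Tuples \<open>(a\<^sub>1, \<dots>, a\<^sub>n)\<close> are non-empty lists, indexed from 0.
\<close>

definition free_subalgebras :: "('a::ring_1 \<Rightarrow> complex) \<Rightarrow> 'k set \<Rightarrow> ('k \<Rightarrow> 'a set) \<Rightarrow> bool" where
  "free_subalgebras \<phi> K Alg \<longleftrightarrow>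
     (\<forall>xs j. xs \<noteq> [] \<longrightarrow>
        (\<forall>i<length xs. j i \<in> K \<and> xs ! i \<in> Alg (j i) \<and> \<phi> (xs ! i) = 0) \<longrightarrow>
        (\<forall>i. Suc i < length xs \<longrightarrow> j i \<noteq> j (Suc i)) \<longrightarrow>
        \<phi> (prod_list xs) = 0)"

definition cyclically_alternating :: "'k set \<Rightarrow> ('k \<Rightarrow> 'a set) \<Rightarrow> 'a list \<Rightarrow> bool" where
  "cyclically_alternating K Alg xs \<longleftrightarrow> xs \<noteq> [] \<and>
     (\<exists>j. (\<forall>i<length xs. j i \<in> K \<and> xs ! i \<in> Alg (j i)) \<and>
          (length xs \<ge> 2 \<longrightarrow> (\<forall>i<length xs. j i \<noteq> j (Suc i mod length xs))))"

definition centred :: "('a \<Rightarrow> complex) \<Rightarrow> 'a list \<Rightarrow> bool" where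
  "centred \<phi> xs \<longleftrightarrow> (\<forall>x\<in>set xs. \<phi> x = 0)"

text \<open>
  In the sum below, \<open>k + n - i\<close> and \<open>i + n - k\<close> avoid truncated subtraction. Since \<open>k\<close> runs over
  all residues modulo \<open>n\<close>, counting the positions from 0 instead of 1 only permutes the summands.
\<close>

definition real_free_second_order ::
  "(complex \<Rightarrow> 'a::ring_1 \<Rightarrow> 'a) \<Rightarrow> ('a \<Rightarrow> complex) \<Rightarrow> ('a \<Rightarrow> 'a \<Rightarrow> complex) \<Rightarrow> ('a \<Rightarrow> 'a) \<Rightarrow>
   'k set \<Rightarrow> ('k \<Rightarrow> 'a set) \<Rightarrow> bool" where
  "real_free_second_order sc \<phi> \<phi>2 t K Alg \<longleftrightarrow>
     (\<forall>k\<in>K. unital_subalgebra sc (Alg k) \<and> t ` Alg k \<subseteq> Alg k) \<and>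
     free_subalgebras \<phi> K Alg \<and>
     (\<forall>xs ys.
        cyclically_alternating K Alg xs \<and> centred \<phi> xs \<longrightarrow>
        cyclically_alternating K Alg ys \<and> centred \<phi> ys \<longrightarrow>
        (length xs \<noteq> length ys \<longrightarrow> \<phi>2 (prod_list xs) (prod_list ys) = 0) \<and>
        (length xs = 1 \<and> length ys = 1 \<and>
           (\<exists>k\<in>K. \<exists>l\<in>K. k \<noteq> l \<and> xs ! 0 \<in> Alg k \<and> ys ! 0 \<in> Alg l) \<longrightarrow>
           \<phi>2 (prod_list xs) (prod_list ys) = 0) \<and>
        (\<forall>n>1. length xs = n \<and> length ys = n \<longrightarrow>
           \<phi>2 (prod_list xs) (prod_list ys) =
             (\<Sum>k<n. (\<Prod>i<n. \<phi> (xs ! i * ys ! ((k + n - i) mod n))) +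
                     (\<Prod>i<n. \<phi> (xs ! i * t (ys ! ((i + n - k) mod n)))))))"


section \<open>Random matrices\<close>

definition mat_trace :: "complex mat \<Rightarrow> complex" where
  "mat_trace A = (\<Sum>i<dim_row A. A $$ (i, i))"

definition random_matrix_family :: "'w measure \<Rightarrow> nat \<Rightarrow> ('i \<Rightarrow> 'w \<Rightarrow> complex mat) \<Rightarrow> bool" where
  "random_matrix_family M d A \<longleftrightarrow>
     (\<forall>i. (\<forall>w\<in>space M. A i w \<in> carrier_mat d d) \<and>
        (\<forall>r<d. \<forall>s<d. (\<lambda>w. A i w $$ (r, s)) \<in> borel_measurable M \<and>
           (\<forall>m::nat. integrable M (\<lambda>w. norm (A i w $$ (r, s)) ^ m))))"

definition entry_index :: "nat \<Rightarrow> ('i \<times> nat \<times> nat) set" where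
  "entry_index d = UNIV \<times> {..<d} \<times> {..<d}"

definition entries :: "nat \<Rightarrow> ('i \<Rightarrow> 'w \<Rightarrow> complex mat) \<Rightarrow> 'w \<Rightarrow> 'i \<times> nat \<times> nat \<Rightarrow> complex" where
  "entries d A w = (\<lambda>(i, r, s)\<in>entry_index d. A i w $$ (r, s))"

definition entries_sigma :: "'w measure \<Rightarrow> nat \<Rightarrow> ('i \<Rightarrow> 'w \<Rightarrow> complex mat) \<Rightarrow> 'w set set" where
  "entries_sigma M d A =
     sets (vimage_algebra (space M) (entries d A) (PiM (entry_index d) (\<lambda>_. borel)))"

definition entries_independent ::
  "'w measure \<Rightarrow> nat \<Rightarrow> ('i \<Rightarrow> 'w \<Rightarrow> complex mat) \<Rightarrow> ('j \<Rightarrow> 'w \<Rightarrow> complex mat) \<Rightarrow> bool" where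
  "entries_independent M d A B \<longleftrightarrow>
     prob_space.indep_set M (entries_sigma M d A) (entries_sigma M d B)"

text \<open>
  The constant \<^const>\<open>orthogonal_mat\<close> of the matrix library only asks for pairwise orthogonal
  non-zero columns, without normalization.
\<close>

definition real_orthogonal :: "nat \<Rightarrow> real mat \<Rightarrow> bool" where
  "real_orthogonal d Q \<longleftrightarrow> Q \<in> carrier_mat d d \<and>
     Q * transpose_mat Q = 1\<^sub>m d \<and> transpose_mat Q * Q = 1\<^sub>m d"

definition conj_orthogonal :: "real mat \<Rightarrow> complex mat \<Rightarrow> complex mat" where
  "conj_orthogonal Q X =
     map_mat complex_of_real Q * X * map_mat complex_of_real (transpose_mat Q)"

definition orthogonally_invariant ::
  "'w measure \<Rightarrow> nat \<Rightarrow> ('i \<Rightarrow> 'w \<Rightarrow> complex mat) \<Rightarrow> bool" where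
  "orthogonally_invariant M d A \<longleftrightarrow>
     (\<forall>Q. real_orthogonal d Q \<longrightarrow>
        (\<forall>es. set es \<subseteq> entry_index d \<longrightarrow>
           (LINT w|M. (\<Prod>(i, r, s)\<leftarrow>es. conj_orthogonal Q (A i w) $$ (r, s))) =
           (LINT w|M. (\<Prod>(i, r, s)\<leftarrow>es. A i w $$ (r, s)))))"

definition joint_cumulant :: "'w measure \<Rightarrow> nat \<Rightarrow> (nat \<Rightarrow> 'w \<Rightarrow> complex) \<Rightarrow> complex" where
  "joint_cumulant M r X =
     (\<Sum>\<pi> | partition_on {..<r} \<pi>.
        (-1) ^ (card \<pi> - 1) * fact (card \<pi> - 1) * (\<Prod>V\<in>\<pi>. LINT w|M. (\<Prod>i\<in>V. X i w)))"

definition covariance :: "'w measure \<Rightarrow> ('w \<Rightarrow> complex) \<Rightarrow> ('w \<Rightarrow> complex) \<Rightarrow> complex" where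
  "covariance M X Y = (LINT w|M. X w * Y w) - (LINT w|M. X w) * (LINT w|M. Y w)"

lemma covariance_eq_joint_cumulant: "covariance M (X 0) (X 1) = joint_cumulant M 2 X"
proof -
  have P: "{\<pi>. partition_on {0, 1::nat} \<pi>} = {{{0, 1}}, {{0}, {1}}}"
  proof (intro equalityI subsetI)
    fix \<pi> assume "\<pi> \<in> {\<pi>. partition_on {0, 1::nat} \<pi>}"
    then have p: "\<Union>\<pi> = {0, 1}" "{} \<notin> \<pi>" "\<And>U V. U \<in> \<pi> \<Longrightarrow> V \<in> \<pi> \<Longrightarrow> U \<noteq> V \<Longrightarrow> U \<inter> V = {}"
      by (auto simp: partition_on_def disjoint_def)
    have "\<pi> \<subseteq> Pow {0, 1}" using p(1) by blast
    then have sub: "\<pi> \<subseteq> {{0}, {1}, {0, 1}}" using p(2) by (auto simp: Pow_insert)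
    show "\<pi> \<in> {{{0, 1}}, {{0}, {1}}}"
    proof (cases "{0, 1} \<in> \<pi>")
      case True
      have "{0} \<notin> \<pi>" "{1} \<notin> \<pi>"
        using p(3)[OF True, of "{0}"] p(3)[OF True, of "{1}"] by (auto simp: set_eq_iff)
      with sub True have "\<pi> = {{0, 1}}" by blast
      then show ?thesis by simp
    next
      case False
      with sub have sub': "\<pi> \<subseteq> {{0}, {1}}" by blast
      have "{0} \<in> \<pi>"
      proof (rule ccontr)
        assume "{0} \<notin> \<pi>"
        with sub' have "\<pi> \<subseteq> {{1}}" by blast
        then have "\<Union>\<pi> \<subseteq> {1}" by blast
        with p(1) show False by simp
      qed
      moreover have "{1} \<in> \<pi>"
      proof (rule ccontr)
        assume "{1} \<notin> \<pi>"
        with sub' have "\<pi> \<subseteq> {{0}}" by blast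
        then have "\<Union>\<pi> \<subseteq> {0}" by blast
        with p(1) show False by simp
      qed
      ultimately have "\<pi> = {{0}, {1}}" using sub' by blast
      then show ?thesis by simp
    qed
  next
    fix \<pi> :: "nat set set"
    assume "\<pi> \<in> {{{0, 1}}, {{0}, {1}}}"
    then consider "\<pi> = {{0, 1}}" | "\<pi> = {{0}, {1}}" by blast
    then show "\<pi> \<in> {\<pi>. partition_on {0, 1} \<pi>}"
      by cases (simp_all add: partition_on_def disjoint_def insert_commute)
  qed
  have two: "{..<2::nat} = {0, 1}"
    by (simp add: lessThan_Suc numeral_2_eq_2 insert_commute)
  have ne: "{0::nat} \<noteq> {1}" "{{0, 1::nat}} \<noteq> {{0}, {1}}"
    by (simp, metis insertI1 insertI2 singletonD zero_neq_one)
  have "joint_cumulant M 2 X =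
      (\<Sum>\<pi>\<in>{{{0, 1}}, {{0}, {1}}}.
        (-1) ^ (card \<pi> - 1) * fact (card \<pi> - 1) * (\<Prod>V\<in>\<pi>. LINT w|M. (\<Prod>i\<in>V. X i w)))"
    unfolding joint_cumulant_def two P ..
  also have "\<dots> = covariance M (X 0) (X 1)"
    using ne by (simp add: covariance_def)
  finally show ?thesis ..
qed

abbreviation Tr_poly :: "nat \<Rightarrow> ('i \<Rightarrow> 'w \<Rightarrow> complex mat) \<Rightarrow> 'i ncpoly \<Rightarrow> 'w \<Rightarrow> complex" where
  "Tr_poly d A p w \<equiv> mat_trace (ncpoly_mat d (\<lambda>i. A i w) p)"


section \<open>Limit distributions and asymptotic freeness\<close>

definition real_second_order_limit ::
  "(nat \<Rightarrow> 'w measure) \<Rightarrow> (nat \<Rightarrow> 'i \<Rightarrow> 'w \<Rightarrow> complex mat) \<Rightarrow>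
   (complex \<Rightarrow> 'a::ring_1 \<Rightarrow> 'a) \<Rightarrow> ('a \<Rightarrow> complex) \<Rightarrow> ('a \<Rightarrow> 'a \<Rightarrow> complex) \<Rightarrow> ('a \<Rightarrow> 'a) \<Rightarrow>
   ('i \<Rightarrow> 'a) \<Rightarrow> bool" where
  "real_second_order_limit M A sc \<phi> \<phi>2 t a \<longleftrightarrow>
     real_second_order_space sc \<phi> \<phi>2 t \<and>
     (\<forall>p. (\<lambda>d. LINT w|M d. Tr_poly d (A d) p w / of_nat d)
            \<longlonglongrightarrow> \<phi> (ncpoly_eval sc t a p)) \<and>
     (\<forall>p q. (\<lambda>d. covariance (M d) (Tr_poly d (A d) p) (Tr_poly d (A d) q))
            \<longlonglongrightarrow> \<phi>2 (ncpoly_eval sc t a p) (ncpoly_eval sc t a q)) \<and>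
     (\<forall>r\<ge>3. \<forall>p :: nat \<Rightarrow> 'i ncpoly.
        (\<lambda>d. joint_cumulant (M d) r (\<lambda>k. Tr_poly d (A d) (p k))) \<longlonglongrightarrow> 0)"

definition real_free_limit ::
  "(nat \<Rightarrow> 'w measure) \<Rightarrow> (nat \<Rightarrow> 'i \<Rightarrow> 'w \<Rightarrow> complex mat) \<Rightarrow> (nat \<Rightarrow> 'j \<Rightarrow> 'w \<Rightarrow> complex mat) \<Rightarrow>
   (complex \<Rightarrow> 'a::ring_1 \<Rightarrow> 'a) \<Rightarrow> ('a \<Rightarrow> complex) \<Rightarrow> ('a \<Rightarrow> 'a \<Rightarrow> complex) \<Rightarrow> ('a \<Rightarrow> 'a) \<Rightarrow>
   ('i \<Rightarrow> 'a) \<Rightarrow> ('j \<Rightarrow> 'a) \<Rightarrow> bool" where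
  "real_free_limit M A B sc \<phi> \<phi>2 t a b \<longleftrightarrow>
     real_second_order_limit M (\<lambda>d. case_sum (A d) (B d)) sc \<phi> \<phi>2 t (case_sum a b) \<and>
     real_free_second_order sc \<phi> \<phi>2 t UNIV
       (\<lambda>first. if first then generated_subalgebra sc t a else generated_subalgebra sc t b)"

text \<open>
  ``Some real second order space'' would be a quantifier over types. We let the space range over
  all structures on the ring of non-commutative polynomials. Nothing is lost: by
  \<open>asymptotically_real_free_second_orderI\<close> below, a limit in a space over any type can be
  pulled back to this ring.
\<close>

definition asymptotically_real_free_second_order ::
  "(nat \<Rightarrow> 'w measure) \<Rightarrow> (nat \<Rightarrow> 'i \<Rightarrow> 'w \<Rightarrow> complex mat) \<Rightarrow> (nat \<Rightarrow> 'j \<Rightarrow> 'w \<Rightarrow> complex mat) \<Rightarrow>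
   bool" where
  "asymptotically_real_free_second_order M A B \<longleftrightarrow>
     (\<exists>(sc :: complex \<Rightarrow> ('i + 'j) ncpoly \<Rightarrow> ('i + 'j) ncpoly) \<phi> \<phi>2 t a b.
        real_free_limit M A B sc \<phi> \<phi>2 t a b)"


subsection \<open>Limits in spaces over an arbitrary type\<close>

definition ncpoly_sc :: "complex \<Rightarrow> 'i ncpoly \<Rightarrow> 'i ncpoly" where
  "ncpoly_sc c p = Poly_Mapping.single 0 c * p"

primrec letter_t :: "'i letter \<Rightarrow> 'i letter" where
  "letter_t (Var i) = VarT i"
| "letter_t (VarT i) = Var i"

definition word_t :: "'i letter free_monoid \<Rightarrow> 'i letter free_monoid" where
  "word_t w = Word (rev (map letter_t (letters w)))"

definition ncpoly_t :: "'i ncpoly \<Rightarrow> 'i ncpoly" where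
  "ncpoly_t p =
     (\<Sum>w\<in>Poly_Mapping.keys p. Poly_Mapping.single (word_t w) (Poly_Mapping.lookup p w))"

definition ncpoly_var :: "'i \<Rightarrow> 'i ncpoly" where
  "ncpoly_var i = Poly_Mapping.single (Word [Var i]) 1"

lemma sum_keys_add:
  fixes F :: "'k \<Rightarrow> 'c::monoid_add \<Rightarrow> 'b::comm_monoid_add"
  assumes add: "\<And>w x y. F w (x + y) = F w x + F w y" and zero: "\<And>w. F w 0 = 0"
  shows "(\<Sum>w\<in>Poly_Mapping.keys (p + q). F w (Poly_Mapping.lookup (p + q) w)) =
    (\<Sum>w\<in>Poly_Mapping.keys p. F w (Poly_Mapping.lookup p w)) +
    (\<Sum>w\<in>Poly_Mapping.keys q. F w (Poly_Mapping.lookup q w))"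
proof -
  let ?S = "Poly_Mapping.keys p \<union> Poly_Mapping.keys q"
  have ext: "(\<Sum>w\<in>Poly_Mapping.keys r. F w (Poly_Mapping.lookup r w)) =
      (\<Sum>w\<in>?S. F w (Poly_Mapping.lookup r w))" if "Poly_Mapping.keys r \<subseteq> ?S" for r
    using that by (intro sum.mono_neutral_left) (auto simp: in_keys_iff zero)
  show ?thesis
    unfolding ext[OF Poly_Mapping.keys_add] ext[OF Un_upper1] ext[OF Un_upper2]
    by (simp add: lookup_add add sum.distrib)
qed

lemma sum_monomials: "(\<Sum>w\<in>Poly_Mapping.keys p. Poly_Mapping.single w (Poly_Mapping.lookup p w)) = p"
  by (rule poly_mapping_eqI) (simp add: lookup_sum lookup_single when_def in_keys_iff)

lemma ncpoly_induct [case_names single add]: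
  fixes p :: "'k \<Rightarrow>\<^sub>0 complex"
  assumes single: "\<And>w c. P (Poly_Mapping.single w c)"
    and add: "\<And>p q. P p \<Longrightarrow> P q \<Longrightarrow> P (p + q)"
  shows "P p"
proof -
  have "P (\<Sum>w\<in>W. Poly_Mapping.single w (Poly_Mapping.lookup p w))" if "finite W" for W
    using that
  proof (induction W)
    case empty
    show ?case using single[of undefined 0] by simp
  qed (simp add: single add)
  from this[OF finite_keys, of p] show ?thesis
    by (simp add: sum_monomials)
qed

lemma ncpoly_t_add: "ncpoly_t (p + q) = ncpoly_t p + ncpoly_t q"
  unfolding ncpoly_t_def by (rule sum_keys_add) (auto simp: single_add)

lemma ncpoly_t_single: "ncpoly_t (Poly_Mapping.single w c) = Poly_Mapping.single (word_t w) c"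
  by (simp add: ncpoly_t_def)

lemma word_t_add: "word_t (u + v) = word_t v + word_t u"
  by (simp add: word_t_def plus_free_monoid_def)

lemma letter_t_letter_t [simp]: "letter_t (letter_t l) = l"
  by (cases l) auto

lemma word_t_word_t: "word_t (word_t w) = w"
  by (cases w) (simp add: word_t_def rev_map comp_def)

lemma ncpoly_t_mult: "ncpoly_t (p * q) = ncpoly_t q * ncpoly_t p"
proof (induction p rule: ncpoly_induct)
  case (single u c)
  show ?case
  proof (induction q rule: ncpoly_induct)
    case (single v e)
    show ?case by (simp add: mult_single ncpoly_t_single word_t_add mult.commute)
  qed (simp add: distrib_left distrib_right ncpoly_t_add)
qed (simp add: distrib_left distrib_right ncpoly_t_add)

lemma ncpoly_t_ncpoly_t: "ncpoly_t (ncpoly_t p) = p"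
  by (induction p rule: ncpoly_induct) (simp_all add: ncpoly_t_single ncpoly_t_add word_t_word_t)

lemma ncpoly_sc_single: "ncpoly_sc c (Poly_Mapping.single w e) = Poly_Mapping.single w (c * e)"
  by (simp add: ncpoly_sc_def mult_single)

lemma ncpoly_sc_add: "ncpoly_sc c (p + q) = ncpoly_sc c p + ncpoly_sc c q"
  by (simp add: ncpoly_sc_def distrib_left)

lemma ncpoly_t_sc: "ncpoly_t (ncpoly_sc c p) = ncpoly_sc c (ncpoly_t p)"
  by (induction p rule: ncpoly_induct)
    (simp_all add: ncpoly_t_single ncpoly_t_add ncpoly_sc_single ncpoly_sc_add)

lemma vector_space_ncpoly_sc: "vector_space ncpoly_sc"
proof
  show "ncpoly_sc a (ncpoly_sc b x) = ncpoly_sc (a * b) x" for a b and x :: "'i ncpoly"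
    by (simp add: ncpoly_sc_def mult.assoc[symmetric] mult_single)
  show "ncpoly_sc 1 x = x" for x :: "'i ncpoly"
    by (simp add: ncpoly_sc_def)
qed (simp_all add: ncpoly_sc_def algebra_simps single_add)

lemma ncpoly_sc_mult_right: "p * ncpoly_sc c q = ncpoly_sc c (p * q)"
proof (induction p rule: ncpoly_induct)
  case (single u e)
  show ?case
  proof (induction q rule: ncpoly_induct)
    case (single v f)
    show ?case by (simp add: mult_single ncpoly_sc_single mult.left_commute)
  qed (simp add: distrib_left ncpoly_sc_add)
qed (simp add: distrib_right ncpoly_sc_add)

lemma ncpoly_eval_var:
  fixes p :: "'i ncpoly"
  shows "ncpoly_eval ncpoly_sc ncpoly_t ncpoly_var p = p"
proof -
  have "prod_list (map (letter_val ncpoly_t ncpoly_var) ls) = Poly_Mapping.single (Word ls) 1"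
    for ls :: "'i letter list"
  proof (induction ls)
    case Nil
    then show ?case by (simp flip: zero_free_monoid_def)
  next
    case (Cons l ls)
    have "letter_val ncpoly_t ncpoly_var l = Poly_Mapping.single (Word [l]) 1"
      by (cases l) (simp_all add: ncpoly_var_def ncpoly_t_single word_t_def)
    with Cons show ?case by (simp add: mult_single plus_free_monoid_def)
  qed
  then have "word_eval ncpoly_t ncpoly_var w = Poly_Mapping.single w 1"
    for w :: "'i letter free_monoid"
    by (cases w) (simp add: word_eval_def)
  then show ?thesis
    by (simp add: ncpoly_eval_def ncpoly_sc_single sum_monomials)
qed

context real_second_order_space
begin

interpretation t: Vector_Spaces.linear sc sc t
  by (rule t_linear)

lemma t_one: "t 1 = 1"
  by (metis t_mult t_t mult_1_left mult_1_right)

lemma ncpoly_eval_add: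
  "ncpoly_eval sc t a (p + q) = ncpoly_eval sc t a p + ncpoly_eval sc t a q"
  unfolding ncpoly_eval_def by (rule sum_keys_add) (simp_all add: scale_left_distrib)

lemma ncpoly_eval_single: "ncpoly_eval sc t a (Poly_Mapping.single w c) = sc c (word_eval t a w)"
  by (simp add: ncpoly_eval_def)

lemma ncpoly_eval_sc: "ncpoly_eval sc t a (ncpoly_sc c p) = sc c (ncpoly_eval sc t a p)"
  by (induction p rule: ncpoly_induct)
    (simp_all add: ncpoly_eval_add ncpoly_eval_single ncpoly_sc_single ncpoly_sc_add scale_right_distrib)

lemma ncpoly_eval_mult: "ncpoly_eval sc t a (p * q) = ncpoly_eval sc t a p * ncpoly_eval sc t a q"
proof (induction p rule: ncpoly_induct)
  case (single u c)
  show ?case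
  proof (induction q rule: ncpoly_induct)
    case (single v e)
    have "word_eval t a (u + v) = word_eval t a u * word_eval t a v"
      by (simp add: word_eval_def plus_free_monoid_def)
    then show ?case
      by (simp add: mult_single ncpoly_eval_single scale_mult_left scale_mult_right)
  qed (simp add: distrib_left ncpoly_eval_add)
qed (simp add: distrib_right ncpoly_eval_add)

lemma ncpoly_eval_one: "ncpoly_eval sc t a 1 = 1"
proof -
  have "ncpoly_eval sc t a (Poly_Mapping.single 0 1) = 1"
    by (subst ncpoly_eval_single) (simp add: word_eval_def zero_free_monoid_def)
  then show ?thesis by simp
qed

lemma ncpoly_eval_prod_list:
  "ncpoly_eval sc t a (prod_list ps) = prod_list (map (ncpoly_eval sc t a) ps)"
  by (induction ps) (simp_all add: ncpoly_eval_one ncpoly_eval_mult)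

lemma ncpoly_eval_t: "ncpoly_eval sc t a (ncpoly_t p) = t (ncpoly_eval sc t a p)"
proof (induction p rule: ncpoly_induct)
  case (single w c)
  have l: "letter_val t a (letter_t l) = t (letter_val t a l)" for l
    by (cases l) (simp_all add: t_t)
  have "prod_list (map (letter_val t a) (rev (map letter_t ls))) =
      t (prod_list (map (letter_val t a) ls))" for ls
    by (induction ls) (simp_all add: t_one t_mult l)
  then have "word_eval t a (word_t w) = t (word_eval t a w)"
    by (simp add: word_eval_def word_t_def)
  then show ?case
    by (simp add: ncpoly_t_single ncpoly_eval_single t.scale)
qed (simp add: ncpoly_t_add ncpoly_eval_add t.add)

lemma ncpoly_eval_ncpoly_var: "ncpoly_eval sc t a (ncpoly_var i) = a i"
  by (simp add: ncpoly_var_def ncpoly_eval_single word_eval_def)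

lemma unital_subalgebra_iff:
  "unital_subalgebra sc S \<longleftrightarrow>
     0 \<in> S \<and> (\<forall>x\<in>S. \<forall>y\<in>S. x + y \<in> S) \<and> (\<forall>c. \<forall>x\<in>S. sc c x \<in> S) \<and> 1 \<in> S \<and>
     (\<forall>x\<in>S. \<forall>y\<in>S. x * y \<in> S)"
  by (auto simp: unital_subalgebra_def subspace_def)

lemma unital_subalgebra_generated: "unital_subalgebra sc (generated_subalgebra sc t a)"
  unfolding generated_subalgebra_def
  by (rule hull_in) (auto simp: unital_subalgebra_iff)

lemma generated_subalgebra_gens:
  "a i \<in> generated_subalgebra sc t a" "t (a i) \<in> generated_subalgebra sc t a"
  unfolding generated_subalgebra_def by (auto intro!: hull_inc)

lemma generated_subalgebra_t: "t ` generated_subalgebra sc t a \<subseteq> generated_subalgebra sc t a"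
proof -
  let ?G = "generated_subalgebra sc t a"
  have "unital_subalgebra sc {x. t x \<in> ?G}"
    using unital_subalgebra_generated[of a] unfolding unital_subalgebra_iff
    by (simp add: t_one t_mult t.scale
        t.add t.zero)
  moreover have "range a \<union> range (\<lambda>i. t (a i)) \<subseteq> {x. t x \<in> ?G}"
    by (auto simp: t_t generated_subalgebra_gens)
  ultimately have "?G \<subseteq> {x. t x \<in> ?G}"
    unfolding generated_subalgebra_def by (intro hull_minimal)
  then show ?thesis by auto
qed

lemma real_second_order_space_pullback:
  fixes a :: "'i \<Rightarrow> 'a"
  defines "E \<equiv> ncpoly_eval sc t a"
  shows "real_second_order_space ncpoly_sc (\<lambda>p. \<phi> (E p)) (\<lambda>p q. \<phi>2 (E p) (E q)) ncpoly_t"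
proof -
  interpret P: vector_space "ncpoly_sc :: complex \<Rightarrow> 'i ncpoly \<Rightarrow> 'i ncpoly"
    by (rule vector_space_ncpoly_sc)
  interpret C: vector_space "(*) :: complex \<Rightarrow> complex \<Rightarrow> complex"
    by standard (simp_all add: algebra_simps)
  note E = ncpoly_eval_add ncpoly_eval_sc ncpoly_eval_mult ncpoly_eval_one ncpoly_eval_t
  have lin: "Vector_Spaces.linear ncpoly_sc (*) (\<lambda>p. f (E p))"
    if "Vector_Spaces.linear sc (*) f" for f :: "'a \<Rightarrow> complex"
  proof -
    interpret f: Vector_Spaces.linear sc "(*)" f by (rule that)
    show ?thesis
      by unfold_locales (simp_all add: E_def E f.add f.scale)
  qed
  show ?thesis
  proof (intro real_second_order_space.intro real_second_order_space_axioms.intro)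
    show "Vector_Spaces.linear ncpoly_sc ncpoly_sc (ncpoly_t :: 'i ncpoly \<Rightarrow> _)"
      by unfold_locales (simp_all add: ncpoly_t_add ncpoly_t_sc)
    show "\<phi> (E (p * q)) = \<phi> (E (q * p))" for p q
      unfolding E_def E by (rule phi_tracial)
    show "\<phi>2 (E (p * q)) (E r) = \<phi>2 (E (q * p)) (E r)" for p q r
      unfolding E_def E by (rule phi2_tracial_left)
    show "\<phi>2 (E r) (E (p * q)) = \<phi>2 (E r) (E (q * p))" for p q r
      unfolding E_def E by (rule phi2_tracial_right)
    show "Vector_Spaces.linear ncpoly_sc (*) (\<lambda>p. \<phi>2 (E p) (E q))" for q
      by (rule lin[OF phi2_linear_left])
    show "ncpoly_sc c p * q = ncpoly_sc c (p * q)" for c and p q :: "'i ncpoly"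
      by (simp add: ncpoly_sc_def mult.assoc)
  qed (use phi_linear phi2_linear_right P.vector_space_axioms in
      \<open>simp_all add: E_def E ncpoly_sc_mult_right ncpoly_t_mult ncpoly_t_ncpoly_t
        lin[unfolded E_def] phi_one phi_t phi2_one_left phi2_one_right phi2_t_left phi2_t_right\<close>)
qed

lemma generated_subalgebra_pullback:
  assumes "p \<in> generated_subalgebra ncpoly_sc ncpoly_t (\<lambda>k. ncpoly_var (f k))"
  shows "ncpoly_eval sc t a p \<in> generated_subalgebra sc t (\<lambda>k. a (f k))"
proof -
  let ?G = "generated_subalgebra sc t (\<lambda>k. a (f k))"
  interpret P: real_second_order_space ncpoly_sc "\<lambda>p. \<phi> (ncpoly_eval sc t a p)"
    "\<lambda>p q. \<phi>2 (ncpoly_eval sc t a p) (ncpoly_eval sc t a q)" ncpoly_t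
    by (rule real_second_order_space_pullback)
  have "ncpoly_eval sc t a 0 = 0"
    by (simp add: ncpoly_eval_def)
  then have "unital_subalgebra ncpoly_sc {p. ncpoly_eval sc t a p \<in> ?G}"
    using unital_subalgebra_generated[of "\<lambda>k. a (f k)"]
    unfolding unital_subalgebra_iff P.unital_subalgebra_iff
    by (simp add: ncpoly_eval_add ncpoly_eval_sc ncpoly_eval_mult ncpoly_eval_one)
  moreover have "range (\<lambda>k. ncpoly_var (f k)) \<union> range (\<lambda>k. ncpoly_t (ncpoly_var (f k)))
      \<subseteq> {p. ncpoly_eval sc t a p \<in> ?G}"
    using generated_subalgebra_gens[of "\<lambda>k. a (f k)"]
    by (auto simp: ncpoly_eval_t ncpoly_eval_ncpoly_var)
  ultimately have "generated_subalgebra ncpoly_sc ncpoly_t (\<lambda>k. ncpoly_var (f k))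
      \<subseteq> {p. ncpoly_eval sc t a p \<in> ?G}"
    unfolding generated_subalgebra_def[of ncpoly_sc] by (intro hull_minimal)
  with assms show ?thesis by auto
qed

lemma real_free_second_order_pullback:
  fixes a :: "'i \<Rightarrow> 'a" and Alg :: "'k \<Rightarrow> 'a set" and Alg' :: "'k \<Rightarrow> 'i ncpoly set"
  defines "E \<equiv> ncpoly_eval sc t a"
  assumes free: "real_free_second_order sc \<phi> \<phi>2 t K Alg"
    and sub: "\<And>k. k \<in> K \<Longrightarrow> unital_subalgebra ncpoly_sc (Alg' k) \<and> ncpoly_t ` Alg' k \<subseteq> Alg' k"
    and img: "\<And>k p. p \<in> Alg' k \<Longrightarrow> E p \<in> Alg k"
  shows "real_free_second_order ncpoly_sc (\<lambda>p. \<phi> (E p)) (\<lambda>p q. \<phi>2 (E p) (E q)) ncpoly_t K Alg'"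
proof -
  note E = ncpoly_eval_prod_list[of a, folded E_def] ncpoly_eval_mult[of a, folded E_def]
    ncpoly_eval_t[of a, folded E_def]
  have alt: "cyclically_alternating K Alg (map E xs)" if "cyclically_alternating K Alg' xs" for xs
    using that img unfolding cyclically_alternating_def by auto
  have cen: "centred \<phi> (map E xs)" if "centred (\<lambda>p. \<phi> (E p)) xs" for xs
    using that by (auto simp: centred_def)
  have free1: "free_subalgebras (\<lambda>p. \<phi> (E p)) K Alg'"
    unfolding free_subalgebras_def
  proof (intro allI impI)
    fix xs :: "'i ncpoly list" and j :: "nat \<Rightarrow> 'k"
    assume xs: "xs \<noteq> []" "\<forall>i<length xs. j i \<in> K \<and> xs ! i \<in> Alg' (j i) \<and> \<phi> (E (xs ! i)) = 0"
      "\<forall>i. Suc i < length xs \<longrightarrow> j i \<noteq> j (Suc i)"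
    have "\<phi> (prod_list (map E xs)) = 0"
      using free xs img unfolding real_free_second_order_def free_subalgebras_def
      by (elim conjE allE[of _ "map E xs"] allE[of _ j]) auto
    then show "\<phi> (E (prod_list xs)) = 0" by (simp add: E)
  qed
  show ?thesis
    unfolding real_free_second_order_def
  proof (intro conjI allI impI ballI)
    fix xs ys :: "'i ncpoly list"
    assume "cyclically_alternating K Alg' xs \<and> centred (\<lambda>p. \<phi> (E p)) xs"
      "cyclically_alternating K Alg' ys \<and> centred (\<lambda>p. \<phi> (E p)) ys"
    then have xy: "cyclically_alternating K Alg (map E xs) \<and> centred \<phi> (map E xs)"
      "cyclically_alternating K Alg (map E ys) \<and> centred \<phi> (map E ys)"
      using alt cen by auto
    note * = free[unfolded real_free_second_order_def, THEN conjunct2, THEN conjunct2, rule_format, OF xy]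
    show "\<phi>2 (E (prod_list xs)) (E (prod_list ys)) = 0" if "length xs \<noteq> length ys"
      using * that by (simp add: E)
    show "\<phi>2 (E (prod_list xs)) (E (prod_list ys)) = 0"
      if "length xs = 1 \<and> length ys = 1 \<and>
        (\<exists>k\<in>K. \<exists>l\<in>K. k \<noteq> l \<and> xs ! 0 \<in> Alg' k \<and> ys ! 0 \<in> Alg' l)"
    proof -
      have "length (map E xs) = 1 \<and> length (map E ys) = 1 \<and>
        (\<exists>k\<in>K. \<exists>l\<in>K. k \<noteq> l \<and> map E xs ! 0 \<in> Alg k \<and> map E ys ! 0 \<in> Alg l)"
        using that img by force
      with * have "\<phi>2 (prod_list (map E xs)) (prod_list (map E ys)) = 0" by blast
      then show ?thesis by (simp add: E)
    qed
    fix n :: nat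
    assume n: "n > 1" "length xs = n \<and> length ys = n"
    have "\<phi>2 (prod_list (map E xs)) (prod_list (map E ys)) =
        (\<Sum>k<n. (\<Prod>i<n. \<phi> (map E xs ! i * map E ys ! ((k + n - i) mod n))) +
               (\<Prod>i<n. \<phi> (map E xs ! i * t (map E ys ! ((i + n - k) mod n)))))"
      using * n by simp
    then show "\<phi>2 (E (prod_list xs)) (E (prod_list ys)) =
        (\<Sum>k<n. (\<Prod>i<n. \<phi> (E (xs ! i * ys ! ((k + n - i) mod n)))) +
               (\<Prod>i<n. \<phi> (E (xs ! i * ncpoly_t (ys ! ((i + n - k) mod n))))))"
      using n by (simp add: E)
  qed (use sub free1 in auto)
qed

end

theorem asymptotically_real_free_second_orderI:
  fixes M :: "nat \<Rightarrow> 'w measure"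
    and A :: "nat \<Rightarrow> 'i \<Rightarrow> 'w \<Rightarrow> complex mat"
    and B :: "nat \<Rightarrow> 'j \<Rightarrow> 'w \<Rightarrow> complex mat"
    and a :: "'i \<Rightarrow> 'a::ring_1" and b :: "'j \<Rightarrow> 'a"
  assumes "real_free_limit M A B sc \<phi> \<phi>2 t a b"
  shows "asymptotically_real_free_second_order M A B"
proof -
  let ?c = "case_sum a b"
  define E where "E = ncpoly_eval sc t ?c"
  have lim: "real_second_order_limit M (\<lambda>d. case_sum (A d) (B d)) sc \<phi> \<phi>2 t ?c"
    and free: "real_free_second_order sc \<phi> \<phi>2 t UNIV
       (\<lambda>first. if first then generated_subalgebra sc t a else generated_subalgebra sc t b)"
    using assms by (auto simp: real_free_limit_def)
  interpret S: real_second_order_space sc \<phi> \<phi>2 t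
    using lim by (simp add: real_second_order_limit_def)
  interpret P: real_second_order_space ncpoly_sc "\<lambda>p. \<phi> (E p)" "\<lambda>p q. \<phi>2 (E p) (E q)" ncpoly_t
    unfolding E_def by (rule S.real_second_order_space_pullback)
  let ?va = "\<lambda>i. ncpoly_var (Inl i) :: ('i + 'j) ncpoly"
  let ?vb = "\<lambda>j. ncpoly_var (Inr j) :: ('i + 'j) ncpoly"
  have v: "case_sum ?va ?vb = ncpoly_var"
    by (rule ext) (simp split: sum.split)
  have "real_second_order_limit M (\<lambda>d. case_sum (A d) (B d)) ncpoly_sc
      (\<lambda>p. \<phi> (E p)) (\<lambda>p q. \<phi>2 (E p) (E q)) ncpoly_t (case_sum ?va ?vb)"
    using lim P.real_second_order_space_axioms
    unfolding v real_second_order_limit_def ncpoly_eval_var by (simp add: E_def)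
  moreover have "real_free_second_order ncpoly_sc (\<lambda>p. \<phi> (E p)) (\<lambda>p q. \<phi>2 (E p) (E q)) ncpoly_t UNIV
      (\<lambda>first. if first then generated_subalgebra ncpoly_sc ncpoly_t ?va
               else generated_subalgebra ncpoly_sc ncpoly_t ?vb)"
    unfolding E_def
  proof (rule S.real_free_second_order_pullback[OF free])
    show "ncpoly_eval sc t ?c p \<in> (if k then generated_subalgebra sc t a else generated_subalgebra sc t b)"
      if "p \<in> (if k then generated_subalgebra ncpoly_sc ncpoly_t ?va
               else generated_subalgebra ncpoly_sc ncpoly_t ?vb)" for k p
      using that S.generated_subalgebra_pullback[of p Inl ?c]
        S.generated_subalgebra_pullback[of p Inr ?c] by (auto split: if_splits)
  qed (use P.unital_subalgebra_generated[of ?va] P.generated_subalgebra_t[of ?va]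
      P.unital_subalgebra_generated[of ?vb] P.generated_subalgebra_t[of ?vb] in auto)
  ultimately show ?thesis
    unfolding asymptotically_real_free_second_order_def real_free_limit_def by blast
qed

end

theory Submission
  imports Defs
begin

text \<open>
  The proof uses neither Haar unitaries nor Weingarten calculus. Differentiating, at the identity, the
  invariance under rotations of the coordinate planes \<open>(\<rho>, \<sigma>)\<close> gives \<open>E (D f) = 0\<close> for a derivation \<open>D\<close>
  that annihilates the entries of the second family. For \<open>f\<close> the \<open>(\<rho>, \<sigma>)\<close> entry of a word
  \<open>a\<^sub>1 b\<^sub>1 \<dots> a\<^sub>n b\<^sub>n\<close> times a product of centred traces, summation over \<open>\<rho>\<close> and \<open>\<sigma>\<close> yields a
  Schwinger-Dyson equation. It expresses \<open>(d - 1) Tr (a\<^sub>1 b\<^sub>1 \<dots> a\<^sub>n b\<^sub>n)\<close>, inside any such expectation, by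
  products of two traces of words with fewer blocks, by single traces of words with at most \<open>n\<close> blocks,
  and by the terms in which the word is merged with one of the other traces.

  Rank the moments by the total number of blocks. Terms of top rank enter with a factor that tends to 0,
  so induction on the rank gives convergence of the normalized traces and of all centred moments, and in
  the limit the equations become a recursion that propagates Wick's rule from traces of words in one
  family, where it is the hypothesis, to all words. Hence the higher cumulants vanish in the limit. For
  centred alternating words all products of two limiting traces vanish, which gives freeness, and only
  the merged terms survive in the covariance, which gives the formula for second order freeness.
\<close>

section \<open>Asymptotically decoupled linear systems\<close>

text \<open>There is no a priori bound on the means or the centred moments of mixed words, so a
  coefficient tending to 0 does not by itself make a term disappear. Moreover two kinds of unknowns
  are coupled within one rank: the equation for a normalized mean contains covariances of the same
  total rank, and the equation for a centred moment contains normalized means of that rank. After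
  division of the moments by \<open>d\<close> every such coupling has a coefficient that tends to 0.
  Hence the passage to the limit is made twice. The first pass treats, for each rank, a finite
  system in the normalized means and in the moments divided by \<open>d\<close>; such a system
  forces its own boundedness. The second pass uses the outcome, that moments are of order
  \<open>o(d)\<close>, to discard the terms with the factor \<open>1 / (d - 1)\<close> and to find
  the limits of the moments themselves. The transposes have one source: the generator
  \<open>E_rs - E_sr\<close> of a plane rotation is skew, and in the sum over all planes one half of
  it glues words directly, the other half after a transposition.\<close>

lemma sum_mset_remove_add:
  "(\<Sum>x\<in>#add_mset z F. g x (add_mset z F - {#x#})) =
    (g z F + (\<Sum>x\<in>#F. g x (add_mset z (F - {#x#}))) :: 'b::comm_monoid_add)"
proof -
  have "(\<Sum>x\<in>#F. g x (add_mset z F - {#x#})) = (\<Sum>x\<in>#F. g x (add_mset z (F - {#x#})))"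
    by (intro arg_cong[of _ _ sum_mset] image_mset_cong arg_cong2[of _ _ _ _ g] refl)
      (simp add: insert_DiffM2 multi_union_self_other_eq)
  then show ?thesis by simp
qed

text \<open>Ordered pairs of occurrences in a multiset may be listed in either order, because the
  remainder after both removals is the same. In Wick's rule this exchanges the partners of two
  items.\<close>

lemma sum_mset_remove_swap:
  fixes f :: "'x \<Rightarrow> 'x \<Rightarrow> 'x multiset \<Rightarrow> 'b::comm_monoid_add"
  shows "(\<Sum>x\<in>#F. \<Sum>y\<in>#F - {#x#}. f x y (F - {#x#} - {#y#})) =
    (\<Sum>x\<in>#F. \<Sum>y\<in>#F - {#x#}. f y x (F - {#x#} - {#y#}))"
proof (induction F arbitrary: f)
  case (add z F)
  have *: "(\<Sum>x\<in>#add_mset z F. \<Sum>y\<in>#add_mset z F - {#x#}. h x y (add_mset z F - {#x#} - {#y#})) =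
     (\<Sum>y\<in>#F. h z y (F - {#y#})) + ((\<Sum>x\<in>#F. h x z (F - {#x#})) +
      (\<Sum>x\<in>#F. \<Sum>y\<in>#F - {#x#}. h x y (add_mset z (F - {#x#} - {#y#}))))"
    for h :: "'x \<Rightarrow> 'x \<Rightarrow> 'x multiset \<Rightarrow> 'b"
    by (subst sum_mset_remove_add[where g = "\<lambda>x G. \<Sum>y\<in>#G. h x y (G - {#y#})"],
        subst sum_mset_remove_add[where g = "h x" for x]) (simp add: sum_mset.distrib)
  show ?case
    unfolding *[of f] *[of "\<lambda>x y. f y x"] add.IH[of "\<lambda>x y G. f x y (add_mset z G)"]
    by (simp only: add.left_commute)
qed simp

lemma tendsto_sum_mset:
  fixes f :: "'x \<Rightarrow> nat \<Rightarrow> complex"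
  assumes "\<And>x. x \<in># F \<Longrightarrow> f x \<longlonglongrightarrow> l x"
  shows "(\<lambda>d. \<Sum>x\<in>#F. f x d) \<longlonglongrightarrow> (\<Sum>x\<in>#F. l x)"
  using assms by (induction F) (auto intro!: tendsto_add)

text \<open>\<open>f = o(W)\<close> for a weight that may be unbounded: \<open>W\<close> will be one
  plus the sum of the norms of the unknowns, about whose size nothing is known in advance.\<close>

definition negligible :: "(nat \<Rightarrow> real) \<Rightarrow> (nat \<Rightarrow> complex) \<Rightarrow> bool" where
  "negligible W f \<longleftrightarrow> (\<lambda>d. norm (f d) / W d) \<longlonglongrightarrow> 0"

lemma negligible_add:
  assumes "negligible W f" "negligible W g" "\<And>d. W d \<ge> 1"
  shows "negligible W (\<lambda>d. f d + g d)"
  unfolding negligible_def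
proof (rule tendsto_sandwich[OF _ _ tendsto_const])
  show "(\<lambda>d. norm (f d) / W d + norm (g d) / W d) \<longlonglongrightarrow> 0"
    using tendsto_add[OF assms(1,2)[unfolded negligible_def]] by simp
  show "\<forall>\<^sub>F d in sequentially. norm (f d + g d) / W d \<le> norm (f d) / W d + norm (g d) / W d"
    using assms(3) by (intro always_eventually allI)
      (metis add_divide_distrib divide_right_mono norm_triangle_ineq order_trans zero_le_one)
  show "\<forall>\<^sub>F d in sequentially. 0 \<le> norm (f d + g d) / W d"
    using assms(3) by (intro always_eventually allI) (meson divide_nonneg_nonneg norm_ge_zero order_trans zero_le_one)
qed

text \<open>An unknown is dominated by the weight, so a vanishing coefficient suffices even if the
  unknown might be unbounded.\<close>

lemma negligible_tendsto_mult:
  assumes e: "e \<longlonglongrightarrow> 0" and v: "\<forall>\<^sub>F d in sequentially. norm (v d) \<le> W d" and W: "\<And>d. W d \<ge> 1"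
  shows "negligible W (\<lambda>d. e d * v d)"
  unfolding negligible_def
proof (rule tendsto_sandwich[OF _ _ tendsto_const])
  show "(\<lambda>d. norm (e d)) \<longlonglongrightarrow> 0" using tendsto_norm[OF e] by simp
  show "\<forall>\<^sub>F d in sequentially. norm (e d * v d) / W d \<le> norm (e d)"
    using v
  proof eventually_elim
    case (elim d)
    have "norm (e d * v d) \<le> norm (e d) * W d" using elim by (simp add: norm_mult mult_left_mono)
    then show ?case using W[of d] by (simp add: divide_le_eq)
  qed
  show "\<forall>\<^sub>F d in sequentially. 0 \<le> norm (e d * v d) / W d"
    using W by (intro always_eventually allI) (meson divide_nonneg_nonneg norm_ge_zero order_trans zero_le_one)
qed

lemma negligible_tendsto: "e \<longlonglongrightarrow> 0 \<Longrightarrow> (\<And>d. W d \<ge> 1) \<Longrightarrow> negligible W e"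
  using negligible_tendsto_mult[of e "\<lambda>_. 1" W] by simp

lemma negligible_cong: "\<forall>\<^sub>F d in sequentially. f d = g d \<Longrightarrow> negligible W f \<Longrightarrow> negligible W g"
  unfolding negligible_def by (erule Lim_transform_eventually, erule eventually_mono) simp

lemma negligible_0: "negligible W (\<lambda>_. 0)"
  by (simp add: negligible_def)

lemma negligible_sum_list:
  "(\<And>x. x \<in> set xs \<Longrightarrow> negligible W (f x)) \<Longrightarrow> (\<And>d. W d \<ge> 1) \<Longrightarrow> negligible W (\<lambda>d. \<Sum>x\<leftarrow>xs. f x d)"
  by (induction xs) (auto intro!: negligible_add negligible_0)

lemma negligible_sum_mset:
  "(\<And>x. x \<in># F \<Longrightarrow> negligible W (f x)) \<Longrightarrow> (\<And>d. W d \<ge> 1) \<Longrightarrow> negligible W (\<lambda>d. \<Sum>x\<in>#F. f x d)"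
  by (induction F) (auto intro!: negligible_add negligible_0)

text \<open>A finite linear system whose coupling coefficients tend to 0 decouples in the limit.\<close>

lemma negligible_bootstrap:
  fixes v :: "'c \<Rightarrow> nat \<Rightarrow> complex"
  assumes C: "finite C"
    and v: "\<And>c. c \<in> C \<Longrightarrow> negligible (\<lambda>d. 1 + (\<Sum>c\<in>C. norm (v c d))) (\<lambda>d. v c d - l c)"
    and c: "c \<in> C"
  shows "v c \<longlonglongrightarrow> l c"
proof -
  define W where "W d = 1 + (\<Sum>c\<in>C. norm (v c d))" for d
  define K where "K = 1 + (\<Sum>c\<in>C. norm (l c))"
  have W1: "W d \<ge> 1" for d by (simp add: W_def sum_nonneg)
  have v': "(\<lambda>d. norm (v c d - l c) / W d) \<longlonglongrightarrow> 0" if "c \<in> C" for c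
    using v[OF that] by (simp add: negligible_def W_def)
  have "(\<lambda>d. \<Sum>c\<in>C. norm (v c d - l c) / W d) \<longlonglongrightarrow> (\<Sum>c\<in>C. 0)"
    by (intro tendsto_sum v')
  \<comment> \<open>Once the total relative error is below one half,
    \<open>W \<le> K + W / 2\<close>. So the weight is eventually at most \<open>2 * K\<close>, and
    all unknowns are bounded.\<close>
  then have "\<forall>\<^sub>F d in sequentially. (\<Sum>c\<in>C. norm (v c d - l c) / W d) < 1/2"
    by (intro order_tendstoD(2)[of _ 0]) auto
  then have "\<forall>\<^sub>F d in sequentially. W d \<le> 2 * K"
  proof eventually_elim
    case (elim d)
    have "(\<Sum>c\<in>C. norm (v c d)) \<le> (\<Sum>c\<in>C. norm (l c) + norm (v c d - l c))"
      by (intro sum_mono norm_triangle_sub)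
    also have "\<dots> = K - 1 + (\<Sum>c\<in>C. norm (v c d - l c))"
      unfolding K_def sum.distrib by simp
    finally have "W d \<le> K + (\<Sum>c\<in>C. norm (v c d - l c))" by (simp add: W_def)
    moreover have "(\<Sum>c\<in>C. norm (v c d - l c)) \<le> W d / 2"
    proof -
      have "(\<Sum>c\<in>C. norm (v c d - l c)) / W d < 1 / 2"
        using elim by (simp only: sum_divide_distrib)
      then show ?thesis using W1[of d] by (auto simp: divide_less_eq)
    qed
    ultimately show ?case by linarith
  qed
  then have "\<forall>\<^sub>F d in sequentially. norm (v c d - l c) \<le> 2 * K * (norm (v c d - l c) / W d)"
  proof eventually_elim
    case (elim d)
    have "norm (v c d - l c) * W d \<le> norm (v c d - l c) * (2 * K)"
      by (rule mult_left_mono[OF elim]) simp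
    then have "norm (v c d - l c) \<le> norm (v c d - l c) * (2 * K) / W d"
      using W1[of d] by (subst pos_le_divide_eq) auto
    then show ?case by (simp add: mult_ac)
  qed
  moreover have "(\<lambda>d. 2 * K * (norm (v c d - l c) / W d)) \<longlonglongrightarrow> 0"
    using tendsto_mult_left[OF v'[OF c], of "2 * K"] by simp
  ultimately have "(\<lambda>d. v c d - l c) \<longlonglongrightarrow> 0"
    by (rule Lim_null_comparison)
  then show ?thesis by (simp add: LIM_zero_iff)
qed

section \<open>Moments and cumulants\<close>

text \<open>The moments are an arbitrary function on index sets. Cumulants of subfamilies are then
  values of the same function, and the combinatorics is separated from integration.\<close>

definition set_cumulant :: "(nat set \<Rightarrow> complex) \<Rightarrow> nat set \<Rightarrow> complex" where
  "set_cumulant m S =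
     (\<Sum>\<pi> | partition_on S \<pi>. (-1) ^ (card \<pi> - 1) * fact (card \<pi> - 1) * (\<Prod>V\<in>\<pi>. m V))"

lemma partition_on_finite:
  assumes "partition_on S \<pi>" "finite S" shows "finite \<pi>"
  using assms finite_UnionD by (force simp: partition_on_def)

lemma finite_partitions: "finite S \<Longrightarrow> finite {\<pi>. partition_on S \<pi>}"
  by (rule finite_subset[of _ "Pow (Pow S)"]) (auto simp: partition_on_def)

text \<open>Expand each cumulant over partitions. A proper subset \<open>V\<close> together with a
  partition of \<open>V\<close> is a partition of \<open>S\<close> with a marked block that avoids
  \<open>j\<close>, namely \<open>S - V\<close>. A partition with \<open>n\<close> blocks allows
  \<open>n - 1\<close> marks, each with coefficient \<open>(-1) ^ (n - 2) * fact (n - 2)\<close>,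
  and these cancel its own coefficient unless \<open>n = 1\<close>.\<close>

lemma moment_cumulant:
  assumes S: "finite S" and j: "j \<in> S" and m0: "m {} = 1"
  shows "m S = (\<Sum>V | V \<subseteq> S \<and> j \<in> V. set_cumulant m V * m (S - V))"
proof -
  define q where "q \<pi> = (-1) ^ (card \<pi> - 1) * (fact (card \<pi> - 1) :: complex)" for \<pi> :: "nat set set"
  define p where "p \<pi> = (\<Prod>V\<in>\<pi>. m V)" for \<pi>
  let ?X = "{V. V \<subset> S \<and> j \<in> V}"
  have fX: "finite ?X" using S by (auto intro: finite_subset[of _ "Pow S"])
  have split: "{V. V \<subseteq> S \<and> j \<in> V} = insert S ?X" using j by auto
  have fP: "finite {\<pi>. partition_on V \<pi>}" if "V \<subseteq> S" for V
    using that S finite_subset finite_partitions by blast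
  have k: "set_cumulant m V = (\<Sum>\<pi> | partition_on V \<pi>. q \<pi> * p \<pi>)" for V
    by (simp add: set_cumulant_def q_def p_def)
  have "(\<Sum>V\<in>?X. set_cumulant m V * m (S - V)) =
      (\<Sum>V\<in>?X. \<Sum>\<pi> | partition_on V \<pi>. q \<pi> * p \<pi> * m (S - V))"
    by (simp add: k sum_distrib_right)
  also have "\<dots> = (\<Sum>(V, \<pi>)\<in>Sigma ?X (\<lambda>V. {\<pi>. partition_on V \<pi>}). q \<pi> * p \<pi> * m (S - V))"
    using fX fP by (subst sum.Sigma) auto
  \<comment> \<open>Adjoining \<open>S - V\<close> to the partition of \<open>V\<close> is inverted
    by removing the marked block.\<close>
  also have "\<dots> = (\<Sum>(\<rho>, U)\<in>Sigma {\<rho>. partition_on S \<rho>} (\<lambda>\<rho>. {U\<in>\<rho>. j \<notin> U}). q (\<rho> - {U}) * p \<rho>)"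
  proof (rule sum.reindex_bij_witness[where i = "\<lambda>(\<rho>, U). (S - U, \<rho> - {U})"
        and j = "\<lambda>(V, \<pi>). (insert (S - V) \<pi>, S - V)"], goal_cases)
    case (1 a)
    then obtain V \<pi> where a: "a = (V, \<pi>)" "V \<subset> S" "j \<in> V" "partition_on V \<pi>" by auto
    then have "S - V \<notin> \<pi>" by (auto simp: partition_on_def)
    then show ?case using a by auto
  next
    case (2 a)
    then obtain V \<pi> where a: "a = (V, \<pi>)" "V \<subset> S" "j \<in> V" "partition_on V \<pi>" by auto
    then show ?case by (auto simp: partition_on_def disjoint_def)
  next
    case (3 b)
    then obtain \<rho> U where b: "b = (\<rho>, U)" "partition_on S \<rho>" "U \<in> \<rho>" by auto
    then have "U \<subseteq> S" by (auto simp: partition_on_def)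
    then have "S - (S - U) = U" by blast
    then show ?case using b by (simp add: insert_absorb)
  next
    case (4 b)
    then obtain \<rho> U where b: "b = (\<rho>, U)" "partition_on S \<rho>" "U \<in> \<rho>" "j \<notin> U" by auto
    then have "U \<noteq> {}" "U \<subseteq> S" by (auto simp: partition_on_def)
    then have "S - U \<subset> S" "j \<in> S - U" using b(4) j by auto
    moreover have "partition_on (S - U) (\<rho> - {U})"
    proof (rule partition_onI)
      show "\<Union>(\<rho> - {U}) = S - U"
      proof (intro equalityI subsetI)
        fix x assume "x \<in> \<Union>(\<rho> - {U})"
        then obtain V where "V \<in> \<rho>" "V \<noteq> U" "x \<in> V" by blast
        then show "x \<in> S - U" using b(2,3) disjointD[of \<rho> V U] by (auto simp: partition_on_def)
      next
        fix x assume "x \<in> S - U"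
        then show "x \<in> \<Union>(\<rho> - {U})" using b(2) by (auto simp: partition_on_def)
      qed
    qed (use b(2) in \<open>auto simp: partition_on_def disjnt_def dest: disjointD\<close>)
    ultimately show ?case using b by auto
  next
    case (5 a)
    then obtain V \<pi> where a: "a = (V, \<pi>)" "V \<subset> S" "j \<in> V" "partition_on V \<pi>" by auto
    then have "S - V \<notin> \<pi>" by (auto simp: partition_on_def)
    moreover have "finite \<pi>" using partition_on_finite[OF a(4)] a(2) S finite_subset by blast
    ultimately show ?case using a by (simp add: p_def mult_ac)
  qed
  also have "\<dots> = (\<Sum>\<rho> | partition_on S \<rho>. \<Sum>U | U \<in> \<rho> \<and> j \<notin> U. q (\<rho> - {U}) * p \<rho>)"
    using finite_partitions[OF S] partition_on_finite[OF _ S]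
    by (subst sum.Sigma) (auto intro!: finite_Collect_conjI)
  finally have eq: "(\<Sum>V\<in>?X. set_cumulant m V * m (S - V)) = \<dots>" .
  have "(\<Sum>V | V \<subseteq> S \<and> j \<in> V. set_cumulant m V * m (S - V)) =
      set_cumulant m S * m {} + (\<Sum>V\<in>?X. set_cumulant m V * m (S - V))"
    unfolding split using fX by simp
  also have "\<dots> = (\<Sum>\<rho> | partition_on S \<rho>. q \<rho> * p \<rho> + (\<Sum>U | U \<in> \<rho> \<and> j \<notin> U. q (\<rho> - {U}) * p \<rho>))"
    unfolding eq by (simp add: k m0 sum.distrib)
  also have "\<dots> = (\<Sum>\<rho> | partition_on S \<rho>. if \<rho> = {S} then m S else 0)"
  proof (rule sum.cong[OF refl])
    fix \<rho> assume "\<rho> \<in> {\<rho>. partition_on S \<rho>}"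
    then have \<rho>: "partition_on S \<rho>" by simp
    have fin: "finite \<rho>" using partition_on_finite[OF \<rho> S] .
    obtain U0 where U0: "U0 \<in> \<rho>" "j \<in> U0" using \<rho> j by (auto simp: partition_on_def)
    have set: "{U. U \<in> \<rho> \<and> j \<notin> U} = \<rho> - {U0}"
      using U0 \<rho> by (auto simp: partition_on_def disjoint_def)
    have "(\<Sum>U | U \<in> \<rho> \<and> j \<notin> U. q (\<rho> - {U}) * p \<rho>) =
        (\<Sum>U\<in>\<rho> - {U0}. (-1) ^ (card \<rho> - 2) * fact (card \<rho> - 2) * p \<rho>)"
      unfolding set using fin by (intro sum.cong) (auto simp: q_def card_Diff_singleton numeral_2_eq_2)
    also have "\<dots> = of_nat (card \<rho> - 1) * ((-1) ^ (card \<rho> - 2) * fact (card \<rho> - 2) * p \<rho>)"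
      using fin U0 by (simp add: card_Diff_singleton)
    finally have s: "(\<Sum>U | U \<in> \<rho> \<and> j \<notin> U. q (\<rho> - {U}) * p \<rho>) = \<dots>" .
    have c0: "card \<rho> > 0" using fin U0 by (auto simp: card_gt_0_iff)
    show "q \<rho> * p \<rho> + (\<Sum>U | U \<in> \<rho> \<and> j \<notin> U. q (\<rho> - {U}) * p \<rho>) = (if \<rho> = {S} then m S else 0)"
    proof (cases "card \<rho> = 1")
      case True
      then obtain U1 where "\<rho> = {U1}" by (auto simp: card_1_singleton_iff)
      with U0 have r: "\<rho> = {U0}" by simp
      then have "U0 = S" using \<rho> by (simp add: partition_on_def)
      with r show ?thesis unfolding s by (simp add: q_def p_def)
    next
      case False
      define n where "n = card \<rho> - 2"
      with False c0 have n: "card \<rho> = Suc (Suc n)" by simp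
      then have "\<rho> \<noteq> {S}" by auto
      then show ?thesis unfolding s using n by (simp add: q_def algebra_simps)
    qed
  qed
  also have "\<dots> = m S"
  proof -
    have "{\<rho>. partition_on S \<rho>} \<inter> {\<rho>. \<rho> = {S}} = {{S}}"
      using j by (auto simp: partition_on_def)
    moreover have "{\<rho>. partition_on S \<rho>} \<inter> {\<rho>. \<rho> = {S}} = {\<rho>. partition_on S \<rho>} \<inter> {{S}}" by auto
    ultimately show ?thesis using finite_partitions[OF S] by (subst sum.If_cases) auto
  qed
  finally show ?thesis by simp
qed

text \<open>The recursion isolates the cumulant of the full set. Multilinearity and vanishing follow
  from it by induction on the number of indices instead of from sums over partitions.\<close>

lemma set_cumulant_eq:
  assumes S: "finite S" and j: "j \<in> S" and m0: "m {} = 1"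
  shows "set_cumulant m S = m S - (\<Sum>V | V \<subset> S \<and> j \<in> V. set_cumulant m V * m (S - V))"
proof -
  have "{V. V \<subseteq> S \<and> j \<in> V} = insert S {V. V \<subset> S \<and> j \<in> V}" using j by auto
  moreover have "finite {V. V \<subset> S \<and> j \<in> V}" using S by (auto intro: finite_subset[of _ "Pow S"])
  ultimately show ?thesis using moment_cumulant[where m = m, OF assms] by (simp add: m0)
qed

lemma set_cumulant_singleton: "m {} = 1 \<Longrightarrow> set_cumulant m {j} = m {j}"
proof -
  assume "m {} = 1"
  moreover have e: "{V. V \<subset> {j} \<and> j \<in> V} = {}" by auto
  ultimately show ?thesis using set_cumulant_eq[of "{j}" j m, unfolded e] by simp
qed

lemma set_cumulant_pair:
  assumes "m {} = 1" "i \<noteq> j"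
  shows "set_cumulant m {i, j} = m {i, j} - m {i} * m {j}"
proof -
  have "{V. V \<subset> {i, j} \<and> i \<in> V} = {{i}}" using assms by auto
  moreover have "{i, j} - {i} = {j}" using assms by auto
  ultimately show ?thesis using set_cumulant_eq[of "{i, j}" i m] assms by (simp add: set_cumulant_singleton)
qed

lemma set_cumulant_cong:
  assumes "\<And>V. V \<subseteq> S \<Longrightarrow> m V = m' V"
  shows "set_cumulant m S = set_cumulant m' S"
  unfolding set_cumulant_def
proof (intro sum.cong refl arg_cong2[of _ _ _ _ "(*)"] prod.cong)
  fix \<pi> V assume "\<pi> \<in> {\<pi>. partition_on S \<pi>}" "V \<in> \<pi>"
  then have "V \<subseteq> S" by (auto simp: partition_on_def)
  then show "m V = m' V" by (rule assms)
qed

text \<open>By induction the only surviving term of the recursion is \<open>V = {j}\<close>, and it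
  equals \<open>c * m (S - {j})\<close>, which is all of \<open>m S\<close>.\<close>

lemma set_cumulant_const_arg:
  assumes S: "finite S" "j \<in> S" "card S \<ge> 2" and m0: "m {} = 1"
    and m: "\<And>V. V \<subseteq> S \<Longrightarrow> j \<in> V \<Longrightarrow> m V = c * m (V - {j})"
  shows "set_cumulant m S = 0"
  using S m
proof (induction S rule: measure_induct_rule[of card])
  case (less S)
  have f: "finite {V. V \<subset> S \<and> j \<in> V}" using less.prems(1) by (auto intro: finite_subset[of _ "Pow S"])
  have "{j} \<subset> S" using less.prems(2,3) by (auto simp: psubset_eq)
  then have s: "{V. V \<subset> S \<and> j \<in> V} = insert {j} {V. V \<subset> S \<and> j \<in> V \<and> V \<noteq> {j}}" by auto
  have f': "finite {V. V \<subset> S \<and> j \<in> V \<and> V \<noteq> {j}}" by (rule finite_subset[OF _ f]) auto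
  have "set_cumulant m V = 0" if V: "V \<subset> S" "j \<in> V" "V \<noteq> {j}" for V
  proof (rule less.IH)
    show "finite V" "card V < card S"
      using V less.prems(1) finite_subset psubset_card_mono by blast+
    have "\<exists>k\<in>V. k \<noteq> j" using V by auto
    then obtain k where "{j, k} \<subseteq> V" "k \<noteq> j" using V by auto
    then show "card V \<ge> 2" using card_mono[OF \<open>finite V\<close>, of "{j, k}"] by simp
  qed (use V less.prems in auto)
  then have "(\<Sum>V | V \<subset> S \<and> j \<in> V. set_cumulant m V * m (S - V)) = set_cumulant m {j} * m (S - {j})"
    unfolding s using f' by simp
  also have "\<dots> = m S"
    using less.prems by (simp add: set_cumulant_singleton[where m = m, OF m0] m0)
  finally show ?case using set_cumulant_eq[of S j m] less.prems m0 by simp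
qed

text \<open>In each product of the recursion exactly one factor contains \<open>j\<close>, and the
  other factor is common to the three moment functions; so linearity in this argument is
  inherited.\<close>

lemma set_cumulant_linear_arg:
  assumes S: "finite S" "j \<in> S" and 1: "m1 {} = 1"
    and m: "\<And>V. V \<subseteq> S \<Longrightarrow> j \<in> V \<Longrightarrow> m V = c * m1 V + e * m2 V"
    and eq: "\<And>V. V \<subseteq> S \<Longrightarrow> j \<notin> V \<Longrightarrow> m V = m1 V" "\<And>V. V \<subseteq> S \<Longrightarrow> j \<notin> V \<Longrightarrow> m2 V = m1 V"
  shows "set_cumulant m S = c * set_cumulant m1 S + e * set_cumulant m2 S"
  using S m eq
proof (induction S rule: measure_induct_rule[of card])
  case (less S)
  have IH: "set_cumulant m V = c * set_cumulant m1 V + e * set_cumulant m2 V" if V: "V \<subset> S" "j \<in> V" for V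
  proof (rule less.IH)
    show "finite V" "card V < card S"
      using V less.prems(1) finite_subset psubset_card_mono by blast+
  qed (use V less.prems in auto)
  have emp: "m {} = 1" "m2 {} = 1" using less.prems(4,5)[of "{}"] 1 by auto
  have moment: "m (S - V) = m1 (S - V)" "m2 (S - V) = m1 (S - V)" if "j \<in> V" for V
    using that less.prems(4,5)[of "S - V"] by auto
  let ?X = "{V. V \<subset> S \<and> j \<in> V}"
  have "set_cumulant m S = m S - (\<Sum>V\<in>?X. set_cumulant m V * m (S - V))"
    by (rule set_cumulant_eq[where m = m, OF less.prems(1,2) emp(1)])
  also have "(\<Sum>V\<in>?X. set_cumulant m V * m (S - V)) =
      (\<Sum>V\<in>?X. c * (set_cumulant m1 V * m1 (S - V)) + e * (set_cumulant m2 V * m2 (S - V)))"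
  proof (rule sum.cong[OF refl])
    fix V assume "V \<in> ?X"
    then have V: "V \<subset> S" "j \<in> V" by auto
    show "set_cumulant m V * m (S - V) =
        c * (set_cumulant m1 V * m1 (S - V)) + e * (set_cumulant m2 V * m2 (S - V))"
      unfolding IH[OF V] moment[OF V(2)] by (simp add: algebra_simps)
  qed
  also have "\<dots> = c * (\<Sum>V\<in>?X. set_cumulant m1 V * m1 (S - V)) + e * (\<Sum>V\<in>?X. set_cumulant m2 V * m2 (S - V))"
    by (simp add: sum.distrib sum_distrib_left)
  also have "m S - \<dots> = c * (m1 S - (\<Sum>V\<in>?X. set_cumulant m1 V * m1 (S - V))) +
      e * (m2 S - (\<Sum>V\<in>?X. set_cumulant m2 V * m2 (S - V)))"
    unfolding less.prems(3)[OF order_refl less.prems(2)] by (simp add: algebra_simps)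
  also have "\<dots> = c * set_cumulant m1 S + e * set_cumulant m2 S"
    unfolding set_cumulant_eq[where m = m1, OF less.prems(1,2) 1]
      set_cumulant_eq[where m = m2, OF less.prems(1,2) emp(2)] ..
  finally show ?case .
qed

text \<open>Joint cumulants are given for initial segments, while the recursion meets arbitrary
  subsets; injections pass between the two.\<close>

lemma set_cumulant_reindex:
  assumes f: "inj_on f S" and S: "finite S" and m0: "m {} = 1"
  shows "set_cumulant m (f ` S) = set_cumulant (\<lambda>V. m (f ` V)) S"
  using f S
proof (induction S rule: measure_induct_rule[of card])
  case (less S)
  show ?case
  proof (cases "S = {}")
    case True
    then show ?thesis by (simp add: set_cumulant_def partition_on_empty)
  next
    case False
    then obtain j where j: "j \<in> S" by blast
    have set: "{V. V \<subset> f ` S \<and> f j \<in> V} = (`) f ` {V. V \<subset> S \<and> j \<in> V}"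
    proof (intro equalityI subsetI)
      fix V assume V: "V \<in> {V. V \<subset> f ` S \<and> f j \<in> V}"
      then obtain U where U: "U \<subseteq> S" "V = f ` U" by (auto simp: psubset_eq subset_image_iff)
      moreover have "U \<noteq> S" "j \<in> U"
        using V U j inj_on_image_mem_iff[OF less.prems(1), of j U] by auto
      ultimately show "V \<in> (`) f ` {V. V \<subset> S \<and> j \<in> V}" by auto
    next
      fix V assume "V \<in> (`) f ` {V. V \<subset> S \<and> j \<in> V}"
      then obtain U where U: "U \<subset> S" "j \<in> U" "V = f ` U" by blast
      then have "f ` U \<noteq> f ` S"
        using inj_on_image_eq_iff[OF less.prems(1), of U S] by (simp add: psubset_eq)
      then show "V \<in> {V. V \<subset> f ` S \<and> f j \<in> V}"
        using U by (simp add: psubset_eq image_mono)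
    qed
    have inj: "inj_on ((`) f) {V. V \<subset> S \<and> j \<in> V}"
    proof (rule inj_onI)
      fix U V assume "U \<in> {V. V \<subset> S \<and> j \<in> V}" "V \<in> {V. V \<subset> S \<and> j \<in> V}" "f ` U = f ` V"
      then show "U = V" using inj_on_image_eq_iff[OF less.prems(1), of U V] by (simp add: psubset_eq)
    qed
    have "(\<Sum>V | V \<subset> f ` S \<and> f j \<in> V. set_cumulant m V * m (f ` S - V)) =
        (\<Sum>V | V \<subset> S \<and> j \<in> V. set_cumulant (\<lambda>V. m (f ` V)) V * m (f ` (S - V)))"
      unfolding set sum.reindex[OF inj] comp_def
    proof (intro sum.cong refl)
      fix V assume "V \<in> {V. V \<subset> S \<and> j \<in> V}"
      then have V: "V \<subset> S" by simp
      have "set_cumulant m (f ` V) = set_cumulant (\<lambda>V. m (f ` V)) V"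
      proof (rule less.IH)
        show "finite V" by (rule finite_subset[OF psubset_imp_subset[OF V] less.prems(2)])
        show "card V < card S" by (rule psubset_card_mono[OF less.prems(2) V])
        show "inj_on f V" by (rule inj_on_subset[OF less.prems(1) psubset_imp_subset[OF V]])
      qed
      moreover have "f ` (S - V) = f ` S - f ` V"
        using V less.prems(1) by (intro inj_on_image_set_diff) auto
      ultimately show "set_cumulant m (f ` V) * m (f ` S - f ` V) =
          set_cumulant (\<lambda>V. m (f ` V)) V * m (f ` (S - V))" by simp
    qed
    note sum_eq = this
    have "set_cumulant m (f ` S) = m (f ` S) -
        (\<Sum>V | V \<subset> f ` S \<and> f j \<in> V. set_cumulant m V * m (f ` S - V))"
      by (rule set_cumulant_eq[where m = m]) (use less.prems(2) j m0 in auto)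
    also have "\<dots> = set_cumulant (\<lambda>V. m (f ` V)) S"
      unfolding sum_eq by (rule set_cumulant_eq[where m = "\<lambda>V. m (f ` V)", symmetric]) (use less.prems(2) j m0 in auto)
    finally show ?thesis .
  qed
qed

section \<open>Random variables with moments of all orders, and their cumulants\<close>

definition all_moments :: "'w measure \<Rightarrow> ('w \<Rightarrow> complex) \<Rightarrow> bool" where
  "all_moments M f \<longleftrightarrow> f \<in> borel_measurable M \<and> (\<forall>m::nat. integrable M (\<lambda>w. norm (f w) ^ m))"

lemma power_add_le:
  fixes x y :: real
  assumes "x \<ge> 0" "y \<ge> 0"
  shows "(x + y) ^ m \<le> 2 ^ m * (x ^ m + y ^ m)"
proof -
  have "(x + y) ^ m \<le> (2 * max x y) ^ m" using assms by (intro power_mono) auto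
  also have "\<dots> = 2 ^ m * max x y ^ m" by (simp add: power_mult_distrib)
  also have "\<dots> \<le> 2 ^ m * (x ^ m + y ^ m)"
    using assms by (intro mult_left_mono) (auto simp: max_def)
  finally show ?thesis .
qed

context prob_space
begin

lemma all_moments_const: "all_moments M (\<lambda>_. c)"
  by (simp add: all_moments_def)

lemma all_moments_add:
  assumes "all_moments M f" "all_moments M g"
  shows "all_moments M (\<lambda>w. f w + g w)"
  unfolding all_moments_def
proof (intro conjI allI)
  note [measurable] = assms[unfolded all_moments_def, THEN conjunct1]
  show "(\<lambda>w. f w + g w) \<in> borel_measurable M" by measurable
  fix m :: nat
  show "integrable M (\<lambda>w. norm (f w + g w) ^ m)"
  proof (rule Bochner_Integration.integrable_bound)
    show "integrable M (\<lambda>w. 2 ^ m * (norm (f w) ^ m + norm (g w) ^ m))"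
      using assms by (auto simp: all_moments_def)
    show "AE w in M. norm (norm (f w + g w) ^ m) \<le> norm (2 ^ m * (norm (f w) ^ m + norm (g w) ^ m))"
    proof (intro AE_I2)
      fix w
      have "norm (f w + g w) ^ m \<le> (norm (f w) + norm (g w)) ^ m"
        by (intro power_mono norm_triangle_ineq) simp
      also have "\<dots> \<le> 2 ^ m * (norm (f w) ^ m + norm (g w) ^ m)" by (rule power_add_le) auto
      finally show "norm (norm (f w + g w) ^ m) \<le> norm (2 ^ m * (norm (f w) ^ m + norm (g w) ^ m))"
        by simp
    qed
  qed measurable
qed

text \<open>The moments of order \<open>2 * m\<close> of the factors dominate the moment of order
  \<open>m\<close> of the product, by the inequality between arithmetic and geometric mean. Thus the
  class is an algebra, and it supplies the integrability conditions throughout.\<close>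

lemma all_moments_mult:
  assumes "all_moments M f" "all_moments M g"
  shows "all_moments M (\<lambda>w. f w * g w)"
  unfolding all_moments_def
proof (intro conjI allI)
  note [measurable] = assms[unfolded all_moments_def, THEN conjunct1]
  show "(\<lambda>w. f w * g w) \<in> borel_measurable M" by measurable
  fix m :: nat
  show "integrable M (\<lambda>w. norm (f w * g w) ^ m)"
  proof (rule Bochner_Integration.integrable_bound)
    show "integrable M (\<lambda>w. norm (f w) ^ (2 * m) + norm (g w) ^ (2 * m))"
      using assms by (auto simp: all_moments_def)
    show "AE w in M. norm (norm (f w * g w) ^ m) \<le> norm (norm (f w) ^ (2 * m) + norm (g w) ^ (2 * m))"
    proof (intro AE_I2)
      fix w
      let ?x = "norm (f w) ^ m" and ?y = "norm (g w) ^ m"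
      have "2 * (?x * ?y) \<le> ?x\<^sup>2 + ?y\<^sup>2" using sum_squares_bound[of ?x ?y] by simp
      moreover have "0 \<le> ?x * ?y" by simp
      ultimately have "?x * ?y \<le> ?x\<^sup>2 + ?y\<^sup>2" by linarith
      then show "norm (norm (f w * g w) ^ m) \<le> norm (norm (f w) ^ (2 * m) + norm (g w) ^ (2 * m))"
        by (simp add: norm_mult power_mult_distrib power_mult[of _ m 2] mult.commute[of 2])
    qed
  qed measurable
qed

lemma all_moments_sum: "(\<And>i. i \<in> I \<Longrightarrow> all_moments M (f i)) \<Longrightarrow> all_moments M (\<lambda>w. \<Sum>i\<in>I. f i w)"
  by (induction I rule: infinite_finite_induct) (auto intro: all_moments_const all_moments_add)

lemma all_moments_prod: "(\<And>i. i \<in> I \<Longrightarrow> all_moments M (f i)) \<Longrightarrow> all_moments M (\<lambda>w. \<Prod>i\<in>I. f i w)"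
  by (induction I rule: infinite_finite_induct) (auto intro: all_moments_const all_moments_mult)

lemma all_moments_prod_mset:
  "(\<And>i. i \<in># F \<Longrightarrow> all_moments M (f i)) \<Longrightarrow> all_moments M (\<lambda>w. \<Prod>i\<in>#F. f i w)"
  by (induction F) (auto intro: all_moments_const all_moments_mult)

lemma all_moments_prod_list:
  "(\<And>i. i \<in> set xs \<Longrightarrow> all_moments M (f i)) \<Longrightarrow> all_moments M (\<lambda>w. \<Prod>i\<leftarrow>xs. f i w)"
  by (induction xs) (auto intro: all_moments_const all_moments_mult)

lemma all_moments_sum_list:
  "(\<And>i. i \<in> set xs \<Longrightarrow> all_moments M (f i)) \<Longrightarrow> all_moments M (\<lambda>w. \<Sum>i\<leftarrow>xs. f i w)"
  by (induction xs) (auto intro: all_moments_const all_moments_add)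

lemma all_moments_sum_mset:
  "(\<And>i. i \<in># F \<Longrightarrow> all_moments M (f i)) \<Longrightarrow> all_moments M (\<lambda>w. \<Sum>i\<in>#F. f i w)"
  by (induction F) (auto intro: all_moments_const all_moments_add)

lemma all_moments_diff:
  "all_moments M f \<Longrightarrow> all_moments M g \<Longrightarrow> all_moments M (\<lambda>w. f w - g w)"
  using all_moments_add[of f "\<lambda>w. (-1) * g w"] all_moments_mult[of "\<lambda>_. -1" g]
  by (simp add: all_moments_const)

lemma all_moments_integrable: "all_moments M f \<Longrightarrow> integrable M f"
proof -
  assume f: "all_moments M f"
  then have "integrable M (\<lambda>w. norm (f w) ^ 1)" unfolding all_moments_def by blast
  then show ?thesis using f by (auto simp: all_moments_def integrable_norm_iff)
qed

lemmas all_moments_intros = all_moments_const all_moments_add all_moments_mult all_moments_sum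
  all_moments_prod all_moments_prod_mset all_moments_prod_list all_moments_diff all_moments_sum_list
  all_moments_sum_mset

definition family_moment :: "(nat \<Rightarrow> 'a \<Rightarrow> complex) \<Rightarrow> nat set \<Rightarrow> complex" where
  "family_moment X V = (LINT w|M. (\<Prod>i\<in>V. X i w))"

lemma family_moment_empty [simp]: "family_moment X {} = 1"
  by (simp add: family_moment_def prob_space)

lemma joint_cumulant_eq: "joint_cumulant M r X = set_cumulant (family_moment X) {..<r}"
  by (simp add: joint_cumulant_def set_cumulant_def family_moment_def)

lemma cumulant_linear:
  assumes S: "finite S" "j \<in> S" and X: "\<And>i. i \<in> S \<Longrightarrow> all_moments M (X i)"
    and f: "all_moments M f" and g: "all_moments M g" and eq: "\<And>w. X j w = c * f w + e * g w"
  shows "set_cumulant (family_moment X) S =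
    c * set_cumulant (family_moment (X(j := f))) S + e * set_cumulant (family_moment (X(j := g))) S"
proof (rule set_cumulant_linear_arg[OF S])
  fix V assume V: "V \<subseteq> S" "j \<in> V"
  then have fin: "finite V" using S finite_subset by blast
  have P: "(\<Prod>i\<in>V. (X(j := h)) i w) = h w * (\<Prod>i\<in>V - {j}. X i w)" for h w
    using V fin by (subst prod.remove[of V j]) (auto intro!: prod.cong)
  have P': "(\<Prod>i\<in>V. X i w) = (c * f w + e * g w) * (\<Prod>i\<in>V - {j}. X i w)" for w
    using V fin by (subst prod.remove[of V j]) (auto simp: eq)
  have "integrable M (\<lambda>w. h w * (\<Prod>i\<in>V - {j}. X i w))" if "all_moments M h" for h
    using that X V by (intro all_moments_integrable all_moments_intros) auto
  note this[OF f] this[OF g]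
  then show "family_moment X V = c * family_moment (X(j := f)) V + e * family_moment (X(j := g)) V"
    unfolding family_moment_def P P' by (simp add: distrib_right mult.assoc)
next
  fix V assume "j \<notin> V"
  then show "family_moment X V = family_moment (X(j := f)) V"
    "family_moment (X(j := g)) V = family_moment (X(j := f)) V"
    by (auto simp: family_moment_def intro!: Bochner_Integration.integral_cong prod.cong)
qed simp

lemma cumulant_const:
  assumes S: "finite S" "j \<in> S" "card S \<ge> 2" and eq: "\<And>w. X j w = c"
  shows "set_cumulant (family_moment X) S = 0"
proof (rule set_cumulant_const_arg[OF S])
  fix V assume V: "V \<subseteq> S" "j \<in> V"
  then have "finite V" using S finite_subset by blast
  then show "family_moment X V = c * family_moment X (V - {j})"
    using V by (simp add: family_moment_def prod.remove[of V j] eq)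
qed simp

text \<open>The arguments are centred one at a time. By multilinearity each change adds a cumulant
  with a constant argument, which vanishes in order at least 2.\<close>

lemma cumulant_shift:
  assumes S: "finite S" "card S \<ge> 2" and X: "\<And>i. i \<in> S \<Longrightarrow> all_moments M (X i)"
  shows "set_cumulant (family_moment (\<lambda>i w. X i w - c i)) S = set_cumulant (family_moment X) S"
proof -
  define Z where "Z T = (\<lambda>i. if i \<in> T then (\<lambda>w. X i w - c i) else X i)" for T
  have Z: "all_moments M (Z T i)" if "i \<in> S" for T i
    unfolding Z_def using X[OF that] by (auto intro!: all_moments_intros)
  have "set_cumulant (family_moment (Z T)) S = set_cumulant (family_moment X) S"
    if "finite T" "T \<subseteq> S" for T
    using that
  proof (induction T)
    case empty
    then show ?case by (simp add: Z_def)
  next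
    case (insert j T)
    have j: "j \<in> S" using insert by simp
    have "set_cumulant (family_moment (Z (insert j T))) S =
        1 * set_cumulant (family_moment ((Z (insert j T))(j := X j))) S +
        (-1) * set_cumulant (family_moment ((Z (insert j T))(j := (\<lambda>_. c j)))) S"
    proof (rule cumulant_linear[OF S(1) j])
      show "Z (insert j T) j w = 1 * X j w + - 1 * c j" for w by (simp add: Z_def)
    qed (rule Z X[OF j] all_moments_const, assumption?)+
    moreover have "set_cumulant (family_moment ((Z (insert j T))(j := (\<lambda>_. c j)))) S = 0"
      by (rule cumulant_const[OF S(1) j S(2)]) simp
    moreover have "(Z (insert j T))(j := X j) = Z T"
      using insert.hyps by (auto simp: Z_def fun_eq_iff)
    ultimately show ?case using insert by simp
  qed
  from this[OF S(1) order_refl] have "set_cumulant (family_moment (Z S)) S = set_cumulant (family_moment X) S" .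
  moreover have "set_cumulant (family_moment (Z S)) S = set_cumulant (family_moment (\<lambda>i w. X i w - c i)) S"
    by (rule set_cumulant_cong)
      (auto simp: family_moment_def Z_def intro!: Bochner_Integration.integral_cong prod.cong)
  ultimately show ?thesis by simp
qed

lemma cumulant_reindex:
  assumes "inj_on f S" "finite S"
  shows "set_cumulant (family_moment X) (f ` S) = set_cumulant (family_moment (X \<circ> f)) S"
proof -
  have "set_cumulant (family_moment X) (f ` S) = set_cumulant (\<lambda>V. family_moment X (f ` V)) S"
    using assms by (intro set_cumulant_reindex) auto
  also have "\<dots> = set_cumulant (family_moment (X \<circ> f)) S"
    using assms by (intro set_cumulant_cong) (auto simp: family_moment_def prod.reindex inj_on_subset)
  finally show ?thesis .
qed

lemma covariance_eq_cumulant: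
  assumes "i \<noteq> j"
  shows "covariance M (X i) (X j) = set_cumulant (family_moment X) {i, j}"
proof -
  have "set_cumulant (family_moment X) {i, j} =
      family_moment X {i, j} - family_moment X {i} * family_moment X {j}"
    using assms by (intro set_cumulant_pair) auto
  then show ?thesis using assms by (simp add: covariance_def family_moment_def)
qed

end

section \<open>Limits of centred moments and of cumulants\<close>

definition centred_moment :: "(nat \<Rightarrow> 'w measure) \<Rightarrow> (nat \<Rightarrow> nat \<Rightarrow> 'w \<Rightarrow> complex) \<Rightarrow> nat set \<Rightarrow> nat \<Rightarrow> complex" where
  "centred_moment M X V d = (LINT w|M d. (\<Prod>i\<in>V. X d i w - (LINT w|M d. X d i w)))"

text \<open>Centring kills the cumulants of order 1 and leaves the higher ones unchanged, so centred
  moments and cumulants of the original variables meet in one recursion.\<close>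

lemma centred_moment_recursion:
  assumes M: "prob_space (M d)" and X: "\<And>i. i \<in> S \<Longrightarrow> all_moments (M d) (X d i)"
    and S: "finite S" "j \<in> S"
  shows "centred_moment M X S d =
    (\<Sum>V | V \<subseteq> S \<and> j \<in> V \<and> card V \<ge> 2.
       set_cumulant (prob_space.family_moment (M d) (X d)) V * centred_moment M X (S - V) d)"
proof -
  interpret prob_space "M d" by (rule M)
  define Y where "Y i w = X d i w - (LINT w|M d. X d i w)" for i w
  have cm: "centred_moment M X V d = family_moment Y V" for V
    by (simp add: centred_moment_def family_moment_def Y_def)
  have "family_moment Y S = (\<Sum>V | V \<subseteq> S \<and> j \<in> V. set_cumulant (family_moment Y) V * family_moment Y (S - V))"
    by (rule moment_cumulant[OF S]) simp
  also have "\<dots> = (\<Sum>V | V \<subseteq> S \<and> j \<in> V \<and> card V \<ge> 2. set_cumulant (family_moment Y) V * family_moment Y (S - V))"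
  proof (rule sum.mono_neutral_right)
    show "\<forall>V\<in>{V. V \<subseteq> S \<and> j \<in> V} - {V. V \<subseteq> S \<and> j \<in> V \<and> card V \<ge> 2}.
        set_cumulant (family_moment Y) V * family_moment Y (S - V) = 0"
    proof
      fix V assume V: "V \<in> {V. V \<subseteq> S \<and> j \<in> V} - {V. V \<subseteq> S \<and> j \<in> V \<and> card V \<ge> 2}"
      then have "finite V" "j \<in> V" "card V < 2" using S finite_subset by auto
      then have "card V = 1" by (metis One_nat_def card_0_eq empty_iff less_2_cases_iff)
      then have V: "V = {j}" using \<open>j \<in> V\<close> by (auto simp: card_1_singleton_iff)
      have "family_moment Y {j} = 0"
        using all_moments_integrable[OF X[OF S(2)]] prob_space
        by (simp add: family_moment_def Y_def)
      then have "set_cumulant (family_moment Y) V = 0" unfolding V by (subst set_cumulant_singleton) auto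
      then show "set_cumulant (family_moment Y) V * family_moment Y (S - V) = 0" by simp
    qed
  qed (use S in auto)
  also have "\<dots> = (\<Sum>V | V \<subseteq> S \<and> j \<in> V \<and> card V \<ge> 2. set_cumulant (family_moment (X d)) V * family_moment Y (S - V))"
  proof (rule sum.cong[OF refl])
    fix V assume "V \<in> {V. V \<subseteq> S \<and> j \<in> V \<and> card V \<ge> 2}"
    then have V: "finite V" "card V \<ge> 2" "V \<subseteq> S" using S finite_subset by auto
    have "set_cumulant (family_moment Y) V = set_cumulant (family_moment (X d)) V"
      unfolding Y_def using V X by (intro cumulant_shift) auto
    then show "set_cumulant (family_moment Y) V * family_moment Y (S - V) =
        set_cumulant (family_moment (X d)) V * family_moment Y (S - V)" by simp
  qed
  finally show ?thesis by (simp add: cm)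
qed

text \<open>When the cumulants of order at least 3 vanish, the block of \<open>j\<close> must be a
  pair. The sum over blocks then becomes the sum over partners of \<open>j\<close> that appears in
  Wick's rule.\<close>

lemma pairs_of_subset:
  assumes S: "finite S" and j: "j \<in> S"
  shows "(\<Sum>V | V \<subseteq> S \<and> j \<in> V \<and> card V \<ge> 2. (if card V = 2 then g V else 0) :: complex) =
    (\<Sum>k\<in>S - {j}. g {j, k})"
proof -
  have "(\<Sum>V | V \<subseteq> S \<and> j \<in> V \<and> card V \<ge> 2. (if card V = 2 then g V else 0)) =
      (\<Sum>V | V \<subseteq> S \<and> j \<in> V \<and> card V = 2. g V)"
    using S by (intro sum.mono_neutral_cong_right) auto
  also have "\<dots> = (\<Sum>k\<in>S - {j}. g {j, k})"
  proof -
    have "{V. V \<subseteq> S \<and> j \<in> V \<and> card V = 2} = (\<lambda>k. {j, k}) ` (S - {j})"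
    proof (intro equalityI subsetI)
      fix V assume V: "V \<in> {V. V \<subseteq> S \<and> j \<in> V \<and> card V = 2}"
      then obtain k l where "V = {k, l}" "k \<noteq> l" by (auto simp: card_2_iff)
      with V show "V \<in> (\<lambda>k. {j, k}) ` (S - {j})" by (auto simp: insert_commute)
    qed (use j in auto)
    moreover have "inj_on (\<lambda>k. {j, k}) (S - {j})"
      by (rule inj_onI) (auto simp: doubleton_eq_iff)
    ultimately show ?thesis by (simp add: sum.reindex)
  qed
  finally show ?thesis .
qed

text \<open>Along the moment-cumulant recursion, vanishing of the limits of all cumulants of order at least 3
  is equivalent to Wick's rule for the limits of the centred moments.\<close>

locale limit_family =
  fixes M :: "nat \<Rightarrow> 'w measure" and X :: "nat \<Rightarrow> nat \<Rightarrow> 'w \<Rightarrow> complex" and S :: "nat set"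
  assumes M: "\<And>d. d \<ge> 1 \<Longrightarrow> prob_space (M d)" and S: "finite S"
    and X: "\<And>d i. d \<ge> 1 \<Longrightarrow> i \<in> S \<Longrightarrow> all_moments (M d) (X d i)"
begin

definition cumulant_seq :: "nat set \<Rightarrow> nat \<Rightarrow> complex" where
  "cumulant_seq V d = set_cumulant (prob_space.family_moment (M d) (X d)) V"

lemma eventually_recursion:
  assumes "V \<subseteq> S" "j \<in> V"
  shows "\<forall>\<^sub>F d in sequentially. centred_moment M X V d =
    (\<Sum>U | U \<subseteq> V \<and> j \<in> U \<and> card U \<ge> 2. cumulant_seq U d * centred_moment M X (V - U) d)"
  unfolding cumulant_seq_def
  by (rule eventually_mono[OF eventually_ge_at_top[of 1]], rule centred_moment_recursion)
    (use M X assms S finite_subset in auto)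

lemma centred_moment_empty: "\<forall>\<^sub>F d in sequentially. centred_moment M X {} d = 1"
proof (rule eventually_mono[OF eventually_ge_at_top[of 1]])
  fix d :: nat assume "1 \<le> d"
  then interpret prob_space "M d" by (rule M)
  show "centred_moment M X {} d = 1" by (simp add: centred_moment_def prob_space)
qed

text \<open>For an index set \<open>V\<close> the recursion refers to moments of strictly smaller
  sets only, so convergence and the Wick formula for \<open>V\<close> come out of the same passage
  to the limit. The choice of \<open>j\<close> is free because limits are unique.\<close>

lemma moments_of_cumulants:
  fixes c :: "nat \<Rightarrow> nat \<Rightarrow> complex"
  assumes c2: "\<And>i j. i \<in> S \<Longrightarrow> j \<in> S \<Longrightarrow> i \<noteq> j \<Longrightarrow> cumulant_seq {i, j} \<longlonglongrightarrow> c i j"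
    and c3: "\<And>V. V \<subseteq> S \<Longrightarrow> card V \<ge> 3 \<Longrightarrow> cumulant_seq V \<longlonglongrightarrow> 0"
  shows "\<exists>L. L {} = 1 \<and> (\<forall>V\<subseteq>S. centred_moment M X V \<longlonglongrightarrow> L V \<and>
    (\<forall>j\<in>V. L V = (\<Sum>k\<in>V - {j}. c j k * L (V - {j, k}))))"
proof -
  define L where "L V = lim (centred_moment M X V)" for V
  have rec: "centred_moment M X V \<longlonglongrightarrow> (\<Sum>k\<in>V - {j}. c j k * L (V - {j, k}))"
    if V: "V \<subseteq> S" "j \<in> V" and IH: "\<And>U. U \<subset> V \<Longrightarrow> centred_moment M X U \<longlonglongrightarrow> L U" for V j
  proof -
    have fin: "finite V" using V S finite_subset by blast
    \<comment> \<open>For a pair \<open>U\<close> the term \<open>the_elem (U - {j})\<close> is the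
      partner of \<open>j\<close>.\<close>
    have "(\<lambda>d. \<Sum>U | U \<subseteq> V \<and> j \<in> U \<and> card U \<ge> 2. cumulant_seq U d * centred_moment M X (V - U) d)
        \<longlonglongrightarrow> (\<Sum>U | U \<subseteq> V \<and> j \<in> U \<and> card U \<ge> 2.
           (if card U = 2 then c j (the_elem (U - {j})) * L (V - U) else 0))"
    proof (rule tendsto_sum)
      fix U assume "U \<in> {U. U \<subseteq> V \<and> j \<in> U \<and> card U \<ge> 2}"
      then have U: "U \<subseteq> V" "j \<in> U" "card U \<ge> 2" by auto
      have m: "centred_moment M X (V - U) \<longlonglongrightarrow> L (V - U)"
        using U by (intro IH) auto
      have k: "cumulant_seq U \<longlonglongrightarrow> (if card U = 2 then c j (the_elem (U - {j})) else 0)"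
      proof (cases "card U = 2")
        case True
        then obtain k where k: "U = {j, k}" "k \<noteq> j" using U(2) by (auto simp: card_2_iff)
        have "{j, k} - {j} = {k}" using k by auto
        then show ?thesis using k V U c2[of j k] by auto
      next
        case False
        then show ?thesis using U V c3[of U] by auto
      qed
      have "(\<lambda>d. cumulant_seq U d * centred_moment M X (V - U) d) \<longlonglongrightarrow>
          (if card U = 2 then c j (the_elem (U - {j})) else 0) * L (V - U)"
        by (rule tendsto_mult[OF k m])
      also have "(if card U = 2 then c j (the_elem (U - {j})) else 0) * L (V - U) =
          (if card U = 2 then c j (the_elem (U - {j})) * L (V - U) else 0)" by simp
      finally show "(\<lambda>d. cumulant_seq U d * centred_moment M X (V - U) d) \<longlonglongrightarrow>
          (if card U = 2 then c j (the_elem (U - {j})) * L (V - U) else 0)" .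
    qed
    also have "(\<Sum>U | U \<subseteq> V \<and> j \<in> U \<and> card U \<ge> 2.
           (if card U = 2 then c j (the_elem (U - {j})) * L (V - U) else 0)) =
        (\<Sum>k\<in>V - {j}. c j (the_elem ({j, k} - {j})) * L (V - {j, k}))"
      using fin V by (intro pairs_of_subset)
    also have "\<dots> = (\<Sum>k\<in>V - {j}. c j k * L (V - {j, k}))"
    proof (rule sum.cong[OF refl])
      fix k assume "k \<in> V - {j}"
      then have "{j, k} - {j} = {k}" by auto
      then show "c j (the_elem ({j, k} - {j})) * L (V - {j, k}) = c j k * L (V - {j, k})" by simp
    qed
    finally show ?thesis
      using eventually_recursion[OF V] by (simp add: tendsto_cong)
  qed
  have conv: "centred_moment M X V \<longlonglongrightarrow> L V" if "V \<subseteq> S" for V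
    using finite_subset[OF that S] that
  proof (induction V rule: finite_psubset_induct)
    case (psubset V)
    show ?case
    proof (cases "V = {}")
      case True
      have "centred_moment M X {} \<longlonglongrightarrow> 1"
        using centred_moment_empty by (rule tendsto_eventually)
      then show ?thesis unfolding True L_def by (metis limI)
    next
      case False
      then obtain j where "j \<in> V" by blast
      from rec[OF psubset.prems this] psubset show ?thesis
        unfolding L_def[of V] by (intro convergent_LIMSEQ_iff[THEN iffD1] convergentI) auto
    qed
  qed
  have "L {} = 1"
    using tendsto_eventually[OF centred_moment_empty] conv[of "{}"] LIMSEQ_unique by blast
  moreover have "L V = (\<Sum>k\<in>V - {j}. c j k * L (V - {j, k}))" if "V \<subseteq> S" "j \<in> V" for V j
    using LIMSEQ_unique[OF conv[OF that(1)] rec[OF that]] conv that by auto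
  ultimately show ?thesis using conv by blast
qed

text \<open>The recursion is solved for the cumulant of the full set, whose cofactor is the moment
  of the empty set. The remaining terms converge by induction, and Wick's rule says that those
  belonging to pairs already exhaust the limit of the moment.\<close>

lemma cumulants_of_moments:
  assumes conv: "\<And>V. V \<subseteq> S \<Longrightarrow> centred_moment M X V \<longlonglongrightarrow> L V"
    and wick: "\<And>V j. V \<subseteq> S \<Longrightarrow> j \<in> V \<Longrightarrow> L V = (\<Sum>k\<in>V - {j}. L {j, k} * L (V - {j, k}))"
  shows "V \<subseteq> S \<Longrightarrow> card V \<ge> 2 \<Longrightarrow> cumulant_seq V \<longlonglongrightarrow> (if card V = 2 then L V else 0)"
proof (induction V rule: measure_induct_rule[of card])
  case (less V)
  have L0: "L {} = 1"
    using tendsto_eventually[OF centred_moment_empty] conv[of "{}"] LIMSEQ_unique by blast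
  have fin: "finite V" using less.prems S finite_subset by blast
  obtain j where j: "j \<in> V" using less.prems by fastforce
  let ?X = "{U. U \<subseteq> V \<and> j \<in> U \<and> card U \<ge> 2}"
  have fX: "finite ?X" using fin by auto
  have VX: "V \<in> ?X" using j less.prems by auto
  have "\<forall>\<^sub>F d in sequentially. centred_moment M X V d - (\<Sum>U\<in>?X - {V}. cumulant_seq U d * centred_moment M X (V - U) d) = cumulant_seq V d"
    using eventually_recursion[OF less.prems(1) j] centred_moment_empty
  proof eventually_elim
    case (elim d)
    then show ?case using fX VX by (simp add: sum.remove[of ?X V])
  qed
  moreover have "(\<lambda>d. centred_moment M X V d - (\<Sum>U\<in>?X - {V}. cumulant_seq U d * centred_moment M X (V - U) d))
      \<longlonglongrightarrow> L V - (\<Sum>U\<in>?X - {V}. (if card U = 2 then L U else 0) * L (V - U))"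
  proof (intro tendsto_diff tendsto_sum tendsto_mult conv less.prems)
    fix U assume U: "U \<in> ?X - {V}"
    then have "U \<subset> V" by auto
    then show "cumulant_seq U \<longlonglongrightarrow> (if card U = 2 then L U else 0)"
      using U less.prems psubset_card_mono[OF fin] by (intro less.IH) auto
  qed (use less.prems in auto)
  moreover have "L V - (\<Sum>U\<in>?X - {V}. (if card U = 2 then L U else 0) * L (V - U)) =
      (if card V = 2 then L V else 0)"
  proof -
    have "L V = (\<Sum>k\<in>V - {j}. L {j, k} * L (V - {j, k}))" by (rule wick[OF less.prems(1) j])
    also have "\<dots> = (\<Sum>U\<in>?X. (if card U = 2 then L U * L (V - U) else 0))"
      using pairs_of_subset[OF fin j, of "\<lambda>U. L U * L (V - U)"] by simp
    also have "\<dots> = (\<Sum>U\<in>?X. (if card U = 2 then L U else 0) * L (V - U))"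
      by (intro sum.cong) auto
    also have "\<dots> = (if card V = 2 then L V else 0) + (\<Sum>U\<in>?X - {V}. (if card U = 2 then L U else 0) * L (V - U))"
      using fX VX by (simp add: sum.remove[of ?X V] L0)
    finally show ?thesis by (rule diff_eq_eq[THEN iffD2])
  qed
  ultimately show ?case by (simp add: tendsto_cong)
qed

end

section \<open>Entries of words and plane rotations\<close>

text \<open>Scalar entries instead of matrices: the expression is linear in \<open>p\<close> for all
  indices, and only units, products and transposes require them to be in range.\<close>

definition ent :: "nat \<Rightarrow> ('i \<Rightarrow> complex mat) \<Rightarrow> 'i ncpoly \<Rightarrow> nat \<Rightarrow> nat \<Rightarrow> complex" where
  "ent d X p r s = (\<Sum>w\<in>Poly_Mapping.keys p. Poly_Mapping.lookup p w * word_mat d X w $$ (r, s))"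

lemma mat_trace_ncpoly_mat: "mat_trace (ncpoly_mat d X p) = (\<Sum>r<d. ent d X p r r)"
  by (simp add: mat_trace_def ncpoly_mat_def ent_def)

lemma ent_add: "ent d X (p + q) r s = ent d X p r s + ent d X q r s"
  unfolding ent_def by (rule sum_keys_add) (simp_all add: distrib_right)

lemma ent_single: "ent d X (Poly_Mapping.single w c) r s = c * word_mat d X w $$ (r, s)"
  by (simp add: ent_def)

lemma ent_sc: "ent d X (ncpoly_sc c p) r s = c * ent d X p r s"
  by (induction p rule: ncpoly_induct)
    (simp_all add: ncpoly_sc_add ncpoly_sc_single ent_add ent_single distrib_left)

lemma word_mat_Cons: "word_mat d X (Word (l # ls)) = letter_val transpose_mat X l * word_mat d X (Word ls)"
  by (simp add: word_mat_def)

lemma word_mat_Nil: "word_mat d X (Word []) = 1\<^sub>m d"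
  by (simp add: word_mat_def)

context
  fixes d :: nat and X :: "'i \<Rightarrow> complex mat"
  assumes X: "\<And>i. X i \<in> carrier_mat d d"
begin

lemma letter_val_carrier: "letter_val transpose_mat X l \<in> carrier_mat d d"
  using X by (cases l) auto

lemma word_mat_carrier: "word_mat d X (Word ls) \<in> carrier_mat d d"
  by (induction ls) (auto simp: word_mat_Nil word_mat_Cons intro: mult_carrier_mat letter_val_carrier)

lemma word_mat_append: "word_mat d X (Word (ls @ ms)) = word_mat d X (Word ls) * word_mat d X (Word ms)"
proof (induction ls)
  case Nil
  show ?case using word_mat_carrier[of ms] by (simp add: word_mat_Nil)
next
  case (Cons l ls)
  show ?case
    using assoc_mult_mat[OF letter_val_carrier[of l] word_mat_carrier[of ls] word_mat_carrier[of ms]]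
    by (simp add: word_mat_Cons Cons)
qed

lemma word_mat_word_t: "word_mat d X (word_t w) = transpose_mat (word_mat d X w)"
proof -
  have l: "letter_val transpose_mat X (letter_t l) = transpose_mat (letter_val transpose_mat X l)" for l
    by (cases l) auto
  have "word_mat d X (Word (rev (map letter_t ls))) = transpose_mat (word_mat d X (Word ls))" for ls
  proof (induction ls)
    case (Cons k ls)
    have "transpose_mat (letter_val transpose_mat X k) * 1\<^sub>m d = transpose_mat (letter_val transpose_mat X k)"
      using letter_val_carrier[of k] by (intro right_mult_one_mat[of _ d]) auto
    then show ?case
      using letter_val_carrier[of k] word_mat_carrier[of ls]
      by (simp add: word_mat_append word_mat_Cons word_mat_Nil Cons l transpose_mult[of _ d d _ d])
  qed (simp add: word_mat_Nil)
  then show ?thesis by (cases w) (simp add: word_t_def)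
qed

lemma ent_one: "r < d \<Longrightarrow> s < d \<Longrightarrow> ent d X 1 r s = (if r = s then 1 else 0)"
  using ent_single[of d X 0 1 r s] by (simp add: word_mat_Nil[folded zero_free_monoid_def])

lemma ent_mult:
  assumes "r < d" "s < d"
  shows "ent d X (p * q) r s = (\<Sum>k<d. ent d X p r k * ent d X q k s)"
proof (induction p rule: ncpoly_induct)
  case (single u c)
  show ?case
  proof (induction q rule: ncpoly_induct)
    case (single v e)
    have "(word_mat d X u * word_mat d X v) $$ (r, s) = (\<Sum>k<d. word_mat d X u $$ (r, k) * word_mat d X v $$ (k, s))"
      using word_mat_carrier[of "letters u"] word_mat_carrier[of "letters v"] assms
      by (simp add: scalar_prod_def lessThan_atLeast0)
    moreover have "word_mat d X (u + v) = word_mat d X u * word_mat d X v"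
      using word_mat_append[of "letters u" "letters v"] by (simp add: plus_free_monoid_def)
    ultimately show ?case
      by (simp add: mult_single ent_single sum_distrib_left mult_ac)
  qed (simp add: distrib_left ent_add sum.distrib)
qed (simp add: distrib_right ent_add sum.distrib)

lemma ent_t:
  assumes "r < d" "s < d"
  shows "ent d X (ncpoly_t p) r s = ent d X p s r"
proof (induction p rule: ncpoly_induct)
  case (single u c)
  show ?case using word_mat_carrier[of "letters u"] assms
    by (simp add: ncpoly_t_single ent_single word_mat_word_t)
qed (simp add: ncpoly_t_add ent_add)

end

text \<open>Renaming of variables, written as an evaluation so that it inherits the homomorphism
  laws of \<open>ncpoly_eval\<close>. With \<open>Inl\<close> and \<open>Inr\<close> it embeds the
  polynomials of one family into those of the joint ensemble.\<close>

definition emb :: "('i \<Rightarrow> 'k) \<Rightarrow> 'i ncpoly \<Rightarrow> 'k ncpoly" where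
  "emb f = ncpoly_eval ncpoly_sc ncpoly_t (\<lambda>i. ncpoly_var (f i))"

text \<open>The laws of \<open>ncpoly_eval\<close> are stated inside second order spaces. The
  scalars with covariance 0 are such a space, and pulling it back along the evaluation at 0 makes
  the polynomial ring one.\<close>

lemma complex_space: "real_second_order_space (*) (\<lambda>x. x) (\<lambda>_ _. 0) (\<lambda>x::complex. x)"
proof -
  interpret C: vector_space "(*) :: complex \<Rightarrow> complex \<Rightarrow> complex"
    by standard (simp_all add: algebra_simps)
  show ?thesis by unfold_locales (simp_all add: algebra_simps)
qed

lemma ncpoly_space:
  "real_second_order_space ncpoly_sc (\<lambda>p. ncpoly_eval (*) (\<lambda>x. x) (\<lambda>_. 0) p) (\<lambda>_ _. 0)
     (ncpoly_t :: 'i ncpoly \<Rightarrow> 'i ncpoly)"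
proof -
  interpret real_second_order_space "(*)" "\<lambda>x. x" "\<lambda>_ _. 0" "\<lambda>x::complex. x" by (rule complex_space)
  show ?thesis by (rule real_second_order_space_pullback)
qed

lemmas emb_add = real_second_order_space.ncpoly_eval_add[OF ncpoly_space, where a = "\<lambda>i. ncpoly_var (f i)" for f, folded emb_def]
lemmas emb_sc = real_second_order_space.ncpoly_eval_sc[OF ncpoly_space, where a = "\<lambda>i. ncpoly_var (f i)" for f, folded emb_def]
lemmas emb_mult = real_second_order_space.ncpoly_eval_mult[OF ncpoly_space, where a = "\<lambda>i. ncpoly_var (f i)" for f, folded emb_def]
lemmas emb_one = real_second_order_space.ncpoly_eval_one[OF ncpoly_space, where a = "\<lambda>i. ncpoly_var (f i)" for f, folded emb_def]
lemmas emb_t = real_second_order_space.ncpoly_eval_t[OF ncpoly_space, where a = "\<lambda>i. ncpoly_var (f i)" for f, folded emb_def]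

lemma emb_single: "emb f (Poly_Mapping.single w c) = Poly_Mapping.single (Word (map (map_letter f) (letters w))) c"
proof -
  have "prod_list (map (letter_val ncpoly_t (\<lambda>i. ncpoly_var (f i))) ls) =
      Poly_Mapping.single (Word (map (map_letter f) ls)) 1" for ls
  proof (induction ls)
    case Nil
    then show ?case by (simp flip: zero_free_monoid_def)
  next
    case (Cons l ls)
    have "letter_val ncpoly_t (\<lambda>i. ncpoly_var (f i)) l = Poly_Mapping.single (Word [map_letter f l]) 1"
      by (cases l) (simp_all add: ncpoly_var_def ncpoly_t_single word_t_def)
    with Cons show ?case by (simp add: mult_single plus_free_monoid_def)
  qed
  then show ?thesis
    by (simp add: emb_def ncpoly_eval_def word_eval_def ncpoly_sc_single)
qed

lemma ent_emb: "ent d X (emb f p) r s = ent d (\<lambda>i. X (f i)) p r s"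
proof (induction p rule: ncpoly_induct)
  case (single w c)
  have "letter_val transpose_mat X (map_letter f l) = letter_val transpose_mat (\<lambda>i. X (f i)) l" for l
    by (cases l) auto
  then have "word_mat d X (Word (map (map_letter f) ls)) = word_mat d (\<lambda>i. X (f i)) (Word ls)" for ls
    by (induction ls) (simp_all add: word_mat_Nil word_mat_Cons)
  from this[of "letters w"] show ?case by (simp add: emb_single ent_single)
qed (simp add: emb_add ent_add)

section \<open>Plane rotations and their derivative at angle 0\<close>

definition plane_rotation :: "nat \<Rightarrow> nat \<Rightarrow> real \<Rightarrow> nat \<Rightarrow> nat \<Rightarrow> real" where
  "plane_rotation \<rho> \<sigma> \<theta> x k =
     (if x = \<rho> then (if k = \<rho> then cos \<theta> else 0) + (if k = \<sigma> then sin \<theta> else 0)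
      else if x = \<sigma> then (if k = \<sigma> then cos \<theta> else 0) - (if k = \<rho> then sin \<theta> else 0)
      else if k = x then 1 else 0)"

lemma sum_plane_rotation:
  fixes f :: "nat \<Rightarrow> 'a::real_algebra_1"
  assumes "\<rho> < d" "\<sigma> < d" "x < d"
  shows "(\<Sum>k<d. of_real (plane_rotation \<rho> \<sigma> \<theta> x k) * f k) =
    (if x = \<rho> then of_real (cos \<theta>) * f \<rho> + of_real (sin \<theta>) * f \<sigma>
     else if x = \<sigma> then of_real (cos \<theta>) * f \<sigma> - of_real (sin \<theta>) * f \<rho> else f x)"
proof -
  have 1: "(\<Sum>k<d. of_real (if k = a then c else 0) * f k) = of_real c * f a" if "a < d" for a c
  proof -
    have "(\<Sum>k<d. of_real (if k = a then c else 0) * f k) = (\<Sum>k<d. if k = a then of_real c * f k else 0)"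
      by (intro sum.cong) auto
    then show ?thesis using that by simp
  qed
  show ?thesis
    using assms 1[of x 1] by (simp add: plane_rotation_def distrib_right left_diff_distrib sum.distrib sum_subtractf 1)
qed

lemma real_orthogonal_plane_rotation:
  assumes "\<rho> < d" "\<sigma> < d" "\<rho> \<noteq> \<sigma>"
  shows "real_orthogonal d (mat d d (\<lambda>(x, k). plane_rotation \<rho> \<sigma> \<theta> x k))"
proof -
  let ?Q = "\<lambda>\<theta>. mat d d (\<lambda>(x, k). plane_rotation \<rho> \<sigma> \<theta> x k)"
  have t: "transpose_mat (?Q \<theta>) = ?Q (- \<theta>)" for \<theta>
    by (rule eq_matI) (use assms in \<open>auto simp: plane_rotation_def\<close>)
  have "?Q \<theta> * ?Q (- \<theta>) = 1\<^sub>m d" for \<theta>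
  proof (rule eq_matI)
    fix x y assume xy: "x < dim_row (1\<^sub>m d :: real mat)" "y < dim_col (1\<^sub>m d :: real mat)"
    have "(?Q \<theta> * ?Q (- \<theta>)) $$ (x, y) =
        (\<Sum>k<d. of_real (plane_rotation \<rho> \<sigma> \<theta> x k) * plane_rotation \<rho> \<sigma> (- \<theta>) k y)"
      using xy by (simp add: scalar_prod_def lessThan_atLeast0)
    also have "\<dots> = (if x = y then 1 else 0)"
      using assms xy sin_cos_squared_add[of \<theta>] sin_cos_squared_add2[of \<theta>]
      by (subst sum_plane_rotation) (auto simp: plane_rotation_def power2_eq_square)
    finally show "(?Q \<theta> * ?Q (- \<theta>)) $$ (x, y) = (1\<^sub>m d) $$ (x, y)" using xy by simp
  qed auto
  from this[of \<theta>] this[of "- \<theta>"] show ?thesis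
    unfolding real_orthogonal_def t by simp
qed

lemma plane_rotation_0: "\<rho> \<noteq> \<sigma> \<Longrightarrow> plane_rotation \<rho> \<sigma> 0 x k = (if x = k then 1 else 0)"
  by (auto simp: plane_rotation_def)

definition rotation_generator :: "nat \<Rightarrow> nat \<Rightarrow> nat \<Rightarrow> nat \<Rightarrow> real" where
  "rotation_generator \<rho> \<sigma> x k =
     (if x = \<rho> \<and> k = \<sigma> then 1 else 0) - (if x = \<sigma> \<and> k = \<rho> then 1 else 0)"

lemma plane_rotation_derivative:
  assumes "\<rho> \<noteq> \<sigma>"
  shows "((\<lambda>\<theta>. plane_rotation \<rho> \<sigma> \<theta> x k) has_real_derivative rotation_generator \<rho> \<sigma> x k) (at 0)"
proof -
  have "((\<lambda>\<theta>. (if k = \<rho> then cos \<theta> else 0) + (if k = \<sigma> then sin \<theta> else 0)) has_real_derivative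
      (if k = \<sigma> then 1 else 0)) (at 0)"
    by (cases "k = \<rho>"; cases "k = \<sigma>") (auto intro!: derivative_eq_intros)
  moreover have "((\<lambda>\<theta>. (if k = \<sigma> then cos \<theta> else 0) - (if k = \<rho> then sin \<theta> else 0)) has_real_derivative
      - (if k = \<rho> then 1 else 0)) (at 0)"
    by (cases "k = \<rho>"; cases "k = \<sigma>") (auto intro!: derivative_eq_intros)
  ultimately show ?thesis
    using assms unfolding plane_rotation_def rotation_generator_def
    by (cases "x = \<rho>"; cases "x = \<sigma>") (simp_all split del: if_split)
qed

context prob_space
begin

text \<open>\<open>expansion H H'\<close> says that \<open>H \<theta>\<close> is a finite sum of scalar functions of the angle, differentiable
  at 0, times random variables, with derivative \<open>H'\<close> at \<open>\<theta> = 0\<close>; this form makes it trivial to differentiate under the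
  expectation.\<close>

inductive expansion :: "(real \<Rightarrow> 'a \<Rightarrow> complex) \<Rightarrow> ('a \<Rightarrow> complex) \<Rightarrow> bool" where
  scale: "(g has_vector_derivative g') (at 0) \<Longrightarrow> all_moments M C \<Longrightarrow>
    expansion (\<lambda>\<theta> w. g \<theta> * C w) (\<lambda>w. g' * C w)"
| add: "expansion H H' \<Longrightarrow> expansion K K' \<Longrightarrow>
    expansion (\<lambda>\<theta> w. H \<theta> w + K \<theta> w) (\<lambda>w. H' w + K' w)"

lemma expansion_const: "expansion (\<lambda>\<theta> w. c) (\<lambda>w. 0)"
  using scale[of "\<lambda>_. c" 0 "\<lambda>_. 1"] by (simp add: all_moments_const)

lemma expansion_sum:
  "(\<And>i. i \<in> I \<Longrightarrow> expansion (H i) (H' i)) \<Longrightarrow> expansion (\<lambda>\<theta> w. \<Sum>i\<in>I. H i \<theta> w) (\<lambda>w. \<Sum>i\<in>I. H' i w)"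
  by (induction I rule: infinite_finite_induct) (auto intro: expansion_const add)

lemma expansion_mult:
  assumes "expansion H H'" "expansion K K'"
  shows "expansion (\<lambda>\<theta> w. H \<theta> w * K \<theta> w) (\<lambda>w. H' w * K 0 w + H 0 w * K' w)"
  using assms
proof (induction arbitrary: K K')
  case (scale g g' C)
  note g = scale(1,2)
  show ?case using scale(3)
  proof induction
    case (scale h h' D)
    have "((\<lambda>\<theta>. g \<theta> * h \<theta>) has_vector_derivative g 0 * h' + g' * h 0) (at 0)"
      using g(1) scale(1) by (rule has_vector_derivative_mult)
    from expansion.scale[OF this all_moments_mult[OF g(2) scale(2)]] show ?case
      by (simp add: algebra_simps)
  next
    case (add H H' K K')
    from expansion.add[OF add.IH] show ?case by (simp add: algebra_simps)
  qed
next
  case (add H H' L L')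
  from expansion.add[OF add.IH(1)[OF add.prems] add.IH(2)[OF add.prems]] show ?case
    by (simp add: algebra_simps)
qed

lemma expansion_expectation:
  assumes "expansion H H'"
  shows "((\<lambda>\<theta>. LINT w|M. H \<theta> w) has_vector_derivative (LINT w|M. H' w)) (at 0) \<and>
    (\<forall>\<theta>. all_moments M (H \<theta>)) \<and> all_moments M H'"
  using assms
proof induction
  case (scale g g' C)
  then show ?case
    using has_vector_derivative_mult[OF scale(1), of "\<lambda>_. LINT w|M. C w" 0]
    by (auto intro: all_moments_intros)
next
  case (add H H' K K')
  then show ?case
    using has_vector_derivative_add[of "\<lambda>\<theta>. LINT w|M. H \<theta> w" "LINT w|M. H' w" "at 0"
        "\<lambda>\<theta>. LINT w|M. K \<theta> w" "LINT w|M. K' w"]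
    by (auto intro: all_moments_intros simp: all_moments_integrable)
qed

end

section \<open>Independence and infinitesimal invariance in a fixed dimension\<close>

locale invariant_pair = prob_space M for M :: "'w measure" +
  fixes d :: nat and A :: "'i \<Rightarrow> 'w \<Rightarrow> complex mat" and B :: "'j \<Rightarrow> 'w \<Rightarrow> complex mat"
  assumes random_A: "random_matrix_family M d A" and random_B: "random_matrix_family M d B"
    and independent: "entries_independent M d A B"
    and invariant: "orthogonally_invariant M d A"
begin

definition X :: "'w \<Rightarrow> 'i + 'j \<Rightarrow> complex mat" where
  "X w = case_sum (\<lambda>i. A i w) (\<lambda>j. B j w)"

definition e :: "('i + 'j) ncpoly \<Rightarrow> nat \<Rightarrow> nat \<Rightarrow> 'w \<Rightarrow> complex" where
  "e p r s w = ent d (X w) p r s"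

lemma X_carrier: "w \<in> space M \<Longrightarrow> X w k \<in> carrier_mat d d"
  using random_A random_B by (cases k) (auto simp: X_def random_matrix_family_def)

lemma all_moments_cong: "(\<And>w. w \<in> space M \<Longrightarrow> f w = g w) \<Longrightarrow> all_moments M f \<longleftrightarrow> all_moments M g"
proof -
  assume eq: "\<And>w. w \<in> space M \<Longrightarrow> f w = g w"
  have "integrable M (\<lambda>w. norm (f w) ^ m) \<longleftrightarrow> integrable M (\<lambda>w. norm (g w) ^ m)" for m :: nat
    by (rule Bochner_Integration.integrable_cong) (simp_all add: eq)
  moreover have "f \<in> borel_measurable M \<longleftrightarrow> g \<in> borel_measurable M"
    by (rule measurable_cong) (rule eq)
  ultimately show ?thesis by (simp add: all_moments_def)
qed

fun coord :: "('k \<Rightarrow> 'w \<Rightarrow> complex mat) \<Rightarrow> 'k \<times> nat \<times> nat \<Rightarrow> 'w \<Rightarrow> complex" where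
  "coord C (i, r, s) = (\<lambda>w. C i w $$ (r, s))"

lemma all_moments_coord:
  "x \<in> entry_index d \<Longrightarrow> all_moments M (coord A x)" "y \<in> entry_index d \<Longrightarrow> all_moments M (coord B y)"
proof -
  have "all_moments M (coord C z)" if "random_matrix_family M d C" "z \<in> entry_index d"
    for C :: "'k \<Rightarrow> 'w \<Rightarrow> complex mat" and z
  proof -
    obtain i r s where "z = (i, r, s)" by (cases z)
    then show ?thesis using that by (simp add: entry_index_def all_moments_def random_matrix_family_def)
  qed
  note this[OF random_A, of x] this[OF random_B, of y]
  then show "x \<in> entry_index d \<Longrightarrow> all_moments M (coord A x)"
    "y \<in> entry_index d \<Longrightarrow> all_moments M (coord B y)" by auto
qed

definition monomial :: "('k \<Rightarrow> 'w \<Rightarrow> complex mat) \<Rightarrow> ('k \<times> nat \<times> nat) list \<Rightarrow> 'w \<Rightarrow> complex" where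
  "monomial C es w = (\<Prod>x\<leftarrow>es. coord C x w)"

lemma monomial_simps [simp]:
  "monomial C [] = (\<lambda>w. 1)" "monomial C (x # es) = (\<lambda>w. coord C x w * monomial C es w)"
  "monomial C (es @ es') = (\<lambda>w. monomial C es w * monomial C es' w)"
  by (simp_all add: monomial_def fun_eq_iff)

lemma all_moments_monomial:
  "set es \<subseteq> entry_index d \<Longrightarrow> all_moments M (monomial A es)"
  "set fs \<subseteq> entry_index d \<Longrightarrow> all_moments M (monomial B fs)"
  unfolding monomial_def by (auto intro!: all_moments_prod_list all_moments_coord)

definition sigma_of :: "('k \<Rightarrow> 'w \<Rightarrow> complex mat) \<Rightarrow> 'w measure" where
  "sigma_of C = vimage_algebra (space M) (entries d C) (PiM (entry_index d) (\<lambda>_. borel))"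

lemma measurable_coord:
  assumes "x \<in> entry_index d"
  shows "coord C x \<in> borel_measurable (sigma_of C)"
proof -
  have "entries d C \<in> sigma_of C \<rightarrow>\<^sub>M PiM (entry_index d) (\<lambda>_. borel)"
    unfolding sigma_of_def
    by (rule measurable_vimage_algebra1) (auto simp: space_PiM entries_def)
  then have "(\<lambda>w. entries d C w x) \<in> borel_measurable (sigma_of C)"
    by (rule measurable_compose) (rule measurable_component_singleton[OF assms])
  also have "(\<lambda>w. entries d C w x) = coord C x"
    using assms by (cases x) (auto simp: entries_def fun_eq_iff)
  finally show ?thesis .
qed

lemma measurable_monomial:
  assumes "set es \<subseteq> entry_index d"
  shows "monomial C es \<in> borel_measurable (sigma_of C)"
  using assms by (induction es) (auto intro!: borel_measurable_times measurable_coord simp del: coord.simps)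

text \<open>Independence is given for the sigma-algebras of all entries and passes to any two
  integrable functions measurable with respect to them.\<close>

lemma expectation_mult:
  fixes f g :: "'w \<Rightarrow> complex"
  assumes f: "f \<in> borel_measurable (sigma_of A)" "integrable M f"
    and g: "g \<in> borel_measurable (sigma_of B)" "integrable M g"
  shows "(LINT w|M. f w * g w) = (LINT w|M. f w) * (LINT w|M. g w)"
proof (rule indep_var_lebesgue_integral[OF _ f(2) g(2)])
  have sub: "sigma_sets (space M) {h -` S \<inter> space M |S. S \<in> sets borel} \<subseteq> sets (sigma_of C)"
    if "h \<in> borel_measurable (sigma_of C)" for h :: "'w \<Rightarrow> complex" and C :: "'k \<Rightarrow> 'w \<Rightarrow> complex mat"
  proof -
    have sp: "space (sigma_of C) = space M" by (simp add: sigma_of_def)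
    have "{h -` S \<inter> space M |S. S \<in> sets borel} \<subseteq> sets (sigma_of C)"
      using measurable_sets[OF that] by (auto simp: sp)
    from sets.sigma_sets_subset[OF this] show ?thesis by (simp add: sp)
  qed
  have "indep_set (sets (sigma_of A)) (sets (sigma_of B))"
    using independent by (simp add: entries_independent_def entries_sigma_def sigma_of_def)
  then have "indep_set (sigma_sets (space M) {f -` S \<inter> space M |S. S \<in> sets borel})
      (sigma_sets (space M) {g -` S \<inter> space M |S. S \<in> sets borel})"
    unfolding indep_set_def
    by (rule indep_sets_mono_sets) (use sub[OF f(1)] sub[OF g(1)] in \<open>auto split: bool.splits\<close>)
  then show "indep_var borel f borel g"
    using f(2) g(2) by (auto simp: indep_var_eq)
qed

text \<open>The \<open>(x, y)\<close> entry of \<open>[G, A\<^sub>i]\<close>, where \<open>G\<close> generates the rotations of the plane \<open>(\<rho>, \<sigma>)\<close>.\<close>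

definition commutator_coord :: "nat \<Rightarrow> nat \<Rightarrow> 'i \<times> nat \<times> nat \<Rightarrow> 'w \<Rightarrow> complex" where
  "commutator_coord \<rho> \<sigma> = (\<lambda>(i, x, y) w.
     (if x = \<rho> then A i w $$ (\<sigma>, y) else 0) - (if x = \<sigma> then A i w $$ (\<rho>, y) else 0)
     - (if y = \<sigma> then A i w $$ (x, \<rho>) else 0) + (if y = \<rho> then A i w $$ (x, \<sigma>) else 0))"

text \<open>The derivative is taken on the list of factors, because a random variable does not
  determine its representation as a monomial in the entries.\<close>

fun d_monomial :: "nat \<Rightarrow> nat \<Rightarrow> ('i \<times> nat \<times> nat) list \<Rightarrow> 'w \<Rightarrow> complex" where
  "d_monomial \<rho> \<sigma> [] = (\<lambda>w. 0)"
| "d_monomial \<rho> \<sigma> (x # es) = (\<lambda>w.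
     commutator_coord \<rho> \<sigma> x w * monomial A es w + coord A x w * d_monomial \<rho> \<sigma> es w)"

lemma d_monomial_append:
  "d_monomial \<rho> \<sigma> (es @ fs) w = d_monomial \<rho> \<sigma> es w * monomial A fs w + monomial A es w * d_monomial \<rho> \<sigma> fs w"
  by (induction es) (simp_all add: algebra_simps)

text \<open>The derivative is again a polynomial in the entries of the first family, so independence
  still separates it from the entries of the second.\<close>

lemma measurable_d_monomial:
  assumes "set es \<subseteq> entry_index d" "\<rho> < d" "\<sigma> < d"
  shows "d_monomial \<rho> \<sigma> es \<in> borel_measurable (sigma_of A)" "all_moments M (d_monomial \<rho> \<sigma> es)"
proof -
  have c: "commutator_coord \<rho> \<sigma> x \<in> borel_measurable (sigma_of A) \<and> all_moments M (commutator_coord \<rho> \<sigma> x)"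
    if "x \<in> entry_index d" for x
  proof -
    obtain i r s where x: "x = (i, r, s)" by (cases x)
    have idx: "(i, a, b) \<in> entry_index d" if "a < d" "b < d" for a b using that by (simp add: entry_index_def)
    have [measurable]: "(\<lambda>w. A i w $$ (a, b)) \<in> borel_measurable (sigma_of A)" if "a < d" "b < d" for a b
      using measurable_coord[OF idx[OF that], of A] by simp
    have moment_rules: "all_moments M (\<lambda>w. A i w $$ (a, b))" if "a < d" "b < d" for a b
      using all_moments_coord(1)[OF idx[OF that]] by simp
    have rs: "r < d" "s < d" using that x by (auto simp: entry_index_def)
    have ifm: "all_moments M (\<lambda>w. if P then f w else 0)" if "all_moments M f" for P f
      using that by (cases P) (auto intro: all_moments_const)
    show ?thesis
      unfolding x commutator_coord_def prod.case
      using rs assms(2,3) by (auto intro!: all_moments_diff all_moments_add ifm moment_rules)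
  qed
  show "d_monomial \<rho> \<sigma> es \<in> borel_measurable (sigma_of A)"
    using assms(1) by (induction es)
      (auto intro!: borel_measurable_add borel_measurable_times measurable_monomial measurable_coord c[THEN conjunct1] simp del: coord.simps)
  show "all_moments M (d_monomial \<rho> \<sigma> es)"
    using assms(1) by (induction es)
      (auto intro!: all_moments_add all_moments_mult all_moments_monomial all_moments_coord all_moments_const c[THEN conjunct2] simp del: coord.simps)
qed

text \<open>By invariance the expectation of the rotated monomial is constant in the angle, and its
  derivative at angle 0 is the expectation of \<open>d_monomial\<close>.\<close>

lemma expectation_d_monomial:
  assumes es: "set es \<subseteq> entry_index d" and \<rho>: "\<rho> < d" and \<sigma>: "\<sigma> < d"
  shows "(LINT w|M. d_monomial \<rho> \<sigma> es w) = 0"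
proof (cases "\<rho> = \<sigma>")
  \<comment> \<open>The degenerate plane is included because the later sums run over all pairs of
    indices; its generator is 0.\<close>
  case True
  then have "commutator_coord \<rho> \<sigma> x w = 0" for x w
    by (cases x) (simp add: commutator_coord_def)
  then have "d_monomial \<rho> \<sigma> es w = 0" for w by (induction es) auto
  then show ?thesis by simp
next
  case False
  let ?q = "\<lambda>\<theta> x k. complex_of_real (plane_rotation \<rho> \<sigma> \<theta> x k)"
  let ?g = "\<lambda>x k. complex_of_real (rotation_generator \<rho> \<sigma> x k)"
  \<comment> \<open>The entry of \<open>Q A Q^t\<close> written out, so that the angle occurs in
    scalar coefficients only.\<close>
  define rot where "rot = (\<lambda>(i, x, y) \<theta> w. \<Sum>u<d. \<Sum>v<d. (?q \<theta> x u * ?q \<theta> y v) * A i w $$ (u, v))"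
  have q: "((\<lambda>\<theta>. ?q \<theta> x k) has_vector_derivative ?g x k) (at 0)" for x k
    using plane_rotation_derivative[OF False]
    by (intro has_vector_derivative_of_real) (simp add: has_real_derivative_iff_has_vector_derivative)
  have delta: "(\<Sum>k<d. (if P k then c else 0) * f k) = (\<Sum>k<d. if P k then c * f k else 0)"
    for P and c :: complex and f by (intro sum.cong) auto
  have rot_expansion: "expansion (rot x) (commutator_coord \<rho> \<sigma> x)" "rot x 0 w = coord A x w"
    if x: "x \<in> entry_index d" for x w
  proof -
    obtain i r s where irs: "x = (i, r, s)" by (cases x)
    with x have rs: "r < d" "s < d" by (auto simp: entry_index_def)
    have moment_rules: "all_moments M (\<lambda>w. A i w $$ (u, v))" if "u < d" "v < d" for u v
      using all_moments_coord(1)[of "(i, u, v)"] that by (simp add: entry_index_def)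
    have q0: "?q 0 x k = (if x = k then 1 else 0)" for x k by (simp add: plane_rotation_0[OF False])
    have "expansion (rot x) (\<lambda>w. \<Sum>u<d. \<Sum>v<d. (?q 0 r u * ?g s v + ?g r u * ?q 0 s v) * A i w $$ (u, v))"
      unfolding irs rot_def prod.case
      by (intro expansion_sum scale has_vector_derivative_mult q moment_rules) auto
    \<comment> \<open>At angle 0 the rotation is the identity and its derivative \<open>G\<close> is
      skew, so the product rule gives \<open>G A + A G^t = [G, A]\<close>.\<close>
    also have "(\<lambda>w. \<Sum>u<d. \<Sum>v<d. (?q 0 r u * ?g s v + ?g r u * ?q 0 s v) * A i w $$ (u, v)) =
        commutator_coord \<rho> \<sigma> x"
    proof
      fix w
      have "(\<Sum>u<d. \<Sum>v<d. (?q 0 r u * ?g s v + ?g r u * ?q 0 s v) * A i w $$ (u, v)) =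
          (\<Sum>u<d. \<Sum>v<d. if u = r then ?g s v * A i w $$ (r, v) else 0) +
          (\<Sum>u<d. \<Sum>v<d. if v = s then ?g r u * A i w $$ (u, s) else 0)"
        unfolding sum.distrib[symmetric] by (intro sum.cong refl) (auto simp: q0 distrib_right)
      also have "(\<Sum>u<d. \<Sum>v<d. if u = r then ?g s v * A i w $$ (r, v) else 0) =
          (\<Sum>v<d. \<Sum>u<d. if u = r then ?g s v * A i w $$ (r, v) else 0)"
        by (rule sum.swap)
      also have "\<dots> + (\<Sum>u<d. \<Sum>v<d. if v = s then ?g r u * A i w $$ (u, s) else 0) =
          (\<Sum>v<d. ?g s v * A i w $$ (r, v)) + (\<Sum>u<d. ?g r u * A i w $$ (u, s))"
        using rs by simp
      also have "(\<Sum>v<d. ?g s v * A i w $$ (r, v)) =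
          (if s = \<rho> then A i w $$ (r, \<sigma>) else 0) - (if s = \<sigma> then A i w $$ (r, \<rho>) else 0)"
      proof -
        have "(\<Sum>v<d. ?g s v * A i w $$ (r, v)) =
            (\<Sum>v<d. if v = \<sigma> then (if s = \<rho> then A i w $$ (r, \<sigma>) else 0) else 0) -
            (\<Sum>v<d. if v = \<rho> then (if s = \<sigma> then A i w $$ (r, \<rho>) else 0) else 0)"
          unfolding sum_subtractf[symmetric]
          by (intro sum.cong) (auto simp: rotation_generator_def)
        then show ?thesis using \<rho> \<sigma> by simp
      qed
      also have "(\<Sum>u<d. ?g r u * A i w $$ (u, s)) =
          (if r = \<rho> then A i w $$ (\<sigma>, s) else 0) - (if r = \<sigma> then A i w $$ (\<rho>, s) else 0)"
      proof -
        have "(\<Sum>u<d. ?g r u * A i w $$ (u, s)) =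
            (\<Sum>u<d. if u = \<sigma> then (if r = \<rho> then A i w $$ (\<sigma>, s) else 0) else 0) -
            (\<Sum>u<d. if u = \<rho> then (if r = \<sigma> then A i w $$ (\<rho>, s) else 0) else 0)"
          unfolding sum_subtractf[symmetric]
          by (intro sum.cong) (auto simp: rotation_generator_def)
        then show ?thesis using \<rho> \<sigma> by simp
      qed
      finally show "(\<Sum>u<d. \<Sum>v<d. (?q 0 r u * ?g s v + ?g r u * ?q 0 s v) * A i w $$ (u, v)) =
          commutator_coord \<rho> \<sigma> x w"
        by (simp add: irs commutator_coord_def)
    qed
    finally show "expansion (rot x) (commutator_coord \<rho> \<sigma> x)" .
    have "rot x 0 w = (\<Sum>u<d. \<Sum>v<d. if v = s then (if u = r then A i w $$ (u, v) else 0) else 0)"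
      unfolding irs rot_def prod.case by (intro sum.cong) (auto simp: q0)
    then show "rot x 0 w = coord A x w" using rs by (simp add: irs)
  qed
  have exp: "expansion (\<lambda>\<theta> w. \<Prod>x\<leftarrow>es. rot x \<theta> w) (d_monomial \<rho> \<sigma> es) \<and>
      (\<forall>w. (\<Prod>x\<leftarrow>es. rot x 0 w) = monomial A es w)"
    using es
  proof (induction es)
    case Nil
    then show ?case by (simp add: expansion_const fun_eq_iff)
  next
    case (Cons x es)
    then have x: "x \<in> entry_index d" by simp
    from Cons have IH: "expansion (\<lambda>\<theta> w. \<Prod>x\<leftarrow>es. rot x \<theta> w) (d_monomial \<rho> \<sigma> es)"
      "(\<Prod>x\<leftarrow>es. rot x 0 w) = monomial A es w" for w by auto
    have "d_monomial \<rho> \<sigma> (x # es) =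
        (\<lambda>w. commutator_coord \<rho> \<sigma> x w * (\<Prod>x\<leftarrow>es. rot x 0 w) + rot x 0 w * d_monomial \<rho> \<sigma> es w)"
      by (simp add: fun_eq_iff IH rot_expansion(2)[OF x])
    then show ?case
      using expansion_mult[OF rot_expansion(1)[OF x] IH(1)] by (simp add: IH rot_expansion(2)[OF x])
  qed
  have const: "(LINT w|M. (\<Prod>x\<leftarrow>es. rot x \<theta> w)) = (LINT w|M. monomial A es w)" for \<theta>
  proof -
    let ?Q = "mat d d (\<lambda>(x, k). plane_rotation \<rho> \<sigma> \<theta> x k)"
    have "(LINT w|M. (\<Prod>x\<leftarrow>es. rot x \<theta> w)) =
        (LINT w|M. (\<Prod>(i, r, s)\<leftarrow>es. conj_orthogonal ?Q (A i w) $$ (r, s)))"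
    proof (rule Bochner_Integration.integral_cong[OF refl])
      fix w assume w: "w \<in> space M"
      show "(\<Prod>x\<leftarrow>es. rot x \<theta> w) = (\<Prod>(i, r, s)\<leftarrow>es. conj_orthogonal ?Q (A i w) $$ (r, s))"
      proof (intro arg_cong[of _ _ prod_list] map_cong refl)
        fix x assume "x \<in> set es"
        then obtain i r s where x: "x = (i, r, s)" "r < d" "s < d"
          using es by (cases x) (auto simp: entry_index_def)
        have Ai: "A i w \<in> carrier_mat d d" using random_A w by (auto simp: random_matrix_family_def)
        have "conj_orthogonal ?Q (A i w) $$ (r, s) = (\<Sum>v<d. (\<Sum>u<d. ?q \<theta> r u * A i w $$ (u, v)) * ?q \<theta> s v)"
          using Ai x by (simp add: conj_orthogonal_def scalar_prod_def lessThan_atLeast0)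
        also have "\<dots> = rot x \<theta> w"
          unfolding x rot_def prod.case sum_distrib_right by (subst sum.swap) (simp add: mult_ac)
        finally show "rot x \<theta> w = (case x of (i, r, s) \<Rightarrow> conj_orthogonal ?Q (A i w) $$ (r, s))"
          by (simp add: x)
      qed
    qed
    also have "\<dots> = (LINT w|M. (\<Prod>(i, r, s)\<leftarrow>es. A i w $$ (r, s)))"
      using invariant es real_orthogonal_plane_rotation[OF \<rho> \<sigma> False, of \<theta>]
      unfolding orthogonally_invariant_def by blast
    also have "\<dots> = (LINT w|M. monomial A es w)"
      unfolding monomial_def
      by (intro Bochner_Integration.integral_cong arg_cong[of _ _ prod_list] map_cong refl) auto
    finally show ?thesis .
  qed
  have "((\<lambda>\<theta>. LINT w|M. (\<Prod>x\<leftarrow>es. rot x \<theta> w)) has_vector_derivative (LINT w|M. d_monomial \<rho> \<sigma> es w)) (at 0)"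
    using expansion_expectation[OF exp[THEN conjunct1]] by blast
  then have "((\<lambda>\<theta>::real. LINT w|M. monomial A es w) has_vector_derivative (LINT w|M. d_monomial \<rho> \<sigma> es w)) (at 0)"
    by (simp add: const)
  then show ?thesis
    using vector_derivative_unique_at[OF _ has_vector_derivative_const] by blast
qed

end

text \<open>Every word is the product of its letters. This form of induction suits statements that
  respect products, such as the Leibniz rule, because only variables and their transposes have to be
  computed.\<close>

lemma ncpoly_closure_induct [case_names one var vart add sc mult]:
  fixes p :: "'k ncpoly"
  assumes one: "P 1" and var: "\<And>i. P (ncpoly_var i)" and vart: "\<And>i. P (ncpoly_t (ncpoly_var i))"
    and add: "\<And>p q. P p \<Longrightarrow> P q \<Longrightarrow> P (p + q)" and sc: "\<And>c p. P p \<Longrightarrow> P (ncpoly_sc c p)"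
    and mult: "\<And>p q. P p \<Longrightarrow> P q \<Longrightarrow> P (p * q)"
  shows "P p"
proof (induction p rule: ncpoly_induct)
  case (single w c)
  have "P (Poly_Mapping.single (Word ls) 1)" for ls :: "'k letter list"
  proof (induction ls)
    case Nil
    then show ?case using one by (simp flip: zero_free_monoid_def)
  next
    case (Cons l ls)
    have "P (Poly_Mapping.single (Word [l]) 1)"
      using var vart by (cases l) (simp_all add: ncpoly_var_def ncpoly_t_single word_t_def)
    from mult[OF this Cons] show ?case by (simp add: mult_single plus_free_monoid_def)
  qed
  from sc[OF this[of "letters w"], of c] show ?case by (simp add: ncpoly_sc_single)
qed (rule add)

section \<open>The loop equation\<close>

text \<open>\<open>Mix [(a\<^sub>1, b\<^sub>1), \<dots>]\<close> stands for the word \<open>a\<^sub>1 b\<^sub>1 \<dots> a\<^sub>n b\<^sub>n\<close>; \<open>PA\<close> and \<open>PB\<close> are the polynomials in one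
  family, whose traces are controlled by hypothesis. Any word in the letters of both families is of the
  form \<open>Mix\<close>, since \<open>1\<close> is allowed as a component.\<close>

datatype ('p, 'q) item = Mix "('p \<times> 'q) list" | PA 'p | PB 'q

type_synonym ('i, 'j) blocks = "('i ncpoly \<times> 'j ncpoly) list"

abbreviation "iA \<equiv> emb Inl"
abbreviation "iB \<equiv> emb Inr"

definition block_word :: "('i, 'j) blocks \<Rightarrow> ('i + 'j) ncpoly" where
  "block_word l = (\<Prod>(a, b)\<leftarrow>l. iA a * iB b)"

lemma block_word_simps [simp]:
  "block_word [] = 1" "block_word ((a, b) # l) = iA a * iB b * block_word l" "block_word (l @ l') = block_word l * block_word l'"
  by (simp_all add: block_word_def)

fun ev :: "('i ncpoly, 'j ncpoly) item \<Rightarrow> ('i + 'j) ncpoly" where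
  "ev (Mix l) = block_word l"
| "ev (PA a) = iA a"
| "ev (PB b) = iB b"

section \<open>Derivations of entries and traces along a rotation\<close>

context invariant_pair
begin

text \<open>A relation between representatives, since the derivative is attached to an expression
  and not to a random variable. The rule \<open>equal\<close> admits the matrix identities, which
  hold on the sample space only.\<close>

inductive derivation :: "nat \<Rightarrow> nat \<Rightarrow> ('w \<Rightarrow> complex) \<Rightarrow> ('w \<Rightarrow> complex) \<Rightarrow> bool" for \<rho> \<sigma> where
  monomial: "set es \<subseteq> entry_index d \<Longrightarrow> set fs \<subseteq> entry_index d \<Longrightarrow>
    derivation \<rho> \<sigma> (\<lambda>w. c * monomial A es w * monomial B fs w)
      (\<lambda>w. c * d_monomial \<rho> \<sigma> es w * monomial B fs w)"
| add: "derivation \<rho> \<sigma> f f' \<Longrightarrow> derivation \<rho> \<sigma> g g' \<Longrightarrow>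
    derivation \<rho> \<sigma> (\<lambda>w. f w + g w) (\<lambda>w. f' w + g' w)"
| equal: "derivation \<rho> \<sigma> f f' \<Longrightarrow> (\<And>w. w \<in> space M \<Longrightarrow> f w = g w) \<Longrightarrow>
    (\<And>w. w \<in> space M \<Longrightarrow> f' w = g' w) \<Longrightarrow> derivation \<rho> \<sigma> g g'"

lemma derivation_mult:
  assumes "derivation \<rho> \<sigma> f f'" "derivation \<rho> \<sigma> g g'"
  shows "derivation \<rho> \<sigma> (\<lambda>w. f w * g w) (\<lambda>w. f' w * g w + f w * g' w)"
  using assms
proof (induction arbitrary: g g')
  case (monomial es fs c)
  note es = monomial(1,2)
  show ?case using monomial(3)
  proof induction
    case (monomial es' fs' c')
    have "derivation \<rho> \<sigma> (\<lambda>w. (c * c') * monomial A (es @ es') w * monomial B (fs @ fs') w)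
        (\<lambda>w. (c * c') * d_monomial \<rho> \<sigma> (es @ es') w * monomial B (fs @ fs') w)"
      using es monomial by (intro derivation.monomial) auto
    then show ?case by (rule derivation.equal) (simp_all add: d_monomial_append algebra_simps)
  next
    case (add h h' k k')
    from derivation.add[OF add.IH] show ?case by (rule derivation.equal) (simp_all add: algebra_simps)
  next
    case (equal h h' k k')
    from equal.IH show ?case by (rule derivation.equal) (simp_all add: equal.hyps)
  qed
next
  case (add h h' k k')
  from derivation.add[OF add.IH(1)[OF add.prems] add.IH(2)[OF add.prems]] show ?case
    by (rule derivation.equal) (simp_all add: algebra_simps)
next
  case (equal h h' k k')
  from equal.IH[OF equal.prems] show ?case by (rule derivation.equal) (simp_all add: equal.hyps)
qed

lemma derivation_const: "derivation \<rho> \<sigma> (\<lambda>_. c) (\<lambda>_. 0)"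
  using monomial[of "[]" "[]" \<rho> \<sigma> c] by simp

lemma derivation_scale: "derivation \<rho> \<sigma> f f' \<Longrightarrow> derivation \<rho> \<sigma> (\<lambda>w. c * f w) (\<lambda>w. c * f' w)"
  using derivation_mult[OF derivation_const] by simp

lemma derivation_sum:
  "(\<And>i. i \<in> I \<Longrightarrow> derivation \<rho> \<sigma> (f i) (f' i)) \<Longrightarrow>
    derivation \<rho> \<sigma> (\<lambda>w. \<Sum>i\<in>I. f i w) (\<lambda>w. \<Sum>i\<in>I. f' i w)"
  by (induction I rule: infinite_finite_induct) (auto intro: derivation_const derivation.add)

lemma derivation_prod_mset:
  assumes "\<And>x. x \<in># F \<Longrightarrow> derivation \<rho> \<sigma> (f x) (f' x)"
  shows "derivation \<rho> \<sigma> (\<lambda>w. \<Prod>x\<in>#F. f x w) (\<lambda>w. \<Sum>x\<in>#F. f' x w * (\<Prod>y\<in>#F - {#x#}. f y w))"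
  using assms
proof (induction F)
  case empty
  then show ?case by (simp add: derivation_const)
next
  case (add z F)
  have IH: "derivation \<rho> \<sigma> (\<lambda>w. \<Prod>x\<in>#F. f x w) (\<lambda>w. \<Sum>x\<in>#F. f' x w * (\<Prod>y\<in>#F - {#x#}. f y w))"
    using add by auto
  have z: "derivation \<rho> \<sigma> (f z) (f' z)" using add by auto
  have "(\<Sum>x\<in>#add_mset z F. f' x w * (\<Prod>y\<in>#add_mset z F - {#x#}. f y w)) =
      f' z w * (\<Prod>y\<in>#F. f y w) + f z w * (\<Sum>x\<in>#F. f' x w * (\<Prod>y\<in>#F - {#x#}. f y w))" for w
    by (subst sum_mset_remove_add[where g = "\<lambda>x G. f' x w * (\<Prod>y\<in>#G. f y w)"])
      (simp add: sum_mset_distrib_left mult.left_commute multiset.map_comp comp_def)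
  then show ?case using derivation_mult[OF z IH] by simp
qed

lemma derivation_coord:
  assumes "r < d" "s < d"
  shows "derivation \<rho> \<sigma> (\<lambda>w. A i w $$ (r, s)) (commutator_coord \<rho> \<sigma> (i, r, s))"
    "derivation \<rho> \<sigma> (\<lambda>w. B j w $$ (r, s)) (\<lambda>_. 0)"
  using monomial[of "[(i, r, s)]" "[]" \<rho> \<sigma> 1] monomial[of "[]" "[(j, r, s)]" \<rho> \<sigma> 1] assms
  by (auto simp: entry_index_def)

text \<open>In each monomial independence splits off the factor of the second family, and the
  remaining factor has mean 0 by invariance.\<close>

lemma derivation_expectation:
  assumes "derivation \<rho> \<sigma> f f'" "\<rho> < d" "\<sigma> < d"
  shows "all_moments M f \<and> all_moments M f' \<and> (LINT w|M. f' w) = 0"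
  using assms(1)
proof induction
  case (monomial es fs c)
  note dm = measurable_d_monomial[OF monomial(1) assms(2,3)]
  have "(LINT w|M. d_monomial \<rho> \<sigma> es w * monomial B fs w) =
      (LINT w|M. d_monomial \<rho> \<sigma> es w) * (LINT w|M. monomial B fs w)"
    by (intro expectation_mult dm(1) measurable_monomial all_moments_integrable dm(2)
        all_moments_monomial monomial)
  then have "(LINT w|M. c * d_monomial \<rho> \<sigma> es w * monomial B fs w) = 0"
    by (simp add: expectation_d_monomial[OF monomial(1) assms(2,3)] mult.assoc)
  then show ?case using monomial dm by (auto intro!: all_moments_intros all_moments_monomial)
next
  case (add f f' g g')
  then show ?case by (auto intro: all_moments_add simp: all_moments_integrable)
next
  case (equal f f' g g')
  moreover have "(LINT w|M. f' w) = (LINT w|M. g' w)"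
    by (intro Bochner_Integration.integral_cong) (auto simp: equal)
  ultimately show ?case using all_moments_cong[of f g] all_moments_cong[of f' g'] by auto
qed

lemma e_add: "e (p + q) r s w = e p r s w + e q r s w"
  and e_sc: "e (ncpoly_sc c p) r s w = c * e p r s w"
  by (simp_all add: e_def ent_add ent_sc)

lemma e_mult: "w \<in> space M \<Longrightarrow> r < d \<Longrightarrow> s < d \<Longrightarrow> e (p * q) r s w = (\<Sum>k<d. e p r k w * e q k s w)"
  and e_one: "w \<in> space M \<Longrightarrow> r < d \<Longrightarrow> s < d \<Longrightarrow> e 1 r s w = (if r = s then 1 else 0)"
  and e_t: "w \<in> space M \<Longrightarrow> r < d \<Longrightarrow> s < d \<Longrightarrow> e (ncpoly_t p) r s w = e p s r w"
  using X_carrier by (simp_all add: e_def ent_mult ent_one ent_t)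

lemma e_var: "w \<in> space M \<Longrightarrow> r < d \<Longrightarrow> s < d \<Longrightarrow> e (ncpoly_var k) r s w = X w k $$ (r, s)"
  using X_carrier[of w k] by (simp add: e_def ncpoly_var_def ent_single word_mat_Cons word_mat_Nil)

text \<open>The entry \<open>(x, y)\<close> of \<open>u G v\<close>, where \<open>G\<close> is the
  skew matrix with 1 at \<open>(\<rho>, \<sigma>)\<close> and -1 at
  \<open>(\<sigma>, \<rho>)\<close>. Likewise \<open>skew\<close> is the trace of
  \<open>G p\<close>.\<close>

definition ins :: "nat \<Rightarrow> nat \<Rightarrow> ('i + 'j) ncpoly \<Rightarrow> ('i + 'j) ncpoly \<Rightarrow> nat \<Rightarrow> nat \<Rightarrow> 'w \<Rightarrow> complex" where
  "ins \<rho> \<sigma> u v x y w = e u x \<rho> w * e v \<sigma> y w - e u x \<sigma> w * e v \<rho> y w"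

definition skew :: "nat \<Rightarrow> nat \<Rightarrow> ('i + 'j) ncpoly \<Rightarrow> 'w \<Rightarrow> complex" where
  "skew \<rho> \<sigma> p w = e p \<sigma> \<rho> w - e p \<rho> \<sigma> w"

definition T :: "('i + 'j) ncpoly \<Rightarrow> 'w \<Rightarrow> complex" where
  "T p w = (\<Sum>x<d. e p x x w)"

text \<open>Leibniz rule with \<open>[G, a]\<close> in place of each letter \<open>a\<close> of the
  first family: \<open>G\<close> is inserted in front of the letter and, with a minus sign, behind
  it. In \<open>d_item\<close> the trace closes the cut word up cyclically.\<close>

definition d_block_word :: "nat \<Rightarrow> nat \<Rightarrow> ('i, 'j) blocks \<Rightarrow> nat \<Rightarrow> nat \<Rightarrow> 'w \<Rightarrow> complex" where
  "d_block_word \<rho> \<sigma> l x y w = (\<Sum>i<length l. ins \<rho> \<sigma> (block_word (take i l)) (block_word (drop i l)) x y w -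
     ins \<rho> \<sigma> (block_word (take i l) * iA (fst (l ! i))) (iB (snd (l ! i)) * block_word (drop (Suc i) l)) x y w)"

fun d_item :: "nat \<Rightarrow> nat \<Rightarrow> ('i ncpoly, 'j ncpoly) item \<Rightarrow> 'w \<Rightarrow> complex" where
  "d_item \<rho> \<sigma> (Mix l) = (\<lambda>w. \<Sum>i<length l. skew \<rho> \<sigma> (block_word (drop i l) * block_word (take i l)) w -
     skew \<rho> \<sigma> (iB (snd (l ! i)) * block_word (drop (Suc i) l) * (block_word (take i l) * iA (fst (l ! i)))) w)"
| "d_item \<rho> \<sigma> (PA a) = (\<lambda>w. 0)"
| "d_item \<rho> \<sigma> (PB b) = (\<lambda>w. 0)"

context
  fixes \<rho> \<sigma> :: nat
  assumes \<rho>: "\<rho> < d" and \<sigma>: "\<sigma> < d"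
begin

lemma ins_mult_right:
  "w \<in> space M \<Longrightarrow> x < d \<Longrightarrow> y < d \<Longrightarrow> (\<Sum>k<d. ins \<rho> \<sigma> u v x k w * e z k y w) = ins \<rho> \<sigma> u (v * z) x y w"
  using \<rho> \<sigma> by (simp add: ins_def e_mult left_diff_distrib sum_subtractf sum_distrib_left mult.assoc)

lemma ins_mult_left:
  "w \<in> space M \<Longrightarrow> x < d \<Longrightarrow> y < d \<Longrightarrow> (\<Sum>k<d. e z x k w * ins \<rho> \<sigma> u v k y w) = ins \<rho> \<sigma> (z * u) v x y w"
  using \<rho> \<sigma> by (simp add: ins_def e_mult right_diff_distrib sum_subtractf sum_distrib_right sum_distrib_left mult_ac)

lemma sum_ins_diag: "w \<in> space M \<Longrightarrow> (\<Sum>x<d. ins \<rho> \<sigma> u v x x w) = skew \<rho> \<sigma> (v * u) w"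
  using \<rho> \<sigma> by (simp add: ins_def skew_def e_mult sum_subtractf mult_ac)

lemma derivation_e_mult:
  assumes "\<And>x y. x < d \<Longrightarrow> y < d \<Longrightarrow> derivation \<rho> \<sigma> (e p x y) (p' x y)"
    and "\<And>x y. x < d \<Longrightarrow> y < d \<Longrightarrow> derivation \<rho> \<sigma> (e q x y) (q' x y)"
    and xy: "x < d" "y < d"
  shows "derivation \<rho> \<sigma> (e (p * q) x y)
    (\<lambda>w. (\<Sum>k<d. p' x k w * e q k y w) + (\<Sum>k<d. e p x k w * q' k y w))"
proof -
  have "derivation \<rho> \<sigma> (\<lambda>w. \<Sum>k<d. e p x k w * e q k y w)
      (\<lambda>w. \<Sum>k<d. p' x k w * e q k y w + e p x k w * q' k y w)"
    using assms by (intro derivation_sum derivation_mult) auto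
  then show ?thesis by (rule derivation.equal) (simp_all add: e_mult xy sum.distrib)
qed

text \<open>The map \<open>p \<mapsto> [G, p]\<close> is itself a derivation, so comparing on
  variables is enough. For a transposed variable the formula is the same because \<open>G\<close> is
  skew.\<close>

lemma derivation_iA:
  assumes "x < d" "y < d"
  shows "derivation \<rho> \<sigma> (e (iA a) x y) (\<lambda>w. ins \<rho> \<sigma> 1 (iA a) x y w - ins \<rho> \<sigma> (iA a) 1 x y w)"
  using assms
proof (induction a arbitrary: x y rule: ncpoly_closure_induct)
  case one
  show ?case by (rule derivation.equal[OF derivation_const[of _ _ "if x = y then 1 else 0"]])
      (use one in \<open>simp_all add: emb_one e_one\<close>)
next
  case (var i)
  have iv: "iA (ncpoly_var i) = (ncpoly_var (Inl i) :: ('i + 'j) ncpoly)"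
    by (simp add: ncpoly_var_def emb_single)
  show ?case
    by (rule derivation.equal[OF derivation_coord(1)[OF var, of \<rho> \<sigma> i]])
      (use var \<rho> \<sigma> in \<open>auto simp: iv e_var X_def ins_def e_one commutator_coord_def\<close>)
next
  case (vart i)
  have iv: "iA (ncpoly_t (ncpoly_var i)) = (ncpoly_t (ncpoly_var (Inl i)) :: ('i + 'j) ncpoly)"
    by (simp add: ncpoly_var_def emb_single emb_t)
  show ?case
    by (rule derivation.equal[OF derivation_coord(1)[OF vart(2,1), of \<rho> \<sigma> i]])
      (use vart \<rho> \<sigma> in \<open>auto simp: iv e_t e_var X_def ins_def e_one commutator_coord_def\<close>)
next
  case (add p q)
  show ?case
    by (rule derivation.equal[OF derivation.add[OF add.IH(1)[OF add.prems] add.IH(2)[OF add.prems]]])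
      (simp_all add: emb_add e_add ins_def algebra_simps)
next
  case (sc c p)
  show ?case
    by (rule derivation.equal[OF derivation_scale[OF sc.IH[OF sc.prems], of c]])
      (simp_all add: emb_sc e_sc ins_def algebra_simps)
next
  case (mult p q)
  show ?case
    by (rule derivation.equal[OF derivation_e_mult[OF mult.IH mult.prems]])
      (simp_all add: emb_mult left_diff_distrib right_diff_distrib sum_subtractf
        ins_mult_left ins_mult_right mult.prems)
qed

lemma derivation_iB:
  assumes "x < d" "y < d"
  shows "derivation \<rho> \<sigma> (e (iB b) x y) (\<lambda>w. 0)"
  using assms
proof (induction b arbitrary: x y rule: ncpoly_closure_induct)
  case one
  show ?case by (rule derivation.equal[OF derivation_const[of _ _ "if x = y then 1 else 0"]])
      (use one in \<open>simp_all add: emb_one e_one\<close>)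
next
  case (var i)
  have iv: "iB (ncpoly_var i) = (ncpoly_var (Inr i) :: ('i + 'j) ncpoly)"
    by (simp add: ncpoly_var_def emb_single)
  show ?case
    by (rule derivation.equal[OF derivation_coord(2)[OF var, of \<rho> \<sigma> i]])
      (use var in \<open>auto simp: iv e_var X_def\<close>)
next
  case (vart i)
  have iv: "iB (ncpoly_t (ncpoly_var i)) = (ncpoly_t (ncpoly_var (Inr i)) :: ('i + 'j) ncpoly)"
    by (simp add: ncpoly_var_def emb_single emb_t)
  show ?case
    by (rule derivation.equal[OF derivation_coord(2)[OF vart(2,1), of \<rho> \<sigma> i]])
      (use vart in \<open>auto simp: iv e_t e_var X_def\<close>)
next
  case (add p q)
  show ?case
    by (rule derivation.equal[OF derivation.add[OF add.IH(1)[OF add.prems] add.IH(2)[OF add.prems]]])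
      (simp_all add: emb_add e_add)
next
  case (sc c p)
  show ?case
    by (rule derivation.equal[OF derivation_scale[OF sc.IH[OF sc.prems], of c]])
      (simp_all add: emb_sc e_sc)
next
  case (mult p q)
  show ?case
    by (rule derivation.equal[OF derivation_e_mult[OF mult.IH mult.prems]])
      (simp_all add: emb_mult)
qed

text \<open>The new first block contributes the two insertions at index 0; multiplying the
  derivative of the rest by \<open>a b\<close> from the left shifts the other indices by
  one.\<close>

lemma derivation_block_word:
  assumes "x < d" "y < d"
  shows "derivation \<rho> \<sigma> (e (block_word l) x y) (d_block_word \<rho> \<sigma> l x y)"
  using assms
proof (induction l arbitrary: x y)
  case Nil
  show ?case by (rule derivation.equal[OF derivation_const[of _ _ "if x = y then 1 else 0"]])
      (use Nil in \<open>simp_all add: e_one d_block_word_def\<close>)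
next
  case (Cons ab l)
  obtain a b where ab: "ab = (a, b)" by (cases ab)
  have 1: "derivation \<rho> \<sigma> (e (iB b * block_word l) x y)
      (\<lambda>w. (\<Sum>k<d. 0 * e (block_word l) k y w) + (\<Sum>k<d. e (iB b) x k w * d_block_word \<rho> \<sigma> l k y w))"
    if "x < d" "y < d" for x y
    by (rule derivation_e_mult) (use derivation_iB Cons.IH that in auto)
  show ?case
  proof (rule derivation.equal[OF derivation_e_mult[OF derivation_iA 1 Cons.prems]])
    show "e (iA a * (iB b * block_word l)) x y w = e (block_word (ab # l)) x y w" for w
      by (simp add: ab mult.assoc)
    fix w assume w: "w \<in> space M"
    have s: "(\<Sum>k<d. e p x k w * d_block_word \<rho> \<sigma> l k y w) =
        (\<Sum>i<length l. ins \<rho> \<sigma> (p * block_word (take i l)) (block_word (drop i l)) x y w -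
          ins \<rho> \<sigma> (p * (block_word (take i l) * iA (fst (l ! i)))) (iB (snd (l ! i)) * block_word (drop (Suc i) l)) x y w)"
      if "x < d" for p x
      unfolding d_block_word_def sum_distrib_left
      by (subst sum.swap) (simp add: right_diff_distrib sum_subtractf ins_mult_left w that Cons.prems)
    have t: "(\<Sum>k<d. e (iA a) x k w * (\<Sum>k'<d. e (iB b) k k' w * d_block_word \<rho> \<sigma> l k' y w)) =
        (\<Sum>k<d. e (iA a * iB b) x k w * d_block_word \<rho> \<sigma> l k y w)"
      unfolding sum_distrib_left
      by (subst sum.swap) (simp add: e_mult w Cons.prems sum_distrib_right mult.assoc)
    show "(\<Sum>k<d. (ins \<rho> \<sigma> 1 (iA a) x k w - ins \<rho> \<sigma> (iA a) 1 x k w) * e (iB b * block_word l) k y w) +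
        (\<Sum>k<d. e (iA a) x k w * ((\<Sum>k'<d. 0 * e (block_word l) k' y w) + (\<Sum>k'<d. e (iB b) k k' w * d_block_word \<rho> \<sigma> l k' y w))) =
        d_block_word \<rho> \<sigma> (ab # l) x y w"
      by (simp add: left_diff_distrib sum_subtractf ins_mult_right w Cons.prems t, subst s[OF Cons.prems(1)])
        (simp add: d_block_word_def ab sum.lessThan_Suc_shift mult.assoc del: sum.lessThan_Suc)
  qed
qed

lemma derivation_item: "derivation \<rho> \<sigma> (T (ev x)) (d_item \<rho> \<sigma> x)"
proof (cases x)
  case (Mix l)
  have "derivation \<rho> \<sigma> (\<lambda>w. \<Sum>x<d. e (block_word l) x x w) (\<lambda>w. \<Sum>x<d. d_block_word \<rho> \<sigma> l x x w)"
    by (intro derivation_sum derivation_block_word) auto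
  then show ?thesis
  proof (rule derivation.equal)
    fix w assume w: "w \<in> space M"
    show "(\<Sum>x<d. d_block_word \<rho> \<sigma> l x x w) = d_item \<rho> \<sigma> x w"
      unfolding d_block_word_def by (subst sum.swap) (simp add: Mix sum_subtractf sum_ins_diag w)
  qed (simp add: Mix T_def)
next
  case (PA a)
  \<comment> \<open>A commutator has trace 0, so traces of the first family alone have derivative
    0.\<close>
  have "derivation \<rho> \<sigma> (\<lambda>w. \<Sum>x<d. e (iA a) x x w)
      (\<lambda>w. \<Sum>x<d. ins \<rho> \<sigma> 1 (iA a) x x w - ins \<rho> \<sigma> (iA a) 1 x x w)"
    by (intro derivation_sum derivation_iA) auto
  then show ?thesis
    by (rule derivation.equal) (simp_all add: PA T_def sum_subtractf sum_ins_diag)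
next
  case (PB b)
  have "derivation \<rho> \<sigma> (\<lambda>w. \<Sum>x<d. e (iB b) x x w) (\<lambda>w. \<Sum>x<d. 0)"
    by (intro derivation_sum derivation_iB) auto
  then show ?thesis by (rule derivation.equal) (simp_all add: PB T_def)
qed

end

definition Y :: "('i ncpoly, 'j ncpoly) item \<Rightarrow> 'w \<Rightarrow> complex" where
  "Y x w = T (ev x) w - (LINT w|M. T (ev x) w)"

text \<open>One half of \<open>G\<close> closes the two parts of the word to separate traces; the
  other half leaves a single trace in which one part is transposed.\<close>

lemma sum_ins:
  "w \<in> space M \<Longrightarrow> (\<Sum>\<rho><d. \<Sum>\<sigma><d. ins \<rho> \<sigma> u v \<rho> \<sigma> w) = T u w * T v w - T (u * ncpoly_t v) w"
  by (simp add: ins_def T_def sum_product sum_subtractf e_mult e_t)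

text \<open>The same contraction between two different words merges them, once directly and once
  after transposing the second.\<close>

lemma sum_skew:
  "w \<in> space M \<Longrightarrow> (\<Sum>\<rho><d. \<Sum>\<sigma><d. e p \<rho> \<sigma> w * skew \<rho> \<sigma> q w) = T (p * q) w - T (p * ncpoly_t q) w"
  by (simp add: skew_def T_def right_diff_distrib sum_subtractf e_mult e_t)

definition loop_self :: "('i, 'j) blocks \<Rightarrow> 'w \<Rightarrow> complex" where
  "loop_self l w = (\<Sum>i<length l.
     T (block_word (take i l)) w * T (block_word (drop i l)) w - T (block_word (take i l) * ncpoly_t (block_word (drop i l))) w -
     (T (block_word (take i l) * iA (fst (l ! i))) w * T (iB (snd (l ! i)) * block_word (drop (Suc i) l)) w -
      T (block_word (take i l) * iA (fst (l ! i)) * ncpoly_t (iB (snd (l ! i)) * block_word (drop (Suc i) l))) w))"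

fun loop_cross :: "('i, 'j) blocks \<Rightarrow> ('i ncpoly, 'j ncpoly) item \<Rightarrow> 'w \<Rightarrow> complex" where
  "loop_cross l (Mix q) = (\<lambda>w. \<Sum>k<length q.
     T (block_word l * (block_word (drop k q) * block_word (take k q))) w - T (block_word l * ncpoly_t (block_word (drop k q) * block_word (take k q))) w -
     (T (block_word l * (iB (snd (q ! k)) * block_word (drop (Suc k) q) * (block_word (take k q) * iA (fst (q ! k))))) w -
      T (block_word l * ncpoly_t (iB (snd (q ! k)) * block_word (drop (Suc k) q) * (block_word (take k q) * iA (fst (q ! k))))) w))"
| "loop_cross l (PA a) = (\<lambda>w. 0)"
| "loop_cross l (PB b) = (\<lambda>w. 0)"

text \<open>Expectation of the derivative of the \<open>(\<rho>, \<sigma>)\<close> entry of the word \<open>l\<close> times the centred traces of \<open>F\<close>,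
  summed over all planes \<open>(\<rho>, \<sigma>)\<close>.\<close>

lemma loop_equation:
  "(LINT w|M. loop_self l w * (\<Prod>x\<in>#F. Y x w) +
     (\<Sum>x\<in>#F. loop_cross l x w * (\<Prod>y\<in>#F - {#x#}. Y y w))) = 0"
proof -
  \<comment> \<open>The derivative hits either the open word, which gives the self terms, or one of
    the centred traces, which gives the cross terms.\<close>
  define D where "D \<rho> \<sigma> w = d_block_word \<rho> \<sigma> l \<rho> \<sigma> w * (\<Prod>x\<in>#F. Y x w) +
    e (block_word l) \<rho> \<sigma> w * (\<Sum>x\<in>#F. d_item \<rho> \<sigma> x w * (\<Prod>y\<in>#F - {#x#}. Y y w))" for \<rho> \<sigma> w
  have D: "all_moments M (D \<rho> \<sigma>)" "(LINT w|M. D \<rho> \<sigma> w) = 0" if "\<rho> < d" "\<sigma> < d" for \<rho> \<sigma>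
  proof -
    have "derivation \<rho> \<sigma> (Y x) (d_item \<rho> \<sigma> x)" for x
    proof (rule derivation.equal)
      show "derivation \<rho> \<sigma> (\<lambda>w. T (ev x) w + - (LINT w|M. T (ev x) w)) (\<lambda>w. d_item \<rho> \<sigma> x w + 0)"
        by (intro derivation.add derivation_item derivation_const that)
    qed (simp_all add: Y_def)
    then have "derivation \<rho> \<sigma> (\<lambda>w. e (block_word l) \<rho> \<sigma> w * (\<Prod>x\<in>#F. Y x w)) (D \<rho> \<sigma>)"
      unfolding D_def by (intro derivation_mult derivation_block_word derivation_prod_mset that)
    from derivation_expectation[OF this that] show "all_moments M (D \<rho> \<sigma>)" "(LINT w|M. D \<rho> \<sigma> w) = 0"
      by auto
  qed
  have "(LINT w|M. (\<Sum>\<rho><d. \<Sum>\<sigma><d. D \<rho> \<sigma> w)) = (\<Sum>\<rho><d. \<Sum>\<sigma><d. LINT w|M. D \<rho> \<sigma> w)"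
    by (subst Bochner_Integration.integral_sum, intro Bochner_Integration.integrable_sum all_moments_integrable D)
      (auto intro!: sum.cong Bochner_Integration.integral_sum all_moments_integrable D)
  also have "\<dots> = 0" using D by simp
  also have "(LINT w|M. (\<Sum>\<rho><d. \<Sum>\<sigma><d. D \<rho> \<sigma> w)) =
      (LINT w|M. loop_self l w * (\<Prod>x\<in>#F. Y x w) +
        (\<Sum>x\<in>#F. loop_cross l x w * (\<Prod>y\<in>#F - {#x#}. Y y w)))"
  proof (rule Bochner_Integration.integral_cong[OF refl])
    fix w assume w: "w \<in> space M"
    have s1: "(\<Sum>\<rho><d. \<Sum>\<sigma><d. d_block_word \<rho> \<sigma> l \<rho> \<sigma> w) = loop_self l w"
    proof -
      define f where "f \<rho> \<sigma> i = ins \<rho> \<sigma> (block_word (take i l)) (block_word (drop i l)) \<rho> \<sigma> w -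
        ins \<rho> \<sigma> (block_word (take i l) * iA (fst (l ! i))) (iB (snd (l ! i)) * block_word (drop (Suc i) l)) \<rho> \<sigma> w"
        for \<rho> \<sigma> i
      have "(\<Sum>\<rho><d. \<Sum>\<sigma><d. d_block_word \<rho> \<sigma> l \<rho> \<sigma> w) = (\<Sum>\<rho><d. \<Sum>\<sigma><d. \<Sum>i<length l. f \<rho> \<sigma> i)"
        by (simp add: d_block_word_def f_def)
      also have "\<dots> = (\<Sum>\<rho><d. \<Sum>i<length l. \<Sum>\<sigma><d. f \<rho> \<sigma> i)"
        by (intro sum.cong refl sum.swap)
      also have "\<dots> = (\<Sum>i<length l. \<Sum>\<rho><d. \<Sum>\<sigma><d. f \<rho> \<sigma> i)" by (rule sum.swap)
      also have "\<dots> = loop_self l w"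
        unfolding loop_self_def f_def sum_subtractf sum_ins[OF w] ..
      finally show ?thesis .
    qed
    have s2: "(\<Sum>\<rho><d. \<Sum>\<sigma><d. e (block_word l) \<rho> \<sigma> w * d_item \<rho> \<sigma> x w) = loop_cross l x w" for x
    proof (cases x)
      case (Mix q)
      define f where "f \<rho> \<sigma> k = e (block_word l) \<rho> \<sigma> w * (skew \<rho> \<sigma> (block_word (drop k q) * block_word (take k q)) w -
        skew \<rho> \<sigma> (iB (snd (q ! k)) * block_word (drop (Suc k) q) * (block_word (take k q) * iA (fst (q ! k)))) w)" for \<rho> \<sigma> k
      have "(\<Sum>\<rho><d. \<Sum>\<sigma><d. e (block_word l) \<rho> \<sigma> w * d_item \<rho> \<sigma> x w) = (\<Sum>\<rho><d. \<Sum>\<sigma><d. \<Sum>k<length q. f \<rho> \<sigma> k)"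
        by (intro sum.cong refl) (simp add: Mix f_def sum_distrib_left)
      also have "\<dots> = (\<Sum>\<rho><d. \<Sum>k<length q. \<Sum>\<sigma><d. f \<rho> \<sigma> k)"
        by (intro sum.cong refl sum.swap)
      also have "\<dots> = (\<Sum>k<length q. \<Sum>\<rho><d. \<Sum>\<sigma><d. f \<rho> \<sigma> k)" by (rule sum.swap)
      also have "\<dots> = loop_cross l x w"
        unfolding Mix loop_cross.simps f_def right_diff_distrib sum_subtractf sum_skew[OF w] ..
      finally show ?thesis .
    qed (simp_all)
    have "(\<Sum>\<rho><d. \<Sum>\<sigma><d. D \<rho> \<sigma> w) = (\<Sum>\<rho><d. \<Sum>\<sigma><d. d_block_word \<rho> \<sigma> l \<rho> \<sigma> w) * (\<Prod>x\<in>#F. Y x w) +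
        (\<Sum>\<rho><d. \<Sum>\<sigma><d. \<Sum>x\<in>#F. e (block_word l) \<rho> \<sigma> w * d_item \<rho> \<sigma> x w * (\<Prod>y\<in>#F - {#x#}. Y y w))"
      by (simp add: D_def sum.distrib sum_distrib_right sum_mset_distrib_left mult.assoc multiset.map_comp comp_def)
    also have "(\<Sum>\<rho><d. \<Sum>\<sigma><d. \<Sum>x\<in>#F. e (block_word l) \<rho> \<sigma> w * d_item \<rho> \<sigma> x w * (\<Prod>y\<in>#F - {#x#}. Y y w)) =
        (\<Sum>x\<in>#F. (\<Sum>\<rho><d. \<Sum>\<sigma><d. e (block_word l) \<rho> \<sigma> w * d_item \<rho> \<sigma> x w) * (\<Prod>y\<in>#F - {#x#}. Y y w))"
    proof -
      have sw: "(\<Sum>i\<in>I. \<Sum>x\<in>#G. h i x) = (\<Sum>x\<in>#G. \<Sum>i\<in>I. h i x)"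
        for I :: "nat set" and G and h :: "nat \<Rightarrow> ('i ncpoly, 'j ncpoly) item \<Rightarrow> complex"
        by (induction G) (simp_all add: sum.distrib)
      show ?thesis by (simp only: sw sum_distrib_right)
    qed
    finally show "(\<Sum>\<rho><d. \<Sum>\<sigma><d. D \<rho> \<sigma> w) = loop_self l w * (\<Prod>x\<in>#F. Y x w) +
        (\<Sum>x\<in>#F. loop_cross l x w * (\<Prod>y\<in>#F - {#x#}. Y y w))"
      by (simp only: s1 s2)
  qed
  finally show ?thesis .
qed

end

section \<open>The loop equation in terms of block words and centred moments\<close>

definition append_letter :: "('i, 'j) blocks \<Rightarrow> 'j ncpoly \<Rightarrow> ('i, 'j) blocks" where
  "append_letter l b = butlast l @ [(fst (last l), snd (last l) * b)]"

text \<open>A trace is cyclic, so a letter left over at one end of a word is absorbed by the block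
  at the other end. No block is created, and a one-family item appears only if no block is left.
  This absorption is what lowers the rank in the loop equation.\<close>

fun prepend_A :: "'i ncpoly \<Rightarrow> ('i, 'j) blocks \<Rightarrow> ('i ncpoly, 'j ncpoly) item" where
  "prepend_A a [] = PA a"
| "prepend_A a ((a', b) # l) = Mix ((a * a', b) # l)"

definition prepend_B :: "'j ncpoly \<Rightarrow> ('i, 'j) blocks \<Rightarrow> ('i ncpoly, 'j ncpoly) item" where
  "prepend_B b l = (if l = [] then PB b else Mix (append_letter l b))"

text \<open>The transpose of \<open>b a\<^sub>1 b\<^sub>1 \<dots> a\<^sub>n b\<^sub>n\<close> is \<open>t_head\<close> followed by the blocks \<open>t_blocks\<close>.\<close>

fun t_head :: "'j ncpoly \<Rightarrow> ('i, 'j) blocks \<Rightarrow> 'j ncpoly" where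
  "t_head b [] = ncpoly_t b"
| "t_head b ((a, b') # l) = t_head b' l"

fun t_blocks :: "'j ncpoly \<Rightarrow> ('i, 'j) blocks \<Rightarrow> ('i, 'j) blocks" where
  "t_blocks b [] = []"
| "t_blocks b ((a, b') # l) = t_blocks b' l @ [(ncpoly_t a, ncpoly_t b)]"

lemma block_word_append_letter: "l \<noteq> [] \<Longrightarrow> block_word (append_letter l b) = block_word l * iB b"
proof -
  assume "l \<noteq> []"
  then have "l = butlast l @ [(fst (last l), snd (last l))]" by simp
  then have "block_word l = block_word (butlast l) * (iA (fst (last l)) * iB (snd (last l)))"
    by (metis mult.right_neutral block_word_simps)
  then show ?thesis by (simp add: append_letter_def emb_mult mult.assoc)
qed

lemma ncpoly_t_block_word: "ncpoly_t (iB b * block_word l) = iB (t_head b l) * block_word (t_blocks b l)"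
proof (induction l arbitrary: b)
  case Nil
  then show ?case by (simp add: emb_t)
next
  case (Cons ab l)
  obtain a b' where ab: "ab = (a, b')" by (cases ab)
  have "iB b * block_word (ab # l) = iB b * (iA a * (iB b' * block_word l))" by (simp add: ab mult.assoc)
  then have "ncpoly_t (iB b * block_word (ab # l)) = ncpoly_t (iB b' * block_word l) * ncpoly_t (iA a) * ncpoly_t (iB b)"
    by (simp only: ncpoly_t_mult[of "iB b"] ncpoly_t_mult[of "iA a"])
  then show ?case by (simp add: ab Cons mult.assoc emb_t)
qed

lemma length_append_letter [simp]: "l \<noteq> [] \<Longrightarrow> length (append_letter l b) = length l"
  by (simp add: append_letter_def)

lemma length_t_blocks [simp]: "length (t_blocks b l) = length l"
  by (induction l arbitrary: b) auto

text \<open>The signed terms of the loop equation: products of two traces, single traces, and traces of the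
  word merged with another one; the transposes come from the second half of the skew-symmetric generator.
  The two terms omitted for \<open>i = 0\<close> are \<open>d\<close> and \<open>- 1\<close> times the trace of \<open>l\<close> itself; they form the left
  hand side of the Schwinger-Dyson equation.\<close>

definition quad :: "('i, 'j) blocks \<Rightarrow> (complex \<times> ('i ncpoly, 'j ncpoly) item \<times> ('i ncpoly, 'j ncpoly) item) list" where
  "quad l = concat (map (\<lambda>i.
     (1, prepend_A (fst (l ! i)) (take i l), prepend_B (snd (l ! i)) (drop (Suc i) l)) #
     (if i = 0 then [] else [(-1, Mix (take i l), Mix (drop i l))])) [0..<length l])"

definition lin :: "('i, 'j) blocks \<Rightarrow> (complex \<times> ('i ncpoly, 'j ncpoly) item) list" where
  "lin l = concat (map (\<lambda>i. let b = snd (l ! i); r = drop (Suc i) l in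
     (-1, Mix (take i l @ (fst (l ! i), t_head b r) # t_blocks b r)) #
     (if i = 0 then []
      else [(1, prepend_A (ncpoly_t (fst (l ! i))) (append_letter (take i l) (t_head b r) @ t_blocks b r))])) [0..<length l])"

fun cross :: "('i, 'j) blocks \<Rightarrow> ('i ncpoly, 'j ncpoly) item \<Rightarrow> (complex \<times> ('i ncpoly, 'j ncpoly) item) list" where
  "cross l (Mix q) = concat (map (\<lambda>k. let c = fst (q ! k); b = snd (q ! k); r = drop (Suc k) q @ take k q in
     [(-1, Mix (l @ (c, b) # r)),
      (1, prepend_A (ncpoly_t c) (append_letter l (t_head b r) @ t_blocks b r)),
      (1, prepend_A c (append_letter l b @ r)),
      (-1, Mix (l @ (ncpoly_t c, t_head b r) # t_blocks b r))]) [0..<length q])"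
| "cross l (PA a) = []"
| "cross l (PB b) = []"

lemma sum_list_concat_upt:
  "(\<Sum>x\<leftarrow>concat (map h [0..<n]). g x) = (\<Sum>i<n. \<Sum>x\<leftarrow>h i. g x :: 'b::comm_monoid_add)"
  by (induction n) (simp_all add: add.commute)

context invariant_pair
begin

lemma T_mult_commute: "w \<in> space M \<Longrightarrow> T (p * q) w = T (q * p) w"
proof -
  assume w: "w \<in> space M"
  have "T (p * q) w = (\<Sum>x<d. \<Sum>k<d. e p x k w * e q k x w)" by (simp add: T_def e_mult w)
  also have "\<dots> = (\<Sum>k<d. \<Sum>x<d. e p x k w * e q k x w)" by (rule sum.swap)
  also have "\<dots> = T (q * p) w" by (simp add: T_def e_mult w mult.commute)
  finally show ?thesis .
qed

lemma T_t: "w \<in> space M \<Longrightarrow> T (ncpoly_t p) w = T p w"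
  by (simp add: T_def e_t)

lemma T_one: "w \<in> space M \<Longrightarrow> T 1 w = of_nat d"
  by (simp add: T_def e_one)

lemma T_prepend_A: "w \<in> space M \<Longrightarrow> T (ev (prepend_A a l)) w = T (block_word l * iA a) w"
  using T_mult_commute[of w "block_word l" "iA a"]
  by (cases "(a, l)" rule: prepend_A.cases) (simp_all add: emb_mult mult.assoc)

lemma T_prepend_B: "w \<in> space M \<Longrightarrow> T (ev (prepend_B b l)) w = T (iB b * block_word l) w"
  using T_mult_commute[of w "block_word l" "iB b"] by (simp add: prepend_B_def block_word_append_letter)

text \<open>Transposition preserves the trace. In the summand \<open>i = 0\<close> the transposed
  half of the generator therefore only lowers the factor \<open>d\<close>, the trace of the empty
  prefix, to \<open>d - 1\<close>.\<close>

lemma loop_self_eq: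
  assumes w: "w \<in> space M" and l: "l \<noteq> []"
  shows "loop_self l w = (of_nat d - 1) * T (block_word l) w -
    (\<Sum>(s, U, V)\<leftarrow>quad l. s * (T (ev U) w * T (ev V) w)) - (\<Sum>(s, U)\<leftarrow>lin l. s * T (ev U) w)"
proof -
  define f where "f i = T (block_word (take i l)) w * T (block_word (drop i l)) w - T (block_word (take i l) * ncpoly_t (block_word (drop i l))) w -
     (T (block_word (take i l) * iA (fst (l ! i))) w * T (iB (snd (l ! i)) * block_word (drop (Suc i) l)) w -
      T (block_word (take i l) * iA (fst (l ! i)) * ncpoly_t (iB (snd (l ! i)) * block_word (drop (Suc i) l))) w)" for i
  define g where "g i = (\<Sum>(s, U, V)\<leftarrow>(1, prepend_A (fst (l ! i)) (take i l), prepend_B (snd (l ! i)) (drop (Suc i) l)) #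
     (if i = 0 then [] else [(-1, Mix (take i l), Mix (drop i l))]). s * (T (ev U) w * T (ev V) w))" for i
  define h where "h i = (\<Sum>(s, U)\<leftarrow>(let b = snd (l ! i); r = drop (Suc i) l in
     (-1, Mix (take i l @ (fst (l ! i), t_head b r) # t_blocks b r)) #
     (if i = 0 then []
      else [(1, prepend_A (ncpoly_t (fst (l ! i))) (append_letter (take i l) (t_head b r) @ t_blocks b r))])). s * T (ev U) w)" for i
  have "f i = (if i = 0 then (of_nat d - 1) * T (block_word l) w else 0) - g i - h i" if i: "i < length l" for i
  proof -
    define a b r where "a = fst (l ! i)" and "b = snd (l ! i)" and "r = drop (Suc i) l"
    have dr: "drop i l = (a, b) # r" using Cons_nth_drop_Suc[OF i] by (simp add: a_def b_def r_def)
    have t1: "block_word (take i l) * iA a * ncpoly_t (iB b * block_word r) = block_word (take i l @ (a, t_head b r) # t_blocks b r)"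
      by (simp add: ncpoly_t_block_word mult.assoc)
    \<comment> \<open>The prefix is non-empty here, so the leading letter \<open>t_head b r\<close>
      of the transposed suffix is absorbed by its last block.\<close>
    have t2: "block_word (take i l) * ncpoly_t (block_word (drop i l)) =
        block_word (append_letter (take i l) (t_head b r) @ t_blocks b r) * iA (ncpoly_t a)" if "i \<noteq> 0"
    proof -
      have "block_word (drop i l) = iA a * (iB b * block_word r)" by (simp add: dr mult.assoc)
      then have "ncpoly_t (block_word (drop i l)) = iB (t_head b r) * block_word (t_blocks b r) * iA (ncpoly_t a)"
        by (simp only: ncpoly_t_mult[of "iA a"] ncpoly_t_block_word emb_t)
      moreover have "take i l \<noteq> []" using that l by simp
      ultimately show ?thesis by (simp add: block_word_append_letter mult.assoc)
    qed
    have 0: "f i = T (block_word (take i l)) w * T (block_word (drop i l)) w - T (block_word (take i l) * ncpoly_t (block_word (drop i l))) w -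
      (T (ev (prepend_A a (take i l))) w * T (ev (prepend_B b r)) w - T (ev (Mix (take i l @ (a, t_head b r) # t_blocks b r))) w)"
      unfolding f_def a_def[symmetric] b_def[symmetric] r_def[symmetric] t1 T_prepend_A[OF w] T_prepend_B[OF w] ev.simps ..
    show ?thesis
    proof (cases "i = 0")
      case True
      then show ?thesis
        unfolding 0 g_def h_def a_def[symmetric] b_def[symmetric] r_def[symmetric]
        by (simp add: T_one T_t w Let_def left_diff_distrib)
    next
      case False
      then show ?thesis
        unfolding 0 t2[OF False] g_def h_def a_def[symmetric] b_def[symmetric] r_def[symmetric]
        by (simp add: T_prepend_A w Let_def)
    qed
  qed
  then have "(\<Sum>i<length l. f i) = (\<Sum>i<length l. (if i = 0 then (of_nat d - 1) * T (block_word l) w else 0)) -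
      (\<Sum>i<length l. g i) - (\<Sum>i<length l. h i)"
    by (simp add: sum_subtractf)
  moreover have "(\<Sum>i<length l. g i) = (\<Sum>(s, U, V)\<leftarrow>quad l. s * (T (ev U) w * T (ev V) w))"
    unfolding quad_def sum_list_concat_upt g_def ..
  moreover have "(\<Sum>i<length l. h i) = (\<Sum>(s, U)\<leftarrow>lin l. s * T (ev U) w)"
    unfolding lin_def sum_list_concat_upt h_def ..
  ultimately show ?thesis using l by (simp add: loop_self_def f_def)
qed

text \<open>Four terms for each first-family letter \<open>c\<close> of \<open>q\<close>: the
  generator stands before or behind \<open>c\<close>, and the cut word enters directly or
  transposed. The blocks \<open>r\<close> are the rest of \<open>q\<close>, read cyclically from
  that place.\<close>

lemma loop_cross_eq:
  assumes w: "w \<in> space M" and l: "l \<noteq> []"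
  shows "loop_cross l x w = - (\<Sum>(s, U)\<leftarrow>cross l x. s * T (ev U) w)"
proof (cases x)
  case (Mix q)
  have "T (block_word l * (block_word (drop k q) * block_word (take k q))) w - T (block_word l * ncpoly_t (block_word (drop k q) * block_word (take k q))) w -
     (T (block_word l * (iB (snd (q ! k)) * block_word (drop (Suc k) q) * (block_word (take k q) * iA (fst (q ! k))))) w -
      T (block_word l * ncpoly_t (iB (snd (q ! k)) * block_word (drop (Suc k) q) * (block_word (take k q) * iA (fst (q ! k))))) w) =
     - (\<Sum>(s, U)\<leftarrow>(let c = fst (q ! k); b = snd (q ! k); r = drop (Suc k) q @ take k q in
     [(-1, Mix (l @ (c, b) # r)),
      (1, prepend_A (ncpoly_t c) (append_letter l (t_head b r) @ t_blocks b r)),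
      (1, prepend_A c (append_letter l b @ r)),
      (-1, Mix (l @ (ncpoly_t c, t_head b r) # t_blocks b r))]). s * T (ev U) w)" if k: "k < length q" for k
  proof -
    define c b r where "c = fst (q ! k)" and "b = snd (q ! k)" and "r = drop (Suc k) q @ take k q"
    have dr: "drop k q = (c, b) # drop (Suc k) q" using Cons_nth_drop_Suc[OF k] by (simp add: c_def b_def)
    have r: "block_word (drop (Suc k) q) * block_word (take k q) = block_word r" by (simp add: r_def)
    have 1: "block_word (drop k q) * block_word (take k q) = iA c * (iB b * block_word r)" by (simp add: dr r[symmetric] mult.assoc)
    have 2: "iB b * block_word (drop (Suc k) q) * (block_word (take k q) * iA c) = iB b * block_word r * iA c"
      by (simp add: r[symmetric] mult.assoc)
    have 3: "block_word l * (iA c * (iB b * block_word r)) = block_word (l @ (c, b) # r)" by (simp add: mult.assoc)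
    have 4: "block_word l * ncpoly_t (iA c * (iB b * block_word r)) = block_word (append_letter l (t_head b r) @ t_blocks b r) * iA (ncpoly_t c)"
      by (simp add: ncpoly_t_mult[of "iA c"] ncpoly_t_block_word emb_t block_word_append_letter l mult.assoc)
    have 5: "block_word l * (iB b * block_word r * iA c) = block_word (append_letter l b @ r) * iA c"
      by (simp add: block_word_append_letter l mult.assoc)
    have 6: "block_word l * ncpoly_t (iB b * block_word r * iA c) = block_word (l @ (ncpoly_t c, t_head b r) # t_blocks b r)"
      unfolding ncpoly_t_mult[of "iB b * block_word r"] ncpoly_t_block_word by (simp add: emb_t mult.assoc)
    show ?thesis
      unfolding c_def[symmetric] b_def[symmetric] r_def[symmetric] 1 2 3 4 5 6 Let_def
      by (simp add: T_prepend_A w)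
  qed
  then show ?thesis
    unfolding Mix loop_cross.simps cross.simps sum_list_concat_upt
    by (simp add: sum_negf)
qed simp_all

definition K :: "('i ncpoly, 'j ncpoly) item \<Rightarrow> complex" where
  "K x = (LINT w|M. T (ev x) w)"

definition mom :: "('i ncpoly, 'j ncpoly) item multiset \<Rightarrow> complex" where
  "mom F = (LINT w|M. (\<Prod>x\<in>#F. Y x w))"

lemma all_moments_e: "r < d \<Longrightarrow> s < d \<Longrightarrow> all_moments M (e p r s)"
proof (induction p arbitrary: r s rule: ncpoly_closure_induct)
  case one
  have "all_moments M (e 1 r s) \<longleftrightarrow> all_moments M (\<lambda>_. if r = s then 1 else 0)"
    by (rule all_moments_cong) (simp add: e_one one)
  then show ?case using all_moments_const by simp
next
  case (var k)
  have 1: "all_moments M (\<lambda>w. X w k $$ (r, s))" if "r < d" "s < d" for r s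
    using all_moments_coord that by (cases k) (force simp: X_def entry_index_def)+
  have "all_moments M (e (ncpoly_var k) r s) \<longleftrightarrow> all_moments M (\<lambda>w. X w k $$ (r, s))"
    by (rule all_moments_cong) (simp add: e_var var)
  then show ?case using 1[OF var] by simp
next
  case (vart k)
  have 1: "all_moments M (\<lambda>w. X w k $$ (r, s))" if "r < d" "s < d" for r s
    using all_moments_coord that by (cases k) (force simp: X_def entry_index_def)+
  have "all_moments M (e (ncpoly_t (ncpoly_var k)) r s) \<longleftrightarrow> all_moments M (\<lambda>w. X w k $$ (s, r))"
    by (rule all_moments_cong) (simp add: e_var e_t vart)
  then show ?case using 1[OF vart(2,1)] by simp
next
  case (add p q)
  have "e (p + q) r s = (\<lambda>w. e p r s w + e q r s w)" by (simp add: e_add fun_eq_iff)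
  then show ?case using add by (simp add: all_moments_add)
next
  case (sc c p)
  have "e (ncpoly_sc c p) r s = (\<lambda>w. c * e p r s w)" by (simp add: e_sc fun_eq_iff)
  then show ?case using sc by (simp add: all_moments_mult all_moments_const)
next
  case (mult p q)
  have "all_moments M (e (p * q) r s) \<longleftrightarrow> all_moments M (\<lambda>w. \<Sum>k<d. e p r k w * e q k s w)"
    by (rule all_moments_cong) (simp add: e_mult mult)
  then show ?case using mult by (auto intro!: all_moments_sum all_moments_mult)
qed

lemma all_moments_T: "all_moments M (T p)"
  unfolding T_def by (auto intro!: all_moments_sum all_moments_e)

lemma all_moments_Y: "all_moments M (Y x)"
  unfolding Y_def by (auto intro!: all_moments_diff all_moments_T all_moments_const)

lemma T_Y: "T (ev x) w = Y x w + K x"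
  by (simp add: Y_def K_def)

lemmas moment_rules = all_moments_T all_moments_Y all_moments_intros

lemma mom_empty [simp]: "mom {#} = 1"
  by (simp add: mom_def prob_space)

lemma mom_single [simp]: "mom {#x#} = 0"
  using prob_space by (simp add: mom_def Y_def all_moments_integrable all_moments_T)

lemma expectation_T_mult: "(LINT w|M. T (ev x) w * (\<Prod>y\<in>#F. Y y w)) = mom (add_mset x F) + K x * mom F"
proof -
  have "integrable M (\<lambda>w. Y x w * (\<Prod>y\<in>#F. Y y w))" "integrable M (\<lambda>w. \<Prod>y\<in>#F. Y y w)"
    by (intro all_moments_integrable moment_rules)+
  then show ?thesis by (simp add: T_Y mom_def distrib_right)
qed

lemma expectation_TT_mult:
  "(LINT w|M. T (ev U) w * T (ev V) w * (\<Prod>y\<in>#F. Y y w)) =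
    mom (add_mset U (add_mset V F)) + K U * mom (add_mset V F) + K V * mom (add_mset U F) + K U * K V * mom F"
proof -
  have i: "integrable M (\<lambda>w. Y U w * Y V w * (\<Prod>y\<in>#F. Y y w))" "integrable M (\<lambda>w. Y U w * (\<Prod>y\<in>#F. Y y w))"
    "integrable M (\<lambda>w. Y V w * (\<Prod>y\<in>#F. Y y w))" "integrable M (\<lambda>w. \<Prod>y\<in>#F. Y y w)"
    by (intro all_moments_integrable moment_rules)+
  have "(LINT w|M. T (ev U) w * T (ev V) w * (\<Prod>y\<in>#F. Y y w)) =
    (LINT w|M. Y U w * Y V w * (\<Prod>y\<in>#F. Y y w) + K U * (Y V w * (\<Prod>y\<in>#F. Y y w)) +
      K V * (Y U w * (\<Prod>y\<in>#F. Y y w)) + K U * K V * (\<Prod>y\<in>#F. Y y w))"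
    by (simp add: T_Y algebra_simps)
  then show ?thesis using i by (simp add: mom_def mult.assoc)
qed

lemma expectation_sum_list:
  assumes "\<And>x. x \<in> set xs \<Longrightarrow> all_moments M (f x)"
  shows "(LINT w|M. (\<Sum>x\<leftarrow>xs. f x w)) = (\<Sum>x\<leftarrow>xs. LINT w|M. f x w)"
  using assms by (induction xs) (simp_all add: all_moments_integrable all_moments_sum_list)

lemma expectation_sum_mset:
  assumes "\<And>x. x \<in># F \<Longrightarrow> all_moments M (f x)"
  shows "(LINT w|M. (\<Sum>x\<in>#F. f x w)) = (\<Sum>x\<in>#F. LINT w|M. f x w)"
  using assms by (induction F) (simp_all add: all_moments_integrable all_moments_sum_mset)

text \<open>Every uncentred trace in the loop equation is split into its fluctuation and its mean,
  so that only centred moments and means remain as unknowns.\<close>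

lemma schwinger_dyson:
  assumes l: "l \<noteq> []"
  shows "(of_nat d - 1) * (mom (add_mset (Mix l) F) + K (Mix l) * mom F) =
    (\<Sum>(s, U, V)\<leftarrow>quad l. s * (mom (add_mset U (add_mset V F)) + K U * mom (add_mset V F) +
       K V * mom (add_mset U F) + K U * K V * mom F)) +
    (\<Sum>(s, U)\<leftarrow>lin l. s * (mom (add_mset U F) + K U * mom F)) +
    (\<Sum>x\<in>#F. \<Sum>(s, U)\<leftarrow>cross l x. s * (mom (add_mset U (F - {#x#})) + K U * mom (F - {#x#})))"
proof -
  let ?P = "\<lambda>F w. \<Prod>x\<in>#F. Y x w"
  define q where "q w = (\<Sum>(s, U, V)\<leftarrow>quad l. s * (T (ev U) w * T (ev V) w * ?P F w))" for w
  define n where "n w = (\<Sum>(s, U)\<leftarrow>lin l. s * (T (ev U) w * ?P F w))" for w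
  define c where "c w = (\<Sum>x\<in>#F. \<Sum>(s, U)\<leftarrow>cross l x. s * (T (ev U) w * ?P (F - {#x#}) w))" for w
  have amq: "all_moments M q" "all_moments M n" "all_moments M c"
    unfolding q_def n_def c_def
    by (auto intro!: all_moments_sum_list all_moments_sum_mset all_moments_mult all_moments_const
        all_moments_T all_moments_prod_mset all_moments_Y simp: case_prod_unfold)
  have amT: "all_moments M (\<lambda>w. T (block_word l) w * ?P F w)" by (intro moment_rules)
  have dist: "(\<Sum>x\<leftarrow>xs. f x) * (z::complex) = (\<Sum>x\<leftarrow>xs. f x * z)" for xs :: "'z list" and f z
    by (induction xs) (simp_all add: distrib_right)
  have neg: "(\<Sum>x\<in>#G. - f x) = - (\<Sum>x\<in>#G. f x)" for G :: "('i ncpoly, 'j ncpoly) item multiset" and f :: "_ \<Rightarrow> complex"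
    by (induction G) simp_all
  have "0 = (LINT w|M. loop_self l w * ?P F w + (\<Sum>x\<in>#F. loop_cross l x w * ?P (F - {#x#}) w))"
    by (rule loop_equation[symmetric])
  also have "\<dots> = (LINT w|M. (of_nat d - 1) * (T (block_word l) w * ?P F w) - q w - n w - c w)"
  proof (rule Bochner_Integration.integral_cong[OF refl])
    fix w assume w: "w \<in> space M"
    have "(\<Sum>x\<in>#F. loop_cross l x w * ?P (F - {#x#}) w) = - c w"
      unfolding c_def loop_cross_eq[OF w l]
      by (simp add: dist neg case_prod_unfold mult.assoc)
    then show "loop_self l w * ?P F w + (\<Sum>x\<in>#F. loop_cross l x w * ?P (F - {#x#}) w) =
        (of_nat d - 1) * (T (block_word l) w * ?P F w) - q w - n w - c w"
      unfolding loop_self_eq[OF w l] q_def n_def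
      by (simp add: left_diff_distrib dist case_prod_unfold mult.assoc)
  qed
  also have "\<dots> = (of_nat d - 1) * (LINT w|M. T (ev (Mix l)) w * ?P F w) -
      (LINT w|M. q w) - (LINT w|M. n w) - (LINT w|M. c w)"
    using amq amT by (simp add: all_moments_integrable)
  also have "(LINT w|M. q w) = (\<Sum>(s, U, V)\<leftarrow>quad l. s * (LINT w|M. T (ev U) w * T (ev V) w * ?P F w))"
    unfolding q_def
    by (subst expectation_sum_list) (auto intro!: moment_rules simp: case_prod_unfold)
  also have "(LINT w|M. n w) = (\<Sum>(s, U)\<leftarrow>lin l. s * (LINT w|M. T (ev U) w * ?P F w))"
    unfolding n_def
    by (subst expectation_sum_list) (auto intro!: moment_rules simp: case_prod_unfold)
  also have "(LINT w|M. c w) = (\<Sum>x\<in>#F. \<Sum>(s, U)\<leftarrow>cross l x. s * (LINT w|M. T (ev U) w * ?P (F - {#x#}) w))"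
    unfolding c_def
    by (subst expectation_sum_mset, (auto intro!: moment_rules simp: case_prod_unfold)[1],
        subst expectation_sum_list) (auto intro!: moment_rules simp: case_prod_unfold)
  finally show ?thesis
    unfolding expectation_T_mult expectation_TT_mult by (simp add: algebra_simps)
qed

end

section \<open>Convergence and the Wick rule\<close>

fun level :: "('p, 'q) item \<Rightarrow> nat" where
  "level (Mix l) = length l"
| "level (PA a) = 0"
| "level (PB b) = 0"

text \<open>Selects candidates for the unknowns of one finite system: words whose letters lie in
  prescribed sets. One-family items are excluded since their behaviour is given.\<close>

fun over :: "'p set \<Rightarrow> 'q set \<Rightarrow> ('p, 'q) item \<Rightarrow> bool" where
  "over R S (Mix l) \<longleftrightarrow> set l \<subseteq> R \<times> S"
| "over R S (PA a) \<longleftrightarrow> False"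
| "over R S (PB b) \<longleftrightarrow> False"

lemma level_prepend_A [simp]: "level (prepend_A a l) = length l"
  by (cases "(a, l)" rule: prepend_A.cases) auto

lemma level_prepend_B [simp]: "level (prepend_B b l) = length l"
  by (simp add: prepend_B_def)

text \<open>If the generator stands between the two letters of block \<open>i\<close>, both are
  absorbed or left alone and one block is lost. Only the cut between two blocks keeps the full rank,
  and it uses the letters of \<open>l\<close> unchanged; \<open>i \<noteq> 0\<close> makes both
  parts shorter than \<open>l\<close>.\<close>

lemma quad_cases:
  assumes "(s, U, V) \<in> set (quad l)"
  shows "level U < length l \<and> level V < length l \<and> level U + level V \<le> length l \<and>
    (level U + level V = length l \<longrightarrow> set l \<subseteq> R \<times> S \<longrightarrow> over R S U \<and> over R S V)"
proof -
  from assms obtain i where i: "i < length l"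
    and "(U = prepend_A (fst (l ! i)) (take i l) \<and> V = prepend_B (snd (l ! i)) (drop (Suc i) l)) \<or>
      (i \<noteq> 0 \<and> U = Mix (take i l) \<and> V = Mix (drop i l))"
    unfolding quad_def by (fastforce split: if_splits)
  then show ?thesis
    by (elim disjE conjE) (auto dest: in_set_takeD in_set_dropD)
qed

lemma set_t_blocks:
  assumes "set l \<subseteq> R \<times> S" "b \<in> S" "ncpoly_t ` R \<subseteq> R" "ncpoly_t ` S \<subseteq> S"
  shows "set (t_blocks b l) \<subseteq> R \<times> S \<and> t_head b l \<in> S"
  using assms(1,2)
proof (induction l arbitrary: b)
  case Nil
  then show ?case using assms(4) by auto
next
  case (Cons ab l)
  obtain a b' where ab: "ab = (a, b')" by (cases ab)
  have "ncpoly_t a \<in> R" "ncpoly_t b \<in> S" using Cons.prems assms(3,4) ab by auto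
  then show ?case using Cons.IH[of b'] Cons.prems by (simp add: ab)
qed

text \<open>At full rank no letters are multiplied: only letters of \<open>l\<close> and transposes
  of such letters occur. Products of letters, which could leave any finite set, come with the loss
  of a block.\<close>

lemma lin_cases:
  assumes "(s, U) \<in> set (lin l)"
  shows "level U \<le> length l \<and>
    (level U = length l \<longrightarrow> set l \<subseteq> R \<times> S \<longrightarrow> ncpoly_t ` R \<subseteq> R \<longrightarrow> ncpoly_t ` S \<subseteq> S \<longrightarrow> over R S U)"
proof -
  from assms obtain i where i: "i < length l"
    and c: "U = Mix (take i l @ (fst (l ! i), t_head (snd (l ! i)) (drop (Suc i) l)) # t_blocks (snd (l ! i)) (drop (Suc i) l)) \<or>
      (i \<noteq> 0 \<and> U = prepend_A (ncpoly_t (fst (l ! i)))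
        (append_letter (take i l) (t_head (snd (l ! i)) (drop (Suc i) l)) @ t_blocks (snd (l ! i)) (drop (Suc i) l)))"
    unfolding lin_def Let_def by (fastforce split: if_splits)
  from c show ?thesis
  proof (elim disjE conjE)
    assume U: "U = Mix (take i l @ (fst (l ! i), t_head (snd (l ! i)) (drop (Suc i) l)) # t_blocks (snd (l ! i)) (drop (Suc i) l))"
    have "over R S U" if R: "set l \<subseteq> R \<times> S" "ncpoly_t ` R \<subseteq> R" "ncpoly_t ` S \<subseteq> S"
    proof -
      have li: "fst (l ! i) \<in> R" "snd (l ! i) \<in> S" using nth_mem[OF i] R(1) by auto
      have "set (drop (Suc i) l) \<subseteq> R \<times> S" "set (take i l) \<subseteq> R \<times> S"
        using R(1) set_drop_subset set_take_subset by fast+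
      then show ?thesis using set_t_blocks[OF _ li(2) R(2,3), of "drop (Suc i) l"] li U by auto
    qed
    then show ?thesis using i U by simp
  next
    assume "i \<noteq> 0" "U = prepend_A (ncpoly_t (fst (l ! i)))
        (append_letter (take i l) (t_head (snd (l ! i)) (drop (Suc i) l)) @ t_blocks (snd (l ! i)) (drop (Suc i) l))"
    moreover from this have "take i l \<noteq> []" using i by auto
    ultimately show ?thesis using i by (simp del: take_all take_all_iff drop_all) linarith
  qed
qed

text \<open>As for the single traces, a block is lost whenever letters are multiplied. One-family
  items and the empty word have no cross terms, hence the lower bound on the level of
  \<open>x\<close>.\<close>

lemma cross_cases:
  assumes "(s, U) \<in> set (cross l x)" "l \<noteq> []"
  shows "level x \<ge> 1 \<and> level U \<le> length l + level x \<and>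
    (level U = length l + level x \<longrightarrow> set l \<subseteq> R \<times> S \<longrightarrow> over R S x \<longrightarrow>
      ncpoly_t ` R \<subseteq> R \<longrightarrow> ncpoly_t ` S \<subseteq> S \<longrightarrow> over R S U)"
proof (cases x)
  case (Mix q)
  have "(s, U) \<in> (\<Union>k\<in>{0..<length q}. set (let c = fst (q ! k); b = snd (q ! k); r = drop (Suc k) q @ take k q in
     [(-1, Mix (l @ (c, b) # r)),
      (1, prepend_A (ncpoly_t c) (append_letter l (t_head b r) @ t_blocks b r)),
      (1, prepend_A c (append_letter l b @ r)),
      (-1, Mix (l @ (ncpoly_t c, t_head b r) # t_blocks b r))]))"
    using assms(1) unfolding Mix cross.simps by (simp only: set_concat set_map set_upt image_image)
  then obtain k where "k \<in> {0..<length q}"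
    and U: "(s, U) \<in> set (let c = fst (q ! k); b = snd (q ! k); r = drop (Suc k) q @ take k q in
     [(-1, Mix (l @ (c, b) # r)),
      (1, prepend_A (ncpoly_t c) (append_letter l (t_head b r) @ t_blocks b r)),
      (1, prepend_A c (append_letter l b @ r)),
      (-1, Mix (l @ (ncpoly_t c, t_head b r) # t_blocks b r))])"
    by (elim UN_E)
  then have k: "k < length q" by simp
  define c b r where "c = fst (q ! k)" and "b = snd (q ! k)" and "r = drop (Suc k) q @ take k q"
  have lr: "length r = length q - 1" using k by (simp add: r_def)
  have U': "U = Mix (l @ (c, b) # r) \<or> U = prepend_A (ncpoly_t c) (append_letter l (t_head b r) @ t_blocks b r) \<or>
      U = prepend_A c (append_letter l b @ r) \<or> U = Mix (l @ (ncpoly_t c, t_head b r) # t_blocks b r)"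
    using U unfolding c_def[symmetric] b_def[symmetric] r_def[symmetric] Let_def by auto
  have "over R S U" if R: "level U = length l + level x" "set l \<subseteq> R \<times> S" "over R S x" "ncpoly_t ` R \<subseteq> R" "ncpoly_t ` S \<subseteq> S"
  proof -
    have q: "set q \<subseteq> R \<times> S" using R(3) Mix by simp
    have cb: "c \<in> R" "b \<in> S" using nth_mem[OF k] q by (auto simp: c_def b_def)
    have r: "set r \<subseteq> R \<times> S" unfolding r_def using q set_drop_subset[of "Suc k" q] set_take_subset[of k q] by auto
    have "U = Mix (l @ (c, b) # r) \<or> U = Mix (l @ (ncpoly_t c, t_head b r) # t_blocks b r)"
      using U' R(1) lr k assms(2) Mix by auto
    then show ?thesis using cb r R set_t_blocks[OF r cb(2) R(4,5)] by auto
  qed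
  moreover have "level x \<ge> 1 \<and> level U \<le> length l + level x"
    using U' lr k assms(2) Mix by auto
  ultimately show ?thesis by blast
qed (use assms in auto)

definition total_level :: "('p, 'q) item multiset \<Rightarrow> nat" where
  "total_level F = (\<Sum>x\<in>#F. level x)"

lemma total_level_simps [simp]: "total_level {#} = 0" "total_level (add_mset x F) = level x + total_level F" "total_level (F + G) = total_level F + total_level G"
  by (simp_all add: total_level_def)

lemma total_level_remove: "x \<in># F \<Longrightarrow> total_level (F - {#x#}) + level x = total_level F"
  by (metis total_level_simps(2) add.commute insert_DiffM)

lemma total_level_0_iff: "total_level F = 0 \<longleftrightarrow> (\<forall>x\<in>#F. level x = 0)"
  by (induction F) auto

lemma size_le_total_level: "(\<And>x. x \<in># F \<Longrightarrow> 1 \<le> level x) \<Longrightarrow> size F \<le> total_level F"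
proof (induction F)
  case (add x F)
  then have "size F \<le> total_level F" "1 \<le> level x" by auto
  then show ?case by simp
qed simp

lemma finite_over:
  assumes "finite R" "finite S"
  shows "finite {x. over R S x \<and> level x \<le> N}"
proof (rule finite_subset)
  show "{x. over R S x \<and> level x \<le> N} \<subseteq> Mix ` {l. set l \<subseteq> R \<times> S \<and> length l \<le> N}"
  proof
    fix x assume "x \<in> {x. over R S x \<and> level x \<le> N}"
    then show "x \<in> Mix ` {l. set l \<subseteq> R \<times> S \<and> length l \<le> N}" by (cases x) auto
  qed
  show "finite (Mix ` {l. set l \<subseteq> R \<times> S \<and> length l \<le> N})"
    using assms by (intro finite_imageI finite_lists_length_le finite_cartesian_product)
qed

lemma finite_multisets_le:
  assumes "finite Z"
  shows "finite {F. set_mset F \<subseteq> Z \<and> size F \<le> n}"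
proof (rule finite_subset)
  show "{F. set_mset F \<subseteq> Z \<and> size F \<le> n} \<subseteq> mset ` {xs. set xs \<subseteq> Z \<and> length xs \<le> n}"
  proof
    fix F assume F: "F \<in> {F. set_mset F \<subseteq> Z \<and> size F \<le> n}"
    obtain xs where "mset xs = F" using ex_mset by blast
    with F show "F \<in> mset ` {xs. set xs \<subseteq> Z \<and> length xs \<le> n}" by (auto intro!: image_eqI[of _ _ xs])
  qed
  show "finite (mset ` {xs. set xs \<subseteq> Z \<and> length xs \<le> n})"
    using assms by (intro finite_imageI finite_lists_length_le)
qed

lemma tendsto_sum_list:
  fixes f :: "'x \<Rightarrow> nat \<Rightarrow> complex"
  assumes "\<And>x. x \<in> set xs \<Longrightarrow> f x \<longlonglongrightarrow> l x"
  shows "(\<lambda>d. \<Sum>x\<leftarrow>xs. f x d) \<longlonglongrightarrow> (\<Sum>x\<leftarrow>xs. l x)"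
  using assms by (induction xs) (auto intro!: tendsto_add)

text \<open>Here \<open>D\<close> is \<open>d\<close>, \<open>D1\<close> is \<open>d - 1\<close>,
  and \<open>e\<close>, \<open>f\<close> are \<open>e1\<close>, \<open>e2\<close>. There is one
  identity for each kind of term: means are written as \<open>d\<close> times normalized means, and
  the factor \<open>d - 1\<close>, or \<open>d * (d - 1)\<close> in the equation of a mean, is
  extracted.\<close>

lemma dyson_scaling:
  fixes D :: complex
  assumes e: "D1 * e = 1" and f: "f = D * e"
  shows "D \<noteq> 0 \<Longrightarrow> s * (m + D * tu * (D * tv)) = D * D1 * (s * (e * (m / D) + f * (tu * tv)))"
    and "s * (D * tu) = D * D1 * (s * (e * tu))"
    and "s * (m + D1 * (f * tu) * m2 + D1 * (f * tv) * m3 - m4 * h) =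
      D1 * (s * (e * m + f * (tu * m2) + f * (tv * m3) - (e * m4) * h))"
    and "s * m = D1 * (s * (e * m))"
    and "s * (m + D1 * (f * tu) * h) = D1 * (s * (e * m + f * (tu * h)))"
proof -
  have ee: "D1 * (e * z) = z" for z using e by (simp add: mult.assoc[symmetric])
  show "s * (m + D * tu * (D * tv)) = D * D1 * (s * (e * (m / D) + f * (tu * tv)))" if "D \<noteq> 0"
  proof -
    have "D * D1 * (s * (e * (m / D) + f * (tu * tv))) = s * D * (D1 * (e * (m / D)) + D * (D1 * (e * (tu * tv))))"
      unfolding f by (simp add: algebra_simps)
    then show ?thesis unfolding ee using that by (simp add: distrib_left)
  qed
  have "D * D1 * (s * (e * tu)) = s * (D * (D1 * (e * tu)))" by (simp only: mult.assoc mult.left_commute)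
  then show "s * (D * tu) = D * D1 * (s * (e * tu))" unfolding ee by (rule sym)
  have "D1 * (s * (e * m + f * (tu * m2) + f * (tv * m3) - (e * m4) * h)) =
      s * (D1 * (e * m) + D1 * (f * tu) * m2 + D1 * (f * tv) * m3 - D1 * (e * m4) * h)"
    by (simp add: algebra_simps)
  then show "s * (m + D1 * (f * tu) * m2 + D1 * (f * tv) * m3 - m4 * h) =
      D1 * (s * (e * m + f * (tu * m2) + f * (tv * m3) - (e * m4) * h))" unfolding ee by (rule sym)
  have "D1 * (s * (e * m)) = s * (D1 * (e * m))" by (rule mult.left_commute)
  then show "s * m = D1 * (s * (e * m))" unfolding ee by (rule sym)
  have "D1 * (s * (e * m + f * (tu * h))) = s * (D1 * (e * m) + D1 * (f * tu) * h)"
    by (simp add: algebra_simps)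
  then show "s * (m + D1 * (f * tu) * h) = D1 * (s * (e * m + f * (tu * h)))" unfolding ee by (rule sym)
qed

section \<open>Schwinger-Dyson equations in normalized form\<close>

locale asymptotic_pair =
  fixes M :: "nat \<Rightarrow> 'w measure" and A :: "nat \<Rightarrow> 'i \<Rightarrow> 'w \<Rightarrow> complex mat"
    and B :: "nat \<Rightarrow> 'j \<Rightarrow> 'w \<Rightarrow> complex mat"
  assumes pair: "\<And>d. d \<ge> 1 \<Longrightarrow> invariant_pair (M d) d (A d) (B d)"
begin

definition trace_mean :: "('i ncpoly, 'j ncpoly) item \<Rightarrow> nat \<Rightarrow> complex" where
  "trace_mean x d = invariant_pair.K (M d) d (A d) (B d) x"

definition tau :: "('i ncpoly, 'j ncpoly) item \<Rightarrow> nat \<Rightarrow> complex" where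
  "tau x d = trace_mean x d / of_nat d"

definition moment :: "('i ncpoly, 'j ncpoly) item multiset \<Rightarrow> nat \<Rightarrow> complex" where
  "moment F d = invariant_pair.mom (M d) d (A d) (B d) F"

definition e1 :: "nat \<Rightarrow> complex" where "e1 d = 1 / (of_nat d - 1)"
definition e2 :: "nat \<Rightarrow> complex" where "e2 d = of_nat d / (of_nat d - 1)"

lemma e1: "e1 \<longlonglongrightarrow> 0"
proof -
  have "filterlim (\<lambda>d. - 1 + real d) at_top sequentially"
    by (rule filterlim_tendsto_add_at_top[OF tendsto_const filterlim_real_sequentially])
  then have "(\<lambda>d. complex_of_real (inverse (- 1 + real d))) \<longlonglongrightarrow> complex_of_real 0"
    by (intro tendsto_of_real tendsto_inverse_0_at_top)
  then show ?thesis by (simp add: e1_def[abs_def] inverse_eq_divide)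
qed

lemma e2: "e2 \<longlonglongrightarrow> 1"
proof -
  have "\<forall>\<^sub>F d in sequentially. 1 + e1 d = e2 d"
  proof (rule eventually_mono[OF eventually_ge_at_top[of 2]])
    fix d :: nat assume "2 \<le> d"
    then have "of_nat d - 1 \<noteq> (0 :: complex)" by (auto simp: of_nat_eq_1_iff)
    then show "1 + e1 d = e2 d" by (simp add: e1_def e2_def field_simps)
  qed
  moreover have "(\<lambda>d. 1 + e1 d) \<longlonglongrightarrow> 1 + 0" by (intro tendsto_intros e1)
  ultimately show ?thesis by (simp add: tendsto_cong)
qed

lemma moment_empty: "d \<ge> 1 \<Longrightarrow> moment {#} d = 1" and moment_single: "d \<ge> 1 \<Longrightarrow> moment {#x#} d = 0"
  using invariant_pair.mom_empty[OF pair] invariant_pair.mom_single[OF pair] by (simp_all add: moment_def)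

text \<open>Without further traces there are no cross terms, and the centred moments of order 1
  vanish.\<close>

lemma schwinger_dyson_mean_raw:
  assumes d: "d \<ge> 1" and l: "l \<noteq> []"
  shows "(of_nat d - 1) * trace_mean (Mix l) d =
    (\<Sum>(s, U, V)\<leftarrow>quad l. s * (moment {#U, V#} d + trace_mean U d * trace_mean V d)) + (\<Sum>(s, U)\<leftarrow>lin l. s * trace_mean U d)"
  using invariant_pair.schwinger_dyson[OF pair[OF d] l, of "{#}"]
    moment_empty[OF d, unfolded moment_def] moment_single[OF d, unfolded moment_def]
  by (simp add: trace_mean_def moment_def)

text \<open>The equation for the mean of \<open>l\<close>, multiplied by \<open>moment H d\<close>,
  is subtracted. This removes the products of two means, which are of order \<open>d ^ 2\<close>,
  and leaves the correction \<open>moment {#U, V#} d * moment H d\<close> behind.\<close>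

lemma schwinger_dyson_moment_raw:
  assumes d: "d \<ge> 1" and l: "l \<noteq> []"
  shows "(of_nat d - 1) * moment (add_mset (Mix l) H) d =
    (\<Sum>(s, U, V)\<leftarrow>quad l. s * (moment (add_mset U (add_mset V H)) d + trace_mean U d * moment (add_mset V H) d +
       trace_mean V d * moment (add_mset U H) d - moment {#U, V#} d * moment H d)) +
    (\<Sum>(s, U)\<leftarrow>lin l. s * moment (add_mset U H) d) +
    (\<Sum>x\<in>#H. \<Sum>(s, U)\<leftarrow>cross l x. s * (moment (add_mset U (H - {#x#})) d + trace_mean U d * moment (H - {#x#}) d))"
proof -
  have q: "(\<Sum>(s, U, V)\<leftarrow>xs. s * (moment (add_mset U (add_mset V H)) d + trace_mean U d * moment (add_mset V H) d +
       trace_mean V d * moment (add_mset U H) d + trace_mean U d * trace_mean V d * moment H d)) =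
     (\<Sum>(s, U, V)\<leftarrow>xs. s * (moment (add_mset U (add_mset V H)) d + trace_mean U d * moment (add_mset V H) d +
       trace_mean V d * moment (add_mset U H) d - moment {#U, V#} d * moment H d)) +
     (\<Sum>(s, U, V)\<leftarrow>xs. s * (moment {#U, V#} d + trace_mean U d * trace_mean V d)) * moment H d" for xs
    by (induction xs) (auto simp: algebra_simps)
  have n: "(\<Sum>(s, U)\<leftarrow>xs. s * (moment (add_mset U H) d + trace_mean U d * moment H d)) =
     (\<Sum>(s, U)\<leftarrow>xs. s * moment (add_mset U H) d) + (\<Sum>(s, U)\<leftarrow>xs. s * trace_mean U d) * moment H d" for xs
    by (induction xs) (auto simp: algebra_simps)
  have "(of_nat d - 1) * (moment (add_mset (Mix l) H) d + trace_mean (Mix l) d * moment H d) =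
    (\<Sum>(s, U, V)\<leftarrow>quad l. s * (moment (add_mset U (add_mset V H)) d + trace_mean U d * moment (add_mset V H) d +
       trace_mean V d * moment (add_mset U H) d + trace_mean U d * trace_mean V d * moment H d)) +
    (\<Sum>(s, U)\<leftarrow>lin l. s * (moment (add_mset U H) d + trace_mean U d * moment H d)) +
    (\<Sum>x\<in>#H. \<Sum>(s, U)\<leftarrow>cross l x. s * (moment (add_mset U (H - {#x#})) d + trace_mean U d * moment (H - {#x#}) d))"
    unfolding moment_def trace_mean_def by (rule invariant_pair.schwinger_dyson[OF pair[OF d] l])
  moreover have "(of_nat d - 1) * (moment (add_mset (Mix l) H) d + trace_mean (Mix l) d * moment H d) =
      (of_nat d - 1) * moment (add_mset (Mix l) H) d + ((of_nat d - 1) * trace_mean (Mix l) d) * moment H d"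
    by (simp add: algebra_simps)
  ultimately show ?thesis
    unfolding q n schwinger_dyson_mean_raw[OF d l] by (simp add: distrib_right)
qed

lemma schwinger_dyson_mean:
  assumes d: "d \<ge> 2" and l: "l \<noteq> []"
  shows "tau (Mix l) d =
    (\<Sum>(s, U, V)\<leftarrow>quad l. s * (e1 d * (moment {#U, V#} d / of_nat d) + e2 d * (tau U d * tau V d))) +
    (\<Sum>(s, U)\<leftarrow>lin l. s * (e1 d * tau U d))"
proof -
  define D1 :: complex where "D1 = of_nat d - 1"
  have nz: "D1 \<noteq> 0" "of_nat d \<noteq> (0::complex)"
    using d by (auto simp: D1_def of_nat_eq_1_iff)
  have e: "D1 * e1 d = 1" "e2 d = of_nat d * e1 d" using nz by (simp_all add: e1_def e2_def D1_def)
  have kt: "trace_mean U d = of_nat d * tau U d" for U using nz by (simp add: tau_def)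
  note scaling = dyson_scaling[OF e]
  have q: "(\<Sum>(s, U, V)\<leftarrow>xs. s * (moment {#U, V#} d + trace_mean U d * trace_mean V d)) =
     of_nat d * D1 * (\<Sum>(s, U, V)\<leftarrow>xs. s * (e1 d * (moment {#U, V#} d / of_nat d) + e2 d * (tau U d * tau V d)))" for xs
    unfolding sum_list_const_mult[symmetric]
    by (intro arg_cong[of _ _ sum_list] map_cong refl, clarify, simp only: prod.case kt, rule scaling(1)[OF nz(2)])
  have n: "(\<Sum>(s, U)\<leftarrow>xs. s * trace_mean U d) = of_nat d * D1 * (\<Sum>(s, U)\<leftarrow>xs. s * (e1 d * tau U d))" for xs
    unfolding sum_list_const_mult[symmetric]
    by (intro arg_cong[of _ _ sum_list] map_cong refl, clarify, simp only: prod.case kt, rule scaling(2))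
  have "D1 * (of_nat d * tau (Mix l) d) = D1 * trace_mean (Mix l) d"
    using nz by (simp add: tau_def)
  then have "(of_nat d * D1) * tau (Mix l) d = (of_nat d * D1) *
     ((\<Sum>(s, U, V)\<leftarrow>quad l. s * (e1 d * (moment {#U, V#} d / of_nat d) + e2 d * (tau U d * tau V d))) +
      (\<Sum>(s, U)\<leftarrow>lin l. s * (e1 d * tau U d)))"
    using schwinger_dyson_mean_raw[of d l, folded D1_def] d l unfolding q n by (simp add: distrib_left mult.assoc mult.left_commute)
  then show ?thesis using nz by simp
qed

lemma schwinger_dyson_moment:
  assumes d: "d \<ge> 2" and l: "l \<noteq> []"
  shows "moment (add_mset (Mix l) H) d =
    (\<Sum>(s, U, V)\<leftarrow>quad l. s * (e1 d * moment (add_mset U (add_mset V H)) d + e2 d * (tau U d * moment (add_mset V H) d) +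
       e2 d * (tau V d * moment (add_mset U H) d) - (e1 d * moment {#U, V#} d) * moment H d)) +
    (\<Sum>(s, U)\<leftarrow>lin l. s * (e1 d * moment (add_mset U H) d)) +
    (\<Sum>x\<in>#H. \<Sum>(s, U)\<leftarrow>cross l x. s * (e1 d * moment (add_mset U (H - {#x#})) d + e2 d * (tau U d * moment (H - {#x#}) d)))"
proof -
  define D1 :: complex where "D1 = of_nat d - 1"
  have nz: "D1 \<noteq> 0" "of_nat d \<noteq> (0::complex)"
    using d by (auto simp: D1_def of_nat_eq_1_iff)
  have e: "D1 * e1 d = 1" "e2 d = of_nat d * e1 d" using nz by (simp_all add: e1_def e2_def D1_def)
  have kt: "trace_mean U d = of_nat d * tau U d" for U using nz by (simp add: tau_def)
  note scaling = dyson_scaling[OF e]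
  have trace_mean: "trace_mean U d = D1 * (e2 d * tau U d)" for U
  proof -
    have "D1 * (of_nat d * e1 d * tau U d) = (D1 * e1 d) * (of_nat d * tau U d)"
      by (simp only: mult.assoc mult.left_commute)
    then show ?thesis by (simp add: e kt)
  qed
  have q: "(\<Sum>(s, U, V)\<leftarrow>xs. s * (moment (add_mset U (add_mset V H)) d + trace_mean U d * moment (add_mset V H) d +
       trace_mean V d * moment (add_mset U H) d - moment {#U, V#} d * moment H d)) =
     D1 * (\<Sum>(s, U, V)\<leftarrow>xs. s * (e1 d * moment (add_mset U (add_mset V H)) d + e2 d * (tau U d * moment (add_mset V H) d) +
       e2 d * (tau V d * moment (add_mset U H) d) - (e1 d * moment {#U, V#} d) * moment H d))" for xs
    unfolding sum_list_const_mult[symmetric]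
    by (intro arg_cong[of _ _ sum_list] map_cong refl, clarify, simp only: prod.case trace_mean, rule scaling(3))
  have n: "(\<Sum>(s, U)\<leftarrow>xs. s * moment (add_mset U H) d) = D1 * (\<Sum>(s, U)\<leftarrow>xs. s * (e1 d * moment (add_mset U H) d))" for xs
    unfolding sum_list_const_mult[symmetric]
    by (intro arg_cong[of _ _ sum_list] map_cong refl) (auto simp only: prod.case intro: scaling(4))
  have c: "(\<Sum>(s, U)\<leftarrow>xs. s * (moment (add_mset U G) d + trace_mean U d * moment G d)) =
     D1 * (\<Sum>(s, U)\<leftarrow>xs. s * (e1 d * moment (add_mset U G) d + e2 d * (tau U d * moment G d)))" for xs G
    unfolding sum_list_const_mult[symmetric]
    by (intro arg_cong[of _ _ sum_list] map_cong refl, clarify, simp only: prod.case trace_mean, rule scaling(5))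
  have c': "(\<Sum>x\<in>#F. D1 * f x) = D1 * (\<Sum>x\<in>#F. f x)" for f :: "_ \<Rightarrow> complex" and F
    by (induction F) (simp_all add: distrib_left)
  have "D1 * moment (add_mset (Mix l) H) d = D1 * (
    (\<Sum>(s, U, V)\<leftarrow>quad l. s * (e1 d * moment (add_mset U (add_mset V H)) d + e2 d * (tau U d * moment (add_mset V H) d) +
       e2 d * (tau V d * moment (add_mset U H) d) - (e1 d * moment {#U, V#} d) * moment H d)) +
    (\<Sum>(s, U)\<leftarrow>lin l. s * (e1 d * moment (add_mset U H) d)) +
    (\<Sum>x\<in>#H. \<Sum>(s, U)\<leftarrow>cross l x. s * (e1 d * moment (add_mset U (H - {#x#})) d + e2 d * (tau U d * moment (H - {#x#}) d))))"
    using schwinger_dyson_moment_raw[of d l H, folded D1_def] d l unfolding q n c c' by (simp add: distrib_left)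
  then show ?thesis using nz by simp
qed

end

lemma negligible_scale: "negligible W f \<Longrightarrow> negligible W (\<lambda>d. s * f d)"
proof -
  assume "negligible W f"
  then have "(\<lambda>d. norm s * (norm (f d) / W d)) \<longlonglongrightarrow> norm s * 0"
    unfolding negligible_def by (intro tendsto_mult_left)
  then show ?thesis by (simp add: negligible_def norm_mult mult.assoc)
qed

lemma negligible_diff:
  assumes "negligible W f" "negligible W g" "\<And>d. W d \<ge> 1"
  shows "negligible W (\<lambda>d. f d - g d)"
  using negligible_add[OF assms(1) negligible_scale[OF assms(2), of "-1"] assms(3)] by simp

text \<open>Assumptions are made on items of level 0 only: the empty word and the polynomials in a
  single family. Everything about mixed words comes from the loop equation.\<close>

locale asymptotic_base = asymptotic_pair +
  assumes base_tau: "\<And>x. level x = 0 \<Longrightarrow> convergent (tau x)"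
    and base_moment: "\<And>F. total_level F = 0 \<Longrightarrow> convergent (moment F)"
    and base_wick: "\<And>p F. total_level (add_mset p F) = 0 \<Longrightarrow>
      lim (moment (add_mset p F)) = (\<Sum>y\<in>#F. lim (moment {#p, y#}) * lim (moment (F - {#y#})))"
begin

definition limit_mean :: "('b ncpoly, 'c ncpoly) item \<Rightarrow> complex" where "limit_mean x = lim (tau x)"
definition limit_moment :: "('b ncpoly, 'c ncpoly) item multiset \<Rightarrow> complex" where "limit_moment F = lim (moment F)"

text \<open>The auxiliary unknown of the first pass. In its equation a normalized mean of the same
  rank is multiplied by a \<open>growth\<close> of lower rank, hence by a sequence that tends to
  0.\<close>

definition growth :: "('b ncpoly, 'c ncpoly) item multiset \<Rightarrow> nat \<Rightarrow> complex" where
  "growth F d = moment F d / of_nat d"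

definition level_ok :: "nat \<Rightarrow> bool" where
  "level_ok N \<longleftrightarrow> (\<forall>x. level x = N \<longrightarrow> tau x \<longlonglongrightarrow> limit_mean x) \<and> (\<forall>F. total_level F = N \<longrightarrow> growth F \<longlonglongrightarrow> 0)"

lemma level_ok_0: "level_ok 0"
proof -
  have "growth F \<longlonglongrightarrow> 0" if "total_level F = 0" for F
  proof -
    have "(\<lambda>d. moment F d * inverse (of_nat d)) \<longlonglongrightarrow> lim (moment F) * 0"
      by (intro tendsto_mult lim_inverse_n convergent_LIMSEQ_iff[THEN iffD1] base_moment that)
    then show ?thesis by (simp add: growth_def[abs_def] divide_inverse)
  qed
  moreover have "tau x \<longlonglongrightarrow> limit_mean x" if "level x = 0" for x
    unfolding limit_mean_def by (intro convergent_LIMSEQ_iff[THEN iffD1] base_tau that)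
  ultimately show ?thesis by (simp add: level_ok_def)
qed

lemma schwinger_dyson_growth:
  assumes d: "d \<ge> 2" and l: "l \<noteq> []"
  shows "growth (add_mset (Mix l) H) d =
    (\<Sum>(s, U, V)\<leftarrow>quad l. s * (e1 d * growth (add_mset U (add_mset V H)) d + (e2 d * tau U d) * growth (add_mset V H) d +
       (e2 d * tau V d) * growth (add_mset U H) d - (e2 d * growth H d) * growth {#U, V#} d)) +
    (\<Sum>(s, U)\<leftarrow>lin l. s * (e1 d * growth (add_mset U H) d)) +
    (\<Sum>x\<in>#H. \<Sum>(s, U)\<leftarrow>cross l x. s * (e1 d * growth (add_mset U (H - {#x#})) d + (e2 d * growth (H - {#x#}) d) * tau U d))"
proof -
  define D where "D = inverse (of_nat d :: complex)"
  have g: "growth F d = moment F d * D" for F by (simp add: growth_def D_def divide_inverse)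
  \<comment> \<open>This turns the correction with two moments into a product of two
    \<open>growth\<close> factors.\<close>
  have e: "e2 d * D = e1 d" using d by (simp add: e1_def e2_def D_def)
  have q: "(\<Sum>(s, U, V)\<leftarrow>xs. s * (e1 d * moment (add_mset U (add_mset V H)) d + e2 d * (tau U d * moment (add_mset V H) d) +
       e2 d * (tau V d * moment (add_mset U H) d) - (e1 d * moment {#U, V#} d) * moment H d)) * D =
    (\<Sum>(s, U, V)\<leftarrow>xs. s * (e1 d * growth (add_mset U (add_mset V H)) d + (e2 d * tau U d) * growth (add_mset V H) d +
       (e2 d * tau V d) * growth (add_mset U H) d - (e2 d * growth H d) * growth {#U, V#} d))" for xs
    unfolding sum_list_mult_const[symmetric] g
    by (intro arg_cong[of _ _ sum_list] map_cong refl) (auto simp: e[symmetric] algebra_simps)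
  have n: "(\<Sum>(s, U)\<leftarrow>xs. s * (e1 d * moment (add_mset U H) d)) * D = (\<Sum>(s, U)\<leftarrow>xs. s * (e1 d * growth (add_mset U H) d))" for xs
    unfolding sum_list_mult_const[symmetric] g
    by (intro arg_cong[of _ _ sum_list] map_cong refl) (auto simp: algebra_simps)
  have c: "(\<Sum>(s, U)\<leftarrow>xs. s * (e1 d * moment (add_mset U G) d + e2 d * (tau U d * moment G d))) * D =
    (\<Sum>(s, U)\<leftarrow>xs. s * (e1 d * growth (add_mset U G) d + (e2 d * growth G d) * tau U d))" for xs G
    unfolding sum_list_mult_const[symmetric] g
    by (intro arg_cong[of _ _ sum_list] map_cong refl) (auto simp: algebra_simps)
  have c': "(\<Sum>x\<in>#F. f x) * D = (\<Sum>x\<in>#F. f x * D)" for f :: "_ \<Rightarrow> complex" and F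
    by (induction F) (simp_all add: distrib_right)
  show ?thesis
    unfolding g[of "add_mset (Mix l) H"] schwinger_dyson_moment[OF d l] distrib_right q n c' c ..
qed

text \<open>The letters are restricted to finite sets closed under transposition, because the decoupling lemma
  needs finitely many unknowns; the loop equation introduces no other letters except into items of lower
  level.\<close>

lemma level_step:
  assumes N: "N \<ge> 1" and IH: "\<And>n. n < N \<Longrightarrow> level_ok n"
    and fin: "finite R" "finite S" and closed: "ncpoly_t ` R \<subseteq> R" "ncpoly_t ` S \<subseteq> S"
    and G0: "total_level G0 = 0"
  shows "(\<forall>x. over R S x \<and> level x = N \<longrightarrow> convergent (tau x)) \<and>
    (\<forall>F. (\<forall>x\<in>#F. over R S x \<and> 1 \<le> level x) \<and> total_level F = N \<longrightarrow> growth (F + G0) \<longlonglongrightarrow> 0)"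
proof -
  define CI where "CI = {x. over R S x \<and> level x = N}"
  define C1 where "C1 = {F. (\<forall>x\<in>#F. over R S x \<and> 1 \<le> level x) \<and> total_level F = N}"
  \<comment> \<open>\<open>G0\<close> consists of level 0 items that are carried along. There may be
    infinitely many such items, so \<open>G0\<close> is fixed to keep the system finite. The moments
    without \<open>G0\<close> belong to the system too, because the pair \<open>{#U, V#}\<close>
    occurs alone in the equations of the means and in the correction terms.\<close>
  define CF where "CF = (\<lambda>F. F + G0) ` C1 \<union> C1"
  define C where "C = Inl ` CI \<union> Inr ` CF"
  define v where "v = case_sum tau growth"
  define W where "W d = 1 + (\<Sum>c\<in>C. norm (v c d))" for d
  \<comment> \<open>The expected limits: for a mean only the products of two means of lower level
    survive, and all \<open>growth\<close> sequences tend to 0.\<close>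
  define l0 where "l0 = case_sum (\<lambda>x. case x of Mix l \<Rightarrow> (\<Sum>(s, U, V)\<leftarrow>quad l. s * (limit_mean U * limit_mean V)) | _ \<Rightarrow> 0)
    (\<lambda>F::('b ncpoly, 'c ncpoly) item multiset. 0 :: complex)"
  have "finite CI" unfolding CI_def by (rule finite_subset[OF _ finite_over[OF fin, of N]]) auto
  moreover have "finite C1"
  proof (rule finite_subset)
    show "C1 \<subseteq> {F. set_mset F \<subseteq> {x. over R S x \<and> level x \<le> N} \<and> size F \<le> N}"
    proof
      fix F assume F: "F \<in> C1"
      have "level x \<le> N" if "x \<in># F" for x
        using total_level_remove[OF that] F by (auto simp: C1_def)
      moreover have "size F \<le> N" using size_le_total_level[of F] F by (auto simp: C1_def)
      ultimately show "F \<in> {F. set_mset F \<subseteq> {x. over R S x \<and> level x \<le> N} \<and> size F \<le> N}"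
        using F by (auto simp: C1_def)
    qed
  qed (rule finite_multisets_le[OF finite_over[OF fin]])
  ultimately have finC: "finite C" by (auto simp: C_def CF_def)
  have W1: "W d \<ge> 1" for d by (simp add: W_def sum_nonneg)
  have vW: "norm (v c d) \<le> W d" if "c \<in> C" for c d
    using member_le_sum[OF that _ finC, of "\<lambda>c. norm (v c d)"] by (simp add: W_def)
  have tau_conv: "tau U \<longlonglongrightarrow> limit_mean U" if "level U < N" for U
    using IH[OF that] by (simp add: level_ok_def)
  have growth_conv: "growth F \<longlonglongrightarrow> 0" if "total_level F < N" for F
    using IH[OF that] by (simp add: level_ok_def)
  have negligible_tau: "negligible W (\<lambda>d. e d * tau U d)"
    if "e \<longlonglongrightarrow> 0" "level U \<le> N" "level U = N \<Longrightarrow> over R S U" for e U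
  proof (cases "level U = N")
    case True
    then have "Inl U \<in> C" using that by (auto simp: C_def CI_def)
    from vW[OF this] show ?thesis
      by (intro negligible_tendsto_mult that(1) W1 always_eventually) (simp add: v_def)
  next
    case False
    then have "(\<lambda>d. e d * tau U d) \<longlonglongrightarrow> 0 * limit_mean U" using that by (intro tendsto_mult tau_conv) auto
    then show ?thesis by (intro negligible_tendsto W1) simp
  qed
  have negligible_growth: "negligible W (\<lambda>d. e d * growth F d)"
    if "e \<longlonglongrightarrow> 0" "total_level F \<le> N" "total_level F = N \<Longrightarrow> F \<in> CF" for e F
  proof (cases "total_level F = N")
    case True
    then have "Inr F \<in> C" using that by (auto simp: C_def)
    from vW[OF this] show ?thesis
      by (intro negligible_tendsto_mult that(1) W1 always_eventually) (simp add: v_def)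
  next
    case False
    then have "(\<lambda>d. e d * growth F d) \<longlonglongrightarrow> 0 * 0" using that by (intro tendsto_mult growth_conv) auto
    then show ?thesis by (intro negligible_tendsto W1) simp
  qed
  have "negligible W (\<lambda>d. v c d - l0 c)" if c: "c \<in> C" for c
  proof (cases c)
    case (Inl x)
    then have x: "over R S x" "level x = N" using c by (auto simp: C_def CI_def)
    then obtain l where l: "x = Mix l" by (cases x) auto
    with x N have l': "l \<noteq> []" "set l \<subseteq> R \<times> S" "length l = N" by auto
    have q: "negligible W (\<lambda>d. case z of (s, U, V) \<Rightarrow>
        s * (e1 d * growth {#U, V#} d + (e2 d * (tau U d * tau V d) - limit_mean U * limit_mean V)))"
      if z: "z \<in> set (quad l)" for z
    proof -
      obtain s U V where zz: "z = (s, U, V)" by (cases z)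
      note qc = quad_cases[OF z[unfolded zz], of R S]
      have "{#U, V#} \<in> C1" if "total_level {#U, V#} = N"
        using that qc l' by (auto simp: C1_def)
      then have 1: "negligible W (\<lambda>d. e1 d * growth {#U, V#} d)"
        using qc l' by (intro negligible_growth e1) (auto simp: CF_def)
      have "(\<lambda>d. e2 d * (tau U d * tau V d) - limit_mean U * limit_mean V) \<longlonglongrightarrow> 1 * (limit_mean U * limit_mean V) - limit_mean U * limit_mean V"
        using qc l' by (intro tendsto_intros e2 tau_conv) auto
      then have 2: "negligible W (\<lambda>d. e2 d * (tau U d * tau V d) - limit_mean U * limit_mean V)"
        by (intro negligible_tendsto W1) simp
      show ?thesis unfolding zz prod.case by (intro negligible_scale negligible_add 1 2 W1)
    qed
    have n: "negligible W (\<lambda>d. case z of (s, U) \<Rightarrow> s * (e1 d * tau U d))" if z: "z \<in> set (lin l)" for z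
    proof -
      obtain s U where zz: "z = (s, U)" by (cases z)
      note lc = lin_cases[OF z[unfolded zz], of R S]
      show ?thesis unfolding zz prod.case
        using lc l' closed by (intro negligible_scale negligible_tau e1) auto
    qed
    have "negligible W (\<lambda>d. (\<Sum>z\<leftarrow>quad l. case z of (s, U, V) \<Rightarrow>
        s * (e1 d * growth {#U, V#} d + (e2 d * (tau U d * tau V d) - limit_mean U * limit_mean V))) +
        (\<Sum>z\<leftarrow>lin l. case z of (s, U) \<Rightarrow> s * (e1 d * tau U d)))"
      by (intro negligible_add negligible_sum_list q n W1)
    then show ?thesis
    proof (rule negligible_cong[rotated])
      show "\<forall>\<^sub>F d in sequentially. (\<Sum>z\<leftarrow>quad l. case z of (s, U, V) \<Rightarrow>
        s * (e1 d * growth {#U, V#} d + (e2 d * (tau U d * tau V d) - limit_mean U * limit_mean V))) +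
        (\<Sum>z\<leftarrow>lin l. case z of (s, U) \<Rightarrow> s * (e1 d * tau U d)) = v c d - l0 c"
      proof (rule eventually_mono[OF eventually_ge_at_top[of 2]])
        fix d :: nat assume d: "2 \<le> d"
        have "(\<Sum>(s, U, V)\<leftarrow>xs. s * (e1 d * growth {#U, V#} d + (e2 d * (tau U d * tau V d) - limit_mean U * limit_mean V))) =
          (\<Sum>(s, U, V)\<leftarrow>xs. s * (e1 d * growth {#U, V#} d + e2 d * (tau U d * tau V d))) -
          (\<Sum>(s, U, V)\<leftarrow>xs. s * (limit_mean U * limit_mean V))" for xs
          by (induction xs) (auto simp: algebra_simps)
        then show "(\<Sum>(s, U, V)\<leftarrow>quad l. s * (e1 d * growth {#U, V#} d + (e2 d * (tau U d * tau V d) - limit_mean U * limit_mean V))) +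
          (\<Sum>(s, U)\<leftarrow>lin l. s * (e1 d * tau U d)) = v c d - l0 c"
          using schwinger_dyson_mean[OF d l'(1)] by (simp add: v_def l0_def Inl l growth_def)
      qed
    qed
  next
    case (Inr H)
    then have "H \<in> CF" using c by (auto simp: C_def)
    then have "\<exists>F G. H = F + G \<and> F \<in> C1 \<and> (G = G0 \<or> G = {#})"
      by (auto simp: CF_def intro: exI[of _ H] exI[of _ "{#}"])
    then obtain F G where H: "H = F + G" "F \<in> C1" "G = G0 \<or> G = {#}"
      by blast
    have CFI: "F' + G \<in> CF" if "F' \<in> C1" for F' using that H(3) by (auto simp: CF_def)
    have G: "level x = 0" if "x \<in># G" for x using H(3) G0 that by (auto simp: total_level_0_iff)
    have "F \<noteq> {#}" using H(2) N by (auto simp: C1_def)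
    then obtain P F' where F: "F = add_mset P F'" by (meson multiset_cases)
    then have P: "over R S P" "level P \<ge> 1" and F': "\<forall>x\<in>#F'. over R S x \<and> 1 \<le> level x" "level P + total_level F' = N"
      using H(2) by (auto simp: C1_def)
    from P obtain l where l: "P = Mix l" by (cases P) auto
    with P have l': "l \<noteq> []" "set l \<subseteq> R \<times> S" "length l + total_level F' = N" "length l \<ge> 1" using F' by auto
    define H' where "H' = F' + G"
    have LVG: "total_level G = 0" using G by (simp add: total_level_0_iff)
    have LVH': "total_level H' = total_level F'" by (simp add: H'_def LVG)
    have H': "H = add_mset (Mix l) H'" by (simp add: H F l H'_def)
    have q: "negligible W (\<lambda>d. case z of (s, U, V) \<Rightarrow>
        s * (e1 d * growth (add_mset U (add_mset V H')) d + (e2 d * tau U d) * growth (add_mset V H') d +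
       (e2 d * tau V d) * growth (add_mset U H') d - (e2 d * growth H' d) * growth {#U, V#} d))"
      if z: "z \<in> set (quad l)" for z
    proof -
      obtain s U V where zz: "z = (s, U, V)" by (cases z)
      note qc = quad_cases[OF z[unfolded zz], of R S]
      have "add_mset U (add_mset V F') \<in> C1" if "total_level (add_mset U (add_mset V H')) = N"
        using that qc l' F' LVH' by (auto simp: C1_def)
      from CFI[OF this] have 1: "negligible W (\<lambda>d. e1 d * growth (add_mset U (add_mset V H')) d)"
        using qc l' LVH' by (intro negligible_growth e1) (auto simp: H'_def LVG)
      have g: "(\<lambda>d. (e2 d * tau U d) * growth (add_mset V H') d) \<longlonglongrightarrow> (1 * limit_mean U) * 0"
        "(\<lambda>d. (e2 d * tau V d) * growth (add_mset U H') d) \<longlonglongrightarrow> (1 * limit_mean V) * 0"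
        by (intro tendsto_mult e2 tau_conv growth_conv; use qc l' LVH' in simp; fail)+
      then have 2: "negligible W (\<lambda>d. (e2 d * tau U d) * growth (add_mset V H') d)"
        "negligible W (\<lambda>d. (e2 d * tau V d) * growth (add_mset U H') d)"
        by (auto intro!: negligible_tendsto W1)
      have "(\<lambda>d. e2 d * growth H' d) \<longlonglongrightarrow> 1 * 0"
        using l' LVH' by (intro tendsto_mult e2 growth_conv) auto
      then have e: "(\<lambda>d. e2 d * growth H' d) \<longlonglongrightarrow> 0" by simp
      have "{#U, V#} \<in> C1" if "total_level {#U, V#} = N"
        using that qc l' by (auto simp: C1_def)
      then have 3: "negligible W (\<lambda>d. (e2 d * growth H' d) * growth {#U, V#} d)"
        using qc l' by (intro negligible_growth e) (auto simp: CF_def)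
      show ?thesis unfolding zz prod.case by (intro negligible_scale negligible_add negligible_diff 1 2 3 W1)
    qed
    have n: "negligible W (\<lambda>d. case z of (s, U) \<Rightarrow> s * (e1 d * growth (add_mset U H') d))" if z: "z \<in> set (lin l)" for z
    proof -
      obtain s U where zz: "z = (s, U)" by (cases z)
      note lc = lin_cases[OF z[unfolded zz], of R S]
      have "add_mset U F' \<in> C1" if "total_level (add_mset U H') = N"
        using that lc l' F' LVH' closed by (auto simp: C1_def)
      from CFI[OF this] show ?thesis unfolding zz prod.case
        using lc l' LVH' by (intro negligible_scale negligible_growth e1) (auto simp: H'_def LVG)
    qed
    have k: "negligible W (\<lambda>d. case z of (s, U) \<Rightarrow>
        s * (e1 d * growth (add_mset U (H' - {#x#})) d + (e2 d * growth (H' - {#x#}) d) * tau U d))"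
      if x: "x \<in># H'" and z: "z \<in> set (cross l x)" for x z
    proof -
      obtain s U where zz: "z = (s, U)" by (cases z)
      note cc = cross_cases[OF z[unfolded zz] l'(1), of R S]
      \<comment> \<open>Items of level 0 have no cross terms, so the merged item comes from
        \<open>F'\<close> and the passive part \<open>G\<close> stays intact.\<close>
      have "x \<notin># G" using cc G[of x] by auto
      with x have xF: "x \<in># F'" by (auto simp: H'_def)
      have rem: "H' - {#x#} = (F' - {#x#}) + G" using xF by (simp add: H'_def)
      have LVr: "total_level (H' - {#x#}) + level x = total_level F'" using total_level_remove[OF x] LVH' by simp
      have ox: "over R S x" using F' xF by auto
      have "add_mset U (F' - {#x#}) \<in> C1" if "total_level (add_mset U (H' - {#x#})) = N"
        using that cc l' F' LVr ox closed rem LVG by (auto simp: C1_def dest: in_diffD)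
      from CFI[OF this] have 1: "negligible W (\<lambda>d. e1 d * growth (add_mset U (H' - {#x#})) d)"
        using cc l' LVr by (intro negligible_growth e1) (auto simp: rem)
      have "(\<lambda>d. e2 d * growth (H' - {#x#}) d) \<longlonglongrightarrow> 1 * 0"
        using l' LVr by (intro tendsto_mult e2 growth_conv) auto
      then have 2: "negligible W (\<lambda>d. (e2 d * growth (H' - {#x#}) d) * tau U d)"
        using cc l' LVr ox closed by (intro negligible_tau) auto
      show ?thesis unfolding zz prod.case by (intro negligible_scale negligible_add 1 2 W1)
    qed
    have "negligible W (\<lambda>d. (\<Sum>z\<leftarrow>quad l. case z of (s, U, V) \<Rightarrow>
        s * (e1 d * growth (add_mset U (add_mset V H')) d + (e2 d * tau U d) * growth (add_mset V H') d +
       (e2 d * tau V d) * growth (add_mset U H') d - (e2 d * growth H' d) * growth {#U, V#} d)) +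
        (\<Sum>z\<leftarrow>lin l. case z of (s, U) \<Rightarrow> s * (e1 d * growth (add_mset U H') d)) +
        (\<Sum>x\<in>#H'. \<Sum>z\<leftarrow>cross l x. case z of (s, U) \<Rightarrow>
        s * (e1 d * growth (add_mset U (H' - {#x#})) d + (e2 d * growth (H' - {#x#}) d) * tau U d)))"
      by (intro negligible_add negligible_sum_list negligible_sum_mset q n k W1)
    then show ?thesis
    proof (rule negligible_cong[rotated])
      show "\<forall>\<^sub>F d in sequentially. (\<Sum>z\<leftarrow>quad l. case z of (s, U, V) \<Rightarrow>
        s * (e1 d * growth (add_mset U (add_mset V H')) d + (e2 d * tau U d) * growth (add_mset V H') d +
       (e2 d * tau V d) * growth (add_mset U H') d - (e2 d * growth H' d) * growth {#U, V#} d)) +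
        (\<Sum>z\<leftarrow>lin l. case z of (s, U) \<Rightarrow> s * (e1 d * growth (add_mset U H') d)) +
        (\<Sum>x\<in>#H'. \<Sum>z\<leftarrow>cross l x. case z of (s, U) \<Rightarrow>
        s * (e1 d * growth (add_mset U (H' - {#x#})) d + (e2 d * growth (H' - {#x#}) d) * tau U d)) = v c d - l0 c"
        by (rule eventually_mono[OF eventually_ge_at_top[of 2]])
          (simp add: v_def l0_def Inr H' schwinger_dyson_growth[OF _ l'(1)])
    qed
  qed
  then have lim: "v c \<longlonglongrightarrow> l0 c" if "c \<in> C" for c
    using that by (intro negligible_bootstrap[OF finC]) (auto simp: W_def[abs_def])
  have "convergent (tau x)" if "over R S x \<and> level x = N" for x
    using lim[of "Inl x"] that by (intro convergentI) (auto simp: C_def CI_def v_def)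
  moreover have "growth (F + G0) \<longlonglongrightarrow> 0" if "(\<forall>x\<in>#F. over R S x \<and> 1 \<le> level x) \<and> total_level F = N" for F
    using lim[of "Inr (F + G0)"] that by (simp add: C_def CF_def C1_def v_def l0_def)
  ultimately show ?thesis by blast
qed

text \<open>The transposes are included because the letter sets of \<open>level_step\<close> must be
  closed under transposition.\<close>

definition letters_A :: "('b ncpoly, 'c ncpoly) item \<Rightarrow> 'b ncpoly set" where
  "letters_A x = (case x of Mix l \<Rightarrow> fst ` set l \<union> ncpoly_t ` fst ` set l | _ \<Rightarrow> {})"

definition letters_B :: "('b ncpoly, 'c ncpoly) item \<Rightarrow> 'c ncpoly set" where
  "letters_B x = (case x of Mix l \<Rightarrow> snd ` set l \<union> ncpoly_t ` snd ` set l | _ \<Rightarrow> {})"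

text \<open>A given multiset of words involves finitely many letters; they and their transposes form
  the finite sets for which rank \<open>N\<close> is settled. Lower ranks are known for all letters,
  so the products of letters that occur there do no harm.\<close>

lemma level_ok: "level_ok N"
proof (induction N rule: less_induct)
  case (less N)
  show ?case
  proof (cases "N = 0")
    case True
    then show ?thesis using level_ok_0 by simp
  next
    case False
    then have N: "N \<ge> 1" by simp
    have al: "finite (letters_A x)" "finite (letters_B x)"
      "ncpoly_t ` letters_A x \<subseteq> letters_A x" "ncpoly_t ` letters_B x \<subseteq> letters_B x"
      "level x \<ge> 1 \<Longrightarrow> letters_A x \<subseteq> R \<Longrightarrow> letters_B x \<subseteq> S \<Longrightarrow> over R S x" for x R S
    proof -
      have inv: "ncpoly_t ` ncpoly_t ` Z = Z" for Z :: "'z ncpoly set"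
        by (simp add: image_image ncpoly_t_ncpoly_t)
      show "finite (letters_A x)" "finite (letters_B x)"
        by (simp_all add: letters_A_def letters_B_def split: item.split)
      show "ncpoly_t ` letters_A x \<subseteq> letters_A x" "ncpoly_t ` letters_B x \<subseteq> letters_B x"
        by (auto simp: letters_A_def letters_B_def image_Un inv split: item.splits)
      show "over R S x" if "level x \<ge> 1" "letters_A x \<subseteq> R" "letters_B x \<subseteq> S"
        using that by (cases x) (auto simp: letters_A_def letters_B_def)
    qed
    have "tau x \<longlonglongrightarrow> limit_mean x" if x: "level x = N" for x
    proof -
      have "convergent (tau x)"
        using level_step[OF N less.IH al(1,2)[of x] al(3,4)[of x], of "{#}"] al(5)[of x] x N by auto
      then show ?thesis unfolding limit_mean_def by (rule convergent_LIMSEQ_iff[THEN iffD1])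
    qed
    moreover have "growth F \<longlonglongrightarrow> 0" if F: "total_level F = N" for F
    proof -
      \<comment> \<open>The items of level 0 become the passive part of
        \<open>level_step\<close>.\<close>
      define F1 F0 where "F1 = filter_mset (\<lambda>x. 1 \<le> level x) F" and "F0 = filter_mset (\<lambda>x. \<not> 1 \<le> level x) F"
      have FF: "F = F1 + F0" unfolding F1_def F0_def by (rule multiset_partition)
      have F0: "total_level F0 = 0" by (auto simp: total_level_0_iff F0_def)
      define R S where "R = (\<Union>x\<in>set_mset F1. letters_A x)" and "S = (\<Union>x\<in>set_mset F1. letters_B x)"
      have RS: "finite R" "finite S" "ncpoly_t ` R \<subseteq> R" "ncpoly_t ` S \<subseteq> S"
        using al(1-4) by (fastforce simp: R_def S_def)+
      have "over R S x \<and> 1 \<le> level x" if "x \<in># F1" for x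
        using that by (intro conjI al(5)) (auto simp: R_def S_def F1_def)
      then show ?thesis
        using level_step[OF N less.IH RS F0] FF F F0 by auto
    qed
    ultimately show ?thesis by (simp add: level_ok_def)
  qed
qed

lemma tau_tendsto: "tau x \<longlonglongrightarrow> limit_mean x"
  using level_ok by (auto simp: level_ok_def)

lemma growth_tendsto: "growth F \<longlonglongrightarrow> 0"
  using level_ok by (auto simp: level_ok_def)

end

lemma sum_list_sum_mset_swap:
  "(\<Sum>z\<leftarrow>xs. \<Sum>y\<in>#F. f z y) = (\<Sum>y\<in>#F. \<Sum>z\<leftarrow>xs. f z y :: 'b::comm_monoid_add)"
  by (induction xs) (simp_all add: sum_mset.distrib)

section \<open>Second pass: limits of the centred moments and Wick's rule\<close>

context asymptotic_base
begin

text \<open>What remains of the equation for a centred moment when the terms with the factor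
  \<open>e1\<close> are dropped and \<open>e2\<close> is replaced by 1.\<close>

definition dyson_limit :: "('b, 'c) blocks \<Rightarrow> ('b ncpoly, 'c ncpoly) item multiset \<Rightarrow> complex" where
  "dyson_limit l H = (\<Sum>(s, U, V)\<leftarrow>quad l. s * (limit_mean U * limit_moment (add_mset V H) + limit_mean V * limit_moment (add_mset U H))) +
    (\<Sum>x\<in>#H. \<Sum>(s, U)\<leftarrow>cross l x. s * (limit_mean U * limit_moment (H - {#x#})))"

text \<open>The outcome of the first pass in the form in which it is used: every moment is
  \<open>o(d)\<close>.\<close>

lemma e1_moment: "(\<lambda>d. e1 d * moment F d) \<longlonglongrightarrow> 0"
proof -
  have "(\<lambda>d. e2 d * growth F d) \<longlonglongrightarrow> 1 * 0" by (intro tendsto_mult e2 growth_tendsto)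
  moreover have "\<forall>\<^sub>F d in sequentially. e2 d * growth F d = e1 d * moment F d"
    by (rule eventually_mono[OF eventually_ge_at_top[of 1]]) (simp add: growth_def e1_def e2_def)
  ultimately show ?thesis by (simp add: tendsto_cong)
qed

text \<open>Each term without the factor \<open>e1\<close> is a mean times a moment of smaller total
  level, and the means are known to converge at every level.\<close>

lemma moment_dyson:
  assumes l: "l \<noteq> []" and conv: "\<And>F. total_level F < total_level (add_mset (Mix l) H) \<Longrightarrow> moment F \<longlonglongrightarrow> limit_moment F"
  shows "moment (add_mset (Mix l) H) \<longlonglongrightarrow> dyson_limit l H"
proof -
  have q: "(\<lambda>d. case z of (s, U, V) \<Rightarrow>
       s * (e1 d * moment (add_mset U (add_mset V H)) d + e2 d * (tau U d * moment (add_mset V H) d) +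
       e2 d * (tau V d * moment (add_mset U H) d) - (e1 d * moment {#U, V#} d) * moment H d))
      \<longlonglongrightarrow> (case z of (s, U, V) \<Rightarrow> s * (limit_mean U * limit_moment (add_mset V H) + limit_mean V * limit_moment (add_mset U H)))"
    if z: "z \<in> set (quad l)" for z
  proof -
    obtain s U V where zz: "z = (s, U, V)" by (cases z)
    note qc = quad_cases[OF z[unfolded zz]]
    have "(\<lambda>d. s * (e1 d * moment (add_mset U (add_mset V H)) d + e2 d * (tau U d * moment (add_mset V H) d) +
       e2 d * (tau V d * moment (add_mset U H) d) - (e1 d * moment {#U, V#} d) * moment H d))
      \<longlonglongrightarrow> s * (0 + 1 * (limit_mean U * limit_moment (add_mset V H)) + 1 * (limit_mean V * limit_moment (add_mset U H)) - 0 * limit_moment H)"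
      using qc by (intro tendsto_intros e1_moment e2 tau_tendsto conv) (use l in auto)
    then show ?thesis by (simp add: zz)
  qed
  have n: "(\<lambda>d. case z of (s, U) \<Rightarrow> s * (e1 d * moment (add_mset U H) d)) \<longlonglongrightarrow> 0" for z
  proof (cases z)
    case (Pair s U)
    have "(\<lambda>d. s * (e1 d * moment (add_mset U H) d)) \<longlonglongrightarrow> s * 0" by (intro tendsto_mult_left e1_moment)
    then show ?thesis by (simp add: Pair)
  qed
  have k: "(\<lambda>d. case z of (s, U) \<Rightarrow> s * (e1 d * moment (add_mset U (H - {#x#})) d + e2 d * (tau U d * moment (H - {#x#}) d)))
      \<longlonglongrightarrow> (case z of (s, U) \<Rightarrow> s * (limit_mean U * limit_moment (H - {#x#})))" if x: "x \<in># H" for x z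
  proof (cases z)
    case (Pair s U)
    have "(\<lambda>d. s * (e1 d * moment (add_mset U (H - {#x#})) d + e2 d * (tau U d * moment (H - {#x#}) d)))
      \<longlonglongrightarrow> s * (0 + 1 * (limit_mean U * limit_moment (H - {#x#})))"
      using total_level_remove[OF x] by (intro tendsto_intros e1_moment e2 tau_tendsto conv) (use l in \<open>cases l; simp\<close>)
    then show ?thesis by (simp add: Pair)
  qed
  have "(\<lambda>d. (\<Sum>z\<leftarrow>quad l. case z of (s, U, V) \<Rightarrow>
       s * (e1 d * moment (add_mset U (add_mset V H)) d + e2 d * (tau U d * moment (add_mset V H) d) +
       e2 d * (tau V d * moment (add_mset U H) d) - (e1 d * moment {#U, V#} d) * moment H d)) +
    (\<Sum>z\<leftarrow>lin l. case z of (s, U) \<Rightarrow> s * (e1 d * moment (add_mset U H) d)) +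
    (\<Sum>x\<in>#H. \<Sum>z\<leftarrow>cross l x. case z of (s, U) \<Rightarrow> s * (e1 d * moment (add_mset U (H - {#x#})) d + e2 d * (tau U d * moment (H - {#x#}) d))))
    \<longlonglongrightarrow> (\<Sum>z\<leftarrow>quad l. case z of (s, U, V) \<Rightarrow> s * (limit_mean U * limit_moment (add_mset V H) + limit_mean V * limit_moment (add_mset U H))) +
      (\<Sum>z\<leftarrow>lin l. 0) + (\<Sum>x\<in>#H. \<Sum>z\<leftarrow>cross l x. case z of (s, U) \<Rightarrow> s * (limit_mean U * limit_moment (H - {#x#})))"
    by (intro tendsto_add tendsto_sum_list tendsto_sum_mset q n k)
  moreover have "(\<Sum>z\<leftarrow>xs. 0 :: complex) = 0" for xs :: "'z list" by (induction xs) auto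
  ultimately have "(\<lambda>d. (\<Sum>z\<leftarrow>quad l. case z of (s, U, V) \<Rightarrow>
       s * (e1 d * moment (add_mset U (add_mset V H)) d + e2 d * (tau U d * moment (add_mset V H) d) +
       e2 d * (tau V d * moment (add_mset U H) d) - (e1 d * moment {#U, V#} d) * moment H d)) +
    (\<Sum>z\<leftarrow>lin l. case z of (s, U) \<Rightarrow> s * (e1 d * moment (add_mset U H) d)) +
    (\<Sum>x\<in>#H. \<Sum>z\<leftarrow>cross l x. case z of (s, U) \<Rightarrow> s * (e1 d * moment (add_mset U (H - {#x#})) d + e2 d * (tau U d * moment (H - {#x#}) d))))
    \<longlonglongrightarrow> dyson_limit l H"
    by (simp add: dyson_limit_def)
  then show ?thesis
  proof (rule Lim_transform_eventually)
    show "\<forall>\<^sub>F d in sequentially. (\<Sum>z\<leftarrow>quad l. case z of (s, U, V) \<Rightarrow>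
       s * (e1 d * moment (add_mset U (add_mset V H)) d + e2 d * (tau U d * moment (add_mset V H) d) +
       e2 d * (tau V d * moment (add_mset U H) d) - (e1 d * moment {#U, V#} d) * moment H d)) +
    (\<Sum>z\<leftarrow>lin l. case z of (s, U) \<Rightarrow> s * (e1 d * moment (add_mset U H) d)) +
    (\<Sum>x\<in>#H. \<Sum>z\<leftarrow>cross l x. case z of (s, U) \<Rightarrow> s * (e1 d * moment (add_mset U (H - {#x#})) d + e2 d * (tau U d * moment (H - {#x#}) d))) =
      moment (add_mset (Mix l) H) d"
      by (rule eventually_mono[OF eventually_ge_at_top[of 2]]) (rule schwinger_dyson_moment[OF _ l, symmetric])
  qed
qed

lemma mixed_item: "level x \<ge> 1 \<Longrightarrow> \<exists>l. x = Mix l \<and> l \<noteq> []"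
  by (cases x) auto

lemma mixed_member:
  assumes "total_level F > 0"
  shows "\<exists>l H. l \<noteq> [] \<and> F = add_mset (Mix l) H"
proof -
  have "\<exists>x\<in>#F. level x \<ge> 1" using assms total_level_0_iff[of F] by (force simp: Suc_le_eq)
  then show ?thesis using mixed_item by (metis insert_DiffM)
qed

lemma moment_tendsto: "moment F \<longlonglongrightarrow> limit_moment F"
proof (induction "total_level F" arbitrary: F rule: less_induct)
  case less
  show ?case
  proof (cases "total_level F = 0")
    case True
    then show ?thesis unfolding limit_moment_def by (intro convergent_LIMSEQ_iff[THEN iffD1] base_moment)
  next
    case False
    then obtain l H where lH: "l \<noteq> []" "F = add_mset (Mix l) H" using mixed_member[of F] by auto
    have "moment F \<longlonglongrightarrow> dyson_limit l H"
      unfolding lH(2) by (rule moment_dyson[OF lH(1)]) (use less lH in auto)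
    then show ?thesis by (simp add: limit_moment_def limI)
  qed
qed

lemma limit_moment_dyson: "l \<noteq> [] \<Longrightarrow> limit_moment (add_mset (Mix l) H) = dyson_limit l H"
  using LIMSEQ_unique[OF moment_tendsto moment_dyson[OF _ moment_tendsto]] by blast

lemma limit_moment_empty: "limit_moment {#} = 1"
proof -
  have "\<forall>\<^sub>F d in sequentially. moment {#} d = 1"
    by (rule eventually_mono[OF eventually_ge_at_top[of 1]]) (rule moment_empty)
  then have "moment {#} \<longlonglongrightarrow> 1" by (rule tendsto_eventually)
  then show ?thesis using LIMSEQ_unique[OF moment_tendsto] by blast
qed

text \<open>In the equation of a mean the single traces carry the factor \<open>e1\<close> and the
  covariances are \<open>o(d)\<close>, so only the products of two means survive.\<close>

lemma limit_mean_dyson: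
  assumes l: "l \<noteq> []"
  shows "limit_mean (Mix l) = (\<Sum>(s, U, V)\<leftarrow>quad l. s * (limit_mean U * limit_mean V))"
proof -
  have q: "(\<lambda>d. case z of (s, U, V) \<Rightarrow> s * (e1 d * growth {#U, V#} d + e2 d * (tau U d * tau V d)))
      \<longlonglongrightarrow> (case z of (s, U, V) \<Rightarrow> s * (limit_mean U * limit_mean V))" for z
  proof (cases z)
    case (fields s U V)
    have "(\<lambda>d. s * (e1 d * growth {#U, V#} d + e2 d * (tau U d * tau V d))) \<longlonglongrightarrow> s * (0 * 0 + 1 * (limit_mean U * limit_mean V))"
      by (intro tendsto_intros e1 e2 growth_tendsto tau_tendsto)
    then show ?thesis by (simp add: fields)
  qed
  have n: "(\<lambda>d. case z of (s, U) \<Rightarrow> s * (e1 d * tau U d)) \<longlonglongrightarrow> 0" for z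
  proof (cases z)
    case (Pair s U)
    have "(\<lambda>d. s * (e1 d * tau U d)) \<longlonglongrightarrow> s * (0 * limit_mean U)" by (intro tendsto_intros e1 tau_tendsto)
    then show ?thesis by (simp add: Pair)
  qed
  have z: "(\<Sum>z\<leftarrow>xs. 0 :: complex) = 0" for xs :: "'z list" by (induction xs) auto
  have "(\<lambda>d. (\<Sum>z\<leftarrow>quad l. case z of (s, U, V) \<Rightarrow> s * (e1 d * growth {#U, V#} d + e2 d * (tau U d * tau V d))) +
     (\<Sum>z\<leftarrow>lin l. case z of (s, U) \<Rightarrow> s * (e1 d * tau U d)))
    \<longlonglongrightarrow> (\<Sum>z\<leftarrow>quad l. case z of (s, U, V) \<Rightarrow> s * (limit_mean U * limit_mean V)) + (\<Sum>z\<leftarrow>lin l. 0)"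
    by (intro tendsto_add tendsto_sum_list q n)
  then have "tau (Mix l) \<longlonglongrightarrow> (\<Sum>z\<leftarrow>quad l. case z of (s, U, V) \<Rightarrow> s * (limit_mean U * limit_mean V)) + (\<Sum>z\<leftarrow>lin l. 0)"
  proof (rule Lim_transform_eventually)
    show "\<forall>\<^sub>F d in sequentially. (\<Sum>z\<leftarrow>quad l. case z of (s, U, V) \<Rightarrow> s * (e1 d * growth {#U, V#} d + e2 d * (tau U d * tau V d))) +
     (\<Sum>z\<leftarrow>lin l. case z of (s, U) \<Rightarrow> s * (e1 d * tau U d)) = tau (Mix l) d"
      by (rule eventually_mono[OF eventually_ge_at_top[of 2]]) (simp add: schwinger_dyson_mean[OF _ l] growth_def)
  qed
  from LIMSEQ_unique[OF tau_tendsto this] show ?thesis by (simp add: z)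
qed

lemma limit_moment_pair:
  assumes "l \<noteq> []"
  shows "limit_moment {#Mix l, y#} = (\<Sum>(s, U, V)\<leftarrow>quad l. s * (limit_mean U * limit_moment {#V, y#} + limit_mean V * limit_moment {#U, y#})) +
    (\<Sum>(s, U)\<leftarrow>cross l y. s * limit_mean U)"
  using limit_moment_dyson[OF assms, of "{#y#}"] by (simp add: dyson_limit_def limit_moment_empty)

text \<open>Around a mixed word both sides obey the recursion \<open>dyson_limit\<close>: in its
  first sum the induction hypothesis applies to the shorter words, and its second sum already has
  the shape of a pairing. If a mixed word occurs in \<open>G\<close>, it is expanded instead of
  \<open>p\<close>; without mixed words the rule is the assumption on level 0.\<close>

lemma wick: "limit_moment (add_mset p G) = (\<Sum>y\<in>#G. limit_moment {#p, y#} * limit_moment (G - {#y#}))"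
proof (induction "total_level (add_mset p G)" arbitrary: p G rule: less_induct)
  case less
  have sm: "(\<Sum>x\<in>#F. f x) * (c::complex) = (\<Sum>x\<in>#F. f x * c)" for F :: "'z multiset" and f c
    by (induction F) (simp_all add: distrib_right)
  have mixed: "limit_moment (add_mset (Mix l) H) = (\<Sum>y\<in>#H. limit_moment {#Mix l, y#} * limit_moment (H - {#y#}))"
    if l: "l \<noteq> []" and N: "total_level (add_mset (Mix l) H) \<le> total_level (add_mset p G)" for l H
  proof -
    have IH: "limit_moment (add_mset U H) = (\<Sum>y\<in>#H. limit_moment {#U, y#} * limit_moment (H - {#y#}))" if "level U < length l" for U
      using that N by (intro less) auto
    have q1: "(\<Sum>(s, U, V)\<leftarrow>quad l. s * (limit_mean U * limit_moment (add_mset V H) + limit_mean V * limit_moment (add_mset U H))) =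
        (\<Sum>(s, U, V)\<leftarrow>quad l. \<Sum>y\<in>#H. s * (limit_mean U * limit_moment {#V, y#} + limit_mean V * limit_moment {#U, y#}) * limit_moment (H - {#y#}))"
    proof (intro arg_cong[of _ _ sum_list] map_cong refl)
      fix z assume z: "z \<in> set (quad l)"
      obtain s U V where zz: "z = (s, U, V)" by (cases z)
      note qc = quad_cases[OF z[unfolded zz]]
      have U: "level U < length l" and V: "level V < length l" using qc by auto
      have pull: "s * (limit_mean U * (\<Sum>y\<in>#F. f y) + limit_mean V * (\<Sum>y\<in>#F. g y)) = (\<Sum>y\<in>#F. s * (limit_mean U * f y + limit_mean V * g y))"
        for F :: "('b ncpoly, 'c ncpoly) item multiset" and f g
        by (induction F) (simp_all add: algebra_simps)
      then show "(case z of (s, U, V) \<Rightarrow> s * (limit_mean U * limit_moment (add_mset V H) + limit_mean V * limit_moment (add_mset U H))) =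
          (case z of (s, U, V) \<Rightarrow> \<Sum>y\<in>#H. s * (limit_mean U * limit_moment {#V, y#} + limit_mean V * limit_moment {#U, y#}) * limit_moment (H - {#y#}))"
        unfolding zz prod.case IH[OF U] IH[OF V] pull by (simp add: algebra_simps)
    qed
    have q2: "(\<Sum>(s, U, V)\<leftarrow>quad l. \<Sum>y\<in>#H. s * (limit_mean U * limit_moment {#V, y#} + limit_mean V * limit_moment {#U, y#}) * limit_moment (H - {#y#})) =
        (\<Sum>y\<in>#H. \<Sum>(s, U, V)\<leftarrow>quad l. s * (limit_mean U * limit_moment {#V, y#} + limit_mean V * limit_moment {#U, y#}) * limit_moment (H - {#y#}))"
      unfolding case_prod_unfold by (rule sum_list_sum_mset_swap)
    have "limit_moment (add_mset (Mix l) H) = (\<Sum>y\<in>#H. \<Sum>(s, U, V)\<leftarrow>quad l. s * (limit_mean U * limit_moment {#V, y#} + limit_mean V * limit_moment {#U, y#}) * limit_moment (H - {#y#})) +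
        (\<Sum>y\<in>#H. \<Sum>(s, U)\<leftarrow>cross l y. s * (limit_mean U * limit_moment (H - {#y#})))"
      unfolding limit_moment_dyson[OF l] dyson_limit_def q1 q2 ..
    also have "\<dots> = (\<Sum>y\<in>#H. ((\<Sum>(s, U, V)\<leftarrow>quad l. s * (limit_mean U * limit_moment {#V, y#} + limit_mean V * limit_moment {#U, y#})) +
      (\<Sum>(s, U)\<leftarrow>cross l y. s * limit_mean U)) * limit_moment (H - {#y#}))"
    proof -
      have "((\<Sum>(s, U, V)\<leftarrow>quad l. s * (limit_mean U * limit_moment {#V, y#} + limit_mean V * limit_moment {#U, y#})) + (\<Sum>(s, U)\<leftarrow>cross l y. s * limit_mean U)) * c =
          (\<Sum>(s, U, V)\<leftarrow>quad l. s * (limit_mean U * limit_moment {#V, y#} + limit_mean V * limit_moment {#U, y#}) * c) +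
          (\<Sum>(s, U)\<leftarrow>cross l y. s * (limit_mean U * c))" for y c
        by (simp add: distrib_right[of _ _ c] sum_list_mult_const[symmetric] case_prod_unfold mult.assoc)
      then show ?thesis by (simp only: sum_mset.distrib)
    qed
    finally show ?thesis unfolding limit_moment_pair[OF l] .
  qed
  show ?case
  proof (cases "total_level G = 0")
    case True
    show ?thesis
    proof (cases "level p = 0")
      case True
      then show ?thesis using base_wick[of p G] \<open>total_level G = 0\<close> by (simp add: limit_moment_def)
    next
      case False
      then obtain l where "p = Mix l" "l \<noteq> []" using mixed_item[of p] by auto
      then show ?thesis using mixed[of l G] by simp
    qed
  next
    case False
    then obtain l H where l: "l \<noteq> []" and G: "G = add_mset (Mix l) H" using mixed_member[of G] by auto
    let ?P = "Mix l"
    have l0: "length l > 0" using l by simp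
    have comm: "limit_moment {#p, ?P#} = limit_moment {#?P, p#}" by (simp add: add_mset_commute)
    \<comment> \<open>First \<open>?P\<close> and then \<open>p\<close> chooses a partner.
      Exchanging the two choices yields the expansion around \<open>p\<close>.\<close>
    have "limit_moment (add_mset p G) = limit_moment (add_mset ?P (add_mset p H))" by (simp add: G add_mset_commute)
    also have "\<dots> = (\<Sum>y\<in>#add_mset p H. limit_moment {#?P, y#} * limit_moment (add_mset p H - {#y#}))"
      using G by (intro mixed l) auto
    also have "\<dots> = limit_moment {#?P, p#} * limit_moment H + (\<Sum>y\<in>#H. limit_moment {#?P, y#} * limit_moment (add_mset p (H - {#y#})))"
      by (rule sum_mset_remove_add[where g = "\<lambda>y F. limit_moment {#?P, y#} * limit_moment F"])
    also have "(\<Sum>y\<in>#H. limit_moment {#?P, y#} * limit_moment (add_mset p (H - {#y#}))) =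
        (\<Sum>y\<in>#H. \<Sum>z\<in>#H - {#y#}. limit_moment {#?P, y#} * (limit_moment {#p, z#} * limit_moment (H - {#y#} - {#z#})))"
    proof (intro arg_cong[of _ _ sum_mset] image_mset_cong)
      fix y assume "y \<in># H"
      from total_level_remove[OF this] have "limit_moment (add_mset p (H - {#y#})) = (\<Sum>z\<in>#H - {#y#}. limit_moment {#p, z#} * limit_moment (H - {#y#} - {#z#}))"
        using l0 by (intro less) (simp add: G del: length_greater_0_conv)
      then show "limit_moment {#?P, y#} * limit_moment (add_mset p (H - {#y#})) =
          (\<Sum>z\<in>#H - {#y#}. limit_moment {#?P, y#} * (limit_moment {#p, z#} * limit_moment (H - {#y#} - {#z#})))"
        by (simp add: sum_mset_distrib_left multiset.map_comp comp_def)
    qed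
    also have "\<dots> = (\<Sum>y\<in>#H. \<Sum>z\<in>#H - {#y#}. limit_moment {#?P, z#} * (limit_moment {#p, y#} * limit_moment (H - {#y#} - {#z#})))"
      by (rule sum_mset_remove_swap[where f = "\<lambda>y z F. limit_moment {#?P, y#} * (limit_moment {#p, z#} * limit_moment F)"])
    also have "\<dots> = (\<Sum>z\<in>#H. limit_moment {#p, z#} * limit_moment (add_mset ?P (H - {#z#})))"
    proof (intro arg_cong[of _ _ sum_mset] image_mset_cong)
      fix z assume "z \<in># H"
      from total_level_remove[OF this] have "limit_moment (add_mset ?P (H - {#z#})) = (\<Sum>y\<in>#H - {#z#}. limit_moment {#?P, y#} * limit_moment (H - {#z#} - {#y#}))"
        using l0 by (intro mixed l) (simp add: G)
      then show "(\<Sum>y\<in>#H - {#z#}. limit_moment {#?P, y#} * (limit_moment {#p, z#} * limit_moment (H - {#z#} - {#y#}))) =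
          limit_moment {#p, z#} * limit_moment (add_mset ?P (H - {#z#}))"
        by (simp add: sum_mset_distrib_left multiset.map_comp comp_def mult.left_commute)
    qed
    also have "limit_moment {#?P, p#} * limit_moment H + \<dots> = (\<Sum>z\<in>#add_mset ?P H. limit_moment {#p, z#} * limit_moment (add_mset ?P H - {#z#}))"
      unfolding comm[symmetric]
      by (rule sum_mset_remove_add[where g = "\<lambda>z F. limit_moment {#p, z#} * limit_moment F", symmetric])
    finally show ?thesis by (simp add: G)
  qed
qed

end

text \<open>Passage from index sets to multisets: the multiset is listed, subsets of positions give
  its parts, and a repeated variable occupies several positions.\<close>

lemma gaussian_multisets:
  fixes M :: "nat \<Rightarrow> 'w measure" and Z :: "nat \<Rightarrow> 'p \<Rightarrow> 'w \<Rightarrow> complex"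
  defines "cm \<equiv> \<lambda>G d. LINT w|M d. (\<Prod>x\<in>#G. Z d x w - (LINT w|M d. Z d x w))"
  assumes M: "\<And>d. d \<ge> 1 \<Longrightarrow> prob_space (M d)"
    and Z: "\<And>d x. d \<ge> 1 \<Longrightarrow> all_moments (M d) (Z d x)"
    and cov: "\<And>x y. convergent (\<lambda>d. covariance (M d) (Z d x) (Z d y))"
    and cum: "\<And>r p. r \<ge> 3 \<Longrightarrow> (\<lambda>d. joint_cumulant (M d) r (\<lambda>k. Z d (p k))) \<longlonglongrightarrow> 0"
  shows "convergent (cm G) \<and>
    (\<forall>x F. G = add_mset x F \<longrightarrow> lim (cm G) = (\<Sum>y\<in>#F. lim (cm {#x, y#}) * lim (cm (F - {#y#}))))"
proof -
  have main: "\<exists>L. (\<forall>V\<subseteq>{..<length xs}. cm (image_mset ((!) xs) (mset_set V)) \<longlonglongrightarrow> L V \<and>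
      (\<forall>j\<in>V. L V = (\<Sum>k\<in>V - {j}. L {j, k} * L (V - {j, k}))))" for xs
  proof -
    define c where "c i j = lim (\<lambda>d. covariance (M d) (Z d (xs ! i)) (Z d (xs ! j)))" for i j
    interpret limit_family M "\<lambda>d i. Z d (xs ! i)" "{..<length xs}"
      by (rule limit_family.intro) (simp_all add: M Z)
    have c2: "cumulant_seq {i, j} \<longlonglongrightarrow> c i j" if "i \<noteq> j" for i j
    proof -
      have "(\<lambda>d. covariance (M d) (Z d (xs ! i)) (Z d (xs ! j))) \<longlonglongrightarrow> c i j"
        unfolding c_def by (intro convergent_LIMSEQ_iff[THEN iffD1] cov)
      moreover have "\<forall>\<^sub>F d in sequentially. covariance (M d) (Z d (xs ! i)) (Z d (xs ! j)) = cumulant_seq {i, j} d"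
      proof (rule eventually_mono[OF eventually_ge_at_top[of 1]])
        fix d :: nat assume "1 \<le> d"
        then interpret prob_space "M d" by (rule M)
        show "covariance (M d) (Z d (xs ! i)) (Z d (xs ! j)) = cumulant_seq {i, j} d"
          unfolding cumulant_seq_def by (rule covariance_eq_cumulant[OF that])
      qed
      ultimately show ?thesis by (rule Lim_transform_eventually)
    qed
    have c3: "cumulant_seq V \<longlonglongrightarrow> 0" if V: "V \<subseteq> {..<length xs}" "card V \<ge> 3" for V
    proof -
      have "finite V" using V finite_subset by blast
      \<comment> \<open>The hypothesis on cumulants speaks of initial segments, so \<open>V\<close>
        is enumerated.\<close>
      then obtain f where f: "bij_betw f {..<card V} V"
        using ex_bij_betw_nat_finite[of V] by (auto simp: atLeast0LessThan)
      then have fV: "V = f ` {..<card V}" "inj_on f {..<card V}" by (auto simp: bij_betw_def)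
      have "(\<lambda>d. joint_cumulant (M d) (card V) (\<lambda>k. Z d (xs ! f k))) \<longlonglongrightarrow> 0" by (rule cum[OF V(2)])
      moreover have "\<forall>\<^sub>F d in sequentially. joint_cumulant (M d) (card V) (\<lambda>k. Z d (xs ! f k)) = cumulant_seq V d"
      proof (rule eventually_mono[OF eventually_ge_at_top[of 1]])
        fix d :: nat assume "1 \<le> d"
        then interpret prob_space "M d" by (rule M)
        have "cumulant_seq V d = set_cumulant (family_moment (\<lambda>i. Z d (xs ! i))) (f ` {..<card V})"
          unfolding cumulant_seq_def using fV(1) by simp
        also have "\<dots> = joint_cumulant (M d) (card V) (\<lambda>k. Z d (xs ! f k))"
          using cumulant_reindex[OF fV(2), of "\<lambda>i. Z d (xs ! i)"] by (simp add: joint_cumulant_eq comp_def)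
        finally show "joint_cumulant (M d) (card V) (\<lambda>k. Z d (xs ! f k)) = cumulant_seq V d" ..
      qed
      ultimately show ?thesis by (rule Lim_transform_eventually)
    qed
    obtain L where L0: "L {} = 1" and L: "\<And>V. V \<subseteq> {..<length xs} \<Longrightarrow>
        centred_moment M (\<lambda>d i. Z d (xs ! i)) V \<longlonglongrightarrow> L V \<and>
        (\<forall>j\<in>V. L V = (\<Sum>k\<in>V - {j}. c j k * L (V - {j, k})))"
      using moments_of_cumulants[of c] c2 c3 by blast
    have cmV: "cm (image_mset ((!) xs) (mset_set V)) = centred_moment M (\<lambda>d i. Z d (xs ! i)) V" for V
      by (simp add: cm_def centred_moment_def[abs_def] multiset.map_comp comp_def prod_unfold_prod_mset)
    have Ljk: "L {j, k} = c j k" if "{j, k} \<subseteq> {..<length xs}" "j \<noteq> k" for j k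
    proof -
      have "{j, k} - {j} = {k}" using that by auto
      then show ?thesis using L[OF that(1)] L0 by simp
    qed
    show ?thesis
    proof (intro exI[of _ L] allI impI conjI ballI)
      fix V assume V: "V \<subseteq> {..<length xs}"
      then show "cm (image_mset ((!) xs) (mset_set V)) \<longlonglongrightarrow> L V" using L cmV by simp
      fix j assume j: "j \<in> V"
      have "L V = (\<Sum>k\<in>V - {j}. c j k * L (V - {j, k}))" using L[OF V] j by blast
      also have "\<dots> = (\<Sum>k\<in>V - {j}. L {j, k} * L (V - {j, k}))"
        using V j by (intro sum.cong refl) (subst Ljk, auto)
      finally show "L V = (\<Sum>k\<in>V - {j}. L {j, k} * L (V - {j, k}))" .
    qed
  qed
  have all: "image_mset ((!) xs) (mset_set {..<length xs}) = mset xs" for xs :: "'p list"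
    by (metis map_nth mset_map mset_upt atLeast0LessThan)
  have conv: "convergent (cm G)" for G
  proof -
    obtain xs where "mset xs = G" using ex_mset by blast
    with main[of xs] all[of xs] show ?thesis by (metis convergentI order_refl)
  qed
  have step: "lim (cm (add_mset x F)) = (\<Sum>y\<in>#F. lim (cm {#x, y#}) * lim (cm (F - {#y#})))" for x F
  proof -
    obtain ys where ys: "mset ys = F" using ex_mset by blast
    \<comment> \<open>The distinguished variable is put at position 0; its partners are the
      positions \<open>Suc k\<close>.\<close>
    define xs where "xs = x # ys"
    obtain L where L: "\<And>V. V \<subseteq> {..<length xs} \<Longrightarrow> cm (image_mset ((!) xs) (mset_set V)) \<longlonglongrightarrow> L V \<and>
      (\<forall>j\<in>V. L V = (\<Sum>k\<in>V - {j}. L {j, k} * L (V - {j, k})))" using main[of xs] by blast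
    have lim: "lim (cm (image_mset ((!) xs) (mset_set V))) = L V" if "V \<subseteq> {..<length xs}" for V
      using L[OF that] by (auto intro: limI)
    have S: "{..<length xs} = insert 0 (Suc ` {..<length ys})"
      by (simp add: xs_def lessThan_Suc_eq_insert_0)
    have "lim (cm (add_mset x F)) = L {..<length xs}"
      using lim[OF order_refl] all[of xs] by (simp add: xs_def ys)
    also have "\<dots> = (\<Sum>k\<in>{..<length xs} - {0}. L {0, k} * L ({..<length xs} - {0, k}))"
      using L[OF order_refl] by (auto simp: xs_def)
    also have "{..<length xs} - {0} = Suc ` {..<length ys}" by (auto simp: S)
    also have "(\<Sum>k\<in>Suc ` {..<length ys}. L {0, k} * L ({..<length xs} - {0, k})) =
        (\<Sum>k<length ys. L {0, Suc k} * L (Suc ` ({..<length ys} - {k})))"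
    proof (subst sum.reindex, simp, intro sum.cong refl, unfold comp_def)
      fix k
      have "{..<length xs} - {0, Suc k} = Suc ` ({..<length ys} - {k})" by (auto simp: S)
      then show "L {0, Suc k} * L ({..<length xs} - {0, Suc k}) = L {0, Suc k} * L (Suc ` ({..<length ys} - {k}))"
        by simp
    qed
    also have "\<dots> = (\<Sum>k<length ys. lim (cm {#x, ys ! k#}) * lim (cm (F - {#ys ! k#})))"
    proof (rule sum.cong[OF refl])
      fix k assume k: "k \<in> {..<length ys}"
      have "L {0, Suc k} = lim (cm {#x, ys ! k#})"
        using lim[of "{0, Suc k}"] k by (simp add: xs_def)
      moreover have "L (Suc ` ({..<length ys} - {k})) = lim (cm (F - {#ys ! k#}))"
      proof -
        have "image_mset ((!) xs) (mset_set (Suc ` ({..<length ys} - {k}))) =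
            image_mset ((!) ys) (mset_set ({..<length ys} - {k}))"
          by (simp add: image_mset_mset_set[symmetric] multiset.map_comp comp_def xs_def)
        also have "\<dots> = image_mset ((!) ys) (mset_set {..<length ys}) - {#ys ! k#}"
          using k by (simp add: mset_set_Diff image_mset_Diff)
        finally have "image_mset ((!) xs) (mset_set (Suc ` ({..<length ys} - {k}))) = F - {#ys ! k#}"
          by (simp add: all ys)
        moreover have "Suc ` ({..<length ys} - {k}) \<subseteq> {..<length xs}" by (auto simp: S)
        ultimately show ?thesis using lim by metis
      qed
      ultimately show "L {0, Suc k} * L (Suc ` ({..<length ys} - {k})) =
          lim (cm {#x, ys ! k#}) * lim (cm (F - {#ys ! k#}))" by simp
    qed
    also have "\<dots> = (\<Sum>y\<in>#F. lim (cm {#x, y#}) * lim (cm (F - {#y#})))"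
    proof -
      have "(\<Sum>y\<in>#mset ys. h y) = (\<Sum>k<length ys. h (ys ! k))" for h :: "'p \<Rightarrow> complex"
      proof -
        have "(\<Sum>y\<in>#mset ys. h y) = sum_list (map h ys)" by (induction ys) simp_all
        then show ?thesis by (simp add: sum_list_sum_nth atLeast0LessThan)
      qed
      then show ?thesis by (simp add: ys)
    qed
    finally show ?thesis .
  qed
  show ?thesis
  proof (intro conjI allI impI)
    show "convergent (cm G)" by (rule conv)
  next
    fix x F assume G: "G = add_mset x F"
    show "lim (cm G) = (\<Sum>y\<in>#F. lim (cm {#x, y#}) * lim (cm (F - {#y#})))"
      unfolding G by (rule step)
  qed
qed

section \<open>Level 0: traces in one family under independence\<close>

context invariant_pair
begin

lemma space_sigma_of [simp]: "space (sigma_of C) = space M"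
  by (simp add: sigma_of_def)

lemma measurable_e:
  fixes C :: "'k \<Rightarrow> 'w \<Rightarrow> complex mat"
  assumes X: "\<And>k w. X w (g k) = C k w" and "r < d" "s < d"
  shows "e (emb g p) r s \<in> borel_measurable (sigma_of C)"
  using assms(2,3)
proof (induction p arbitrary: r s rule: ncpoly_closure_induct)
  case one
  have "e (emb g 1) r s \<in> borel_measurable (sigma_of C) \<longleftrightarrow> (\<lambda>_. if r = s then 1 else 0 :: complex) \<in> borel_measurable (sigma_of C)"
    by (rule measurable_cong) (simp add: emb_one e_one one)
  then show ?case by simp
next
  case (var k)
  have gv: "emb g (ncpoly_var k) = ncpoly_var (g k)" by (simp add: ncpoly_var_def emb_single)
  have "e (emb g (ncpoly_var k)) r s \<in> borel_measurable (sigma_of C) \<longleftrightarrow> coord C (k, r, s) \<in> borel_measurable (sigma_of C)"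
    by (rule measurable_cong) (simp add: gv e_var var X)
  moreover have "coord C (k, r, s) \<in> borel_measurable (sigma_of C)"
    using var by (intro measurable_coord) (simp add: entry_index_def)
  ultimately show ?case by blast
next
  case (vart k)
  have gv: "emb g (ncpoly_t (ncpoly_var k)) = ncpoly_t (ncpoly_var (g k))" by (simp add: ncpoly_var_def emb_single emb_t)
  have "e (emb g (ncpoly_t (ncpoly_var k))) r s \<in> borel_measurable (sigma_of C) \<longleftrightarrow> coord C (k, s, r) \<in> borel_measurable (sigma_of C)"
    by (rule measurable_cong) (simp add: gv e_t e_var vart X)
  moreover have "coord C (k, s, r) \<in> borel_measurable (sigma_of C)"
    using vart by (intro measurable_coord) (simp add: entry_index_def)
  ultimately show ?case by blast
next
  case (add p q)
  have "e (emb g (p + q)) r s = (\<lambda>w. e (emb g p) r s w + e (emb g q) r s w)"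
    by (simp add: emb_add e_add fun_eq_iff)
  then show ?case using add by simp
next
  case (sc c p)
  have "e (emb g (ncpoly_sc c p)) r s = (\<lambda>w. c * e (emb g p) r s w)"
    by (simp add: emb_sc e_sc fun_eq_iff)
  then show ?case using sc by simp
next
  case (mult p q)
  have "e (emb g (p * q)) r s \<in> borel_measurable (sigma_of C) \<longleftrightarrow>
      (\<lambda>w. \<Sum>k<d. e (emb g p) r k w * e (emb g q) k s w) \<in> borel_measurable (sigma_of C)"
    by (rule measurable_cong) (simp add: emb_mult e_mult mult)
  moreover have "(\<lambda>w. \<Sum>k<d. e (emb g p) r k w * e (emb g q) k s w) \<in> borel_measurable (sigma_of C)"
    using mult by (intro borel_measurable_sum borel_measurable_times) auto
  ultimately show ?case by blast
qed

lemma measurable_Y: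
  "Y (PA a) \<in> borel_measurable (sigma_of A)" "Y (PB b) \<in> borel_measurable (sigma_of B)"
proof -
  have "Y x \<in> borel_measurable (sigma_of C)"
    if "ev x = emb g p" "\<And>k w. X w (g k) = C k w" for x p and g :: "'k \<Rightarrow> 'i + 'j" and C
  proof -
    have "T (emb g p) \<in> borel_measurable (sigma_of C)"
      unfolding T_def[abs_def] by (intro borel_measurable_sum measurable_e that) auto
    then show ?thesis unfolding Y_def[abs_def] that(1) by simp
  qed
  from this[of "PA a" Inl a A] this[of "PB b" Inr b B]
  show "Y (PA a) \<in> borel_measurable (sigma_of A)" "Y (PB b) \<in> borel_measurable (sigma_of B)"
    by (simp_all add: X_def)
qed

text \<open>The centred traces of the two families are measurable with respect to independent
  sigma-algebras, so the factorization is exact in every dimension.\<close>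

lemma mom_split:
  "mom (image_mset PA G + image_mset PB H) = mom (image_mset PA G) * mom (image_mset PB H)"
proof -
  have "(\<lambda>w. \<Prod>x\<in>#G. Y (PA x) w) \<in> borel_measurable (sigma_of A)"
    by (induction G) (auto intro!: borel_measurable_times measurable_Y)
  moreover have "(\<lambda>w. \<Prod>x\<in>#H. Y (PB x) w) \<in> borel_measurable (sigma_of B)"
    by (induction H) (auto intro!: borel_measurable_times measurable_Y)
  moreover have "integrable M (\<lambda>w. \<Prod>x\<in>#G. Y (PA x) w)" "integrable M (\<lambda>w. \<Prod>x\<in>#H. Y (PB x) w)"
    by (intro all_moments_integrable moment_rules)+
  ultimately have "(LINT w|M. (\<Prod>x\<in>#G. Y (PA x) w) * (\<Prod>x\<in>#H. Y (PB x) w)) =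
      (LINT w|M. (\<Prod>x\<in>#G. Y (PA x) w)) * (LINT w|M. (\<Prod>x\<in>#H. Y (PB x) w))"
    by (intro expectation_mult)
  then show ?thesis by (simp add: mom_def multiset.map_comp comp_def)
qed

lemma T_pure:
  "T (iA a) w = Tr_poly d A a w" "T (iB b) w = Tr_poly d B b w"
  by (simp_all add: T_def e_def ent_emb mat_trace_ncpoly_mat X_def)

lemma T_eq_Tr_poly: "T p w = Tr_poly d (case_sum A B) p w"
proof -
  have "(\<lambda>i. case_sum A B i w) = X w"
    by (auto simp: X_def fun_eq_iff split: sum.split)
  then show ?thesis by (simp add: T_def e_def mat_trace_ncpoly_mat)
qed

lemma mom_pure:
  "mom (image_mset PA G) = (LINT w|M. (\<Prod>x\<in>#G. Tr_poly d A x w - (LINT w|M. Tr_poly d A x w)))"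
  "mom (image_mset PB H) = (LINT w|M. (\<Prod>x\<in>#H. Tr_poly d B x w - (LINT w|M. Tr_poly d B x w)))"
  by (simp_all add: mom_def multiset.map_comp comp_def Y_def T_pure T_pure[abs_def])

lemma K_unit: "K (Mix []) = of_nat d"
proof -
  have "K (Mix []) = (LINT w|M. of_nat d)"
    unfolding K_def by (rule Bochner_Integration.integral_cong) (simp_all add: T_one)
  then show ?thesis by (simp add: prob_space)
qed

text \<open>The trace of the empty word is the constant \<open>d\<close>, so its centred version is
  0.\<close>

lemma mom_unit: "Mix [] \<in># F \<Longrightarrow> mom F = 0"
proof -
  assume "Mix [] \<in># F"
  then obtain G where F: "F = add_mset (Mix []) G" by (metis insert_DiffM)
  have "mom F = (LINT w|M. 0)"
    unfolding mom_def
  proof (rule Bochner_Integration.integral_cong[OF refl])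
    fix w assume "w \<in> space M"
    then have "Y (Mix []) w = 0" using K_unit by (simp add: Y_def K_def T_one)
    then show "(\<Prod>x\<in>#F. Y x w) = 0" by (simp add: F)
  qed
  then show ?thesis by simp
qed

end

lemma pure_items:
  assumes "total_level F = 0" "Mix [] \<notin># F"
  shows "\<exists>G H. F = image_mset PA G + image_mset PB H"
  using assms
proof (induction F)
  case empty
  then show ?case by (intro exI[of _ "{#}"]) simp
next
  case (add x F)
  then obtain G H where F: "F = image_mset PA G + image_mset PB H" by auto
  show ?case
  proof (cases x)
    case (Mix l)
    then show ?thesis using add.prems by simp
  next
    case (PA a)
    then show ?thesis by (intro exI[of _ "add_mset a G"] exI[of _ H]) (simp add: F)
  next
    case (PB b)
    then show ?thesis by (intro exI[of _ G] exI[of _ "add_mset b H"]) (simp add: F)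
  qed
qed

text \<open>A moment of level 0 either contains the empty word, and vanishes, or factorizes over the
  two families. Wick's rule for the two factors combines to the joint rule because pairs across the
  families contribute 0.\<close>

lemma asymptotic_baseI:
  fixes M :: "nat \<Rightarrow> 'w measure" and A :: "nat \<Rightarrow> 'i \<Rightarrow> 'w \<Rightarrow> complex mat"
    and B :: "nat \<Rightarrow> 'j \<Rightarrow> 'w \<Rightarrow> complex mat"
  assumes pair: "\<And>d. d \<ge> 1 \<Longrightarrow> invariant_pair (M d) d (A d) (B d)"
    and limA: "real_second_order_limit M A scaleA \<phi>A \<phi>2A tA a"
    and limB: "real_second_order_limit M B scaleB \<phi>B \<phi>2B tB b"
  shows "asymptotic_base M A B"
proof -
  interpret asymptotic_pair M A B by (rule asymptotic_pair.intro) (rule pair)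
  have prob: "prob_space (M d)" if "d \<ge> 1" for d
    using pair[OF that] by (rule invariant_pair.axioms(1))
  define cA where "cA G d = (LINT w|M d. (\<Prod>x\<in>#G. Tr_poly d (A d) x w - (LINT w|M d. Tr_poly d (A d) x w)))" for G d
  define cB where "cB G d = (LINT w|M d. (\<Prod>x\<in>#G. Tr_poly d (B d) x w - (LINT w|M d. Tr_poly d (B d) x w)))" for G d
  have allA: "all_moments (M d) (Tr_poly d (A d) x)" if "d \<ge> 1" for d x
  proof -
    interpret invariant_pair "M d" d "A d" "B d" by (rule pair[OF that])
    show ?thesis using all_moments_T[of "iA x"] by (simp add: T_pure[abs_def])
  qed
  have allB: "all_moments (M d) (Tr_poly d (B d) x)" if "d \<ge> 1" for d x
  proof -
    interpret invariant_pair "M d" d "A d" "B d" by (rule pair[OF that])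
    show ?thesis using all_moments_T[of "iB x"] by (simp add: T_pure[abs_def])
  qed
  have covA: "convergent (\<lambda>d. covariance (M d) (Tr_poly d (A d) x) (Tr_poly d (A d) y))" for x y
    using limA unfolding real_second_order_limit_def convergent_def by blast
  have covB: "convergent (\<lambda>d. covariance (M d) (Tr_poly d (B d) x) (Tr_poly d (B d) y))" for x y
    using limB unfolding real_second_order_limit_def convergent_def by blast
  have gA: "convergent (cA G) \<and>
    (\<forall>x F. G = add_mset x F \<longrightarrow> lim (cA G) = (\<Sum>y\<in>#F. lim (cA {#x, y#}) * lim (cA (F - {#y#}))))" for G
    unfolding cA_def
    by (rule gaussian_multisets[where Z = "\<lambda>d. Tr_poly d (A d)"])
      (use limA prob allA covA in \<open>auto simp: real_second_order_limit_def\<close>)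
  have gB: "convergent (cB G) \<and>
    (\<forall>x F. G = add_mset x F \<longrightarrow> lim (cB G) = (\<Sum>y\<in>#F. lim (cB {#x, y#}) * lim (cB (F - {#y#}))))" for G
    unfolding cB_def
    by (rule gaussian_multisets[where Z = "\<lambda>d. Tr_poly d (B d)"])
      (use limB prob allB covB in \<open>auto simp: real_second_order_limit_def\<close>)
  have wA: "lim (cA (add_mset x F)) = (\<Sum>y\<in>#F. lim (cA {#x, y#}) * lim (cA (F - {#y#})))" for x F
    using gA by blast
  have wB: "lim (cB (add_mset x F)) = (\<Sum>y\<in>#F. lim (cB {#x, y#}) * lim (cB (F - {#y#})))" for x F
    using gB by blast
  have moment: "\<forall>\<^sub>F d in sequentially. cA G d * cB H d = moment (image_mset PA G + image_mset PB H) d" for G H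
  proof (rule eventually_mono[OF eventually_ge_at_top[of 1]])
    fix d :: nat assume "1 \<le> d"
    then interpret invariant_pair "M d" d "A d" "B d" by (rule pair)
    show "cA G d * cB H d = moment (image_mset PA G + image_mset PB H) d"
      by (simp add: moment_def mom_split mom_pure cA_def cB_def)
  qed
  have conv: "moment (image_mset PA G + image_mset PB H) \<longlonglongrightarrow> lim (cA G) * lim (cB H)" for G H
    by (rule Lim_transform_eventually[OF tendsto_mult moment])
      (use gA gB in \<open>auto simp: convergent_LIMSEQ_iff\<close>)
  have lim_moment: "lim (moment (image_mset PA G + image_mset PB H)) = lim (cA G) * lim (cB H)" for G H
    by (rule limI[OF conv])
  have limA0: "lim (cA {#}) = 1" "lim (cB {#}) = 1"
  proof -
    have "\<forall>\<^sub>F d in sequentially. cA {#} d = 1" "\<forall>\<^sub>F d in sequentially. cB {#} d = 1"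
      by (rule eventually_mono[OF eventually_ge_at_top[of 1]],
        simp add: cA_def cB_def prob_space.prob_space[OF prob])+
    then show "lim (cA {#}) = 1" "lim (cB {#}) = 1"
      by (auto intro!: limI tendsto_eventually)
  qed
  \<comment> \<open>Wick's rule without a possible partner. By factorization the pairs across the
    families then have limit 0.\<close>
  have limA1: "lim (cA {#x#}) = 0" "lim (cB {#y#}) = 0" for x y
    using wA[of x "{#}"] wB[of y "{#}"] by simp_all
  have unit: "moment F \<longlonglongrightarrow> 0" if "Mix [] \<in># F" for F
  proof (rule tendsto_eventually, rule eventually_mono[OF eventually_ge_at_top[of 1]])
    fix d :: nat assume "1 \<le> d"
    then interpret invariant_pair "M d" d "A d" "B d" by (rule pair)
    show "moment F d = 0" using mom_unit[OF that] by (simp add: moment_def)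
  qed
  show ?thesis
  proof unfold_locales
    fix x :: "('i ncpoly, 'j ncpoly) item" assume "level x = 0"
    show "convergent (tau x)"
    proof (cases x)
      case (Mix l)
      with \<open>level x = 0\<close> have x: "x = Mix []" by simp
      have "\<forall>\<^sub>F d in sequentially. tau x d = 1"
      proof (rule eventually_mono[OF eventually_ge_at_top[of 1]])
        fix d :: nat assume "1 \<le> d"
        then interpret invariant_pair "M d" d "A d" "B d" by (rule pair)
        show "tau x d = 1" using K_unit \<open>1 \<le> d\<close> by (simp add: tau_def trace_mean_def x)
      qed
      then show ?thesis by (intro convergentI) (rule tendsto_eventually)
    next
      case (PA p)
      have "(\<lambda>d. LINT w|M d. Tr_poly d (A d) p w / of_nat d) \<longlonglongrightarrow> \<phi>A (ncpoly_eval scaleA tA a p)"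
        using limA by (simp add: real_second_order_limit_def)
      moreover have "\<forall>\<^sub>F d in sequentially. (LINT w|M d. Tr_poly d (A d) p w / of_nat d) = tau x d"
      proof (rule eventually_mono[OF eventually_ge_at_top[of 1]])
        fix d :: nat assume "1 \<le> d"
        then interpret invariant_pair "M d" d "A d" "B d" by (rule pair)
        show "(LINT w|M d. Tr_poly d (A d) p w / of_nat d) = tau x d"
          by (simp add: tau_def trace_mean_def K_def PA T_pure)
      qed
      ultimately have "tau x \<longlonglongrightarrow> \<phi>A (ncpoly_eval scaleA tA a p)" by (rule Lim_transform_eventually)
      then show ?thesis by (rule convergentI)
    next
      case (PB p)
      have "(\<lambda>d. LINT w|M d. Tr_poly d (B d) p w / of_nat d) \<longlonglongrightarrow> \<phi>B (ncpoly_eval scaleB tB b p)"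
        using limB by (simp add: real_second_order_limit_def)
      moreover have "\<forall>\<^sub>F d in sequentially. (LINT w|M d. Tr_poly d (B d) p w / of_nat d) = tau x d"
      proof (rule eventually_mono[OF eventually_ge_at_top[of 1]])
        fix d :: nat assume "1 \<le> d"
        then interpret invariant_pair "M d" d "A d" "B d" by (rule pair)
        show "(LINT w|M d. Tr_poly d (B d) p w / of_nat d) = tau x d"
          by (simp add: tau_def trace_mean_def K_def PB T_pure)
      qed
      ultimately have "tau x \<longlonglongrightarrow> \<phi>B (ncpoly_eval scaleB tB b p)" by (rule Lim_transform_eventually)
      then show ?thesis by (rule convergentI)
    qed
  next
    fix F :: "('i ncpoly, 'j ncpoly) item multiset" assume F: "total_level F = 0"
    show "convergent (moment F)"
    proof (cases "Mix [] \<in># F")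
      case True
      then show ?thesis using unit by (intro convergentI)
    next
      case False
      then obtain G H where "F = image_mset PA G + image_mset PB H" using pure_items[OF F] by blast
      then show ?thesis using conv by (intro convergentI) simp
    qed
  next
    fix p and F :: "('i ncpoly, 'j ncpoly) item multiset" assume F: "total_level (add_mset p F) = 0"
    show "lim (moment (add_mset p F)) = (\<Sum>y\<in>#F. lim (moment {#p, y#}) * lim (moment (F - {#y#})))"
    proof (cases "Mix [] \<in># add_mset p F")
      case True
      have u: "lim (moment F) = 0" if "Mix [] \<in># F" for F using unit[OF that] by (rule limI)
      have "lim (moment {#p, y#}) * lim (moment (F - {#y#})) = 0" if "y \<in># F" for y
      proof (cases "Mix [] \<in># {#p, y#}")
        case True
        then show ?thesis by (simp only: u mult_zero_left)
      next
        case False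
        with \<open>Mix [] \<in># add_mset p F\<close> have "Mix [] \<in># F - {#y#}" by (auto simp: in_diff_count)
        then show ?thesis by (simp only: u mult_zero_right)
      qed
      then have "(\<Sum>y\<in>#F. lim (moment {#p, y#}) * lim (moment (F - {#y#}))) = (\<Sum>y\<in>#F. 0)"
        by (intro arg_cong[of _ _ sum_mset] image_mset_cong)
      then show ?thesis by (simp add: u[OF True])
    next
      case False
      then have "Mix [] \<notin># F" "total_level F = 0" using F by auto
      then obtain G H where GH: "F = image_mset PA G + image_mset PB H" using pure_items by blast
      have sm: "(\<Sum>x\<in>#F. f x) * (c::complex) = (\<Sum>x\<in>#F. f x * c)"
        "c * (\<Sum>x\<in>#F. f x) = (\<Sum>x\<in>#F. c * f x)" for F :: "'z multiset" and f c
        by (induction F) (simp_all add: distrib_right distrib_left)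
      have remA: "F - {#PA x#} = image_mset PA (G - {#x#}) + image_mset PB H" if "x \<in># G" for x
        using that by (simp add: GH image_mset_Diff)
      have remB: "F - {#PB x#} = image_mset PA G + image_mset PB (H - {#x#})" if "x \<in># H" for x
        using that by (simp add: GH image_mset_Diff)
      have AA: "lim (moment {#PA x, PA y#}) = lim (cA {#x, y#})" for x y
        using lim_moment[of "{#x, y#}" "{#}"] by (simp add: limA0)
      have BB: "lim (moment {#PB x, PB y#}) = lim (cB {#x, y#})" for x y
        using lim_moment[of "{#}" "{#x, y#}"] by (simp add: limA0)
      have AB: "lim (moment {#PA x, PB y#}) = 0" for x y
        using lim_moment[of "{#x#}" "{#y#}"] by (simp add: limA1 add_mset_commute)
      have split: "(\<Sum>y\<in>#F. lim (moment {#p, y#}) * lim (moment (F - {#y#}))) =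
          (\<Sum>x\<in>#G. lim (moment {#p, PA x#}) * (lim (cA (G - {#x#})) * lim (cB H))) +
          (\<Sum>x\<in>#H. lim (moment {#p, PB x#}) * (lim (cA G) * lim (cB (H - {#x#}))))"
      proof -
        have "(\<Sum>y\<in>#F. lim (moment {#p, y#}) * lim (moment (F - {#y#}))) =
          (\<Sum>x\<in>#G. lim (moment {#p, PA x#}) * lim (moment (F - {#PA x#}))) +
          (\<Sum>x\<in>#H. lim (moment {#p, PB x#}) * lim (moment (F - {#PB x#})))"
          by (subst (1) GH) (simp add: multiset.map_comp comp_def)
        also have "(\<Sum>x\<in>#G. lim (moment {#p, PA x#}) * lim (moment (F - {#PA x#}))) =
            (\<Sum>x\<in>#G. lim (moment {#p, PA x#}) * (lim (cA (G - {#x#})) * lim (cB H)))"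
          by (intro arg_cong[of _ _ sum_mset] image_mset_cong) (simp add: remA lim_moment)
        also have "(\<Sum>x\<in>#H. lim (moment {#p, PB x#}) * lim (moment (F - {#PB x#}))) =
            (\<Sum>x\<in>#H. lim (moment {#p, PB x#}) * (lim (cA G) * lim (cB (H - {#x#}))))"
          by (intro arg_cong[of _ _ sum_mset] image_mset_cong) (simp add: remB lim_moment)
        finally show ?thesis .
      qed
      show ?thesis
      proof (cases p)
        case (Mix l)
        then show ?thesis using False F by simp
      next
        case (PA x)
        have "lim (moment (add_mset p F)) = lim (cA (add_mset x G)) * lim (cB H)"
          using lim_moment[of "add_mset x G" H] by (simp add: PA GH)
        then show ?thesis unfolding split unfolding PA AA AB wA[of x G] sm(1) by (simp add: mult.assoc)
      next
        case (PB x)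
        have "lim (moment (add_mset p F)) = lim (cA G) * lim (cB (add_mset x H))"
          using lim_moment[of G "add_mset x H"] by (simp add: PB GH)
        moreover have "lim (moment {#PB x, PA y#}) = 0" for y using AB[of y x] by (simp add: add_mset_commute)
        ultimately show ?thesis unfolding split unfolding PB BB wB[of x H] sm(2) by (simp add: mult.left_commute)
      qed
    qed
  qed
qed

section \<open>The limit distribution of the joint ensemble\<close>

text \<open>Each letter is padded with 1 to a full block. Thus every word becomes an item, and the
  results on items extend to all polynomials by linearity.\<close>

fun letter_block :: "('i + 'j) letter \<Rightarrow> 'i ncpoly \<times> 'j ncpoly" where
  "letter_block (Var (Inl i)) = (ncpoly_var i, 1)"
| "letter_block (VarT (Inl i)) = (ncpoly_t (ncpoly_var i), 1)"
| "letter_block (Var (Inr j)) = (1, ncpoly_var j)"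
| "letter_block (VarT (Inr j)) = (1, ncpoly_t (ncpoly_var j))"

definition word_item :: "('i + 'j) letter free_monoid \<Rightarrow> ('i ncpoly, 'j ncpoly) item" where
  "word_item w = Mix (map letter_block (letters w))"

lemma ev_word_item: "ev (word_item w) = Poly_Mapping.single w 1"
proof -
  have l: "iA (fst (letter_block l)) * iB (snd (letter_block l)) = Poly_Mapping.single (Word [l]) 1" for l :: "('a + 'b) letter"
    by (cases l rule: letter_block.cases) (simp_all add: emb_one emb_single emb_t ncpoly_var_def ncpoly_t_single word_t_def)
  have "block_word (map letter_block ls) = Poly_Mapping.single (Word ls) 1" for ls :: "('a + 'b) letter list"
  proof (induction ls)
    case Nil
    then show ?case by (simp flip: zero_free_monoid_def)
  next
    case (Cons l ls)
    then show ?case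
      using l[of l] by (cases "letter_block l") (simp add: mult_single plus_free_monoid_def)
  qed
  then show ?thesis by (cases w) (simp add: word_item_def)
qed

lemma single_eq_sc: "Poly_Mapping.single w c = ncpoly_sc c (ev (word_item w))"
  by (simp add: ev_word_item ncpoly_sc_single)

lemma (in prob_space) covariance_linear:
  assumes "all_moments M f" "all_moments M g" "all_moments M h"
  shows "covariance M (\<lambda>w. c * f w + g w) h = c * covariance M f h + covariance M g h"
    and "covariance M h (\<lambda>w. c * f w + g w) = c * covariance M h f + covariance M h g"
proof -
  have "integrable M f" "integrable M g" "integrable M (\<lambda>w. f w * h w)" "integrable M (\<lambda>w. g w * h w)"
    "integrable M (\<lambda>w. h w * f w)" "integrable M (\<lambda>w. h w * g w)"
    using assms by (auto intro!: all_moments_integrable all_moments_mult)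
  then show "covariance M (\<lambda>w. c * f w + g w) h = c * covariance M f h + covariance M g h"
    "covariance M h (\<lambda>w. c * f w + g w) = c * covariance M h f + covariance M h g"
    by (simp_all add: covariance_def distrib_left distrib_right mult.assoc mult.left_commute[of _ c] algebra_simps)
qed

context asymptotic_base
begin

definition trace_rv :: "nat \<Rightarrow> ('b + 'c) ncpoly \<Rightarrow> 'a \<Rightarrow> complex" where
  "trace_rv d p w = Tr_poly d (case_sum (A d) (B d)) p w"

lemma trace_rv_eq: "d \<ge> 1 \<Longrightarrow> trace_rv d p w = invariant_pair.T d (A d) (B d) p w"
  using invariant_pair.T_eq_Tr_poly[OF pair] by (simp add: trace_rv_def)

lemma prob: "d \<ge> 1 \<Longrightarrow> prob_space (M d)"
  using pair by (rule invariant_pair.axioms(1))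

lemma trace_rv_add: "trace_rv d (p + q) w = trace_rv d p w + trace_rv d q w"
  by (simp add: trace_rv_def mat_trace_ncpoly_mat ent_add sum.distrib)

lemma trace_rv_sc: "trace_rv d (ncpoly_sc c p) w = c * trace_rv d p w"
  by (simp add: trace_rv_def mat_trace_ncpoly_mat ent_sc sum_distrib_left)

lemma all_moments_trace_rv: "d \<ge> 1 \<Longrightarrow> all_moments (M d) (trace_rv d p)"
proof -
  assume d: "d \<ge> 1"
  have "trace_rv d p = invariant_pair.T d (A d) (B d) p" by (rule ext) (rule trace_rv_eq[OF d])
  then show ?thesis using invariant_pair.all_moments_T[OF pair[OF d]] by simp
qed

lemma integrable_trace_rv: "d \<ge> 1 \<Longrightarrow> integrable (M d) (trace_rv d p)"
  using prob_space.all_moments_integrable[OF prob all_moments_trace_rv] by blast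

definition mean :: "('b + 'c) ncpoly \<Rightarrow> nat \<Rightarrow> complex" where
  "mean p d = (LINT w|M d. trace_rv d p w / of_nat d)"

definition trace_cov :: "('b + 'c) ncpoly \<Rightarrow> ('b + 'c) ncpoly \<Rightarrow> nat \<Rightarrow> complex" where
  "trace_cov p q d = covariance (M d) (trace_rv d p) (trace_rv d q)"

lemma mean_ev: "d \<ge> 1 \<Longrightarrow> mean (ev x) d = tau x d"
proof -
  assume d: "d \<ge> 1"
  interpret invariant_pair "M d" d "A d" "B d" by (rule pair[OF d])
  show ?thesis by (simp add: mean_def tau_def trace_mean_def K_def trace_rv_eq[OF d])
qed

lemma trace_cov_ev: "d \<ge> 1 \<Longrightarrow> trace_cov (ev x) (ev y) d = moment {#x, y#} d"
proof -
  assume d: "d \<ge> 1"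
  interpret invariant_pair "M d" d "A d" "B d" by (rule pair[OF d])
  have "(LINT w|M d. T (ev x) w * T (ev y) w) = mom {#x, y#} + K x * K y"
    using expectation_TT_mult[of x y "{#}"] by simp
  then show ?thesis
    by (simp add: trace_cov_def covariance_def moment_def trace_rv_eq[OF d] K_def)
qed

lemma mean_add: "d \<ge> 1 \<Longrightarrow> mean (p + q) d = mean p d + mean q d"
  by (simp add: mean_def trace_rv_add integrable_trace_rv add_divide_distrib)

lemma mean_sc: "mean (ncpoly_sc c p) d = c * mean p d"
  by (simp add: mean_def trace_rv_sc)

lemma trace_cov_linear:
  assumes d: "d \<ge> 1"
  shows "trace_cov (p + q) r d = trace_cov p r d + trace_cov q r d" "trace_cov r (p + q) d = trace_cov r p d + trace_cov r q d"
    "trace_cov (ncpoly_sc c p) r d = c * trace_cov p r d" "trace_cov r (ncpoly_sc c p) d = c * trace_cov r p d"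
proof -
  interpret prob_space "M d" by (rule prob[OF d])
  note moment_rules = all_moments_trace_rv[OF d]
  have 0: "trace_rv d 0 w = 0" for w by (simp add: trace_rv_def mat_trace_ncpoly_mat ent_def)
  have cz: "covariance (M d) (trace_rv d 0) f = 0" "covariance (M d) f (trace_rv d 0) = 0" for f
    by (simp_all add: covariance_def 0)
  have f: "trace_rv d (p + q) = (\<lambda>w. 1 * trace_rv d p w + trace_rv d q w)" "trace_rv d (ncpoly_sc c p) = (\<lambda>w. c * trace_rv d p w + trace_rv d 0 w)"
    by (simp_all add: trace_rv_add trace_rv_sc 0 fun_eq_iff)
  show "trace_cov (p + q) r d = trace_cov p r d + trace_cov q r d" "trace_cov r (p + q) d = trace_cov r p d + trace_cov r q d"
    "trace_cov (ncpoly_sc c p) r d = c * trace_cov p r d" "trace_cov r (ncpoly_sc c p) d = c * trace_cov r p d"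
    unfolding trace_cov_def f by (simp_all only: covariance_linear moment_rules cz) simp_all
qed

lemma mean_convergent: "convergent (mean p)"
proof (induction p rule: ncpoly_induct)
  case (single w c)
  have "(\<lambda>d. c * tau (word_item w) d) \<longlonglongrightarrow> c * limit_mean (word_item w)"
    by (intro tendsto_mult_left tau_tendsto)
  then have "mean (Poly_Mapping.single w c) \<longlonglongrightarrow> c * limit_mean (word_item w)"
    by (rule Lim_transform_eventually)
      (rule eventually_mono[OF eventually_ge_at_top[of 1]], simp add: single_eq_sc mean_sc mean_ev)
  then show ?case by (rule convergentI)
next
  case (add p q)
  then have "convergent (\<lambda>d. mean p d + mean q d)" by (rule convergent_add)
  then obtain L where "(\<lambda>d. mean p d + mean q d) \<longlonglongrightarrow> L" by (auto simp: convergent_def)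
  then have "mean (p + q) \<longlonglongrightarrow> L"
    by (rule Lim_transform_eventually)
      (rule eventually_mono[OF eventually_ge_at_top[of 1]], simp add: mean_add)
  then show ?case by (rule convergentI)
qed

lemma trace_cov_convergent: "convergent (trace_cov p q)"
proof (induction p rule: ncpoly_induct)
  case (single w c)
  show ?case
  proof (induction q rule: ncpoly_induct)
    case (single v e)
    have "(\<lambda>d. c * (e * moment {#word_item w, word_item v#} d)) \<longlonglongrightarrow> c * (e * limit_moment {#word_item w, word_item v#})"
      by (intro tendsto_mult_left moment_tendsto)
    then have "trace_cov (Poly_Mapping.single w c) (Poly_Mapping.single v e) \<longlonglongrightarrow> c * (e * limit_moment {#word_item w, word_item v#})"
      by (rule Lim_transform_eventually)
        (rule eventually_mono[OF eventually_ge_at_top[of 1]], simp add: single_eq_sc trace_cov_linear trace_cov_ev)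
    then show ?case by (rule convergentI)
  next
    case (add p q)
    then have "convergent (\<lambda>d. trace_cov (Poly_Mapping.single w c) p d + trace_cov (Poly_Mapping.single w c) q d)" by (rule convergent_add)
    then obtain L where "(\<lambda>d. trace_cov (Poly_Mapping.single w c) p d + trace_cov (Poly_Mapping.single w c) q d) \<longlonglongrightarrow> L"
      by (auto simp: convergent_def)
    then have "trace_cov (Poly_Mapping.single w c) (p + q) \<longlonglongrightarrow> L"
      by (rule Lim_transform_eventually)
        (rule eventually_mono[OF eventually_ge_at_top[of 1]], simp add: trace_cov_linear)
    then show ?case by (rule convergentI)
  qed
next
  case (add p p')
  then have "convergent (\<lambda>d. trace_cov p q d + trace_cov p' q d)" by (rule convergent_add)
  then obtain L where "(\<lambda>d. trace_cov p q d + trace_cov p' q d) \<longlonglongrightarrow> L"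
    by (auto simp: convergent_def)
  then have "trace_cov (p + p') q \<longlonglongrightarrow> L"
    by (rule Lim_transform_eventually)
      (rule eventually_mono[OF eventually_ge_at_top[of 1]], simp add: trace_cov_linear)
  then show ?case by (rule convergentI)
qed

definition phi :: "('b + 'c) ncpoly \<Rightarrow> complex" where "phi p = lim (mean p)"
definition phi2 :: "('b + 'c) ncpoly \<Rightarrow> ('b + 'c) ncpoly \<Rightarrow> complex" where "phi2 p q = lim (trace_cov p q)"

lemma mean_tendsto: "mean p \<longlonglongrightarrow> phi p"
  unfolding phi_def by (rule convergent_LIMSEQ_iff[THEN iffD1, OF mean_convergent])

lemma trace_cov_tendsto: "trace_cov p q \<longlonglongrightarrow> phi2 p q"
  unfolding phi2_def by (rule convergent_LIMSEQ_iff[THEN iffD1, OF trace_cov_convergent])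

text \<open>Identities that hold in every dimension pass to the limit. In this way the rules for
  \<open>phi\<close> and \<open>phi2\<close> are inherited from matrices.\<close>

lemma lim_eqI:
  fixes f g :: "nat \<Rightarrow> complex"
  assumes "f \<longlonglongrightarrow> a" "g \<longlonglongrightarrow> b" "\<And>d. d \<ge> 1 \<Longrightarrow> f d = g d"
  shows "a = b"
proof -
  have "g \<longlonglongrightarrow> a"
    by (rule Lim_transform_eventually[OF assms(1)], rule eventually_mono[OF eventually_ge_at_top[of 1]])
      (rule assms(3))
  then show ?thesis using assms(2) LIMSEQ_unique by blast
qed

lemma phi_ev: "phi (ev x) = limit_mean x"
  by (rule lim_eqI[OF mean_tendsto tau_tendsto mean_ev])

lemma phi2_ev: "phi2 (ev x) (ev y) = limit_moment {#x, y#}"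
  by (rule lim_eqI[OF trace_cov_tendsto moment_tendsto trace_cov_ev])

lemma phi_add: "phi (p + q) = phi p + phi q"
  by (rule lim_eqI[OF mean_tendsto tendsto_add[OF mean_tendsto mean_tendsto] mean_add])

lemma phi_sc: "phi (ncpoly_sc c p) = c * phi p"
  by (rule lim_eqI[OF mean_tendsto tendsto_mult_left[OF mean_tendsto] mean_sc])

lemma phi2_linear:
  "phi2 (p + q) r = phi2 p r + phi2 q r" "phi2 r (p + q) = phi2 r p + phi2 r q"
  "phi2 (ncpoly_sc c p) r = c * phi2 p r" "phi2 r (ncpoly_sc c p) = c * phi2 r p"
  by (rule lim_eqI[OF trace_cov_tendsto tendsto_add[OF trace_cov_tendsto trace_cov_tendsto]]
      lim_eqI[OF trace_cov_tendsto tendsto_mult_left[OF trace_cov_tendsto]], simp add: trace_cov_linear)+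

lemma phi2_sym: "phi2 p q = phi2 q p"
  by (rule lim_eqI[OF trace_cov_tendsto trace_cov_tendsto]) (simp add: trace_cov_def covariance_def mult.commute)

text \<open>Cyclicity and invariance under transposition hold for matrices of the right size, that
  is, on the sample space; integrals see nothing else.\<close>

lemma trace_equal:
  assumes "\<And>d w. d \<ge> 1 \<Longrightarrow> w \<in> space (M d) \<Longrightarrow> trace_rv d p w = trace_rv d q w"
  shows "phi p = phi q" "phi2 p r = phi2 q r"
proof -
  have "mean p d = mean q d" if "d \<ge> 1" for d
    unfolding mean_def by (rule Bochner_Integration.integral_cong) (simp_all add: assms[OF that])
  then show "phi p = phi q" by (rule lim_eqI[OF mean_tendsto mean_tendsto])
  have "trace_cov p r d = trace_cov q r d" if "d \<ge> 1" for d
    unfolding trace_cov_def covariance_def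
    by (intro arg_cong2[of _ _ _ _ "(-)"] arg_cong2[of _ _ _ _ "(*)"] Bochner_Integration.integral_cong refl)
      (simp_all add: assms[OF that])
  then show "phi2 p r = phi2 q r" by (rule lim_eqI[OF trace_cov_tendsto trace_cov_tendsto])
qed

lemma trace_rv_commute: "d \<ge> 1 \<Longrightarrow> w \<in> space (M d) \<Longrightarrow> trace_rv d (p * q) w = trace_rv d (q * p) w"
  using invariant_pair.T_mult_commute[OF pair] by (simp add: trace_rv_eq)

lemma trace_rv_t: "d \<ge> 1 \<Longrightarrow> w \<in> space (M d) \<Longrightarrow> trace_rv d (ncpoly_t p) w = trace_rv d p w"
  using invariant_pair.T_t[OF pair] by (simp add: trace_rv_eq)

lemma phi_commute: "phi (p * q) = phi (q * p)" and phi2_commute: "phi2 (p * q) r = phi2 (q * p) r"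
  by (rule trace_equal(1), rule trace_rv_commute, assumption+) (rule trace_equal(2), rule trace_rv_commute, assumption+)

lemma phi_t: "phi (ncpoly_t p) = phi p" and phi2_t: "phi2 (ncpoly_t p) r = phi2 p r"
  by (rule trace_equal(1), rule trace_rv_t, assumption+) (rule trace_equal(2), rule trace_rv_t, assumption+)

lemma phi_one: "phi 1 = 1"
proof (rule lim_eqI[OF mean_tendsto tendsto_const])
  fix d :: nat assume d: "d \<ge> 1"
  interpret prob_space "M d" by (rule prob[OF d])
  have "mean 1 d = (LINT w|M d. 1)"
    unfolding mean_def
    by (rule Bochner_Integration.integral_cong)
      (use d in \<open>simp_all add: trace_rv_eq invariant_pair.T_one[OF pair]\<close>)
  then show "mean 1 d = 1" by (simp add: prob_space)
qed

lemma phi2_one: "phi2 1 r = 0"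
proof (rule lim_eqI[OF trace_cov_tendsto tendsto_const])
  fix d :: nat assume d: "d \<ge> 1"
  interpret prob_space "M d" by (rule prob[OF d])
  have 1: "trace_rv d 1 w = of_nat d" if "w \<in> space (M d)" for w
    using d that by (simp add: trace_rv_eq invariant_pair.T_one[OF pair])
  have "trace_cov 1 r d = (LINT w|M d. of_nat d * trace_rv d r w) - (LINT w|M d. of_nat d) * (LINT w|M d. trace_rv d r w)"
    unfolding trace_cov_def covariance_def
    by (intro arg_cong2[of _ _ _ _ "(-)"] arg_cong2[of _ _ _ _ "(*)"] Bochner_Integration.integral_cong refl)
      (simp_all add: 1)
  then show "trace_cov 1 r d = 0" by (simp add: prob_space)
qed

lemma limit_space: "real_second_order_space ncpoly_sc phi phi2 ncpoly_t"
proof -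
  interpret P: vector_space "ncpoly_sc :: complex \<Rightarrow> ('b + 'c) ncpoly \<Rightarrow> _"
    by (rule vector_space_ncpoly_sc)
  interpret C: vector_space "(*) :: complex \<Rightarrow> complex \<Rightarrow> complex"
    by standard (simp_all add: algebra_simps)
  show ?thesis
  proof (intro real_second_order_space.intro real_second_order_space_axioms.intro)
    show "ncpoly_sc c p * q = ncpoly_sc c (p * q)" for c and p q :: "('b + 'c) ncpoly"
      by (simp add: ncpoly_sc_def mult.assoc)
    show "Vector_Spaces.linear ncpoly_sc ncpoly_sc (ncpoly_t :: ('b + 'c) ncpoly \<Rightarrow> _)"
      by unfold_locales (simp_all add: ncpoly_t_add ncpoly_t_sc)
    show "Vector_Spaces.linear ncpoly_sc (*) phi"
      by unfold_locales (simp_all add: phi_add phi_sc)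
    show "Vector_Spaces.linear ncpoly_sc (*) (\<lambda>x. phi2 x y)" "Vector_Spaces.linear ncpoly_sc (*) (phi2 y)" for y
      by (unfold_locales; simp add: phi2_linear)+
    show "phi (x * y) = phi (y * x)" for x y by (rule phi_commute)
    show "phi2 (x * y) z = phi2 (y * x) z" "phi2 z (x * y) = phi2 z (y * x)" for x y z
      unfolding phi2_sym[of z] by (rule phi2_commute)+
    show "phi2 1 x = 0" "phi2 x 1 = 0" for x unfolding phi2_sym[of x] by (rule phi2_one)+
    show "phi2 (ncpoly_t x) y = phi2 x y" for x y by (rule phi2_t)
    then show "phi2 x (ncpoly_t y) = phi2 x y" for x y by (metis phi2_sym)
  qed (use P.vector_space_axioms in \<open>simp_all add: ncpoly_sc_mult_right ncpoly_t_mult ncpoly_t_ncpoly_t phi_one phi_t\<close>)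
qed

text \<open>Wick's rule for the limits is turned back into vanishing of cumulants. Sets of positions
  in \<open>{..<r}\<close> are translated to multisets of items, since items may repeat.\<close>

lemma cumulants_vanish_items:
  assumes r: "r \<ge> 3"
  shows "(\<lambda>d. joint_cumulant (M d) r (\<lambda>k. trace_rv d (ev (x k)))) \<longlonglongrightarrow> 0"
proof -
  interpret limit_family M "\<lambda>d i. trace_rv d (ev (x i))" "{..<r}"
    by (rule limit_family.intro) (simp_all add: prob all_moments_trace_rv)
  have cm: "centred_moment M (\<lambda>d i. trace_rv d (ev (x i))) V d = moment (image_mset x (mset_set V)) d" if d: "d \<ge> 1" for V d
  proof -
    interpret invariant_pair "M d" d "A d" "B d" by (rule pair[OF d])
    show ?thesis
      by (simp add: centred_moment_def moment_def mom_def Y_def trace_rv_eq[OF d] multiset.map_comp comp_def prod_unfold_prod_mset)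
  qed
  have "cumulant_seq {..<r} \<longlonglongrightarrow> (if card {..<r} = 2 then limit_moment (image_mset x (mset_set {..<r})) else 0)"
  proof (rule cumulants_of_moments[where L = "\<lambda>V. limit_moment (image_mset x (mset_set V))"])
    fix V assume "V \<subseteq> {..<r}"
    show "centred_moment M (\<lambda>d i. trace_rv d (ev (x i))) V \<longlonglongrightarrow> limit_moment (image_mset x (mset_set V))"
      by (rule Lim_transform_eventually[OF moment_tendsto], rule eventually_mono[OF eventually_ge_at_top[of 1]])
        (simp add: cm)
  next
    fix V j assume V: "V \<subseteq> {..<r}" "j \<in> V"
    then have fin: "finite V" using finite_subset by blast
    have 1: "mset_set V = add_mset j (mset_set (V - {j}))" using fin V(2) by (simp add: mset_set.remove)
    have "limit_moment (image_mset x (mset_set V)) =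
        (\<Sum>y\<in>#image_mset x (mset_set (V - {j})). limit_moment {#x j, y#} * limit_moment (image_mset x (mset_set (V - {j})) - {#y#}))"
      unfolding 1 image_mset_add_mset by (rule wick)
    also have "\<dots> = (\<Sum>k\<in>V - {j}. limit_moment {#x j, x k#} * limit_moment (image_mset x (mset_set (V - {j})) - {#x k#}))"
      by (simp add: multiset.map_comp comp_def sum_unfold_sum_mset)
    also have "\<dots> = (\<Sum>k\<in>V - {j}. limit_moment (image_mset x (mset_set {j, k})) * limit_moment (image_mset x (mset_set (V - {j, k}))))"
    proof (rule sum.cong[OF refl])
      fix k assume k: "k \<in> V - {j}"
      have "V - {j, k} = V - {j} - {k}" by blast
      moreover have "mset_set (V - {j}) = add_mset k (mset_set (V - {j} - {k}))"
        using k fin by (intro mset_set.remove) auto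
      ultimately have "image_mset x (mset_set (V - {j, k})) = image_mset x (mset_set (V - {j})) - {#x k#}"
        by simp
      then show "limit_moment {#x j, x k#} * limit_moment (image_mset x (mset_set (V - {j})) - {#x k#}) =
          limit_moment (image_mset x (mset_set {j, k})) * limit_moment (image_mset x (mset_set (V - {j, k})))"
        using k by simp
    qed
    finally show "limit_moment (image_mset x (mset_set V)) =
        (\<Sum>k\<in>V - {j}. limit_moment (image_mset x (mset_set {j, k})) * limit_moment (image_mset x (mset_set (V - {j, k}))))" .
  qed (use r in auto)
  then have "cumulant_seq {..<r} \<longlonglongrightarrow> 0" using r by simp
  then show ?thesis
    by (rule Lim_transform_eventually, intro eventually_mono[OF eventually_ge_at_top[of 1]])
      (simp add: cumulant_seq_def prob_space.joint_cumulant_eq[OF prob])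
qed

text \<open>Cumulants are multilinear and items span the polynomials, so items are replaced by
  arbitrary polynomials one argument at a time; in the induction \<open>S\<close> is the set of
  arguments that are already arbitrary.\<close>

lemma cumulants_vanish:
  assumes r: "r \<ge> 3"
  shows "(\<lambda>d. joint_cumulant (M d) r (\<lambda>k. trace_rv d (p k))) \<longlonglongrightarrow> 0"
proof -
  have lin: "joint_cumulant (M d) r (\<lambda>k. trace_rv d ((p(j := ncpoly_sc c q1 + q2)) k)) =
      c * joint_cumulant (M d) r (\<lambda>k. trace_rv d ((p(j := q1)) k)) + 1 * joint_cumulant (M d) r (\<lambda>k. trace_rv d ((p(j := q2)) k))"
    if d: "d \<ge> 1" and j: "j < r" for d j c q1 q2 and p :: "nat \<Rightarrow> ('b + 'c) ncpoly"
  proof -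
    interpret prob_space "M d" by (rule prob[OF d])
    let ?X = "\<lambda>k. trace_rv d ((p(j := ncpoly_sc c q1 + q2)) k)"
    have "set_cumulant (family_moment ?X) {..<r} =
        c * set_cumulant (family_moment (?X(j := trace_rv d q1))) {..<r} + 1 * set_cumulant (family_moment (?X(j := trace_rv d q2))) {..<r}"
      using d j by (intro cumulant_linear) (auto simp: trace_rv_add trace_rv_sc all_moments_trace_rv)
    moreover have "?X(j := trace_rv d q) = (\<lambda>k. trace_rv d ((p(j := q)) k))" for q by (simp add: fun_eq_iff)
    ultimately show ?thesis by (simp add: joint_cumulant_eq)
  qed
  have "\<forall>p. (\<forall>k\<in>{..<r} - S. \<exists>x. p k = ev x) \<longrightarrow> (\<lambda>d. joint_cumulant (M d) r (\<lambda>k. trace_rv d (p k))) \<longlonglongrightarrow> 0"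
    if "finite S" "S \<subseteq> {..<r}" for S
    using that
  proof (induction S)
    case empty
    show ?case
    proof (intro allI impI)
      fix p :: "nat \<Rightarrow> ('b + 'c) ncpoly" assume "\<forall>k\<in>{..<r} - {}. \<exists>x. p k = ev x"
      then obtain x where x: "\<And>k. k < r \<Longrightarrow> p k = ev (x k)" by (metis Diff_empty lessThan_iff)
      have "joint_cumulant (M d) r (\<lambda>k. trace_rv d (ev (x k))) = joint_cumulant (M d) r (\<lambda>k. trace_rv d (p k))" if "d \<ge> 1" for d
        unfolding prob_space.joint_cumulant_eq[OF prob[OF that]]
        by (rule set_cumulant_cong)
          (auto simp: prob_space.family_moment_def[OF prob[OF that]] x intro!: Bochner_Integration.integral_cong prod.cong)
      then show "(\<lambda>d. joint_cumulant (M d) r (\<lambda>k. trace_rv d (p k))) \<longlonglongrightarrow> 0"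
        by (intro Lim_transform_eventually[OF cumulants_vanish_items[OF r, of x]]
            eventually_mono[OF eventually_ge_at_top[of 1]])
    qed
  next
    case (insert j S)
    then have j: "j < r" and IH: "\<And>p. (\<forall>k\<in>{..<r} - S. \<exists>x. p k = ev x) \<Longrightarrow>
        (\<lambda>d. joint_cumulant (M d) r (\<lambda>k. trace_rv d (p k))) \<longlonglongrightarrow> 0" by auto
    show ?case
    proof (intro allI impI)
      fix p :: "nat \<Rightarrow> ('b + 'c) ncpoly" assume p: "\<forall>k\<in>{..<r} - insert j S. \<exists>x. p k = ev x"
      have step: "(\<lambda>d. joint_cumulant (M d) r (\<lambda>k. trace_rv d ((p(j := ncpoly_sc c q1 + q2)) k))) \<longlonglongrightarrow> 0"
        if "(\<lambda>d. joint_cumulant (M d) r (\<lambda>k. trace_rv d ((p(j := q1)) k))) \<longlonglongrightarrow> 0"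
          "(\<lambda>d. joint_cumulant (M d) r (\<lambda>k. trace_rv d ((p(j := q2)) k))) \<longlonglongrightarrow> 0" for c q1 q2
      proof -
        have "(\<lambda>d. c * joint_cumulant (M d) r (\<lambda>k. trace_rv d ((p(j := q1)) k)) +
            1 * joint_cumulant (M d) r (\<lambda>k. trace_rv d ((p(j := q2)) k))) \<longlonglongrightarrow> c * 0 + 1 * 0"
          by (intro tendsto_add tendsto_mult_left that)
        then have "(\<lambda>d. joint_cumulant (M d) r (\<lambda>k. trace_rv d ((p(j := ncpoly_sc c q1 + q2)) k))) \<longlonglongrightarrow> c * 0 + 1 * 0"
          by (rule Lim_transform_eventually, intro eventually_mono[OF eventually_ge_at_top[of 1]])
            (rule lin[OF _ j, symmetric])
        then show ?thesis by simp
      qed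
      have item: "(\<lambda>d. joint_cumulant (M d) r (\<lambda>k. trace_rv d ((p(j := ev x)) k))) \<longlonglongrightarrow> 0" for x
        using p by (intro IH) auto
      have "(\<lambda>d. joint_cumulant (M d) r (\<lambda>k. trace_rv d ((p(j := q)) k))) \<longlonglongrightarrow> 0" for q
      proof (induction q rule: ncpoly_induct)
        case (single w c)
        \<comment> \<open>This brings a multiple of an item to the form required by
          \<open>step\<close>, with both polynomials equal to that item.\<close>
        have "Poly_Mapping.single w c = ncpoly_sc (c - 1) (ev (word_item w)) + ev (word_item w)"
          by (simp add: ev_word_item ncpoly_sc_single flip: single_add)
        then show ?case using step[OF item item, of "c - 1"] by simp
      next
        case (add q1 q2)
        have "q1 + q2 = ncpoly_sc 1 q1 + q2" by (simp add: ncpoly_sc_def)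
        then show ?case using step[OF add, of 1] by simp
      qed
      from this[of "p j"] show "(\<lambda>d. joint_cumulant (M d) r (\<lambda>k. trace_rv d (p k))) \<longlonglongrightarrow> 0" by simp
    qed
  qed
  from this[of "{..<r}"] show ?thesis by auto
qed

text \<open>Evaluation at the variables themselves is the identity, so the limits defining
  \<open>phi\<close> and \<open>phi2\<close> are literally the required ones.\<close>

lemma joint_limit:
  "real_second_order_limit M (\<lambda>d. case_sum (A d) (B d)) ncpoly_sc phi phi2 ncpoly_t ncpoly_var"
  unfolding real_second_order_limit_def ncpoly_eval_var
  using limit_space mean_tendsto[unfolded mean_def[abs_def] trace_rv_def]
    trace_cov_tendsto[unfolded trace_cov_def[abs_def] trace_rv_def[abs_def]] cumulants_vanish[unfolded trace_rv_def[abs_def]]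
  by blast

end

section \<open>Real second order freeness\<close>

definition unroll :: "('i, 'j) blocks \<Rightarrow> ('i + 'j) ncpoly list" where
  "unroll l = concat (map (\<lambda>(a, b). [iA a, iB b]) l)"

lemma unroll_simps [simp]: "unroll [] = []" "unroll ((a, b) # l) = iA a # iB b # unroll l" "unroll (l @ l') = unroll l @ unroll l'"
  by (simp_all add: unroll_def)

lemma length_unroll [simp]: "length (unroll l) = 2 * length l"
  by (induction l) auto

lemma prod_list_unroll: "prod_list (unroll l) = block_word l"
  by (induction l) (auto simp: mult.assoc)

lemma rotate_unroll: "k < length q \<Longrightarrow> rotate (2 * k) (unroll q) = unroll (drop k q @ take k q)"
proof -
  assume k: "k < length q"
  have d: "drop (2 * k) (unroll q) = unroll (drop k q)" for k q
  proof (induction q arbitrary: k)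
    case (Cons ab q)
    then show ?case by (cases ab; cases k) auto
  qed simp
  have t: "take (2 * k) (unroll q) = unroll (take k q)" for k q
  proof (induction q arbitrary: k)
    case (Cons ab q)
    then show ?case by (cases ab; cases k) auto
  qed simp
  show ?thesis using k by (simp add: rotate_drop_take d t)
qed

text \<open>The right-hand side of the second order freeness formula, with the values of the state
  replaced by arbitrary arrays, so that rotations of either tuple can be studied apart from the
  algebra.\<close>

definition pairing_sum :: "(nat \<Rightarrow> nat \<Rightarrow> complex) \<Rightarrow> (nat \<Rightarrow> nat \<Rightarrow> complex) \<Rightarrow> nat \<Rightarrow> complex" where
  "pairing_sum f g n = (\<Sum>k<n. (\<Prod>i<n. f i ((k + n - i) mod n)) + (\<Prod>i<n. g i ((i + n - k) mod n)))"

lemma sum_shift_periodic: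
  fixes f :: "nat \<Rightarrow> complex"
  assumes "f n = f 0"
  shows "(\<Sum>k<n. f (Suc k)) = (\<Sum>k<n. f k)"
  using sum.lessThan_Suc_shift[of f n] sum.lessThan_Suc[of f n] assms by simp

lemma Suc_mod_bij: "n > 0 \<Longrightarrow> bij_betw (\<lambda>i. Suc i mod n) {..<n} {..<n}"
proof -
  assume n: "n > 0"
  have "inj_on (\<lambda>i. Suc i mod n) {..<n}"
  proof (rule inj_onI)
    fix i j assume ij: "i \<in> {..<n}" "j \<in> {..<n}" "Suc i mod n = Suc j mod n"
    have "Suc k mod n = (if Suc k = n then 0 else Suc k)" if "k < n" for k using that by auto
    from this[of i] this[of j] ij show "i = j" by (simp split: if_splits)
  qed
  moreover from this have "(\<lambda>i. Suc i mod n) ` {..<n} = {..<n}"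
    using n by (intro endo_inj_surj) auto
  ultimately show ?thesis by (simp add: bij_betw_def)
qed

text \<open>Rotating the first tuple replaces \<open>k\<close> by \<open>Suc k\<close> in both
  products, and the summands are periodic in \<open>k\<close>. This reduces tuples that begin in the
  second algebra to those that begin in the first.\<close>

lemma pairing_sum_rotate_left:
  "pairing_sum (\<lambda>i. f (Suc i mod n)) (\<lambda>i. g (Suc i mod n)) n = pairing_sum f g n"
proof (cases "n = 0")
  case False
  then have n: "n > 0" by simp
  have reidx: "(\<Prod>i<n. h (Suc i mod n)) = (\<Prod>i<n. h i)" for h :: "nat \<Rightarrow> complex"
    using prod.reindex_bij_betw[OF Suc_mod_bij[OF n], of h] .
  have f: "(\<Prod>i<n. f (Suc i mod n) ((k + n - i) mod n)) = (\<Prod>i<n. f i ((Suc k + n - i) mod n))" if "k < n" for k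
  proof -
    have "(\<Prod>i<n. f (Suc i mod n) ((k + n - i) mod n)) = (\<Prod>i<n. f (Suc i mod n) ((Suc k + n - Suc i mod n) mod n))"
    proof (rule prod.cong[OF refl])
      fix i assume i: "i \<in> {..<n}"
      have "(k + n - i) mod n = (Suc k + n - Suc i mod n) mod n"
      proof (cases "Suc i = n")
        case True
        then have "k + n - i = Suc k" "Suc k + n - Suc i mod n = Suc k + n" by auto
        then show ?thesis by (simp only: mod_add_self2)
      next
        case False
        then have "Suc i mod n = Suc i" using i by simp
        then show ?thesis by simp
      qed
      then show "f (Suc i mod n) ((k + n - i) mod n) = f (Suc i mod n) ((Suc k + n - Suc i mod n) mod n)" by simp
    qed
    then show ?thesis using reidx[of "\<lambda>i. f i ((Suc k + n - i) mod n)"] by simp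
  qed
  have g: "(\<Prod>i<n. g (Suc i mod n) ((i + n - k) mod n)) = (\<Prod>i<n. g i ((i + n - Suc k) mod n))" if k: "k < n" for k
  proof -
    have "(\<Prod>i<n. g (Suc i mod n) ((i + n - k) mod n)) = (\<Prod>i<n. g (Suc i mod n) ((Suc i mod n + n - Suc k) mod n))"
    proof (rule prod.cong[OF refl])
      fix i assume i: "i \<in> {..<n}"
      have "(i + n - k) mod n = (Suc i mod n + n - Suc k) mod n"
      proof (cases "Suc i = n")
        case True
        then have "i + n - k = n + (n - Suc k)" "Suc i mod n + n - Suc k = n - Suc k" using k by auto
        then show ?thesis by simp
      next
        case False
        then have "Suc i mod n = Suc i" using i by simp
        then show ?thesis by simp
      qed
      then show "g (Suc i mod n) ((i + n - k) mod n) = g (Suc i mod n) ((Suc i mod n + n - Suc k) mod n)" by simp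
    qed
    then show ?thesis using reidx[of "\<lambda>i. g i ((i + n - Suc k) mod n)"] by simp
  qed
  have "pairing_sum (\<lambda>i. f (Suc i mod n)) (\<lambda>i. g (Suc i mod n)) n =
      (\<Sum>k<n. (\<Prod>i<n. f i ((Suc k + n - i) mod n)) + (\<Prod>i<n. g i ((i + n - Suc k) mod n)))"
    unfolding pairing_sum_def by (intro sum.cong refl) (use f g in auto)
  also have "\<dots> = pairing_sum f g n"
    unfolding pairing_sum_def
  proof (rule sum_shift_periodic)
    have "(\<Prod>i<n. f i ((n + n - i) mod n)) = (\<Prod>i<n. f i ((0 + n - i) mod n))"
    proof (rule prod.cong[OF refl])
      fix i assume "i \<in> {..<n}"
      then have "n + n - i = n + (n - i)" by auto
      then show "f i ((n + n - i) mod n) = f i ((0 + n - i) mod n)" by simp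
    qed
    then show "(\<Prod>i<n. f i ((n + n - i) mod n)) + (\<Prod>i<n. g i ((i + n - n) mod n)) =
        (\<Prod>i<n. f i ((0 + n - i) mod n)) + (\<Prod>i<n. g i ((i + n - 0) mod n))" by simp
  qed
  finally show ?thesis .
qed (simp add: pairing_sum_def)

text \<open>Here the two products are shifted in opposite directions, so they are treated as
  separate sums.\<close>

lemma pairing_sum_rotate_right:
  "pairing_sum (\<lambda>i j. f i (Suc j mod n)) (\<lambda>i j. g i (Suc j mod n)) n = pairing_sum f g n"
proof (cases "n = 0")
  case False
  have f: "(\<Sum>k<n. \<Prod>i<n. f i (Suc ((k + n - i) mod n) mod n)) = (\<Sum>k<n. \<Prod>i<n. f i ((k + n - i) mod n))"
  proof -
    have "(\<Sum>k<n. \<Prod>i<n. f i (Suc ((k + n - i) mod n) mod n)) = (\<Sum>k<n. \<Prod>i<n. f i ((Suc k + n - i) mod n))"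
    proof (intro sum.cong prod.cong refl)
      fix k i assume "i \<in> {..<n}"
      then have "Suc (k + n - i) = Suc k + n - i" by auto
      then show "f i (Suc ((k + n - i) mod n) mod n) = f i ((Suc k + n - i) mod n)" by (simp add: mod_Suc_eq)
    qed
    also have "\<dots> = (\<Sum>k<n. \<Prod>i<n. f i ((k + n - i) mod n))"
    proof (rule sum_shift_periodic, rule prod.cong[OF refl])
      fix i assume "i \<in> {..<n}"
      then have "n + n - i = n + (n - i)" by auto
      then show "f i ((n + n - i) mod n) = f i ((0 + n - i) mod n)" by simp
    qed
    finally show ?thesis .
  qed
  have g: "(\<Sum>k<n. \<Prod>i<n. g i ((i + n - k) mod n)) = (\<Sum>k<n. \<Prod>i<n. g i (Suc ((i + n - k) mod n) mod n))"
  proof -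
    have "(\<Sum>k<n. \<Prod>i<n. g i ((i + n - k) mod n)) = (\<Sum>k<n. \<Prod>i<n. g i (Suc ((i + n - Suc k) mod n) mod n))"
    proof (intro sum.cong prod.cong refl)
      fix k i assume "k \<in> {..<n}"
      then have "Suc (i + n - Suc k) = i + n - k" by auto
      then show "g i ((i + n - k) mod n) = g i (Suc ((i + n - Suc k) mod n) mod n)" by (simp add: mod_Suc_eq)
    qed
    also have "\<dots> = (\<Sum>k<n. \<Prod>i<n. g i (Suc ((i + n - k) mod n) mod n))"
      by (rule sum_shift_periodic) simp
    finally show ?thesis .
  qed
  show ?thesis unfolding pairing_sum_def sum.distrib f g ..
qed (simp add: pairing_sum_def)

lemma sum_even_only:
  fixes f :: "nat \<Rightarrow> complex"
  assumes "\<And>k. k < 2 * m \<Longrightarrow> odd k \<Longrightarrow> f k = 0"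
  shows "(\<Sum>k<2 * m. f k) = (\<Sum>k<m. f (2 * k))"
  using assms by (induction m) auto

text \<open>Reverses the sense of rotation: the loop terms and the transposed half of the pairing
  sum count the rotations of the second tuple in opposite directions.\<close>

lemma sum_reverse_mod:
  fixes f :: "nat \<Rightarrow> complex"
  assumes "\<And>k. f (k mod m) = f k"
  shows "(\<Sum>k<m. f (m - k)) = (\<Sum>k<m. f k)"
proof -
  have "(\<Sum>k<m. f (m - k)) = (\<Sum>k<m. f (Suc k))"
    using sum.nat_diff_reindex[of "\<lambda>k. f (Suc k)" m] by (simp add: Suc_diff_Suc cong: sum.cong_simp)
  also have "\<dots> = (\<Sum>k<m. f k)"
    using assms[of m] by (intro sum_shift_periodic) simp
  finally show ?thesis .
qed

section \<open>Freeness of centred alternating words\<close>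

context asymptotic_base
begin

definition Alg :: "bool \<Rightarrow> ('b + 'c) ncpoly set" where
  "Alg b = (if b then range iA else range iB)"

lemma Alg_mult: "x \<in> Alg b \<Longrightarrow> y \<in> Alg b \<Longrightarrow> x * y \<in> Alg b"
  by (cases b) (auto simp: Alg_def simp flip: emb_mult)

lemma Alg_t: "x \<in> Alg b \<Longrightarrow> ncpoly_t x \<in> Alg b"
  by (cases b) (auto simp: Alg_def simp flip: emb_t)

lemma Alg_centre: "x \<in> Alg b \<Longrightarrow> x + ncpoly_sc c 1 \<in> Alg b"
proof -
  have "iA a + ncpoly_sc c 1 = (iA (a + ncpoly_sc c 1) :: ('b + 'c) ncpoly)"
    "iB b + ncpoly_sc c 1 = (iB (b + ncpoly_sc c 1) :: ('b + 'c) ncpoly)" for a b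
    by (simp_all add: emb_add emb_sc emb_one)
  then show "x \<in> Alg b \<Longrightarrow> x + ncpoly_sc c 1 \<in> Alg b" by (cases b) (auto simp: Alg_def)
qed

fun alternating :: "bool \<Rightarrow> ('b + 'c) ncpoly list \<Rightarrow> bool" where
  "alternating b [] \<longleftrightarrow> True"
| "alternating b (x # xs) \<longleftrightarrow> x \<in> Alg b \<and> phi x = 0 \<and> alternating (\<not> b) xs"

lemma alternating_append:
  "alternating b (xs @ ys) \<longleftrightarrow> alternating b xs \<and> alternating (if even (length xs) then b else \<not> b) ys"
  by (induction xs arbitrary: b) auto

lemma alternating_rev: "alternating b xs \<Longrightarrow> alternating (if even (length xs) then \<not> b else b) (rev xs)"
proof (induction xs arbitrary: b)
  case (Cons x xs)
  then show ?case using Cons.IH[of "\<not> b"]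
    by (cases "even (length xs)") (simp_all add: alternating_append)
qed simp

lemma alternating_t: "alternating b xs \<Longrightarrow> alternating b (map ncpoly_t xs)"
  by (induction xs arbitrary: b) (auto simp: Alg_t phi_t)

lemma alternating_rotate1: "alternating b xs \<Longrightarrow> even (length xs) \<Longrightarrow> alternating (\<not> b) (rotate1 xs)"
  by (cases xs) (auto simp: alternating_append split: if_splits)

lemma alternating_rotate:
  "alternating b xs \<Longrightarrow> even (length xs) \<Longrightarrow> alternating (if even k then b else \<not> b) (rotate k xs)"
  by (induction k) (auto dest: alternating_rotate1 split: if_splits)

lemma alternating_unroll:
  assumes "alternating True xs" "even (length xs)"
  shows "\<exists>l. xs = unroll l"
  using assms
proof (induction xs rule: induct_list012)
  case 1
  then show ?case by (intro exI[of _ "[]"]) simp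
next
  case (3 x y zs)
  then obtain l where "zs = unroll l" by auto
  moreover obtain a b where "x = iA a" "y = iB b" using 3 by (auto simp: Alg_def)
  ultimately show ?case by (intro exI[of _ "(a, b) # l"]) simp
qed simp

lemma alternating_take_drop:
  assumes l: "alternating True (unroll l)" and i: "i < length l"
  shows "alternating True (unroll (take i l))" "alternating True (unroll (drop i l))"
    "alternating True (unroll (take i l) @ [iA (fst (l ! i))])"
    "alternating False (iB (snd (l ! i)) # unroll (drop (Suc i) l))"
proof -
  define a b r where "a = fst (l ! i)" and "b = snd (l ! i)" and "r = drop (Suc i) l"
  have s: "l = take i l @ (a, b) # r"
    using id_take_nth_drop[OF i] by (simp add: a_def b_def r_def)
  have "alternating True (unroll (take i l @ (a, b) # r))"
    using l s by simp
  then have "alternating True (unroll (take i l))"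
    "alternating True (unroll (take i l) @ [iA a])" "alternating False (iB b # unroll r)"
    by (simp_all add: alternating_append)
  then show "alternating True (unroll (take i l))"
    "alternating True (unroll (take i l) @ [iA (fst (l ! i))])"
    "alternating False (iB (snd (l ! i)) # unroll (drop (Suc i) l))"
    unfolding a_def b_def r_def by auto
  have "alternating True (unroll (take i l) @ unroll (drop i l))"
    using l by (simp flip: unroll_simps(3))
  then show "alternating True (unroll (drop i l))" by (simp add: alternating_append)
qed

lemma phi_prepend_A: "phi (ev (prepend_A a l)) = phi (block_word l * iA a)"
  by (rule trace_equal(1)) (simp add: trace_rv_eq invariant_pair.T_prepend_A[OF pair])

lemma phi_prepend_B: "phi (ev (prepend_B b l)) = phi (iB b * block_word l)"
  by (rule trace_equal(1)) (simp add: trace_rv_eq invariant_pair.T_prepend_B[OF pair])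

text \<open>Each factor is the limiting trace of a shorter centred alternating word. The merged
  items are not of this form, but undoing the cyclic absorption turns them into alternating words of
  odd length.\<close>

lemma quad_vanishes:
  assumes l: "alternating True (unroll l)"
    and short: "\<And>b xs. alternating b xs \<Longrightarrow> xs \<noteq> [] \<Longrightarrow> length xs < 2 * length l \<Longrightarrow> phi (prod_list xs) = 0"
    and q: "(s, U, V) \<in> set (quad l)"
  shows "limit_mean U = 0 \<and> limit_mean V = 0"
proof -
  from q obtain i where i: "i < length l"
    and c: "(U = prepend_A (fst (l ! i)) (take i l) \<and> V = prepend_B (snd (l ! i)) (drop (Suc i) l)) \<or>
      (i \<noteq> 0 \<and> U = Mix (take i l) \<and> V = Mix (drop i l))"
    unfolding quad_def by (fastforce split: if_splits)
  note alt = alternating_take_drop[OF l i]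
  have "phi (block_word (take i l) * iA (fst (l ! i))) = 0"
    using short[OF alt(3)] i by (simp add: prod_list_unroll)
  moreover have "phi (iB (snd (l ! i)) * block_word (drop (Suc i) l)) = 0"
    using short[OF alt(4)] i by (simp add: prod_list_unroll)
  moreover have "phi (block_word (take i l)) = 0 \<and> phi (block_word (drop i l)) = 0" if "i \<noteq> 0"
  proof -
    have "unroll (take i l) \<noteq> []" "unroll (drop i l) \<noteq> []"
      using that i by (auto simp flip: length_0_conv)
    then show ?thesis
      using short[OF alt(1)] short[OF alt(2)] i that by (simp add: prod_list_unroll)
  qed
  ultimately show ?thesis
    using c phi_prepend_A phi_prepend_B by (auto simp flip: phi_ev)
qed

text \<open>The standard reduction in free probability: a letter is replaced by its centred part
  plus a scalar.\<close>

lemma phi_diff_scalar: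
  "phi (u * y) = phi ((u + ncpoly_sc (- phi u) 1) * y) + phi u * phi y" "phi (u + ncpoly_sc (- phi u) 1) = 0"
  and phi_middle: "phi (x * u * y) = phi (x * (u + ncpoly_sc (- phi u) 1) * y) + phi u * phi (x * y)"
proof -
  have "(u + ncpoly_sc (- phi u) 1) * y = u * y + ncpoly_sc (- phi u) y" for y
    by (simp add: distrib_right ncpoly_sc_def)
  then show "phi (u * y) = phi ((u + ncpoly_sc (- phi u) 1) * y) + phi u * phi y" by (simp add: phi_add phi_sc)
  show "phi (u + ncpoly_sc (- phi u) 1) = 0" by (simp add: phi_add phi_sc phi_one)
  have "x * (u + ncpoly_sc (- phi u) 1) * y = x * u * y + ncpoly_sc (- phi u) (x * y)"
    using ncpoly_sc_mult_right[of x "- phi u" 1]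
    by (simp add: distrib_left distrib_right) (simp add: ncpoly_sc_def mult.assoc)
  then show "phi (x * u * y) = phi (x * (u + ncpoly_sc (- phi u) 1) * y) + phi u * phi (x * y)"
    by (simp add: phi_add phi_sc)
qed

text \<open>A word of even length is, up to rotation, a block word, whose limiting mean is a sum of
  products of vanishing means. In a word of odd length at least 3 the first and the last letter lie
  in one algebra; merging them cyclically and centring leaves two shorter alternating words.\<close>

lemma freeness: "alternating b xs \<Longrightarrow> xs \<noteq> [] \<Longrightarrow> phi (prod_list xs) = 0"
proof (induction "length xs" arbitrary: b xs rule: less_induct)
  case less
  have even_True: "phi (prod_list ys) = 0"
    if ys: "alternating True ys" "even (length ys)" "length ys = length xs" for ys
  proof -
    obtain l where l: "ys = unroll l" using alternating_unroll[OF ys(1,2)] by blast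
    then have ne: "l \<noteq> []" using ys(3) less.prems(2) by auto
    have "phi (block_word l) = (\<Sum>(s, U, V)\<leftarrow>quad l. s * (limit_mean U * limit_mean V))"
      using limit_mean_dyson[OF ne] phi_ev[of "Mix l"] by simp
    also have "\<dots> = (\<Sum>z\<leftarrow>quad l. 0)"
    proof (intro arg_cong[of _ _ sum_list] map_cong refl)
      fix z assume z: "z \<in> set (quad l)"
      obtain s U V where zz: "z = (s, U, V)" by (cases z)
      have "limit_mean U = 0 \<and> limit_mean V = 0"
        by (rule quad_vanishes[OF _ _ z[unfolded zz]]) (use ys l less.hyps in auto)
      then show "(case z of (s, U, V) \<Rightarrow> s * (limit_mean U * limit_mean V)) = 0" by (simp add: zz)
    qed
    also have "\<dots> = 0" by (simp add: sum_list_triv)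
    finally show ?thesis by (simp add: l prod_list_unroll)
  qed
  show ?case
  proof (cases "even (length xs)")
    case True
    show ?thesis
    proof (cases b)
      case True
      then show ?thesis using even_True[of xs] less.prems \<open>even (length xs)\<close> by simp
    next
      case False
      obtain x ys where xs: "xs = x # ys" using less.prems by (cases xs) auto
      have "alternating True (rotate1 xs)" using alternating_rotate1[OF less.prems(1) \<open>even (length xs)\<close>] False by simp
      then have "phi (prod_list (rotate1 xs)) = 0" using \<open>even (length xs)\<close> by (intro even_True) auto
      then show ?thesis using phi_commute[of x "prod_list ys"] by (simp add: xs)
    qed
  next
    case False
    obtain x ys where xs: "xs = x # ys" using less.prems by (cases xs) auto
    show ?thesis
    proof (cases "ys = []")
      case True
      then show ?thesis using less.prems xs by simp
    next
      case ne: False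
      then obtain zs z where ys: "ys = zs @ [z]" by (metis rev_exhaust)
      have ev: "odd (length zs)" using False by (simp add: xs ys)
      then have zs: "zs \<noteq> []" by auto
      define u where "u = z * x"
      have alt: "x \<in> Alg b" "z \<in> Alg b" "alternating (\<not> b) zs"
        using less.prems(1) ev by (auto simp: xs ys alternating_append split: if_splits)
      have "phi (prod_list xs) = phi (u * prod_list zs)"
        using phi_commute[of "x * prod_list zs" z] by (simp add: xs ys u_def mult.assoc)
      also have "\<dots> = phi (prod_list ((u + ncpoly_sc (- phi u) 1) # zs)) + phi u * phi (prod_list zs)"
        by (simp add: phi_diff_scalar(1)[of u])
      also have "phi (prod_list ((u + ncpoly_sc (- phi u) 1) # zs)) = 0"
        using alt by (intro less.hyps[of _ b]) (auto simp: xs ys u_def phi_diff_scalar(2) Alg_centre Alg_mult)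
      also have "phi (prod_list zs) = 0"
        using alt zs by (intro less.hyps[of _ "\<not> b"]) (auto simp: xs ys)
      finally show ?thesis by simp
    qed
  qed
qed

text \<open>Two words multiplied at their centres cancel pairwise, from the inside out.\<close>

lemma matching:
  assumes "alternating b xs" "alternating b ys"
  shows "phi (prod_list (rev xs) * prod_list ys) =
    (if length xs = length ys then \<Prod>i<length xs. phi (xs ! i * ys ! i) else 0)"
  using assms
proof (induction xs arbitrary: b ys)
  case Nil
  then show ?case using freeness[of b ys] by (cases ys) (auto simp: phi_one)
next
  case (Cons x xs)
  show ?case
  proof (cases ys)
    case Nil
    have "phi (prod_list (rev (x # xs))) = 0"
      by (rule freeness[OF alternating_rev[OF Cons.prems(1)]]) simp
    then show ?thesis by (simp add: Nil)
  next
    case (Cons y ys')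
    \<comment> \<open>The innermost pair. With its centred part the word alternates and has mean 0
      by freeness, so only the scalar \<open>phi u\<close> remains.\<close>
    define u where "u = x * y"
    have alt: "alternating (\<not> b) xs" "alternating (\<not> b) ys'" "u \<in> Alg b"
      using Cons.prems Cons by (auto simp: u_def Alg_mult)
    have "alternating (if even (length xs) then b else \<not> b) (rev xs)"
      using alternating_rev[OF alt(1)] by (simp split: if_splits)
    then have "alternating (if even (length xs) then b else \<not> b) (rev xs @ (u + ncpoly_sc (- phi u) 1) # ys')"
      using alt by (auto simp: alternating_append phi_diff_scalar(2) Alg_centre split: if_splits)
    then have 0: "phi (prod_list (rev xs @ (u + ncpoly_sc (- phi u) 1) # ys')) = 0"
      by (rule freeness) simp
    have "phi (prod_list (rev (x # xs)) * prod_list ys) = phi (prod_list (rev xs) * u * prod_list ys')"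
      by (simp add: Cons u_def mult.assoc)
    also have "\<dots> = phi u * phi (prod_list (rev xs) * prod_list ys')"
      using phi_middle[of "prod_list (rev xs)" u "prod_list ys'"] 0 by (simp add: mult.assoc)
    also have "\<dots> = (if length xs = length ys' then phi u * (\<Prod>i<length xs. phi (xs ! i * ys' ! i)) else 0)"
      unfolding Cons.IH[OF alt(1,2)] by simp
    also have "\<dots> = (if length (x # xs) = length ys then \<Prod>i<length (x # xs). phi ((x # xs) ! i * ys ! i) else 0)"
      by (simp add: Cons prod.lessThan_Suc_shift u_def del: prod.lessThan_Suc)
    finally show ?thesis .
  qed
qed

text \<open>All quadratic terms contain means that vanish by freeness, so only the terms that merge
  the two words are left.\<close>

lemma phi2_cross:
  assumes l: "alternating True (unroll l)" "l \<noteq> []"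
  shows "phi2 (block_word l) (ev y) = (\<Sum>(s, U)\<leftarrow>cross l y. s * limit_mean U)"
proof -
  have "(\<Sum>(s, U, V)\<leftarrow>quad l. s * (limit_mean U * limit_moment {#V, y#} + limit_mean V * limit_moment {#U, y#})) = (\<Sum>z\<leftarrow>quad l. 0)"
  proof (intro arg_cong[of _ _ sum_list] map_cong refl)
    fix z assume z: "z \<in> set (quad l)"
    obtain s U V where zz: "z = (s, U, V)" by (cases z)
    have "limit_mean U = 0 \<and> limit_mean V = 0"
      by (rule quad_vanishes[OF l(1) _ z[unfolded zz]]) (rule freeness)
    then show "(case z of (s, U, V) \<Rightarrow> s * (limit_mean U * limit_moment {#V, y#} + limit_mean V * limit_moment {#U, y#})) = 0" by (simp add: zz)
  qed
  then show ?thesis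
    using limit_moment_pair[OF l(2), of y] phi2_ev[of "Mix l" y] by (simp add: sum_list_triv)
qed

text \<open>One-family traces have no cross terms with any word.\<close>

lemma phi2_pure: "alternating True (unroll l) \<Longrightarrow> l \<noteq> [] \<Longrightarrow> x \<in> Alg b \<Longrightarrow> phi2 (block_word l) x = 0"
  using phi2_cross[of l "PA a" for a] phi2_cross[of l "PB b" for b] by (cases b) (auto simp: Alg_def)

text \<open>By independence the covariance is 0 already in every dimension.\<close>

lemma phi2_different: "x \<in> Alg True \<Longrightarrow> y \<in> Alg False \<Longrightarrow> phi2 x y = 0"
proof -
  assume "x \<in> Alg True" "y \<in> Alg False"
  then obtain a b where xy: "x = ev (PA a)" "y = ev (PB b)" by (auto simp: Alg_def)
  have "moment {#PA a, PB b#} d = 0" if d: "d \<ge> 1" for d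
  proof -
    interpret invariant_pair "M d" d "A d" "B d" by (rule pair[OF d])
    show ?thesis using mom_split[of "{#a#}" "{#b#}"] by (simp add: moment_def add_mset_commute)
  qed
  then have "limit_moment {#PA a, PB b#} = 0" by (rule lim_eqI[OF moment_tendsto tendsto_const])
  then show ?thesis unfolding xy phi2_ev .
qed

lemma phi_odd: "x \<in> Alg b \<Longrightarrow> y \<in> Alg (\<not> b) \<Longrightarrow> phi x = 0 \<Longrightarrow> phi y = 0 \<Longrightarrow> phi (x * y) = 0"
  using freeness[of b "[x, y]"] by simp

text \<open>Of the four merged words for each block of \<open>q\<close>, two alternate throughout
  and vanish by freeness. In the other two, letters of the same family meet at both junctions, which
  is the situation of \<open>matching\<close>.\<close>

lemma phi2_words:
  assumes l: "alternating True (unroll l)" "l \<noteq> []" and q: "alternating True (unroll q)" "q \<noteq> []"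
  shows "phi2 (block_word l) (block_word q) = (\<Sum>k<length q.
    phi (block_word l * ncpoly_t (prod_list (rotate (2 * k) (unroll q)))) +
    phi (block_word l * prod_list (rotate (Suc (2 * k)) (unroll q))))"
proof -
  have cross_term: "(\<Sum>(s, U)\<leftarrow>(let c = fst (q ! k); b = snd (q ! k); r = drop (Suc k) q @ take k q in
     [(-1, Mix (l @ (c, b) # r)),
      (1, prepend_A (ncpoly_t c) (append_letter l (t_head b r) @ t_blocks b r)),
      (1, prepend_A c (append_letter l b @ r)),
      (-1, Mix (l @ (ncpoly_t c, t_head b r) # t_blocks b r))]). s * limit_mean U) =
    phi (block_word l * ncpoly_t (prod_list (rotate (2 * k) (unroll q)))) +
    phi (block_word l * prod_list (rotate (Suc (2 * k)) (unroll q)))" if k: "k < length q" for k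
  proof -
    define c b r where "c = fst (q ! k)" and "b = snd (q ! k)" and "r = drop (Suc k) q @ take k q"
    have "drop k q = (c, b) # drop (Suc k) q" using Cons_nth_drop_Suc[OF k] by (simp add: c_def b_def)
    then have rot: "rotate (2 * k) (unroll q) = iA c # iB b # unroll r"
      using rotate_unroll[OF k] by (simp add: r_def)
    then have rot': "rotate (Suc (2 * k)) (unroll q) = iB b # unroll r @ [iA c]" by simp
    have alt: "alternating True (rotate (2 * k) (unroll q))" "alternating False (rotate (Suc (2 * k)) (unroll q))"
      using alternating_rotate[OF q(1), of "2 * k"] alternating_rotate[OF q(1), of "Suc (2 * k)"] by auto
    have t1: "limit_mean (Mix (l @ (c, b) # r)) = 0"
    proof -
      have "alternating True (unroll l @ rotate (2 * k) (unroll q))" using l(1) alt(1) by (simp add: alternating_append)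
      then have "phi (prod_list (unroll (l @ (c, b) # r))) = 0" by (intro freeness[of True]) (simp_all add: rot)
      then show ?thesis unfolding prod_list_unroll by (simp add: phi_ev[symmetric])
    qed
    have t: "ncpoly_t (iB b * block_word r) = iB (t_head b r) * block_word (t_blocks b r)" by (rule ncpoly_t_block_word)
    have t2: "limit_mean (prepend_A (ncpoly_t c) (append_letter l (t_head b r) @ t_blocks b r)) =
        phi (block_word l * ncpoly_t (prod_list (rotate (2 * k) (unroll q))))"
      unfolding phi_ev[symmetric] phi_prepend_A rot
      by (simp add: prod_list_unroll ncpoly_t_mult[of "iA c"] t emb_t block_word_append_letter l(2) mult.assoc)
    have t3: "limit_mean (prepend_A c (append_letter l b @ r)) = phi (block_word l * prod_list (rotate (Suc (2 * k)) (unroll q)))"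
      unfolding phi_ev[symmetric] phi_prepend_A rot'
      by (simp add: prod_list_unroll block_word_append_letter l(2) mult.assoc)
    \<comment> \<open>Reversing a word of even length that starts in the second algebra makes it
      start in the first, so it continues \<open>l\<close> without a break.\<close>
    have t4: "limit_mean (Mix (l @ (ncpoly_t c, t_head b r) # t_blocks b r)) = 0"
    proof -
      define ws where "ws = rev (map ncpoly_t (rotate (Suc (2 * k)) (unroll q)))"
      have tp: "ncpoly_t (prod_list xs) = prod_list (rev (map ncpoly_t xs))" for xs :: "('b + 'c) ncpoly list"
        by (induction xs) (simp_all add: ncpoly_t_mult real_second_order_space.t_one[OF limit_space])
      have "alternating True ws"
        using alternating_rev[OF alternating_t[OF alt(2)]] by (simp add: ws_def)
      then have "alternating True (unroll l @ ws)" using l(1) by (simp add: alternating_append)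
      moreover have "unroll l @ ws \<noteq> []" using l(2) by (cases l) auto
      ultimately have "phi (prod_list (unroll l @ ws)) = 0" by (rule freeness)
      moreover have "prod_list (unroll l @ ws) = block_word (l @ (ncpoly_t c, t_head b r) # t_blocks b r)"
      proof -
        have "prod_list ws = ncpoly_t (iB b * block_word r * iA c)"
          by (simp only: ws_def tp[symmetric] rot') (simp add: prod_list_unroll mult.assoc)
        also have "\<dots> = iA (ncpoly_t c) * (iB (t_head b r) * block_word (t_blocks b r))"
          by (simp only: ncpoly_t_mult[of "iB b * block_word r"] t emb_t)
        finally show ?thesis by (simp add: prod_list_unroll mult.assoc)
      qed
      ultimately show ?thesis by (simp add: phi_ev[symmetric])
    qed
    show ?thesis
      unfolding c_def[symmetric] b_def[symmetric] r_def[symmetric] Let_def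
      by (simp add: t1 t2 t3 t4)
  qed
  have "phi2 (block_word l) (ev (Mix q)) = (\<Sum>(s, U)\<leftarrow>cross l (Mix q). s * limit_mean U)" by (rule phi2_cross[OF l])
  also have "\<dots> = (\<Sum>k<length q. phi (block_word l * ncpoly_t (prod_list (rotate (2 * k) (unroll q)))) +
    phi (block_word l * prod_list (rotate (Suc (2 * k)) (unroll q))))"
    unfolding cross.simps sum_list_concat_upt by (intro sum.cong refl) (use cross_term in auto)
  finally show ?thesis by simp
qed

end

lemma pairing_sum_cong:
  assumes "\<And>i j. i < n \<Longrightarrow> j < n \<Longrightarrow> f i j = f' i j" "\<And>i j. i < n \<Longrightarrow> j < n \<Longrightarrow> g i j = g' i j"
  shows "pairing_sum f g n = pairing_sum f' g' n"
  unfolding pairing_sum_def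
  by (intro sum.cong arg_cong2[of _ _ _ _ "(+)"] prod.cong refl) (use assms in auto)

section \<open>The covariance formula for cyclically alternating tuples\<close>

context asymptotic_base
begin

abbreviation "pairings xs ys n \<equiv>
  pairing_sum (\<lambda>i j. phi (xs ! i * ys ! j)) (\<lambda>i j. phi (xs ! i * ncpoly_t (ys ! j))) n"

lemma alternating_nth:
  "alternating b xs \<Longrightarrow> i < length xs \<Longrightarrow> xs ! i \<in> Alg (if even i then b else \<not> b) \<and> phi (xs ! i) = 0"
proof (induction xs arbitrary: b i)
  case (Cons x xs)
  show ?case
  proof (cases i)
    case 0
    then show ?thesis using Cons.prems by simp
  next
    case (Suc k)
    then have "xs ! k \<in> Alg (if even k then \<not> b else \<not> \<not> b) \<and> phi (xs ! k) = 0"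
      using Cons.prems by (intro Cons.IH) auto
    then show ?thesis by (simp add: Suc split: if_splits)
  qed
qed simp

lemma ncpoly_t_prod_list: "ncpoly_t (prod_list xs) = prod_list (rev (map ncpoly_t xs))" for xs :: "('b + 'c) ncpoly list"
  by (induction xs) (simp_all add: ncpoly_t_mult real_second_order_space.t_one[OF limit_space])

text \<open>The loop terms are rotations by whole blocks, which correspond to the even values of
  \<open>k\<close> in the pairing sum; for odd \<open>k\<close> letters of different algebras are
  paired and the products vanish. Each loop term is evaluated by \<open>matching\<close> with the
  first tuple reversed.\<close>

lemma phi2_alternating_True:
  assumes xs: "alternating True xs" "even (length xs)" "xs \<noteq> []"
    and ys: "alternating True ys" "even (length ys)" "ys \<noteq> []"
  shows "phi2 (prod_list xs) (prod_list ys) = (if length xs = length ys then pairings xs ys (length xs) else 0)"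
proof -
  obtain l where l: "xs = unroll l" using alternating_unroll[OF xs(1,2)] by blast
  obtain q where q: "ys = unroll q" using alternating_unroll[OF ys(1,2)] by blast
  have lq: "l \<noteq> []" "q \<noteq> []" using xs(3) ys(3) l q by auto
  define m where "m = length q"
  define N where "N = length ys"
  have N: "N = 2 * m" "m > 0" using lq by (simp_all add: N_def q m_def)
  have rx: "alternating False (rev xs)" using alternating_rev[OF xs(1)] xs(2) by simp
  have 1: "phi (prod_list xs * ncpoly_t (prod_list (rotate (2 * k) ys))) =
      (if length xs = N then \<Prod>i<N. phi (xs ! i * ncpoly_t (ys ! ((2 * k + i) mod N))) else 0)" for k
  proof -
    have alt: "alternating False (rev (map ncpoly_t (rotate (2 * k) ys)))"
      using alternating_rev[OF alternating_t[OF alternating_rotate[OF ys(1,2), of "2 * k"]]] ys(2) by simp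
    have "phi (prod_list xs * ncpoly_t (prod_list (rotate (2 * k) ys))) =
        (if length xs = N then \<Prod>i<length xs. phi (rev xs ! i * rev (map ncpoly_t (rotate (2 * k) ys)) ! i) else 0)"
      using matching[OF rx alt] by (simp add: ncpoly_t_prod_list N_def)
    also have "\<dots> = (if length xs = N then \<Prod>i<N. phi (xs ! (N - Suc i) * ncpoly_t (ys ! ((2 * k + (N - Suc i)) mod N))) else 0)"
      by (auto intro!: prod.cong simp: rev_nth nth_rotate N_def)
    also have "\<dots> = (if length xs = N then \<Prod>i<N. phi (xs ! i * ncpoly_t (ys ! ((2 * k + i) mod N))) else 0)"
      using prod.nat_diff_reindex[of "\<lambda>i. phi (xs ! i * ncpoly_t (ys ! ((2 * k + i) mod N)))" N] by simp
    finally show ?thesis .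
  qed
  have 2: "phi (prod_list xs * prod_list (rotate (Suc (2 * k)) ys)) =
      (if length xs = N then \<Prod>i<N. phi (xs ! i * ys ! ((2 * k + N - i) mod N)) else 0)" for k
  proof -
    have alt: "alternating False (rotate (Suc (2 * k)) ys)"
      using alternating_rotate[OF ys(1,2), of "Suc (2 * k)"] by simp
    have "phi (prod_list xs * prod_list (rotate (Suc (2 * k)) ys)) =
        (if length xs = N then \<Prod>i<length xs. phi (rev xs ! i * rotate (Suc (2 * k)) ys ! i) else 0)"
      using matching[OF rx alt] by (simp add: N_def)
    also have "\<dots> = (if length xs = N then \<Prod>i<N. phi (xs ! (N - Suc i) * ys ! ((2 * k + N - (N - Suc i)) mod N)) else 0)"
    proof -
      have "rotate (Suc (2 * k)) ys ! i = ys ! ((2 * k + N - (N - Suc i)) mod N)" if "i < N" for i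
      proof -
        have "2 * k + N - (N - Suc i) = Suc (2 * k) + i" using that by simp
        then show ?thesis using that by (simp only: nth_rotate N_def)
      qed
      then show ?thesis by (auto intro!: prod.cong simp: rev_nth N_def)
    qed
    also have "\<dots> = (if length xs = N then \<Prod>i<N. phi (xs ! i * ys ! ((2 * k + N - i) mod N)) else 0)"
      using prod.nat_diff_reindex[of "\<lambda>i. phi (xs ! i * ys ! ((2 * k + N - i) mod N))" N] by simp
    finally show ?thesis .
  qed
  have main: "phi2 (prod_list xs) (prod_list ys) = (\<Sum>k<m.
      phi (prod_list xs * ncpoly_t (prod_list (rotate (2 * k) ys))) + phi (prod_list xs * prod_list (rotate (Suc (2 * k)) ys)))"
    using phi2_words[of l q] xs(1) ys(1) lq by (simp add: l q prod_list_unroll m_def)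
  show ?thesis
  proof (cases "length xs = N")
    case False
    then show ?thesis unfolding main 1 2 by (simp add: N_def)
  next
    case True
    define P where "P k = (\<Prod>i<N. phi (xs ! i * ys ! ((k + N - i) mod N)))" for k
    define Q where "Q k = (\<Prod>i<N. phi (xs ! i * ncpoly_t (ys ! ((i + N - k) mod N))))" for k
    define Q' where "Q' k = (\<Prod>i<N. phi (xs ! i * ncpoly_t (ys ! ((2 * k + i) mod N))))" for k
    have x0: "xs ! 0 \<in> Alg True" "phi (xs ! 0) = 0" using alternating_nth[OF xs(1), of 0] xs(3) by auto
    have yodd: "ys ! k \<in> Alg False" "phi (ys ! k) = 0" if "k < N" "odd k" for k
      using alternating_nth[OF ys(1), of k] that by (auto simp: N_def)
    have odd_P: "P k = 0" if k: "k < 2 * m" "odd k" for k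
    proof -
      have "phi (xs ! 0 * ys ! ((k + N - 0) mod N)) = 0"
        using phi_odd[OF x0(1) _ x0(2), of "ys ! k"] yodd[of k] k N by simp
      then show ?thesis unfolding P_def using N by (intro prod_zero bexI[of _ 0]) auto
    qed
    have odd_Q: "Q k = 0" if k: "k < 2 * m" "odd k" for k
    proof -
      have "k > 0" using k(2) by (cases k) auto
      then have "N - k < N" "odd (N - k)" using k N by auto
      then have "phi (xs ! 0 * ncpoly_t (ys ! ((0 + N - k) mod N))) = 0"
        using phi_odd[OF x0(1) _ x0(2), of "ncpoly_t (ys ! (N - k))"] yodd[of "N - k"] Alg_t phi_t by simp
      then show ?thesis unfolding Q_def using N by (intro prod_zero bexI[of _ 0]) auto
    qed
    have per: "Q' (k mod m) = Q' k" for k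
    proof -
      have "(2 * (k mod m) + i) mod N = (2 * k + i) mod N" for i
        unfolding N(1) mult_mod_right by (rule mod_add_left_eq)
      then show ?thesis by (simp add: Q'_def)
    qed
    \<comment> \<open>The rotations run in opposite senses, and \<open>k = 0\<close> corresponds to
      the full rotation \<open>m\<close>; this is where the periodicity \<open>per\<close>
      enters.\<close>
    have QQ: "Q (2 * k) = Q' (m - k)" if "k < m" for k
    proof -
      have "i + N - 2 * k = 2 * (m - k) + i" for i using that N by simp
      then show ?thesis by (simp add: Q_def Q'_def)
    qed
    have "pairings xs ys N = (\<Sum>k<2 * m. P k + Q k)"
      by (simp add: pairing_sum_def P_def Q_def N)
    also have "\<dots> = (\<Sum>k<m. P (2 * k) + Q (2 * k))"
      by (rule sum_even_only) (simp add: odd_P odd_Q)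
    also have "\<dots> = (\<Sum>k<m. P (2 * k)) + (\<Sum>k<m. Q' (m - k))"
      by (simp add: sum.distrib QQ)
    also have "(\<Sum>k<m. Q' (m - k)) = (\<Sum>k<m. Q' k)"
      by (rule sum_reverse_mod) (rule per)
    finally have "pairings xs ys N = (\<Sum>k<m. Q' k + P (2 * k))" by (simp add: sum.distrib)
    also have "\<dots> = phi2 (prod_list xs) (prod_list ys)"
      unfolding main 1 2 by (simp add: True Q'_def P_def)
    finally show ?thesis using True by (simp add: N_def)
  qed
qed

lemma phi2_rotate1: "phi2 (prod_list (rotate1 xs)) z = phi2 (prod_list xs) z"
  by (cases xs) (simp_all add: phi2_commute[of "prod_list _"])

text \<open>The limiting covariance of traces and the pairing sum are both invariant under rotation
  of either tuple, so both tuples may be taken to start in the first algebra.\<close>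

lemma phi2_alternating:
  assumes xs: "alternating b xs" "even (length xs)" "xs \<noteq> []"
    and ys: "alternating c ys" "even (length ys)" "ys \<noteq> []"
  shows "phi2 (prod_list xs) (prod_list ys) = (if length xs = length ys then pairings xs ys (length xs) else 0)"
proof -
  define rot where "rot b zs = (if b then zs else rotate1 zs)" for b and zs :: "('b + 'c) ncpoly list"
  have rot: "alternating True (rot b zs)" "length (rot b zs) = length zs" "rot b zs = [] \<longleftrightarrow> zs = []"
    "phi2 (prod_list (rot b zs)) z = phi2 (prod_list zs) z"
    if "alternating b zs" "even (length zs)" for b zs z
    using that alternating_rotate1[of b zs] by (auto simp: rot_def phi2_rotate1)
  have left: "pairings (rot b zs) ws n = pairings zs ws n" if "length zs = n" for b zs ws n
  proof (cases b)
    case False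
    have "pairings (rot b zs) ws n = pairing_sum (\<lambda>i j. phi (zs ! (Suc i mod n) * ws ! j)) (\<lambda>i j. phi (zs ! (Suc i mod n) * ncpoly_t (ws ! j))) n"
      using False that by (intro pairing_sum_cong) (simp_all add: rot_def nth_rotate1)
    also have "\<dots> = pairings zs ws n" by (rule pairing_sum_rotate_left)
    finally show ?thesis .
  qed (simp add: rot_def)
  have right: "pairings zs (rot b ws) n = pairings zs ws n" if "length ws = n" for b zs ws n
  proof (cases b)
    case False
    have "pairings zs (rot b ws) n = pairing_sum (\<lambda>i j. phi (zs ! i * ws ! (Suc j mod n))) (\<lambda>i j. phi (zs ! i * ncpoly_t (ws ! (Suc j mod n)))) n"
      using False that by (intro pairing_sum_cong) (simp_all add: rot_def nth_rotate1)
    also have "\<dots> = pairings zs ws n" by (rule pairing_sum_rotate_right)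
    finally show ?thesis .
  qed (simp add: rot_def)
  note rx = rot[OF xs(1,2)] and ry = rot[OF ys(1,2)]
  have "phi2 (prod_list xs) (prod_list ys) = phi2 (prod_list (rot b xs)) (prod_list (rot c ys))"
    using rx(4) ry(4) phi2_sym by metis
  also have "\<dots> = (if length xs = length ys then pairings (rot b xs) (rot c ys) (length xs) else 0)"
    using phi2_alternating_True[OF rx(1) _ _ ry(1)] rx(2,3) ry(2,3) xs ys by simp
  also have "\<dots> = (if length xs = length ys then pairings xs ys (length xs) else 0)"
    by (simp add: left right)
  finally show ?thesis .
qed

lemma phi2_alternating_pure:
  assumes xs: "alternating b xs" "even (length xs)" "xs \<noteq> []" and z: "z \<in> Alg c"
  shows "phi2 (prod_list xs) z = 0"
proof -
  have "phi2 (prod_list ys) z = 0" if h: "alternating True ys" "even (length ys)" "ys \<noteq> []" for ys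
  proof -
    obtain l where l: "ys = unroll l" using alternating_unroll[OF h(1,2)] by blast
    then have "l \<noteq> []" using h(3) by auto
    then show ?thesis using phi2_pure[of l z c] h(1) z by (simp add: l prod_list_unroll)
  qed
  from this[of xs] this[of "rotate1 xs"] show ?thesis
    using xs alternating_rotate1[OF xs(1,2)] by (cases b) (auto simp: phi2_rotate1)
qed

lemma generated_subset:
  "generated_subalgebra ncpoly_sc ncpoly_t (\<lambda>i. ncpoly_var (Inl i)) \<subseteq> Alg True"
  "generated_subalgebra ncpoly_sc ncpoly_t (\<lambda>j. ncpoly_var (Inr j)) \<subseteq> Alg False"
proof -
  interpret real_second_order_space ncpoly_sc phi phi2 ncpoly_t by (rule limit_space)
  have sub: "unital_subalgebra ncpoly_sc (Alg b)" for b
    unfolding unital_subalgebra_iff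
  proof (intro conjI ballI allI)
    have "iA 0 = (0 :: ('b + 'c) ncpoly)" "iB 0 = (0 :: ('b + 'c) ncpoly)" by (simp_all add: emb_def ncpoly_eval_def)
    then show "0 \<in> Alg b" by (cases b) (auto simp: Alg_def image_iff intro: exI[of _ 0])
    show "1 \<in> Alg b" by (cases b) (auto simp: Alg_def image_iff emb_one intro!: exI[of _ 1])
    fix x assume x: "x \<in> Alg b"
    then show "ncpoly_sc c x \<in> Alg b" for c by (cases b) (auto simp: Alg_def simp flip: emb_sc)
    fix y assume "y \<in> Alg b"
    with x show "x + y \<in> Alg b" "x * y \<in> Alg b"
      by (auto simp: Alg_mult) (cases b; auto simp: Alg_def simp flip: emb_add)
  qed
  have gens: "ncpoly_var (Inl i) \<in> Alg True" "ncpoly_t (ncpoly_var (Inl i)) \<in> Alg True"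
    "ncpoly_var (Inr j) \<in> Alg False" "ncpoly_t (ncpoly_var (Inr j)) \<in> Alg False" for i j
  proof -
    have v: "ncpoly_var (Inl i) = (iA (ncpoly_var i) :: ('b + 'c) ncpoly)"
      "ncpoly_var (Inr j) = (iB (ncpoly_var j) :: ('b + 'c) ncpoly)"
      by (simp_all add: ncpoly_var_def emb_single)
    show "ncpoly_var (Inl i) \<in> Alg True" "ncpoly_var (Inr j) \<in> Alg False"
      unfolding v by (simp_all add: Alg_def)
    then show "ncpoly_t (ncpoly_var (Inl i)) \<in> Alg True" "ncpoly_t (ncpoly_var (Inr j)) \<in> Alg False"
      by (simp_all add: Alg_t)
  qed
  show "generated_subalgebra ncpoly_sc ncpoly_t (\<lambda>i. ncpoly_var (Inl i)) \<subseteq> Alg True"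
    unfolding generated_subalgebra_def by (rule hull_minimal) (use gens sub in auto)
  show "generated_subalgebra ncpoly_sc ncpoly_t (\<lambda>j. ncpoly_var (Inr j)) \<subseteq> Alg False"
    unfolding generated_subalgebra_def by (rule hull_minimal) (use gens sub in auto)
qed

lemma alternatingI:
  assumes "\<forall>i<length xs. xs ! i \<in> Alg (j i) \<and> phi (xs ! i) = 0" "\<forall>i. Suc i < length xs \<longrightarrow> j i \<noteq> j (Suc i)"
  shows "alternating (j 0) xs"
  using assms
proof (induction xs arbitrary: j)
  case (Cons x xs)
  have "alternating (j (Suc 0)) xs"
    by (rule Cons.IH[of "\<lambda>i. j (Suc i)"]) (use Cons.prems in auto)
  moreover have "j (Suc 0) = (\<not> j 0)" if "xs \<noteq> []" using Cons.prems(2) that by auto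
  ultimately have "alternating (\<not> j 0) xs" by (cases "xs = []") auto
  then show ?case using Cons.prems(1) by auto
qed simp

text \<open>With only two algebras the index is determined by parity, and closing the cycle forces
  even length. For lengths at least 2 the cyclic condition thus reduces to
  \<open>alternating\<close>.\<close>

lemma cyclically_alternating_even:
  assumes "cyclically_alternating UNIV Alg xs" "centred phi xs" "length xs \<ge> 2"
  shows "\<exists>b. alternating b xs \<and> even (length xs)"
proof -
  obtain j where j: "\<forall>i<length xs. xs ! i \<in> Alg (j i)" "\<forall>i<length xs. j i \<noteq> j (Suc i mod length xs)"
    using assms(1,3) unfolding cyclically_alternating_def by blast
  have step: "j i \<noteq> j (Suc i)" if "Suc i < length xs" for i
    using j(2)[rule_format, of i] that by simp
  have "\<forall>i<length xs. xs ! i \<in> Alg (j i) \<and> phi (xs ! i) = 0"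
    using j(1) assms(2) unfolding centred_def by (blast intro: nth_mem)
  moreover have "\<forall>i. Suc i < length xs \<longrightarrow> j i \<noteq> j (Suc i)" using step by blast
  ultimately have alt: "alternating (j 0) xs" by (rule alternatingI)
  have par: "j i = (if even i then j 0 else \<not> j 0)" if "i < length xs" for i
    using that
  proof (induction i)
    case (Suc i)
    then show ?case using step[of i] by auto
  qed simp
  obtain n where n: "length xs = Suc n" using assms(3) by (cases "length xs") auto
  then have "j n \<noteq> j 0" using j(2)[rule_format, of n] by simp
  then have "odd n" using par[of n] n by (cases "even n") auto
  then show ?thesis using alt n by auto
qed

text \<open>The identities are known on the ranges \<open>Alg\<close>, and freeness passes to
  smaller unital algebras that are invariant under transposition.\<close>

lemma real_free_limit_algebras:
  assumes Gsub: "\<And>b. G b \<subseteq> Alg b"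
    and G: "\<And>b. unital_subalgebra ncpoly_sc (G b) \<and> ncpoly_t ` G b \<subseteq> G b"
  shows "real_free_second_order ncpoly_sc phi phi2 ncpoly_t UNIV G"
  unfolding real_free_second_order_def
proof (intro conjI ballI allI impI)
  fix k show "unital_subalgebra ncpoly_sc (G k)" "ncpoly_t ` G k \<subseteq> G k" using G by auto
next
  show "free_subalgebras phi UNIV G"
    unfolding free_subalgebras_def
  proof (intro allI impI)
    fix xs and j :: "nat \<Rightarrow> bool"
    assume "xs \<noteq> []" "\<forall>i<length xs. j i \<in> UNIV \<and> xs ! i \<in> G (j i) \<and> phi (xs ! i) = 0"
      "\<forall>i. Suc i < length xs \<longrightarrow> j i \<noteq> j (Suc i)"
    then show "phi (prod_list xs) = 0"
      using Gsub by (intro freeness[OF alternatingI[of xs j]]) auto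
  qed
next
  have cyc: "cyclically_alternating UNIV Alg xs" if "cyclically_alternating UNIV G xs" for xs
    using that Gsub unfolding cyclically_alternating_def by blast
  have single: "\<exists>b. z \<in> Alg b" if "cyclically_alternating UNIV G [z]" for z
    using cyc[OF that] by (auto simp: cyclically_alternating_def)
  fix xs ys
  assume "cyclically_alternating UNIV G xs \<and> centred phi xs" "cyclically_alternating UNIV G ys \<and> centred phi ys"
  then have xy: "cyclically_alternating UNIV G xs" "centred phi xs" "cyclically_alternating UNIV G ys" "centred phi ys"
    by auto
  then have ne: "xs \<noteq> []" "ys \<noteq> []" by (auto simp: cyclically_alternating_def)
  have ex: "\<exists>b. alternating b xs \<and> even (length xs)" if "length xs \<ge> 2"
    by (rule cyclically_alternating_even[OF cyc[OF xy(1)] xy(2) that])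
  have ey: "\<exists>b. alternating b ys \<and> even (length ys)" if "length ys \<ge> 2"
    by (rule cyclically_alternating_even[OF cyc[OF xy(3)] xy(4) that])
  \<comment> \<open>Tuples of length 1 are cyclically alternating as well, although of odd length;
    they are handled as one-family traces.\<close>
  have long: "\<exists>z. zs = [z]" if "\<not> length zs \<ge> 2" "zs \<noteq> []" for zs :: "('b + 'c) ncpoly list"
    using that by (cases zs rule: remdups_adj.cases) auto
  show "phi2 (prod_list xs) (prod_list ys) = 0" if neq: "length xs \<noteq> length ys"
  proof (cases "length xs \<ge> 2")
    case True
    then obtain b where b: "alternating b xs" "even (length xs)" using ex by blast
    show ?thesis
    proof (cases "length ys \<ge> 2")
      case True
      then obtain c where "alternating c ys" "even (length ys)" using ey by blast
      then show ?thesis using phi2_alternating[OF b ne(1), of c ys] ne neq by simp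
    next
      case False
      then obtain z where z: "ys = [z]" using long[of ys] ne by blast
      then obtain c where "z \<in> Alg c" using single xy by blast
      then show ?thesis using phi2_alternating_pure[OF b ne(1)] z by simp
    qed
  next
    case False
    then obtain z where z: "xs = [z]" using long[of xs] ne by blast
    then obtain c where c: "z \<in> Alg c" using single xy by blast
    have "length ys \<ge> 2" using neq ne z by (cases ys rule: remdups_adj.cases) auto
    then obtain b where "alternating b ys" "even (length ys)" using ey by blast
    then have "phi2 (prod_list ys) z = 0" using phi2_alternating_pure ne c by blast
    then show ?thesis using phi2_sym z by simp
  qed
  show "phi2 (prod_list xs) (prod_list ys) = 0"
    if one: "length xs = 1 \<and> length ys = 1 \<and> (\<exists>k\<in>UNIV. \<exists>l\<in>UNIV. k \<noteq> l \<and> xs ! 0 \<in> G k \<and> ys ! 0 \<in> G l)"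
  proof -
    obtain x y where x: "xs = [x]" and y: "ys = [y]" using one by (auto simp: length_Suc_conv)
    obtain k where "x \<in> G k" "y \<in> G (\<not> k)" using one by (auto simp: x y)
    then have "x \<in> Alg k" "y \<in> Alg (\<not> k)" using Gsub by auto
    then show ?thesis using phi2_different[of x y] phi2_different[of y x] phi2_sym[of x y] by (cases k) (auto simp: x y)
  qed
  show "phi2 (prod_list xs) (prod_list ys) =
      (\<Sum>k<n. (\<Prod>i<n. phi (xs ! i * ys ! ((k + n - i) mod n))) +
             (\<Prod>i<n. phi (xs ! i * ncpoly_t (ys ! ((i + n - k) mod n)))))"
    if n: "n > 1" "length xs = n \<and> length ys = n" for n
  proof -
    have n2: "length xs \<ge> 2" "length ys \<ge> 2" using n by auto
    obtain b c where b: "alternating b xs" "even (length xs)" and c: "alternating c ys" "even (length ys)"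
      using ex[OF n2(1)] ey[OF n2(2)] by blast
    show ?thesis
      using phi2_alternating[OF b ne(1) c ne(2)] n by (simp add: pairing_sum_def)
  qed
qed

lemma joint_real_free_limit:
  "real_free_limit M A B ncpoly_sc phi phi2 ncpoly_t (\<lambda>i. ncpoly_var (Inl i)) (\<lambda>j. ncpoly_var (Inr j))"
proof -
  interpret real_second_order_space ncpoly_sc phi phi2 ncpoly_t by (rule limit_space)
  have v: "case_sum (\<lambda>i. ncpoly_var (Inl i)) (\<lambda>j. ncpoly_var (Inr j)) = (ncpoly_var :: 'b + 'c \<Rightarrow> _)"
    by (rule ext) (simp split: sum.split)
  let ?GA = "generated_subalgebra ncpoly_sc ncpoly_t (\<lambda>i. ncpoly_var (Inl i)) :: ('b + 'c) ncpoly set"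
  let ?GB = "generated_subalgebra ncpoly_sc ncpoly_t (\<lambda>j. ncpoly_var (Inr j)) :: ('b + 'c) ncpoly set"
  have "unital_subalgebra ncpoly_sc ?GA" "unital_subalgebra ncpoly_sc ?GB"
    by (rule unital_subalgebra_generated)+
  moreover have "ncpoly_t ` ?GA \<subseteq> ?GA" "ncpoly_t ` ?GB \<subseteq> ?GB"
    by (rule generated_subalgebra_t)+
  ultimately have "real_free_second_order ncpoly_sc phi phi2 ncpoly_t UNIV (\<lambda>first. if first then ?GA else ?GB)"
    using generated_subset by (intro real_free_limit_algebras) simp_all
  then show ?thesis using joint_limit by (simp add: real_free_limit_def v)
qed

end

theorem theorem54:
  fixes M :: "nat \<Rightarrow> 'w measure"
    and A :: "nat \<Rightarrow> 'i \<Rightarrow> 'w \<Rightarrow> complex mat"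
    and B :: "nat \<Rightarrow> 'j \<Rightarrow> 'w \<Rightarrow> complex mat"
    and a :: "'i \<Rightarrow> 'a::ring_1"
    and b :: "'j \<Rightarrow> 'b::ring_1"
  assumes "\<And>d. d \<ge> 1 \<Longrightarrow> prob_space (M d)"
    and "\<And>d. d \<ge> 1 \<Longrightarrow> random_matrix_family (M d) d (A d)"
    and "\<And>d. d \<ge> 1 \<Longrightarrow> random_matrix_family (M d) d (B d)"
    and "\<And>d. d \<ge> 1 \<Longrightarrow> entries_independent (M d) d (A d) (B d)"
    and "real_second_order_limit M A scaleA \<phi>A \<phi>2A tA a"
    and "real_second_order_limit M B scaleB \<phi>B \<phi>2B tB b"
    and "\<And>d. d \<ge> 1 \<Longrightarrow> orthogonally_invariant (M d) d (A d)"
  shows "asymptotically_real_free_second_order M A B"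
proof -
  have "invariant_pair (M d) d (A d) (B d)" if "d \<ge> 1" for d
    by (intro invariant_pair.intro invariant_pair_axioms.intro assms that)
  then interpret asymptotic_base M A B
    using assms(5,6) by (rule asymptotic_baseI)
  show ?thesis
    unfolding asymptotically_real_free_second_order_def using joint_real_free_limit by blast
qed

end
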